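(* Let $(M,x_0)$ be a path-connected pointed CW-complex with $\dim M=2$. Let $G$ be a topological group with unit $g_0$ such that $\pi_0(G,g_0)$ is abelian and discrete and acts trivially on $\pi_n(G,g_0)$ for all $n\ge 1$. Suppose that $\pi_1(G,g_0)=0$. Then there is a bijection $$\mathcal{B}_G(M)\cong H^1(M;\pi_0(G,g_0)),$$ where $\mathcal{B}_G(M)$ is the pointed set of equivalence classes of principal $G$-bundles over $M$. In particular, if $G$ is discrete, then $\mathcal{B}_G(M)\cong H^1(M;G)$.
   Context: A principal $G$-bundle over $M$ consists of a total space $E$ with a right action of $G$ and a continuous map $p:E\to M$ such that there is an open covering $\{U\}$ of $M$ with homeomorphisms $\phi_U: U\times G\to p^{-1}(U)$ satisfying $p(\phi_U(b,g))=b$ and $\phi_U(b,g)=\phi_U(b,g_0)\cdot g$. Two principal $G$-bundles $p_1:E_1\to M$ and $p_2:E_2\to M$ are equivalent if there is a homeomorphism $h:E_1\to E_2$ with $p_2\circ h=p_1$ and $h(e\cdot g)=h(e)\cdot g$ for all $e\in E_1$, $g\in G$. $\mathcal{B}_G(M)$ is the set of equivalence classes; its base point is the class of the trivial bundle $M\times G\to M$. $\pi_0(G,g_0)=G/G_0$, where $G_0$ is the path component of the unit, and it carries the quotient topology; it acts on $\pi_n(G,g_0)$, $n\ge 1$, by the maps induced by conjugation in $G$. $H^1(M;\pi)$ denotes singular cohomology with coefficients in the abelian group $\pi$. *)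

theory Defs
  imports "HOL-Homology.Homology"
begin

section \<open>CW complexes\<close>

definition unit_disk :: "nat \<Rightarrow> (nat \<Rightarrow> real) topology" where
  "unit_disk n = subtopology (Euclidean_space n) {x. (\<Sum>i<n. (x i)\<^sup>2) \<le> 1}"

definition open_disk :: "nat \<Rightarrow> (nat \<Rightarrow> real) set" where
  "open_disk n = {x \<in> topspace (Euclidean_space n). (\<Sum>i<n. (x i)\<^sup>2) < 1}"

definition boundary_sphere :: "nat \<Rightarrow> (nat \<Rightarrow> real) set" where
  "boundary_sphere n = {x \<in> topspace (Euclidean_space n). (\<Sum>i<n. (x i)\<^sup>2) = 1}"

text \<open>\<open>E n\<close> is the set of open \<open>n\<close>-cells. This is Whitehead's description of a CW complex, with
  closure-finiteness expressed through the characteristic maps and with the weak topology.\<close>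

definition characteristic_map ::
    "'m topology \<Rightarrow> (nat \<Rightarrow> 'm set set) \<Rightarrow> nat \<Rightarrow> 'm set \<Rightarrow> ((nat \<Rightarrow> real) \<Rightarrow> 'm) \<Rightarrow> bool" where
  "characteristic_map X E n e \<Phi> \<longleftrightarrow>
     continuous_map (unit_disk n) X \<Phi> \<and>
     homeomorphic_map (subtopology (unit_disk n) (open_disk n)) (subtopology X e) \<Phi> \<and>
     (\<exists>F. finite F \<and> F \<subseteq> (\<Union>k<n. E k) \<and> \<Phi> ` boundary_sphere n \<subseteq> \<Union>F)"

definition CW_structure :: "'m topology \<Rightarrow> (nat \<Rightarrow> 'm set set) \<Rightarrow> bool" where
  "CW_structure X E \<longleftrightarrow>
     Hausdorff_space X \<and>
     (\<Union>n. \<Union>(E n)) = topspace X \<and>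
     (\<forall>m n. \<forall>e\<in>E m. \<forall>f\<in>E n. (m, e) \<noteq> (n, f) \<longrightarrow> e \<inter> f = {}) \<and>
     (\<forall>n. \<forall>e\<in>E n. \<exists>\<Phi>. characteristic_map X E n e \<Phi>) \<and>
     (\<forall>A \<subseteq> topspace X. closedin X A \<longleftrightarrow> (\<forall>n. \<forall>e\<in>E n. closedin X (A \<inter> X closure_of e)))"

definition CW_complex_of_dim :: "'m topology \<Rightarrow> nat \<Rightarrow> bool" where
  "CW_complex_of_dim X d \<longleftrightarrow> (\<exists>E. CW_structure X E \<and> E d \<noteq> {} \<and> (\<forall>n>d. E n = {}))"

section \<open>Homotopy groups\<close>

definition cube :: "nat \<Rightarrow> (nat \<Rightarrow> real) topology" where
  "cube n = product_topology (\<lambda>_. top_of_set {0..1}) {..<n}"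

definition cube_boundary :: "nat \<Rightarrow> (nat \<Rightarrow> real) set" where
  "cube_boundary n = {t \<in> topspace (cube n). \<exists>i<n. t i = 0 \<or> t i = 1}"

definition spheroid :: "nat \<Rightarrow> 'a topology \<Rightarrow> 'a \<Rightarrow> ((nat \<Rightarrow> real) \<Rightarrow> 'a) \<Rightarrow> bool" where
  "spheroid n X x \<gamma> \<longleftrightarrow> continuous_map (cube n) X \<gamma> \<and> (\<forall>t\<in>cube_boundary n. \<gamma> t = x)"

definition spheroid_class ::
    "nat \<Rightarrow> 'a topology \<Rightarrow> 'a \<Rightarrow> ((nat \<Rightarrow> real) \<Rightarrow> 'a) \<Rightarrow> ((nat \<Rightarrow> real) \<Rightarrow> 'a) set" where
  "spheroid_class n X x \<gamma> =
     {\<delta>. homotopic_with (\<lambda>h. \<forall>t\<in>cube_boundary n. h t = x) (cube n) X \<gamma> \<delta>}"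

text \<open>The pointed set underlying \<open>\<pi>\<^sub>n(X, x)\<close>. Its multiplication is not needed: both the vanishing of
  \<open>\<pi>\<^sub>n\<close> and the triviality of an action on it are conditions on the pointed set.\<close>

definition homotopy_classes :: "nat \<Rightarrow> 'a topology \<Rightarrow> 'a \<Rightarrow> ((nat \<Rightarrow> real) \<Rightarrow> 'a) set set" where
  "homotopy_classes n X x = spheroid_class n X x ` Collect (spheroid n X x)"

definition homotopy_zero :: "nat \<Rightarrow> 'a topology \<Rightarrow> 'a \<Rightarrow> ((nat \<Rightarrow> real) \<Rightarrow> 'a) set" where
  "homotopy_zero n X x = spheroid_class n X x (\<lambda>_. x)"

text \<open>The map induced by a continuous \<open>f\<close> from \<open>(X, x)\<close> to \<open>(Y, y)\<close>; the classes united here all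
  coincide.\<close>

definition homotopy_induced ::
    "nat \<Rightarrow> 'b topology \<Rightarrow> 'b \<Rightarrow> ('a \<Rightarrow> 'b) \<Rightarrow> ((nat \<Rightarrow> real) \<Rightarrow> 'a) set \<Rightarrow> ((nat \<Rightarrow> real) \<Rightarrow> 'b) set" where
  "homotopy_induced n Y y f \<alpha> = (\<Union>\<gamma>\<in>\<alpha>. spheroid_class n Y y (f \<circ> \<gamma>))"

section \<open>Topological groups\<close>

definition topological_group :: "'g monoid \<Rightarrow> 'g topology \<Rightarrow> bool" where
  "topological_group G T \<longleftrightarrow>
     group G \<and> topspace T = carrier G \<and>
     continuous_map (prod_topology T T) T (\<lambda>(x, y). x \<otimes>\<^bsub>G\<^esub> y) \<and>
     continuous_map T T (\<lambda>x. inv\<^bsub>G\<^esub> x)"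

definition unit_path_component :: "'g monoid \<Rightarrow> 'g topology \<Rightarrow> 'g set" where
  "unit_path_component G T = path_component_of_set T \<one>\<^bsub>G\<^esub>"

definition pi0 :: "'g monoid \<Rightarrow> 'g topology \<Rightarrow> 'g set monoid" where
  "pi0 G T = G Mod unit_path_component G T"

definition pi0_proj :: "'g monoid \<Rightarrow> 'g topology \<Rightarrow> 'g \<Rightarrow> 'g set" where
  "pi0_proj G T g = unit_path_component G T #>\<^bsub>G\<^esub> g"

definition pi0_topology :: "'g monoid \<Rightarrow> 'g topology \<Rightarrow> 'g set topology" where
  "pi0_topology G T =
     topology (\<lambda>U. U \<subseteq> carrier (pi0 G T) \<and> openin T {g \<in> topspace T. pi0_proj G T g \<in> U})"

text \<open>The action of a coset on \<open>\<pi>\<^sub>n(G, 1)\<close> by conjugation; again the classes united all coincide.\<close>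

definition pi0_action ::
    "nat \<Rightarrow> 'g monoid \<Rightarrow> 'g topology \<Rightarrow> 'g set \<Rightarrow> ((nat \<Rightarrow> real) \<Rightarrow> 'g) set \<Rightarrow> ((nat \<Rightarrow> real) \<Rightarrow> 'g) set" where
  "pi0_action n G T C \<alpha> =
     (\<Union>g\<in>C. homotopy_induced n T \<one>\<^bsub>G\<^esub> (\<lambda>x. g \<otimes>\<^bsub>G\<^esub> x \<otimes>\<^bsub>G\<^esub> inv\<^bsub>G\<^esub> g) \<alpha>)"

definition pi0_acts_trivially :: "nat \<Rightarrow> 'g monoid \<Rightarrow> 'g topology \<Rightarrow> bool" where
  "pi0_acts_trivially n G T \<longleftrightarrow>
     (\<forall>C\<in>carrier (pi0 G T). \<forall>\<alpha>\<in>homotopy_classes n T \<one>\<^bsub>G\<^esub>. pi0_action n G T C \<alpha> = \<alpha>)"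

section \<open>Singular cohomology\<close>

text \<open>Coefficients form a multiplicatively written abelian group \<open>A\<close>.\<close>

definition cochain_group :: "nat \<Rightarrow> 'a topology \<Rightarrow> 'b monoid \<Rightarrow> ('a chain \<Rightarrow> 'b) monoid" where
  "cochain_group n X A =
     \<lparr>carrier = hom (chain_group n X) A \<inter> extensional (singular_chain_set n X),
      mult = (\<lambda>\<phi> \<psi>. \<lambda>c\<in>singular_chain_set n X. \<phi> c \<otimes>\<^bsub>A\<^esub> \<psi> c),
      one = (\<lambda>c\<in>singular_chain_set n X. \<one>\<^bsub>A\<^esub>)\<rparr>"

definition coboundary :: "nat \<Rightarrow> 'a topology \<Rightarrow> ('a chain \<Rightarrow> 'b) \<Rightarrow> 'a chain \<Rightarrow> 'b" where
  "coboundary n X \<phi> = (\<lambda>c\<in>singular_chain_set (Suc n) X. \<phi> (chain_boundary (Suc n) c))"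

definition cocycles :: "nat \<Rightarrow> 'a topology \<Rightarrow> 'b monoid \<Rightarrow> ('a chain \<Rightarrow> 'b) set" where
  "cocycles n X A =
     {\<phi> \<in> carrier (cochain_group n X A). coboundary n X \<phi> = \<one>\<^bsub>cochain_group (Suc n) X A\<^esub>}"

definition coboundaries :: "nat \<Rightarrow> 'a topology \<Rightarrow> 'b monoid \<Rightarrow> ('a chain \<Rightarrow> 'b) set" where
  "coboundaries n X A =
     (case n of 0 \<Rightarrow> {\<one>\<^bsub>cochain_group 0 X A\<^esub>}
      | Suc k \<Rightarrow> coboundary k X ` carrier (cochain_group k X A))"

definition cohomology_group ::
    "nat \<Rightarrow> 'a topology \<Rightarrow> 'b monoid \<Rightarrow> ('a chain \<Rightarrow> 'b) set monoid" where
  "cohomology_group n X A =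
     (cochain_group n X A)\<lparr>carrier := cocycles n X A\<rparr> Mod coboundaries n X A"

section \<open>Principal bundles\<close>

record ('e, 'g, 'm) gbundle =
  total_space :: "'e topology"
  act :: "'e \<Rightarrow> 'g \<Rightarrow> 'e"
  proj :: "'e \<Rightarrow> 'm"

definition right_action :: "'g monoid \<Rightarrow> 'e set \<Rightarrow> ('e \<Rightarrow> 'g \<Rightarrow> 'e) \<Rightarrow> bool" where
  "right_action G S a \<longleftrightarrow>
     (\<forall>e\<in>S. a e \<one>\<^bsub>G\<^esub> = e \<and>
       (\<forall>g\<in>carrier G. a e g \<in> S \<and> (\<forall>h\<in>carrier G. a (a e g) h = a e (g \<otimes>\<^bsub>G\<^esub> h))))"

definition local_trivialization ::
    "'g monoid \<Rightarrow> 'g topology \<Rightarrow> 'm topology \<Rightarrow> ('e, 'g, 'm) gbundle \<Rightarrow> 'm set \<Rightarrow> ('m \<times> 'g \<Rightarrow> 'e) \<Rightarrow> bool" where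
  "local_trivialization G T M P U \<phi> \<longleftrightarrow>
     homeomorphic_map (prod_topology (subtopology M U) T)
       (subtopology (total_space P) {e \<in> topspace (total_space P). proj P e \<in> U}) \<phi> \<and>
     (\<forall>b\<in>U. \<forall>g\<in>carrier G. proj P (\<phi> (b, g)) = b \<and> \<phi> (b, g) = act P (\<phi> (b, \<one>\<^bsub>G\<^esub>)) g)"

text \<open>Continuity of the action is not listed because local triviality implies it:
  see \<open>principal_bundle_continuous_action\<close> below.\<close>

definition principal_bundle ::
    "'g monoid \<Rightarrow> 'g topology \<Rightarrow> 'm topology \<Rightarrow> ('e, 'g, 'm) gbundle \<Rightarrow> bool" where
  "principal_bundle G T M P \<longleftrightarrow>
     right_action G (topspace (total_space P)) (act P) \<and>
     continuous_map (total_space P) M (proj P) \<and>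
     (\<exists>\<U>. (\<forall>U\<in>\<U>. openin M U) \<and> \<Union>\<U> = topspace M \<and>
           (\<forall>U\<in>\<U>. \<exists>\<phi>. local_trivialization G T M P U \<phi>))"

definition bundle_equivalence ::
    "'g monoid \<Rightarrow> ('e, 'g, 'm) gbundle \<Rightarrow> ('f, 'g, 'm) gbundle \<Rightarrow> ('e \<Rightarrow> 'f) \<Rightarrow> bool" where
  "bundle_equivalence G P Q h \<longleftrightarrow>
     homeomorphic_map (total_space P) (total_space Q) h \<and>
     (\<forall>e\<in>topspace (total_space P). proj Q (h e) = proj P e \<and>
        (\<forall>g\<in>carrier G. h (act P e g) = act Q (h e) g))"

definition equivalent_bundles ::
    "'g monoid \<Rightarrow> ('e, 'g, 'm) gbundle \<Rightarrow> ('f, 'g, 'm) gbundle \<Rightarrow> bool" where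
  "equivalent_bundles G P Q \<longleftrightarrow> (\<exists>h. bundle_equivalence G P Q h)"

definition trivial_bundle ::
    "'g monoid \<Rightarrow> 'g topology \<Rightarrow> 'm topology \<Rightarrow> ('m \<times> 'g, 'g, 'm) gbundle" where
  "trivial_bundle G T M =
     \<lparr>total_space = prod_topology M T, act = (\<lambda>(b, g) h. (b, g \<otimes>\<^bsub>G\<^esub> h)), proj = fst\<rparr>"

text \<open>Equivalence classes must be formed over a fixed type of total spaces. The type \<open>'m \<times> 'g\<close> is
  large enough: every principal bundle, whatever the type of its total space, is equivalent to one
  with total space in \<open>'m \<times> 'g\<close> (\<open>principal_bundle_representative\<close> below).\<close>

definition bundle_equiv_rel ::
    "'g monoid \<Rightarrow> 'g topology \<Rightarrow> 'm topology \<Rightarrow> ('m \<times> 'g, 'g, 'm) gbundle rel" where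
  "bundle_equiv_rel G T M =
     {(P, Q). principal_bundle G T M P \<and> principal_bundle G T M Q \<and> equivalent_bundles G P Q}"

definition bundle_classes ::
    "'g monoid \<Rightarrow> 'g topology \<Rightarrow> 'm topology \<Rightarrow> ('m \<times> 'g, 'g, 'm) gbundle set set" where
  "bundle_classes G T M = Collect (principal_bundle G T M) // bundle_equiv_rel G T M"

definition trivial_class ::
    "'g monoid \<Rightarrow> 'g topology \<Rightarrow> 'm topology \<Rightarrow> ('m \<times> 'g, 'g, 'm) gbundle set" where
  "trivial_class G T M = bundle_equiv_rel G T M `` {trivial_bundle G T M}"

section \<open>Consistency of the definitions\<close>

lemma openin_pi0_topology:
  "openin (pi0_topology G T) U \<longleftrightarrow>
     U \<subseteq> carrier (pi0 G T) \<and> openin T {g \<in> topspace T. pi0_proj G T g \<in> U}"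
proof -
  have "istopology (\<lambda>U. U \<subseteq> carrier (pi0 G T) \<and> openin T {g \<in> topspace T. pi0_proj G T g \<in> U})"
    unfolding istopology_def
  proof (intro conjI allI impI)
    fix S U
    assume S: "S \<subseteq> carrier (pi0 G T) \<and> openin T {g \<in> topspace T. pi0_proj G T g \<in> S}"
      and U: "U \<subseteq> carrier (pi0 G T) \<and> openin T {g \<in> topspace T. pi0_proj G T g \<in> U}"
    have eq: "{g \<in> topspace T. pi0_proj G T g \<in> S \<inter> U} =
        {g \<in> topspace T. pi0_proj G T g \<in> S} \<inter> {g \<in> topspace T. pi0_proj G T g \<in> U}"
      by auto
    show "openin T {g \<in> topspace T. pi0_proj G T g \<in> S \<inter> U}"
      unfolding eq using S U by (intro openin_Int) auto
    show "S \<inter> U \<subseteq> carrier (pi0 G T)"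
      using S by blast
  next
    fix K
    assume K: "\<forall>U\<in>K. U \<subseteq> carrier (pi0 G T) \<and> openin T {g \<in> topspace T. pi0_proj G T g \<in> U}"
    have "{g \<in> topspace T. pi0_proj G T g \<in> \<Union>K} =
        (\<Union>U\<in>K. {g \<in> topspace T. pi0_proj G T g \<in> U})"
      by auto
    then show "openin T {g \<in> topspace T. pi0_proj G T g \<in> \<Union>K}"
      using K by auto
    show "\<Union>K \<subseteq> carrier (pi0 G T)"
      using K by blast
  qed
  then show ?thesis
    by (simp add: pi0_topology_def topology_inverse')
qed

lemma quotient_map_pi0_proj:
  assumes "topological_group G T"
  shows "quotient_map T (pi0_topology G T) (pi0_proj G T)"
proof -
  have ts: "topspace T = carrier G"
    using assms by (simp add: topological_group_def)
  have im: "pi0_proj G T ` topspace T = carrier (pi0 G T)"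
    by (auto simp: ts pi0_def FactGroup_def RCOSETS_def pi0_proj_def)
  have "topspace (pi0_topology G T) = carrier (pi0 G T)"
  proof
    show "topspace (pi0_topology G T) \<subseteq> carrier (pi0 G T)"
      using openin_topspace openin_pi0_topology by blast
    have "{g \<in> topspace T. pi0_proj G T g \<in> carrier (pi0 G T)} = topspace T"
      using im by blast
    then have "openin (pi0_topology G T) (carrier (pi0 G T))"
      by (simp add: openin_pi0_topology)
    then show "carrier (pi0 G T) \<subseteq> topspace (pi0_topology G T)"
      by (rule openin_subset)
  qed
  then show ?thesis
    using im by (auto simp: quotient_map_def openin_pi0_topology)
qed

lemma continuous_map_group_mult:
  assumes "topological_group G T" "continuous_map X T f" "continuous_map X T g"
  shows "continuous_map X T (\<lambda>x. f x \<otimes>\<^bsub>G\<^esub> g x)"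
proof -
  have "continuous_map X (prod_topology T T) (\<lambda>x. (f x, g x))"
    using assms by (simp add: continuous_map_paired)
  then have "continuous_map X T ((\<lambda>(x, y). x \<otimes>\<^bsub>G\<^esub> y) \<circ> (\<lambda>x. (f x, g x)))"
    using assms(1) continuous_map_compose topological_group_def by blast
  then show ?thesis
    by (simp add: o_def)
qed

lemma continuous_map_group_inv:
  assumes "topological_group G T" "continuous_map X T f"
  shows "continuous_map X T (\<lambda>x. inv\<^bsub>G\<^esub> (f x))"
proof -
  have "continuous_map X T ((\<lambda>x. inv\<^bsub>G\<^esub> x) \<circ> f)"
    using assms continuous_map_compose topological_group_def by blast
  then show ?thesis
    by (simp add: o_def)
qed

lemma normal_unit_path_component:
  assumes TG: "topological_group G T"
  shows "unit_path_component G T \<lhd> G"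
proof -
  interpret group G
    using TG by (simp add: topological_group_def)
  have ts: "topspace T = carrier G"
    using TG by (simp add: topological_group_def)
  let ?I = "top_of_set {0..1::real}"
  have iff: "x \<in> unit_path_component G T \<longleftrightarrow>
      (\<exists>p. continuous_map ?I T p \<and> p 0 = \<one>\<^bsub>G\<^esub> \<and> p 1 = x)" for x
    by (auto simp: unit_path_component_def path_component_of_def pathin_def)
  have car: "unit_path_component G T \<subseteq> carrier G"
    by (simp add: unit_path_component_def path_component_of_subset_topspace flip: ts)
  have "subgroup (unit_path_component G T) G"
  proof (rule subgroupI)
    show "unit_path_component G T \<subseteq> carrier G"
      by (rule car)
    have "continuous_map ?I T (\<lambda>_. \<one>\<^bsub>G\<^esub>)"
      by (simp add: ts)
    then show "unit_path_component G T \<noteq> {}"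
      using iff by blast
  next
    fix a assume "a \<in> unit_path_component G T"
    then obtain p where p: "continuous_map ?I T p" "p 0 = \<one>\<^bsub>G\<^esub>" "p 1 = a"
      using iff by blast
    show "inv\<^bsub>G\<^esub> a \<in> unit_path_component G T"
      using continuous_map_group_inv [OF TG p(1)] p unfolding iff
      by (intro exI [of _ "\<lambda>x. inv\<^bsub>G\<^esub> p x"]) auto
  next
    fix a b assume "a \<in> unit_path_component G T" "b \<in> unit_path_component G T"
    then obtain p q where p: "continuous_map ?I T p" "p 0 = \<one>\<^bsub>G\<^esub>" "p 1 = a"
      and q: "continuous_map ?I T q" "q 0 = \<one>\<^bsub>G\<^esub>" "q 1 = b"
      using iff by metis
    show "a \<otimes>\<^bsub>G\<^esub> b \<in> unit_path_component G T"
      using continuous_map_group_mult [OF TG p(1) q(1)] p q unfolding iff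
      by (intro exI [of _ "\<lambda>x. p x \<otimes>\<^bsub>G\<^esub> q x"]) auto
  qed
  moreover have "x \<otimes>\<^bsub>G\<^esub> h \<otimes>\<^bsub>G\<^esub> inv\<^bsub>G\<^esub> x \<in> unit_path_component G T"
    if x: "x \<in> carrier G" and h: "h \<in> unit_path_component G T" for x h
  proof -
    obtain p where p: "continuous_map ?I T p" "p 0 = \<one>\<^bsub>G\<^esub>" "p 1 = h"
      using h iff by blast
    have "continuous_map ?I T (\<lambda>t. x \<otimes>\<^bsub>G\<^esub> p t \<otimes>\<^bsub>G\<^esub> inv\<^bsub>G\<^esub> x)"
      using x by (intro continuous_map_group_mult [OF TG] p) (auto simp: ts)
    then show ?thesis
      unfolding iff using p x by (intro exI [of _ "\<lambda>t. x \<otimes>\<^bsub>G\<^esub> p t \<otimes>\<^bsub>G\<^esub> inv\<^bsub>G\<^esub> x"]) auto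
  qed
  ultimately show ?thesis
    by (simp add: normal_inv_iff)
qed

lemma homotopy_zero_in_homotopy_classes:
  assumes "x \<in> topspace X"
  shows "homotopy_zero n X x \<in> homotopy_classes n X x"
  using assms by (auto simp: homotopy_zero_def homotopy_classes_def spheroid_def)

lemma spheroid_class_eq:
  assumes "homotopic_with (\<lambda>h. \<forall>t\<in>cube_boundary n. h t = x) (cube n) X \<gamma> \<delta>"
  shows "spheroid_class n X x \<gamma> = spheroid_class n X x \<delta>"
  unfolding spheroid_class_def
  using assms homotopic_with_trans homotopic_with_symD by blast

lemma homotopy_induced_class:
  assumes f: "continuous_map X Y f" "f x = y" and \<gamma>: "spheroid n X x \<gamma>"
  shows "homotopy_induced n Y y f (spheroid_class n X x \<gamma>) = spheroid_class n Y y (f \<circ> \<gamma>)"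
proof -
  have "spheroid_class n Y y (f \<circ> \<delta>) = spheroid_class n Y y (f \<circ> \<gamma>)"
    if "\<delta> \<in> spheroid_class n X x \<gamma>" for \<delta>
  proof (rule spheroid_class_eq [symmetric])
    have h: "homotopic_with (\<lambda>h. \<forall>t\<in>cube_boundary n. h t = x) (cube n) X \<gamma> \<delta>"
      using that by (simp add: spheroid_class_def)
    show "homotopic_with (\<lambda>h. \<forall>t\<in>cube_boundary n. h t = y) (cube n) Y (f \<circ> \<gamma>) (f \<circ> \<delta>)"
      by (rule homotopic_with_compose_continuous_map_left [OF h f(1)]) (simp add: f)
  qed
  moreover have "\<gamma> \<in> spheroid_class n X x \<gamma>"
    using \<gamma> by (auto simp: spheroid_class_def spheroid_def)
  ultimately show ?thesis
    unfolding homotopy_induced_def by blast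
qed

lemma pi0_action_class:
  assumes TG: "topological_group G T" and g: "g \<in> carrier G" and \<gamma>: "spheroid n T \<one>\<^bsub>G\<^esub> \<gamma>"
  shows "pi0_action n G T (pi0_proj G T g) (spheroid_class n T \<one>\<^bsub>G\<^esub> \<gamma>) =
         spheroid_class n T \<one>\<^bsub>G\<^esub> (\<lambda>t. g \<otimes>\<^bsub>G\<^esub> \<gamma> t \<otimes>\<^bsub>G\<^esub> inv\<^bsub>G\<^esub> g)"
proof -
  interpret group G
    using TG by (simp add: topological_group_def)
  interpret N: normal "unit_path_component G T" G
    by (rule normal_unit_path_component [OF TG])
  have ts: "topspace T = carrier G"
    using TG by (simp add: topological_group_def)
  let ?I = "top_of_set {0..1::real}"
  let ?conj = "\<lambda>g x. g \<otimes>\<^bsub>G\<^esub> x \<otimes>\<^bsub>G\<^esub> inv\<^bsub>G\<^esub> g"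
  have \<gamma>': "continuous_map (cube n) T \<gamma>" "\<And>t. t \<in> cube_boundary n \<Longrightarrow> \<gamma> t = \<one>\<^bsub>G\<^esub>"
    using \<gamma> by (auto simp: spheroid_def)
  have g_in: "g \<in> pi0_proj G T g"
    unfolding pi0_proj_def using rcos_self [OF g N.subgroup_axioms] .
  have ind: "homotopy_induced n T \<one>\<^bsub>G\<^esub> (?conj h) (spheroid_class n T \<one>\<^bsub>G\<^esub> \<gamma>) =
      spheroid_class n T \<one>\<^bsub>G\<^esub> (\<lambda>t. ?conj h (\<gamma> t))" if h: "h \<in> carrier G" for h
  proof -
    have "continuous_map T T (?conj h)"
      using h by (intro continuous_map_group_mult [OF TG]) (auto simp: ts)
    then show ?thesis
      using homotopy_induced_class [OF _ _ \<gamma>, of T "?conj h"] h by (simp add: o_def)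
  qed
  have "homotopy_induced n T \<one>\<^bsub>G\<^esub> (?conj h) (spheroid_class n T \<one>\<^bsub>G\<^esub> \<gamma>) =
      spheroid_class n T \<one>\<^bsub>G\<^esub> (\<lambda>t. ?conj g (\<gamma> t))" if h: "h \<in> pi0_proj G T g" for h
  proof -
    obtain u where u: "u \<in> unit_path_component G T" and hu: "h = u \<otimes>\<^bsub>G\<^esub> g"
      using h by (auto simp: pi0_proj_def r_coset_def)
    have hG: "h \<in> carrier G"
      using hu u g N.subset by auto
    obtain p where p: "continuous_map ?I T p" "p 0 = \<one>\<^bsub>G\<^esub>" "p 1 = u"
      using u by (auto simp: unit_path_component_def path_component_of_def pathin_def)
    have pc: "p s \<in> carrier G" if "s \<in> {0..1}" for s
      using continuous_map_image_subset_topspace [OF p(1)] that by (auto simp: ts)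
    define H where "H = (\<lambda>(s, t). ?conj (p s \<otimes>\<^bsub>G\<^esub> g) (\<gamma> t))"
    have cp: "continuous_map (prod_topology ?I (cube n)) T (\<lambda>z. p (fst z))"
      using continuous_map_compose [OF continuous_map_fst p(1)] by (simp add: o_def)
    have cg: "continuous_map (prod_topology ?I (cube n)) T (\<lambda>z. \<gamma> (snd z))"
      using continuous_map_compose [OF continuous_map_snd \<gamma>'(1)] by (simp add: o_def)
    have "continuous_map (prod_topology ?I (cube n)) T H"
      unfolding H_def case_prod_unfold using g
      by (intro continuous_map_group_mult [OF TG] continuous_map_group_inv [OF TG] cp cg)
        (auto simp: ts)
    then have "homotopic_with (\<lambda>h. \<forall>t\<in>cube_boundary n. h t = \<one>\<^bsub>G\<^esub>) (cube n) T
        (\<lambda>t. ?conj g (\<gamma> t)) (\<lambda>t. ?conj h (\<gamma> t))"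
      unfolding homotopic_with_def using p g hu pc
      by (intro exI [of _ H]) (auto simp: H_def \<gamma>')
    then show ?thesis
      using ind [OF hG] by (simp add: spheroid_class_eq)
  qed
  then have "(\<Union>h\<in>pi0_proj G T g. homotopy_induced n T \<one>\<^bsub>G\<^esub> (?conj h) (spheroid_class n T \<one>\<^bsub>G\<^esub> \<gamma>)) =
      (\<Union>h\<in>pi0_proj G T g. spheroid_class n T \<one>\<^bsub>G\<^esub> (\<lambda>t. ?conj g (\<gamma> t)))"
    by (intro SUP_cong refl)
  also have "\<dots> = spheroid_class n T \<one>\<^bsub>G\<^esub> (\<lambda>t. ?conj g (\<gamma> t))"
    using g_in by auto
  finally show ?thesis
    by (simp only: pi0_action_def)
qed

lemma comm_group_cochain_group:
  assumes "comm_group A"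
  shows "comm_group (cochain_group n X A)"
proof -
  interpret A: comm_group A by (rule assms)
  have hom_add: "\<phi> (a + b) = \<phi> a \<otimes>\<^bsub>A\<^esub> \<phi> b"
    if "\<phi> \<in> hom (chain_group n X) A" "singular_chain n X a" "singular_chain n X b" for \<phi> a b
    using hom_mult [OF that(1), of a b] that by simp
  have hom_in: "\<phi> a \<in> carrier A"
    if "\<phi> \<in> hom (chain_group n X) A" "singular_chain n X a" for \<phi> a
    using hom_in_carrier [OF that(1)] that by simp
  show ?thesis
  proof (rule comm_groupI)
    fix \<phi> \<psi> assume "\<phi> \<in> carrier (cochain_group n X A)" "\<psi> \<in> carrier (cochain_group n X A)"
    then show "\<phi> \<otimes>\<^bsub>cochain_group n X A\<^esub> \<psi> \<in> carrier (cochain_group n X A)"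
      by (auto simp: cochain_group_def hom_add hom_in singular_chain_add A.m_ac intro!: homI)
  next
    show "\<one>\<^bsub>cochain_group n X A\<^esub> \<in> carrier (cochain_group n X A)"
      by (auto simp: cochain_group_def singular_chain_add intro!: homI)
  next
    fix \<phi> \<psi> \<theta>
    assume "\<phi> \<in> carrier (cochain_group n X A)" "\<psi> \<in> carrier (cochain_group n X A)"
      "\<theta> \<in> carrier (cochain_group n X A)"
    then show "\<phi> \<otimes>\<^bsub>cochain_group n X A\<^esub> \<psi> \<otimes>\<^bsub>cochain_group n X A\<^esub> \<theta> =
        \<phi> \<otimes>\<^bsub>cochain_group n X A\<^esub> (\<psi> \<otimes>\<^bsub>cochain_group n X A\<^esub> \<theta>)"
      by (auto simp: cochain_group_def hom_in A.m_assoc fun_eq_iff)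
  next
    fix \<phi> \<psi> assume "\<phi> \<in> carrier (cochain_group n X A)" "\<psi> \<in> carrier (cochain_group n X A)"
    then show "\<phi> \<otimes>\<^bsub>cochain_group n X A\<^esub> \<psi> = \<psi> \<otimes>\<^bsub>cochain_group n X A\<^esub> \<phi>"
      by (auto simp: cochain_group_def hom_in A.m_comm fun_eq_iff)
  next
    fix \<phi> assume \<phi>: "\<phi> \<in> carrier (cochain_group n X A)"
    then show "\<one>\<^bsub>cochain_group n X A\<^esub> \<otimes>\<^bsub>cochain_group n X A\<^esub> \<phi> = \<phi>"
      by (auto simp: cochain_group_def hom_in fun_eq_iff extensional_def)
    have "(\<lambda>c\<in>singular_chain_set n X. inv\<^bsub>A\<^esub> \<phi> c) \<in> carrier (cochain_group n X A)"
      using \<phi> by (auto simp: cochain_group_def hom_add hom_in singular_chain_add A.inv_mult intro!: homI)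
    moreover have "(\<lambda>c\<in>singular_chain_set n X. inv\<^bsub>A\<^esub> \<phi> c) \<otimes>\<^bsub>cochain_group n X A\<^esub> \<phi> =
        \<one>\<^bsub>cochain_group n X A\<^esub>"
      using \<phi> by (auto simp: cochain_group_def hom_in fun_eq_iff)
    ultimately show "\<exists>\<psi>\<in>carrier (cochain_group n X A). \<psi> \<otimes>\<^bsub>cochain_group n X A\<^esub> \<phi> = \<one>\<^bsub>cochain_group n X A\<^esub>"
      by blast
  qed
qed

lemma coboundary_hom:
  "coboundary n X \<in> hom (cochain_group n X A) (cochain_group (Suc n) X A)"
proof (rule homI)
  fix \<phi> assume \<phi>: "\<phi> \<in> carrier (cochain_group n X A)"
  have "\<phi> (chain_boundary (Suc n) c) \<in> carrier A" if "singular_chain (Suc n) X c" for c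
    using \<phi> that hom_in_carrier [of \<phi> "chain_group n X" A] singular_chain_boundary_alt
    by (fastforce simp: cochain_group_def)
  moreover have "\<phi> (chain_boundary (Suc n) (c + d)) =
      \<phi> (chain_boundary (Suc n) c) \<otimes>\<^bsub>A\<^esub> \<phi> (chain_boundary (Suc n) d)"
    if "singular_chain (Suc n) X c" "singular_chain (Suc n) X d" for c d
    using \<phi> that hom_mult [of \<phi> "chain_group n X" A] singular_chain_boundary_alt
    by (fastforce simp: cochain_group_def chain_boundary_add)
  ultimately show "coboundary n X \<phi> \<in> carrier (cochain_group (Suc n) X A)"
    by (auto simp: cochain_group_def coboundary_def singular_chain_add intro!: homI)
next
  fix \<phi> \<psi> assume "\<phi> \<in> carrier (cochain_group n X A)" "\<psi> \<in> carrier (cochain_group n X A)"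
  show "coboundary n X (\<phi> \<otimes>\<^bsub>cochain_group n X A\<^esub> \<psi>) =
      coboundary n X \<phi> \<otimes>\<^bsub>cochain_group (Suc n) X A\<^esub> coboundary n X \<psi>"
    by (auto simp: cochain_group_def coboundary_def fun_eq_iff singular_chain_boundary_alt)
qed

lemma comm_group_cohomology_group:
  assumes A: "comm_group A"
  shows "comm_group (cohomology_group n X A)"
proof -
  let ?C = "\<lambda>n. cochain_group n X A"
  have cg: "comm_group (?C k)" "group (?C k)" for k
    using comm_group_cochain_group [OF A] by (auto simp: comm_group_def)
  have gh: "group_hom (?C k) (?C (Suc k)) (coboundary k X)" for k
    by (simp add: group_hom_def group_hom_axioms_def cg coboundary_hom)
  have Z: "subgroup (cocycles n X A) (?C n)"
    using group_hom.subgroup_kernel [OF gh [of n]] by (simp add: kernel_def cocycles_def)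
  have B: "subgroup (coboundaries n X A) (?C n)"
    using group_hom.img_is_subgroup [OF gh] group.triv_subgroup [OF cg(2)]
    by (auto simp: coboundaries_def split: nat.split)
  have BZ: "coboundaries n X A \<subseteq> cocycles n X A"
  proof (cases n)
    case 0
    then show ?thesis
      using subgroup.one_closed [OF Z] by (simp add: coboundaries_def)
  next
    case (Suc k)
    have "coboundary (Suc k) X (coboundary k X \<phi>) = \<one>\<^bsub>?C (Suc (Suc k))\<^esub>"
      if \<phi>: "\<phi> \<in> carrier (?C k)" for \<phi>
    proof -
      have "\<phi> 0 = \<one>\<^bsub>A\<^esub>"
        using \<phi> hom_one [of \<phi> "chain_group k X" A] A by (simp add: cochain_group_def comm_group_def)
      then show ?thesis
        by (auto simp: coboundary_def cochain_group_def fun_eq_iff singular_chain_boundary_alt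
            chain_boundary_boundary_alt)
    qed
    moreover have "coboundary k X \<phi> \<in> carrier (?C (Suc k))" if "\<phi> \<in> carrier (?C k)" for \<phi>
      using group_hom.hom_closed [OF gh that] .
    ultimately show ?thesis
      by (auto simp: Suc coboundaries_def cocycles_def)
  qed
  have "comm_group ((?C n)\<lparr>carrier := cocycles n X A\<rparr>)"
  proof (rule group.group_comm_groupI)
    show "group ((?C n)\<lparr>carrier := cocycles n X A\<rparr>)"
      using Z cg(2) by (rule subgroup.subgroup_is_group)
    show "x \<otimes>\<^bsub>(?C n)\<lparr>carrier := cocycles n X A\<rparr>\<^esub> y = y \<otimes>\<^bsub>(?C n)\<lparr>carrier := cocycles n X A\<rparr>\<^esub> x"
      if "x \<in> carrier ((?C n)\<lparr>carrier := cocycles n X A\<rparr>)"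
        "y \<in> carrier ((?C n)\<lparr>carrier := cocycles n X A\<rparr>)" for x y
    proof -
      have "x \<in> carrier (?C n)" "y \<in> carrier (?C n)"
        using that subgroup.subset [OF Z] by auto
      then show ?thesis
        using comm_monoid.m_comm [OF comm_group.axioms(1) [OF cg(1)]] by simp
    qed
  qed
  moreover have "subgroup (coboundaries n X A) ((?C n)\<lparr>carrier := cocycles n X A\<rparr>)"
    using group.subgroup_incl [OF cg(2) B Z BZ] .
  ultimately show ?thesis
    unfolding cohomology_group_def by (rule comm_group.abelian_FactGroup)
qed

lemma local_trivialization_image:
  assumes T: "topspace T = carrier G" and U: "U \<subseteq> topspace M"
    and lt: "local_trivialization G T M P U \<phi>"
  shows "\<phi> ` (U \<times> carrier G) = {e \<in> topspace (total_space P). proj P e \<in> U}"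
proof -
  have "\<phi> ` topspace (prod_topology (subtopology M U) T) =
      topspace (subtopology (total_space P) {e \<in> topspace (total_space P). proj P e \<in> U})"
    using lt by (intro homeomorphic_imp_surjective_map) (simp add: local_trivialization_def)
  moreover have "topspace M \<inter> U = U"
    using U by blast
  ultimately show ?thesis
    by (auto simp: T)
qed

lemma local_trivialization_act:
  assumes G: "group G" and ra: "right_action G (topspace (total_space P)) (act P)"
    and T: "topspace T = carrier G" and U: "U \<subseteq> topspace M"
    and lt: "local_trivialization G T M P U \<phi>"
    and b: "b \<in> U" and g: "g \<in> carrier G" and h: "h \<in> carrier G"
  shows "act P (\<phi> (b, g)) h = \<phi> (b, g \<otimes>\<^bsub>G\<^esub> h)"
proof -
  interpret group G by (rule G)
  have "\<phi> ` (U \<times> carrier G) = {e \<in> topspace (total_space P). proj P e \<in> U}"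
    by (rule local_trivialization_image [OF T U lt])
  then have "\<phi> (b, \<one>\<^bsub>G\<^esub>) \<in> topspace (total_space P)"
    using b by blast
  then have "act P (act P (\<phi> (b, \<one>\<^bsub>G\<^esub>)) g) h = act P (\<phi> (b, \<one>\<^bsub>G\<^esub>)) (g \<otimes>\<^bsub>G\<^esub> h)"
    using ra g h by (simp add: right_action_def)
  moreover have "\<phi> (b, k) = act P (\<phi> (b, \<one>\<^bsub>G\<^esub>)) k" if "k \<in> carrier G" for k
    using lt b that unfolding local_trivialization_def by blast
  ultimately show ?thesis
    using g h by (metis m_closed)
qed

lemma local_trivialization_obtain:
  assumes T: "topspace T = carrier G" and U: "U \<subseteq> topspace M"
    and lt: "local_trivialization G T M P U \<phi>"
    and e: "e \<in> topspace (total_space P)" "proj P e \<in> U"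
  obtains g where "g \<in> carrier G" "e = \<phi> (proj P e, g)"
proof -
  have "\<phi> ` (U \<times> carrier G) = {e \<in> topspace (total_space P). proj P e \<in> U}"
    by (rule local_trivialization_image [OF T U lt])
  then obtain b g where "b \<in> U" "g \<in> carrier G" "e = \<phi> (b, g)"
    using e by blast
  moreover have "proj P (\<phi> (b, g)) = b"
    using calculation lt unfolding local_trivialization_def by blast
  ultimately show ?thesis
    using that [of g] by simp
qed

lemma principal_bundle_trivialization:
  assumes "principal_bundle G T M P" "b \<in> topspace M"
  obtains U \<phi> where "openin M U" "b \<in> U" "local_trivialization G T M P U \<phi>"
proof -
  obtain \<U> where \<U>: "\<forall>U\<in>\<U>. openin M U" "\<Union>\<U> = topspace M"
    "\<forall>U\<in>\<U>. \<exists>\<phi>. local_trivialization G T M P U \<phi>"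
    using assms(1) unfolding principal_bundle_def by (elim conjE exE)
  have "b \<in> \<Union>\<U>"
    using assms(2) \<U>(2) by simp
  then obtain U where U: "U \<in> \<U>" "b \<in> U"
    by (rule UnionE)
  then obtain \<phi> where "local_trivialization G T M P U \<phi>"
    using \<U>(3) by blast
  then show ?thesis
    using that [of U \<phi>] U \<U>(1) by simp
qed

lemma principal_bundle_proj_in:
  assumes "principal_bundle G T M P" "e \<in> topspace (total_space P)"
  shows "proj P e \<in> topspace M"
proof -
  have "continuous_map (total_space P) M (proj P)"
    using assms(1) by (simp add: principal_bundle_def)
  then show ?thesis
    using continuous_map_image_subset_topspace assms(2) by blast
qed

lemma principal_bundle_proj_act:
  assumes TG: "topological_group G T" and P: "principal_bundle G T M P"
    and e: "e \<in> topspace (total_space P)" and h: "h \<in> carrier G"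
  shows "proj P (act P e h) = proj P e"
proof -
  interpret group G
    using TG by (simp add: topological_group_def)
  have ts: "topspace T = carrier G"
    using TG by (simp add: topological_group_def)
  have ra: "right_action G (topspace (total_space P)) (act P)"
    using P by (simp add: principal_bundle_def)
  obtain U \<phi> where U: "openin M U" "proj P e \<in> U" and lt: "local_trivialization G T M P U \<phi>"
    using principal_bundle_trivialization [OF P principal_bundle_proj_in [OF P e]] .
  obtain g where g: "g \<in> carrier G" "e = \<phi> (proj P e, g)"
    using local_trivialization_obtain [OF ts openin_subset [OF U(1)] lt e U(2)] .
  have "act P (\<phi> (proj P e, g)) h = \<phi> (proj P e, g \<otimes>\<^bsub>G\<^esub> h)"
    using local_trivialization_act [OF is_group ra ts openin_subset [OF U(1)] lt U(2) g(1) h] .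
  then have "act P e h = \<phi> (proj P e, g \<otimes>\<^bsub>G\<^esub> h)"
    by (simp only: g(2) [symmetric])
  moreover have "proj P (\<phi> (proj P e, g \<otimes>\<^bsub>G\<^esub> h)) = proj P e"
    using lt U(2) m_closed [OF g(1) h] unfolding local_trivialization_def by blast
  ultimately show ?thesis
    by simp
qed

lemma principal_bundle_continuous_action:
  assumes TG: "topological_group G T" and P: "principal_bundle G T M P"
  shows "continuous_map (prod_topology (total_space P) T) (total_space P) (\<lambda>(e, g). act P e g)"
proof -
  interpret group G
    using TG by (simp add: topological_group_def)
  have ts: "topspace T = carrier G"
    using TG by (simp add: topological_group_def)
  have ra: "right_action G (topspace (total_space P)) (act P)" and cp: "continuous_map (total_space P) M (proj P)"
    using P by (auto simp: principal_bundle_def)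
  obtain \<U> where *: "(\<forall>U\<in>\<U>. openin M U) \<and> \<Union>\<U> = topspace M \<and>
      (\<forall>U\<in>\<U>. \<exists>\<phi>. local_trivialization G T M P U \<phi>)"
    using P unfolding principal_bundle_def by (elim conjE exE) (rule that, intro conjI)
  have \<U>: "\<And>U. U \<in> \<U> \<Longrightarrow> openin M U" "\<Union>\<U> = topspace M"
    "\<And>U. U \<in> \<U> \<Longrightarrow> \<exists>\<phi>. local_trivialization G T M P U \<phi>"
    using * by simp_all
  define W where "W = (\<lambda>U. {e \<in> topspace (total_space P). proj P e \<in> U})"
  have W: "openin (total_space P) (W U)" if "U \<in> \<U>" for U
    unfolding W_def using cp \<U>(1) [OF that] by (rule openin_continuous_map_preimage)
  show ?thesis
  proof (rule pasting_lemma [where I = \<U> and T = "\<lambda>U. W U \<times> carrier G" and f = "\<lambda>_ (e, g). act P e g"])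
    fix U assume U: "U \<in> \<U>"
    show "openin (prod_topology (total_space P) T) (W U \<times> carrier G)"
      using W [OF U] by (simp add: openin_prod_Times_iff flip: ts)
    obtain \<phi> where lt: "local_trivialization G T M P U \<phi>"
      using \<U>(3) [OF U] by blast
    have UM: "U \<subseteq> topspace M"
      using \<U>(1) [OF U] openin_subset by blast
    let ?UG = "prod_topology (subtopology M U) T"
    let ?W = "subtopology (total_space P) (W U)"
    have hm: "homeomorphic_map ?UG ?W \<phi>"
      using lt unfolding local_trivialization_def W_def by blast
    then obtain \<psi> where \<psi>: "homeomorphic_maps ?UG ?W \<phi> \<psi>"
      by (auto simp: homeomorphic_map_maps)
    have c\<psi>: "continuous_map ?W ?UG \<psi>" and c\<phi>: "continuous_map ?UG ?W \<phi>"
      and \<phi>\<psi>: "\<And>e. e \<in> W U \<Longrightarrow> \<phi> (\<psi> e) = e"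
      using \<psi> by (auto simp: homeomorphic_maps_def W_def)
    have c1: "continuous_map (prod_topology ?W T) ?UG (\<lambda>z. \<psi> (fst z))"
      using continuous_map_compose [OF continuous_map_fst c\<psi>] by (simp add: o_def)
    have "continuous_map (prod_topology ?W T) ?UG
        (\<lambda>z. (fst (\<psi> (fst z)), snd (\<psi> (fst z)) \<otimes>\<^bsub>G\<^esub> snd z))"
      using c1 by (intro continuous_map_pairedI continuous_map_group_mult [OF TG] continuous_map_snd)
        (simp_all add: continuous_map_pairwise o_def)
    from continuous_map_compose [OF this c\<phi>]
    have "continuous_map (prod_topology ?W T) ?W
        (\<lambda>z. \<phi> (fst (\<psi> (fst z)), snd (\<psi> (fst z)) \<otimes>\<^bsub>G\<^esub> snd z))"
      by (simp add: o_def)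
    moreover have "\<phi> (fst (\<psi> (fst z)), snd (\<psi> (fst z)) \<otimes>\<^bsub>G\<^esub> snd z) = act P (fst z) (snd z)"
      if "z \<in> topspace (prod_topology ?W T)" for z
    proof -
      have z: "fst z \<in> W U" "snd z \<in> carrier G"
        using that by (auto simp: ts)
      then have "fst z \<in> topspace ?W"
        by (simp add: W_def)
      then have "\<psi> (fst z) \<in> topspace ?UG"
        using continuous_map_image_subset_topspace [OF c\<psi>] by blast
      then have "\<psi> (fst z) \<in> U \<times> carrier G"
        by (simp add: ts mem_Times_iff)
      then have "act P (\<phi> (fst (\<psi> (fst z)), snd (\<psi> (fst z)))) (snd z) =
          \<phi> (fst (\<psi> (fst z)), snd (\<psi> (fst z)) \<otimes>\<^bsub>G\<^esub> snd z)"
        using z by (intro local_trivialization_act [OF is_group ra ts UM lt]) auto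
      then show ?thesis
        using \<phi>\<psi> [OF z(1)] by simp
    qed
    ultimately have "continuous_map (prod_topology ?W T) ?W (\<lambda>z. act P (fst z) (snd z))"
      by (rule continuous_map_eq)
    then have "continuous_map (prod_topology ?W T) (total_space P) (\<lambda>z. act P (fst z) (snd z))"
      by (rule continuous_map_into_fulltopology)
    moreover have "prod_topology ?W T = subtopology (prod_topology (total_space P) T) (W U \<times> carrier G)"
      using subtopology_topspace [of T] by (simp add: subtopology_Times ts)
    ultimately show "continuous_map (subtopology (prod_topology (total_space P) T) (W U \<times> carrier G)) (total_space P)
        (\<lambda>(e, g). act P e g)"
      by (simp add: case_prod_unfold)
  next
    fix z assume "z \<in> topspace (prod_topology (total_space P) T)"
    then have z: "fst z \<in> topspace (total_space P)" "snd z \<in> carrier G"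
      by (auto simp: ts)
    then have "proj P (fst z) \<in> \<Union>\<U>"
      using principal_bundle_proj_in [OF P] \<U>(2) by simp
    then obtain U where "U \<in> \<U>" "proj P (fst z) \<in> U"
      by (rule UnionE)
    then show "\<exists>U. U \<in> \<U> \<and> z \<in> W U \<times> carrier G \<and>
        (case z of (e, g) \<Rightarrow> act P e g) = (case z of (e, g) \<Rightarrow> act P e g)"
      using z by (auto simp: W_def mem_Times_iff)
  qed auto
qed

lemma principal_bundle_trivial:
  fixes M :: "'b topology"
  assumes TG: "topological_group G T"
  shows "principal_bundle G T M (trivial_bundle G T M)"
proof -
  interpret group G
    using TG by (simp add: topological_group_def)
  have ts: "topspace T = carrier G"
    using TG by (simp add: topological_group_def)
  have "subtopology (prod_topology M T) {e \<in> topspace M \<times> topspace T. fst e \<in> topspace M} =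
      prod_topology M T"
    by (rule subtopology_superset) auto
  then have "homeomorphic_map (prod_topology (subtopology M (topspace M)) T)
      (subtopology (prod_topology M T) {e \<in> topspace (prod_topology M T). fst e \<in> topspace M}) id"
    by (simp only: homeomorphic_map_id subtopology_topspace topspace_prod_topology)
  moreover have "id (b, g) = (case id (b, \<one>\<^bsub>G\<^esub>) of (b, g) \<Rightarrow> \<lambda>h. (b, g \<otimes>\<^bsub>G\<^esub> h)) g \<and> fst (id (b, g)) = b"
    if "g \<in> carrier G" for b :: 'b and g
    using that by simp
  ultimately have "local_trivialization G T M (trivial_bundle G T M) (topspace M) id"
    unfolding local_trivialization_def trivial_bundle_def gbundle.simps by blast
  moreover have "right_action G (topspace (total_space (trivial_bundle G T M))) (act (trivial_bundle G T M))"
    by (auto simp: right_action_def trivial_bundle_def ts m_assoc)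
  moreover have "continuous_map (total_space (trivial_bundle G T M)) M (proj (trivial_bundle G T M))"
    by (simp add: trivial_bundle_def continuous_map_fst)
  ultimately show ?thesis
    unfolding principal_bundle_def by (intro conjI exI [of _ "{topspace M}"] ballI) auto
qed

lemma bundle_equivalence_image:
  assumes "bundle_equivalence G P Q h"
  shows "h ` topspace (total_space P) = topspace (total_space Q)"
  using assms by (intro homeomorphic_imp_surjective_map) (simp add: bundle_equivalence_def)

lemma bundle_equivalence_inverse:
  assumes ra: "right_action G (topspace (total_space P)) (act P)"
    and h: "bundle_equivalence G P Q h"
  obtains k where "bundle_equivalence G Q P k" "homeomorphic_maps (total_space P) (total_space Q) h k"
proof -
  obtain k where k: "homeomorphic_maps (total_space P) (total_space Q) h k"
    using h homeomorphic_map_maps unfolding bundle_equivalence_def by blast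
  then have hk: "homeomorphic_map (total_space Q) (total_space P) k"
    and inv: "\<And>e. e \<in> topspace (total_space P) \<Longrightarrow> k (h e) = e" "\<And>e. e \<in> topspace (total_space Q) \<Longrightarrow> h (k e) = e"
    by (simp_all add: homeomorphic_maps_map)
  have kin: "k e \<in> topspace (total_space P)" if "e \<in> topspace (total_space Q)" for e
    using homeomorphic_imp_surjective_map [OF hk] that by blast
  have "proj P (k e) = proj Q e \<and> (\<forall>g\<in>carrier G. k (act Q e g) = act P (k e) g)"
    if e: "e \<in> topspace (total_space Q)" for e
  proof (intro conjI ballI)
    have "proj Q (h (k e)) = proj P (k e)"
      using h kin [OF e] by (simp add: bundle_equivalence_def)
    then show "proj P (k e) = proj Q e"
      using inv(2) [OF e] by simp
    fix g assume g: "g \<in> carrier G"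
    have "h (act P (k e) g) = act Q (h (k e)) g"
      using h kin [OF e] g by (simp add: bundle_equivalence_def)
    then have "h (act P (k e) g) = act Q e g"
      using inv(2) [OF e] by simp
    moreover have "act P (k e) g \<in> topspace (total_space P)"
      using ra kin [OF e] g by (simp add: right_action_def)
    ultimately show "k (act Q e g) = act P (k e) g"
      using inv(1) by metis
  qed
  then have "bundle_equivalence G Q P k"
    using hk by (simp add: bundle_equivalence_def)
  then show ?thesis
    using that k by blast
qed

lemma equiv_bundle_equiv_rel:
  fixes G :: "'g monoid" and M :: "'m topology"
  shows "equiv (Collect (principal_bundle G T M)) (bundle_equiv_rel G T M)"
proof (rule equivI)
  show "bundle_equiv_rel G T M \<subseteq> Collect (principal_bundle G T M) \<times> Collect (principal_bundle G T M)"
    by (auto simp: bundle_equiv_rel_def)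
  have "bundle_equivalence G P P id" for P :: "('m \<times> 'g, 'g, 'm) gbundle"
    by (simp add: bundle_equivalence_def)
  then show "refl_on (Collect (principal_bundle G T M)) (bundle_equiv_rel G T M)"
    by (auto simp: refl_on_def bundle_equiv_rel_def equivalent_bundles_def)
  show "sym (bundle_equiv_rel G T M)"
  proof (rule symI)
    fix P Q assume PQ: "(P, Q) \<in> bundle_equiv_rel G T M"
    then obtain h where "bundle_equivalence G P Q h"
      by (auto simp: bundle_equiv_rel_def equivalent_bundles_def)
    moreover have "right_action G (topspace (total_space P)) (act P)"
      using PQ by (simp add: bundle_equiv_rel_def principal_bundle_def)
    ultimately obtain k where "bundle_equivalence G Q P k"
      using bundle_equivalence_inverse by metis
    then show "(Q, P) \<in> bundle_equiv_rel G T M"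
      using PQ by (auto simp: bundle_equiv_rel_def equivalent_bundles_def)
  qed
  show "trans (bundle_equiv_rel G T M)"
  proof (rule transI)
    fix P Q R assume PQ: "(P, Q) \<in> bundle_equiv_rel G T M" and QR: "(Q, R) \<in> bundle_equiv_rel G T M"
    obtain h k where h: "bundle_equivalence G P Q h" and k: "bundle_equivalence G Q R k"
      using PQ QR by (auto simp: bundle_equiv_rel_def equivalent_bundles_def)
    have "h ` topspace (total_space P) = topspace (total_space Q)"
      by (rule bundle_equivalence_image [OF h])
    then have "h e \<in> topspace (total_space Q)" if "e \<in> topspace (total_space P)" for e
      using that by blast
    moreover have "homeomorphic_map (total_space P) (total_space R) (k \<circ> h)"
      using h k by (auto simp: bundle_equivalence_def intro: homeomorphic_map_compose)
    ultimately have "bundle_equivalence G P R (k \<circ> h)"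
      using h k by (simp add: bundle_equivalence_def)
    then show "(P, R) \<in> bundle_equiv_rel G T M"
      using PQ QR by (auto simp: bundle_equiv_rel_def equivalent_bundles_def)
  qed
qed

lemma principal_bundle_transfer:
  assumes TG: "topological_group G T" and P: "principal_bundle G T M P"
    and k: "bundle_equivalence G Q P k"
    and cl: "\<And>e g. e \<in> topspace (total_space Q) \<Longrightarrow> g \<in> carrier G \<Longrightarrow> act Q e g \<in> topspace (total_space Q)"
  shows "principal_bundle G T M Q"
proof -
  interpret group G
    using TG by (simp add: topological_group_def)
  have ts: "topspace T = carrier G"
    using TG by (simp add: topological_group_def)
  have ra: "right_action G (topspace (total_space P)) (act P)"
    and cp: "continuous_map (total_space P) M (proj P)"
    using P by (simp_all add: principal_bundle_def)
  have hk: "homeomorphic_map (total_space Q) (total_space P) k"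
    using k by (simp add: bundle_equivalence_def)
  have kproj: "proj P (k e) = proj Q e" if "e \<in> topspace (total_space Q)" for e
    using k that by (simp add: bundle_equivalence_def)
  have kact: "k (act Q e g) = act P (k e) g" if "e \<in> topspace (total_space Q)" "g \<in> carrier G" for e g
    using k that by (simp add: bundle_equivalence_def)
  have kin: "k e \<in> topspace (total_space P)" if "e \<in> topspace (total_space Q)" for e
    using bundle_equivalence_image [OF k] that by blast
  have kinj: "inj_on k (topspace (total_space Q))"
    using hk by (simp add: homeomorphic_map_def)
  obtain k' where k': "homeomorphic_maps (total_space Q) (total_space P) k k'"
    using hk homeomorphic_map_maps by blast
  then have hk': "homeomorphic_map (total_space P) (total_space Q) k'"
    and inv: "\<And>e. e \<in> topspace (total_space Q) \<Longrightarrow> k' (k e) = e"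
      "\<And>e. e \<in> topspace (total_space P) \<Longrightarrow> k (k' e) = e"
    by (simp_all add: homeomorphic_maps_map)
  have k'in: "k' e \<in> topspace (total_space Q)" if "e \<in> topspace (total_space P)" for e
    using homeomorphic_imp_surjective_map [OF hk'] that by blast
  have k'proj: "proj Q (k' e) = proj P e" if "e \<in> topspace (total_space P)" for e
    using kproj [OF k'in [OF that]] inv(2) [OF that] by simp
  have "right_action G (topspace (total_space Q)) (act Q)"
    unfolding right_action_def
  proof (intro ballI conjI)
    fix e assume e: "e \<in> topspace (total_space Q)"
    have "k (act Q e \<one>\<^bsub>G\<^esub>) = k e"
      using kact [OF e one_closed] ra kin [OF e] by (simp add: right_action_def)
    then show "act Q e \<one>\<^bsub>G\<^esub> = e"
      by (rule inj_onD [OF kinj]) (simp_all add: e cl)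
    fix g assume g: "g \<in> carrier G"
    show "act Q e g \<in> topspace (total_space Q)"
      by (rule cl [OF e g])
    fix h assume h: "h \<in> carrier G"
    have "k (act Q (act Q e g) h) = act P (act P (k e) g) h"
      using kact [OF cl [OF e g] h] kact [OF e g] by simp
    also have "\<dots> = act P (k e) (g \<otimes>\<^bsub>G\<^esub> h)"
      using ra kin [OF e] g h by (simp add: right_action_def)
    also have "\<dots> = k (act Q e (g \<otimes>\<^bsub>G\<^esub> h))"
      using kact [OF e m_closed [OF g h]] by simp
    finally show "act Q (act Q e g) h = act Q e (g \<otimes>\<^bsub>G\<^esub> h)"
      by (rule inj_onD [OF kinj]) (simp_all add: e cl g h)
  qed
  moreover have "continuous_map (total_space Q) M (proj Q)"
  proof (rule continuous_map_eq)
    show "continuous_map (total_space Q) M (proj P \<circ> k)"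
      using hk homeomorphic_imp_continuous_map cp continuous_map_compose by metis
    show "(proj P \<circ> k) e = proj Q e" if "e \<in> topspace (total_space Q)" for e
      using kproj [OF that] by simp
  qed
  moreover have "local_trivialization G T M Q U (k' \<circ> \<phi>)"
    if U: "U \<subseteq> topspace M" and lt: "local_trivialization G T M P U \<phi>" for U \<phi>
    unfolding local_trivialization_def
  proof (intro conjI ballI)
    have "homeomorphic_map (subtopology (total_space P) {e \<in> topspace (total_space P). proj P e \<in> U})
        (subtopology (total_space Q) {e \<in> topspace (total_space Q). proj Q e \<in> U}) k'"
      by (rule homeomorphic_map_subtopologies_alt [OF hk']) (simp add: k'proj)
    moreover have "homeomorphic_map (prod_topology (subtopology M U) T)
        (subtopology (total_space P) {e \<in> topspace (total_space P). proj P e \<in> U}) \<phi>"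
      using lt unfolding local_trivialization_def by blast
    ultimately show "homeomorphic_map (prod_topology (subtopology M U) T)
        (subtopology (total_space Q) {e \<in> topspace (total_space Q). proj Q e \<in> U}) (k' \<circ> \<phi>)"
      by (intro homeomorphic_map_compose)
  next
    fix b g assume b: "b \<in> U" and g: "g \<in> carrier G"
    have \<phi>in: "\<phi> (b, h) \<in> topspace (total_space P)" if "h \<in> carrier G" for h
      using local_trivialization_image [OF ts U lt] b that by blast
    have \<phi>: "proj P (\<phi> (b, g)) = b" "\<phi> (b, g) = act P (\<phi> (b, \<one>\<^bsub>G\<^esub>)) g"
      using lt b g unfolding local_trivialization_def by blast+
    show "proj Q ((k' \<circ> \<phi>) (b, g)) = b"
      using k'proj [OF \<phi>in [OF g]] \<phi>(1) by simp
    let ?e = "k' (\<phi> (b, \<one>\<^bsub>G\<^esub>))"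
    have e: "?e \<in> topspace (total_space Q)"
      by (rule k'in [OF \<phi>in [OF one_closed]])
    have "k (act Q ?e g) = act P (\<phi> (b, \<one>\<^bsub>G\<^esub>)) g"
      using kact [OF e g] inv(2) [OF \<phi>in [OF one_closed]] by simp
    then have "k (act Q ?e g) = \<phi> (b, g)"
      by (simp only: \<phi>(2) [symmetric])
    then show "(k' \<circ> \<phi>) (b, g) = act Q ((k' \<circ> \<phi>) (b, \<one>\<^bsub>G\<^esub>)) g"
      using inv(1) [OF cl [OF e g]] by simp
  qed
  moreover obtain \<U> where \<U>: "\<forall>U\<in>\<U>. openin M U" "\<Union>\<U> = topspace M"
    "\<forall>U\<in>\<U>. \<exists>\<phi>. local_trivialization G T M P U \<phi>"
    using P unfolding principal_bundle_def by (elim conjE exE)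
  ultimately have "\<forall>U\<in>\<U>. \<exists>\<phi>. local_trivialization G T M Q U \<phi>"
    using openin_subset by meson
  then show ?thesis
    unfolding principal_bundle_def
    using \<U>(1,2) \<open>right_action G _ (act Q)\<close> \<open>continuous_map (total_space Q) M (proj Q)\<close>
    by (intro conjI exI [of _ \<U>])
qed

lemma principal_bundle_representative:
  fixes P :: "('e, 'g, 'm) gbundle"
  assumes TG: "topological_group G T" and P: "principal_bundle G T M P"
  obtains Q :: "('m \<times> 'g, 'g, 'm) gbundle"
    where "principal_bundle G T M Q" "equivalent_bundles G Q P"
proof -
  interpret group G
    using TG by (simp add: topological_group_def)
  have ts: "topspace T = carrier G"
    using TG by (simp add: topological_group_def)
  have ra: "right_action G (topspace (total_space P)) (act P)"
    using P by (simp add: principal_bundle_def)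
  have "\<exists>e. e \<in> topspace (total_space P) \<and> proj P e = b" if b: "b \<in> topspace M" for b
  proof -
    obtain U \<phi> where U: "openin M U" "b \<in> U" and lt: "local_trivialization G T M P U \<phi>"
      using principal_bundle_trivialization [OF P b] .
    have "\<phi> (b, \<one>\<^bsub>G\<^esub>) \<in> topspace (total_space P)"
      using local_trivialization_image [OF ts openin_subset [OF U(1)] lt] U(2) by blast
    moreover have "proj P (\<phi> (b, \<one>\<^bsub>G\<^esub>)) = b"
      using lt U(2) unfolding local_trivialization_def by blast
    ultimately show ?thesis
      by blast
  qed
  then obtain s where s: "\<And>b. b \<in> topspace M \<Longrightarrow> s b \<in> topspace (total_space P)"
      "\<And>b. b \<in> topspace M \<Longrightarrow> proj P (s b) = b"
    by metis
  define k where "k = (\<lambda>(b, g). act P (s b) g)"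
  define A where "A = topspace M \<times> carrier G"
  have kin: "k (b, g) \<in> topspace (total_space P)" and kproj: "proj P (k (b, g)) = b"
    if "b \<in> topspace M" "g \<in> carrier G" for b g
  proof -
    show "k (b, g) \<in> topspace (total_space P)"
      using ra s(1) [OF that(1)] that(2) by (simp add: k_def right_action_def)
    show "proj P (k (b, g)) = b"
      using principal_bundle_proj_act [OF TG P s(1) [OF that(1)] that(2)] s(2) [OF that(1)]
      by (simp add: k_def)
  qed
  have kact: "k (b, g \<otimes>\<^bsub>G\<^esub> h) = act P (k (b, g)) h"
    if "b \<in> topspace M" "g \<in> carrier G" "h \<in> carrier G" for b g h
    using ra s(1) [OF that(1)] that(2,3) by (simp add: k_def right_action_def)
  have fibre: "\<exists>g0\<in>carrier G. \<exists>\<phi>. inj_on \<phi> ({b} \<times> carrier G) \<and>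
      (\<forall>g\<in>carrier G. k (b, g) = \<phi> (b, g0 \<otimes>\<^bsub>G\<^esub> g)) \<and>
      (\<forall>e\<in>topspace (total_space P). proj P e = b \<longrightarrow> (\<exists>g\<in>carrier G. e = \<phi> (b, g)))"
    if b: "b \<in> topspace M" for b
  proof -
    obtain U \<phi> where U: "openin M U" "b \<in> U" and lt: "local_trivialization G T M P U \<phi>"
      using principal_bundle_trivialization [OF P b] .
    note UM = openin_subset [OF U(1)]
    have "proj P (s b) \<in> U"
      using s(2) [OF b] U(2) by simp
    from local_trivialization_obtain [OF ts UM lt s(1) [OF b] this]
    obtain g0 where "g0 \<in> carrier G" "s b = \<phi> (proj P (s b), g0)" .
    then have g0: "g0 \<in> carrier G" "s b = \<phi> (b, g0)"
      using s(2) [OF b] by simp_all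
    have "homeomorphic_map (prod_topology (subtopology M U) T)
        (subtopology (total_space P) {e \<in> topspace (total_space P). proj P e \<in> U}) \<phi>"
      using lt unfolding local_trivialization_def by blast
    then have "inj_on \<phi> (topspace (prod_topology (subtopology M U) T))"
      unfolding homeomorphic_map_def by blast
    then have "inj_on \<phi> ({b} \<times> carrier G)"
      by (rule inj_on_subset) (use b U(2) in \<open>auto simp: ts\<close>)
    moreover have "k (b, g) = \<phi> (b, g0 \<otimes>\<^bsub>G\<^esub> g)" if "g \<in> carrier G" for g
      using local_trivialization_act [OF is_group ra ts UM lt U(2) g0(1) that] g0(2)
      by (simp add: k_def)
    moreover have "\<exists>g\<in>carrier G. e = \<phi> (b, g)"
      if e: "e \<in> topspace (total_space P)" and eb: "proj P e = b" for e
    proof -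
      have "proj P e \<in> U"
        using eb U(2) by simp
      from local_trivialization_obtain [OF ts UM lt e this]
      obtain g where "g \<in> carrier G" "e = \<phi> (proj P e, g)" .
      then show ?thesis
        using eb by auto
    qed
    ultimately show ?thesis
      using g0(1) by blast
  qed
  have inj: "inj_on k A"
  proof (rule inj_onI)
    fix x y assume x: "x \<in> A" and y: "y \<in> A" and eq: "k x = k y"
    obtain b g b' g' where xy: "x = (b, g)" "y = (b', g')" and bg: "b \<in> topspace M" "g \<in> carrier G"
        "b' \<in> topspace M" "g' \<in> carrier G"
      using x y by (auto simp: A_def)
    have bb: "b = b'"
      using kproj [OF bg(1,2)] kproj [OF bg(3,4)] eq xy by simp
    obtain g0 \<phi> where g0: "g0 \<in> carrier G" and \<phi>: "inj_on \<phi> ({b} \<times> carrier G)"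
      "\<forall>g\<in>carrier G. k (b, g) = \<phi> (b, g0 \<otimes>\<^bsub>G\<^esub> g)"
      using fibre [OF bg(1)] by blast
    have "\<phi> (b, g0 \<otimes>\<^bsub>G\<^esub> g) = \<phi> (b, g0 \<otimes>\<^bsub>G\<^esub> g')"
      using \<phi>(2) bg(2,4) eq xy bb by simp
    then have "(b, g0 \<otimes>\<^bsub>G\<^esub> g) = (b, g0 \<otimes>\<^bsub>G\<^esub> g')"
      by (rule inj_onD [OF \<phi>(1)]) (simp_all add: g0 bg)
    then show "x = y"
      using xy bb g0 bg by simp
  qed
  have surj: "k ` A = topspace (total_space P)"
  proof
    show "k ` A \<subseteq> topspace (total_space P)"
      using kin by (auto simp: A_def)
    show "topspace (total_space P) \<subseteq> k ` A"
    proof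
      fix e assume e: "e \<in> topspace (total_space P)"
      define b where "b = proj P e"
      have b: "b \<in> topspace M"
        unfolding b_def by (rule principal_bundle_proj_in [OF P e])
      obtain g0 \<phi> where g0: "g0 \<in> carrier G" and \<phi>: "\<forall>g\<in>carrier G. k (b, g) = \<phi> (b, g0 \<otimes>\<^bsub>G\<^esub> g)"
        "\<forall>e\<in>topspace (total_space P). proj P e = b \<longrightarrow> (\<exists>g\<in>carrier G. e = \<phi> (b, g))"
        using fibre [OF b] by blast
      obtain g where g: "g \<in> carrier G" "e = \<phi> (b, g)"
        using \<phi>(2) e b_def by blast
      have "k (b, inv\<^bsub>G\<^esub> g0 \<otimes>\<^bsub>G\<^esub> g) = e"
        using \<phi>(1) g g0 by (simp flip: m_assoc)
      then show "e \<in> k ` A"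
        using b g0 g(1) by (force simp: A_def)
    qed
  qed
  define Q where "Q = \<lparr>total_space = pullback_topology A k (total_space P),
      act = (\<lambda>(b, g) h. (b, g \<otimes>\<^bsub>G\<^esub> h)), proj = fst\<rparr>"
  have tQ: "topspace (total_space Q) = A"
    using surj by (auto simp: Q_def topspace_pullback_topology)
  have "openin (total_space Q) {x \<in> A. k x \<in> U} \<longleftrightarrow> openin (total_space P) U"
    if U: "U \<subseteq> topspace (total_space P)" for U
  proof
    assume "openin (total_space Q) {x \<in> A. k x \<in> U}"
    then obtain V where V: "openin (total_space P) V" "{x \<in> A. k x \<in> U} = k -` V \<inter> A"
      by (auto simp: Q_def openin_pullback_topology)
    have "y \<in> U \<longleftrightarrow> y \<in> V" if "y \<in> topspace (total_space P)" for y
    proof -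
      obtain x where x: "y = k x" "x \<in> A"
        using \<open>y \<in> topspace (total_space P)\<close> unfolding surj [symmetric] by (rule imageE)
      have "x \<in> {x \<in> A. k x \<in> U} \<longleftrightarrow> x \<in> k -` V \<inter> A"
        by (simp only: V(2))
      then show ?thesis
        using x by simp
    qed
    then have "U \<inter> topspace (total_space P) = V \<inter> topspace (total_space P)"
      by auto
    then have "U = V"
      using U openin_subset [OF V(1)] by (simp add: Int_absorb2)
    then show "openin (total_space P) U"
      using V(1) by simp
  next
    assume "openin (total_space P) U"
    moreover have "{x \<in> A. k x \<in> U} = k -` U \<inter> A"
      by blast
    ultimately show "openin (total_space Q) {x \<in> A. k x \<in> U}"
      by (auto simp: Q_def openin_pullback_topology)
  qed
  then have "homeomorphic_map (total_space Q) (total_space P) k"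
    unfolding homeomorphic_map_def quotient_map_def tQ
    by (intro conjI allI impI surj inj)
  moreover have "proj P (k e) = proj Q e \<and> (\<forall>g\<in>carrier G. k (act Q e g) = act P (k e) g)"
    if "e \<in> A" for e
    using that kproj kact by (auto simp: A_def Q_def)
  ultimately have eq: "bundle_equivalence G Q P k"
    unfolding bundle_equivalence_def tQ by blast
  have "act Q e g \<in> A" if "e \<in> A" "g \<in> carrier G" for e g
    using that by (auto simp: A_def Q_def)
  then have "principal_bundle G T M Q"
    using principal_bundle_transfer [OF TG P eq] by (simp add: tQ)
  moreover have "equivalent_bundles G Q P"
    unfolding equivalent_bundles_def using eq by (rule exI [of "bundle_equivalence G Q P"])
  ultimately show ?thesis
    by (rule that)
qed

end

theory Submission
  imports Defs "HOL-Analysis.Abstract_Topological_Spaces"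
begin

text \<open>Identify every fibre of a principal bundle with \<open>G\<close>, ignoring the topology. What is left of the
  bundle is the set of those functions \<open>t: U \<rightarrow> G\<close> that are continuous sections: an atlas. Let \<open>A\<close> be
  \<open>\<pi>\<^sub>0(G)\<close> and \<open>q\<close> the projection. If \<open>s\<close> is a continuous section along a path \<open>p\<close>, then
  \<open>\<kappa>(p) = q(s(0)) q(s(1))\<^sup>-\<^sup>1\<close> does not depend on \<open>s\<close>; the function \<open>\<kappa>\<close> is a singular 1-cocycle, and another
  identification of the fibres changes it by a coboundary.

  Two bundles with the same \<open>\<kappa>\<close> are isomorphic: an isomorphism is a section of a bundle whose fibre is
  the kernel of \<open>q\<close>, and since this kernel is path connected and its loops are contractible, a section
  extends over the cells of dimension at most two. A bundle with prescribed \<open>\<kappa>\<close> is also built cell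
  by cell: on the complement of the centres of the \<open>n\<close>-cells one takes the pullback under the radial
  retraction to the \<open>(n - 1)\<close>-skeleton, and glues it to trivial bundles on the open cells; the gluing
  functions are sections with holonomy \<open>\<kappa>\<close> over the boundary spheres, which exist because the kernel is
  path connected.\<close>

section \<open>Principal bundles as atlases of frames\<close>

text \<open>The pair \<open>A\<close>, \<open>q\<close> is kept abstract so that one argument serves
  both \<open>pi0 G T\<close> and, for discrete \<open>G\<close>, the group \<open>G\<close> itself
  with \<open>id\<close>. Discreteness of \<pi>0 makes the kernel of \<open>q\<close> open, hence
  \<open>q\<close> locally constant: the ratio of two sections over a connected domain has constant
  image in \<open>A\<close>. This rigidity is behind every statement about \<kappa>. Because the
  fibres are identified without topology, a function that only has to attain prescribed values under
  \<open>q\<close> (the points chosen in the fibres, the twist of a chart, the lift of a coboundary)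
  may be chosen pointwise; continuity is demanded only of ratios
  \<open>inv (t x) \<otimes> t' x\<close>, in which such choices cancel. The obstacle in the
  construction of bundles is that charts over a skeleton are open only in that skeleton. They must
  be thickened before the next cells are added, and this is the purpose of the radial retraction;
  its tracks are paths, so \<kappa> also measures how far the thickened charts are from being
  parallel.\<close>

lemma continuous_map_locally:
  assumes "\<And>x. x \<in> topspace X \<Longrightarrow> \<exists>W. openin X W \<and> x \<in> W \<and> continuous_map (subtopology X W) Y f"
  shows "continuous_map X Y f"
proof (rule pasting_lemma [where I = "{W. openin X W \<and> continuous_map (subtopology X W) Y f}"
      and T = "\<lambda>W. W" and f = "\<lambda>_. f"])
  fix x assume "x \<in> topspace X"
  then show "\<exists>j. j \<in> {W. openin X W \<and> continuous_map (subtopology X W) Y f} \<and> x \<in> j \<and> f x = f x"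
    using assms by blast
qed auto

lemma connected_space_top_of_set: "connected S \<Longrightarrow> connected_space (top_of_set S)"
  using connectedin_iff_connected [of S] by (simp add: connectedin_def)

locale top_group =
  fixes G :: "'g monoid" (structure) and T :: "'g topology"
  assumes TG: "topological_group G T"
begin

sublocale group G
  using TG by (simp add: topological_group_def)

lemma topspace_T: "topspace T = carrier G"
  using TG by (simp add: topological_group_def)

lemma continuous_map_in_carrier: "continuous_map Z T f \<Longrightarrow> z \<in> topspace Z \<Longrightarrow> f z \<in> carrier G"
  using continuous_map_image_subset_topspace topspace_T by blast

lemmas continuous_map_mult = continuous_map_group_mult [OF TG]
lemmas continuous_map_inverse = continuous_map_group_inv [OF TG]

lemma continuous_map_const_carrier: "a \<in> carrier G \<Longrightarrow> continuous_map Z T (\<lambda>_. a)"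
  by (simp add: topspace_T)

lemma inv_mult_telescope:
  assumes "a \<in> carrier G" "b \<in> carrier G" "c \<in> carrier G"
  shows "inv a \<otimes> b \<otimes> (inv b \<otimes> c) = inv a \<otimes> c"
  using assms by (simp add: m_assoc [symmetric]) (simp add: m_assoc)

lemma inv_inv_mult:
  assumes "a \<in> carrier G" "b \<in> carrier G"
  shows "inv (inv a \<otimes> b) = inv b \<otimes> a"
  using assms by (simp add: inv_mult_group)

text \<open>An atlas is a principal bundle whose fibres have been identified with \<open>G\<close> without regard to the
  topology; its members are the local sections that are to be continuous.\<close>

definition atlas :: "'m topology \<Rightarrow> ('m set \<times> ('m \<Rightarrow> 'g)) set \<Rightarrow> bool" where
  "atlas X \<A> \<longleftrightarrow>
     (\<forall>(U, t)\<in>\<A>. openin X U \<and> t ` U \<subseteq> carrier G) \<and>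
     (\<forall>x\<in>topspace X. \<exists>(U, t)\<in>\<A>. x \<in> U) \<and>
     (\<forall>(U, t)\<in>\<A>. \<forall>(V, t')\<in>\<A>. continuous_map (subtopology X (U \<inter> V)) T (\<lambda>x. inv (t x) \<otimes> t' x))"

text \<open>A framing along \<open>f\<close> is a continuous section of the pullback bundle.\<close>

definition framing ::
    "('m set \<times> ('m \<Rightarrow> 'g)) set \<Rightarrow> 'z topology \<Rightarrow> ('z \<Rightarrow> 'm) \<Rightarrow> ('z \<Rightarrow> 'g) \<Rightarrow> bool" where
  "framing \<A> Z f s \<longleftrightarrow>
     s ` topspace Z \<subseteq> carrier G \<and>
     (\<forall>(U, t)\<in>\<A>. continuous_map (subtopology Z {z \<in> topspace Z. f z \<in> U}) T (\<lambda>z. inv (s z) \<otimes> t (f z)))"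

lemma atlas_open: "atlas X \<A> \<Longrightarrow> (U, t) \<in> \<A> \<Longrightarrow> openin X U"
  unfolding atlas_def by blast

lemma atlas_in: "atlas X \<A> \<Longrightarrow> (U, t) \<in> \<A> \<Longrightarrow> x \<in> U \<Longrightarrow> t x \<in> carrier G"
  unfolding atlas_def by blast

lemma atlas_compat: "atlas X \<A> \<Longrightarrow> (U, t) \<in> \<A> \<Longrightarrow> (V, t') \<in> \<A> \<Longrightarrow>
    continuous_map (subtopology X (U \<inter> V)) T (\<lambda>x. inv (t x) \<otimes> t' x)"
  unfolding atlas_def by blast

lemma atlas_chart:
  assumes "atlas X \<A>" "x \<in> topspace X"
  obtains U t where "(U, t) \<in> \<A>" "x \<in> U"
  using assms unfolding atlas_def by blast

lemma framing_in: "framing \<A> Z f s \<Longrightarrow> z \<in> topspace Z \<Longrightarrow> s z \<in> carrier G"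
  unfolding framing_def by blast

lemma framing_continuous: "framing \<A> Z f s \<Longrightarrow> (U, t) \<in> \<A> \<Longrightarrow>
    continuous_map (subtopology Z {z \<in> topspace Z. f z \<in> U}) T (\<lambda>z. inv (s z) \<otimes> t (f z))"
  unfolding framing_def by blast

text \<open>Membership in \<open>framing\<close> has to be checked against every chart. Near a point
  one chart suffices: the ratio to another chart \<open>t'\<close> is the ratio to \<open>t\<close>
  times the transition function \<open>inv t \<otimes> t'\<close>, which \<open>atlas\<close> makes
  continuous.\<close>

lemma framing_locally:
  assumes A: "atlas X \<A>" and f: "continuous_map Z X f" and s: "s ` topspace Z \<subseteq> carrier G"
    and loc: "\<And>z. z \<in> topspace Z \<Longrightarrow> \<exists>W U t. openin Z W \<and> z \<in> W \<and> (U, t) \<in> \<A> \<and> f ` W \<subseteq> U \<and>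
        continuous_map (subtopology Z W) T (\<lambda>z. inv (s z) \<otimes> t (f z))"
  shows "framing \<A> Z f s"
  unfolding framing_def
proof (intro conjI s ballI, clarify)
  fix V t' assume V: "(V, t') \<in> \<A>"
  define Z' where "Z' = {z \<in> topspace Z. f z \<in> V}"
  have Z': "openin Z Z'"
    unfolding Z'_def using f atlas_open [OF A V] by (rule openin_continuous_map_preimage)
  show "continuous_map (subtopology Z {z \<in> topspace Z. f z \<in> V}) T (\<lambda>z. inv s z \<otimes> t' (f z))"
    unfolding Z'_def [symmetric]
  proof (rule continuous_map_locally)
    fix z assume "z \<in> topspace (subtopology Z Z')"
    then have z: "z \<in> topspace Z" "z \<in> Z'" by auto
    obtain W U t where W: "openin Z W" "z \<in> W" "(U, t) \<in> \<A>" "f ` W \<subseteq> U"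
      and c: "continuous_map (subtopology Z W) T (\<lambda>z. inv (s z) \<otimes> t (f z))"
      using loc [OF z(1)] by blast
    have WZ: "W \<subseteq> topspace Z" using W(1) openin_subset by blast
    let ?W = "subtopology Z (W \<inter> Z')"
    have "continuous_map ?W T (\<lambda>z. inv (s z) \<otimes> t (f z))"
      using c by (rule continuous_map_from_subtopology_mono) auto
    moreover have "continuous_map ?W (subtopology X (U \<inter> V)) f"
      using W f WZ by (auto simp: continuous_map_in_subtopology Z'_def intro: continuous_map_from_subtopology)
    then have "continuous_map ?W T ((\<lambda>x. inv (t x) \<otimes> t' x) \<circ> f)"
      using atlas_compat [OF A W(3) V] by (rule continuous_map_compose)
    ultimately have "continuous_map ?W T (\<lambda>z. (inv (s z) \<otimes> t (f z)) \<otimes> (inv (t (f z)) \<otimes> t' (f z)))"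
      unfolding o_def by (rule continuous_map_mult)
    moreover have "inv (s z) \<otimes> t (f z) \<otimes> (inv (t (f z)) \<otimes> t' (f z)) = inv (s z) \<otimes> t' (f z)"
      if "z \<in> topspace ?W" for z
      using that s W(4) WZ atlas_in [OF A W(3)] atlas_in [OF A V]
      by (intro inv_mult_telescope) (auto simp: Z'_def)
    ultimately have "continuous_map ?W T (\<lambda>z. inv (s z) \<otimes> t' (f z))"
      by (rule continuous_map_eq)
    moreover have "?W = subtopology (subtopology Z Z') (W \<inter> Z')"
      by (simp add: subtopology_subtopology Int_absorb1 Int_commute)
    moreover have "openin (subtopology Z Z') (W \<inter> Z')"
      using W(1) by (simp add: openin_subtopology_Int)
    ultimately show "\<exists>W. openin (subtopology Z Z') W \<and> z \<in> W \<and>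
        continuous_map (subtopology (subtopology Z Z') W) T (\<lambda>z. inv (s z) \<otimes> t' (f z))"
      using z W(2) by (intro exI [of _ "W \<inter> Z'"]) auto
  qed
qed

lemma framing_chart:
  assumes A: "atlas X \<A>" and f: "continuous_map Z X f" and U: "(U, t) \<in> \<A>" "f ` topspace Z \<subseteq> U"
  shows "framing \<A> Z f (\<lambda>z. t (f z))"
proof (rule framing_locally [OF A f])
  show "(\<lambda>z. t (f z)) ` topspace Z \<subseteq> carrier G"
    using U atlas_in [OF A U(1)] by auto
  have "continuous_map Z T (\<lambda>z. inv (t (f z)) \<otimes> t (f z))"
    by (rule continuous_map_eq [OF continuous_map_const_carrier [OF one_closed]])
      (use U atlas_in [OF A U(1)] in auto)
  then show "\<exists>W U ta. openin Z W \<and> z \<in> W \<and> (U, ta) \<in> \<A> \<and> f ` W \<subseteq> U \<and>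
      continuous_map (subtopology Z W) T (\<lambda>z. inv (t (f z)) \<otimes> ta (f z))" if "z \<in> topspace Z" for z
    using that U by (intro exI [of _ "topspace Z"] exI [of _ U] exI [of _ t]) (auto simp: subtopology_topspace)
qed

lemma framing_compose:
  assumes s: "framing \<A> Z f s" and g: "continuous_map Z' Z g"
  shows "framing \<A> Z' (\<lambda>z. f (g z)) (\<lambda>z. s (g z))"
  unfolding framing_def
proof (intro conjI ballI, goal_cases)
  case 1
  then show ?case
    using framing_in [OF s] continuous_map_image_subset_topspace [OF g] by blast
next
  case (2 x)
  obtain U t where x: "x = (U, t)" by fastforce
  have "continuous_map (subtopology Z' {z \<in> topspace Z'. f (g z) \<in> U}) (subtopology Z {z \<in> topspace Z. f z \<in> U}) g"
    using g continuous_map_image_subset_topspace [OF g]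
    by (auto simp: continuous_map_in_subtopology intro: continuous_map_from_subtopology)
  from continuous_map_compose [OF this framing_continuous [OF s]] 2 show ?case
    by (auto simp: o_def x)
qed

lemma framing_subtopology:
  "framing \<A> Z f s \<Longrightarrow> framing \<A> (subtopology Z S) f s"
  using framing_compose [of \<A> Z f s "subtopology Z S" id] by (simp add: id_def continuous_map_from_subtopology)

text \<open>\<open>G\<close> acts on sections from the right while ratios invert the left entry, so
  the factor \<open>k\<close> merely puts \<open>inv k\<close> in front of the old ratio.\<close>

lemma framing_mult:
  assumes A: "atlas X \<A>" and f: "continuous_map Z X f" and s: "framing \<A> Z f s" and k: "continuous_map Z T k"
  shows "framing \<A> Z f (\<lambda>z. s z \<otimes> k z)"
  unfolding framing_def
proof (intro conjI ballI, goal_cases)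
  case 1
  then show ?case
    using framing_in [OF s] continuous_map_in_carrier [OF k] by auto
next
  case (2 x)
  obtain U t where x: "x = (U, t)" by fastforce
  let ?Z = "subtopology Z {z \<in> topspace Z. f z \<in> U}"
  have "continuous_map ?Z T (\<lambda>z. inv (k z) \<otimes> (inv (s z) \<otimes> t (f z)))"
    using 2 x
    by (intro continuous_map_mult [OF continuous_map_inverse] framing_continuous [OF s]
        continuous_map_from_subtopology [OF k]) auto
  moreover have "inv (k z) \<otimes> (inv (s z) \<otimes> t (f z)) = inv (s z \<otimes> k z) \<otimes> t (f z)"
    if "z \<in> topspace ?Z" for z
    using that framing_in [OF s] continuous_map_in_carrier [OF k] atlas_in [OF A] 2 x
    by (auto simp: inv_mult_group m_assoc)
  ultimately show ?case
    unfolding x prod.case by (rule continuous_map_eq)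
qed

text \<open>Near each point both sections are compared with one chart, and the chart cancels. This
  is how an honestly continuous \<open>G\<close>-valued function arises from two framings, each of
  which has a meaning only relative to the atlas.\<close>

lemma framing_ratio:
  assumes A: "atlas X \<A>" and f: "continuous_map Z X f" and s: "framing \<A> Z f s" and s': "framing \<A> Z f s'"
  shows "continuous_map Z T (\<lambda>z. inv (s z) \<otimes> s' z)"
proof (rule continuous_map_locally)
  fix z assume z: "z \<in> topspace Z"
  have "f z \<in> topspace X"
    using f z continuous_map_image_subset_topspace by blast
  then obtain U t where U: "(U, t) \<in> \<A>" "f z \<in> U"
    using atlas_chart [OF A] by metis
  define W where "W = {z \<in> topspace Z. f z \<in> U}"
  have W: "openin Z W" "z \<in> W"
    unfolding W_def using f atlas_open [OF A U(1)] U(2) z by (auto intro: openin_continuous_map_preimage)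
  have "continuous_map (subtopology Z W) T (\<lambda>z. (inv (s z) \<otimes> t (f z)) \<otimes> inv (inv (s' z) \<otimes> t (f z)))"
    unfolding W_def
    by (rule continuous_map_mult [OF framing_continuous [OF s U(1)]
          continuous_map_inverse [OF framing_continuous [OF s' U(1)]]])
  moreover have "(inv (s z) \<otimes> t (f z)) \<otimes> inv (inv (s' z) \<otimes> t (f z)) = inv (s z) \<otimes> s' z"
    if "z \<in> topspace (subtopology Z W)" for z
    using that framing_in [OF s] framing_in [OF s'] atlas_in [OF A U(1)]
    by (subst inv_inv_mult) (auto simp: W_def intro: inv_mult_telescope)
  ultimately have "continuous_map (subtopology Z W) T (\<lambda>z. inv (s z) \<otimes> s' z)"
    by (rule continuous_map_eq)
  then show "\<exists>W. openin Z W \<and> z \<in> W \<and> continuous_map (subtopology Z W) T (\<lambda>z. inv (s z) \<otimes> s' z)"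
    using W by blast
qed

text \<open>The mismatch \<open>inv s2 \<otimes> s1\<close> lives on the overlap only; the
  retraction \<open>r\<close> spreads it over \<open>Z2\<close>. Multiplied by it, the second
  framing agrees with the first on the overlap, and closedness of the two pieces allows
  pasting.\<close>

lemma framing_glue:
  assumes A: "atlas X \<A>" and f: "continuous_map Z X f"
    and Z: "closedin Z Z1" "closedin Z Z2" "Z1 \<union> Z2 = topspace Z"
    and s1: "framing \<A> (subtopology Z Z1) f s1" and s2: "framing \<A> (subtopology Z Z2) f s2"
    and r: "continuous_map (subtopology Z Z2) (subtopology Z (Z1 \<inter> Z2)) r"
      "\<And>z. z \<in> Z1 \<inter> Z2 \<Longrightarrow> r z = z"
  shows "\<exists>s. framing \<A> Z f s"
proof -
  have sub: "Z1 \<subseteq> topspace Z" "Z2 \<subseteq> topspace Z"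
    using Z closedin_subset by blast+
  have f12: "continuous_map (subtopology Z S) X f" for S
    using f by (rule continuous_map_from_subtopology)
  have "continuous_map (subtopology Z (Z1 \<inter> Z2)) T (\<lambda>z. inv (s2 z) \<otimes> s1 z)"
    using framing_subtopology [OF s1, of Z2] framing_subtopology [OF s2, of Z1]
    by (intro framing_ratio [OF A f12]) (simp_all add: subtopology_subtopology Int_commute)
  from continuous_map_compose [OF r(1) this]
  have k: "continuous_map (subtopology Z Z2) T (\<lambda>z. inv (s2 (r z)) \<otimes> s1 (r z))"
    by (simp add: o_def)
  define s2' where "s2' = (\<lambda>z. s2 z \<otimes> (inv (s2 (r z)) \<otimes> s1 (r z)))"
  have s2': "framing \<A> (subtopology Z Z2) f s2'"
    unfolding s2'_def by (rule framing_mult [OF A f12 s2 k])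
  have s1in: "s1 z \<in> carrier G" if "z \<in> Z1" for z
    using framing_in [OF s1, of z] that sub by auto
  have s2in: "s2 z \<in> carrier G" "s2' z \<in> carrier G" if "z \<in> Z2" for z
    using framing_in [OF s2, of z] framing_in [OF s2', of z] that sub by auto
  have eq: "s1 z = s2' z" if "z \<in> Z1 \<inter> Z2" for z
    using that r(2) [OF that] s1in [of z] s2in [of z] by (simp add: s2'_def m_assoc [symmetric])
  define s where "s z = (if z \<in> Z1 then s1 z else s2' z)" for z
  have s12: "s z = s1 z" if "z \<in> Z1" for z
    using that by (simp add: s_def)
  have s22: "s z = s2' z" if "z \<in> Z2" for z
    using that eq by (auto simp: s_def)
  have "framing \<A> Z f s"
    unfolding framing_def
  proof (intro conjI ballI, goal_cases)
    case 1
    then show ?case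
      unfolding Z(3) [symmetric] using s12 s22 s1in s2in by auto
  next
    case (2 x)
    obtain U t where x: "x = (U, t)" by fastforce
    let ?W = "{z \<in> topspace Z. f z \<in> U}"
    let ?f = "\<lambda>z. inv (s z) \<otimes> t (f z)"
    have 1: "continuous_map (subtopology (subtopology Z ?W) (?W \<inter> Z1)) T ?f"
    proof (rule continuous_map_eq)
      have "continuous_map (subtopology (subtopology Z Z1) {z \<in> topspace (subtopology Z Z1). f z \<in> U}) T (\<lambda>z. inv (s1 z) \<otimes> t (f z))"
        using 2 x by (intro framing_continuous [OF s1]) simp
      moreover have "Z1 \<inter> {z \<in> topspace (subtopology Z Z1). f z \<in> U} = ?W \<inter> (?W \<inter> Z1)"
        using sub by auto
      ultimately show "continuous_map (subtopology (subtopology Z ?W) (?W \<inter> Z1)) T (\<lambda>z. inv (s1 z) \<otimes> t (f z))"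
        by (simp only: subtopology_subtopology)
    qed (simp add: s12)
    have 2: "continuous_map (subtopology (subtopology Z ?W) (?W \<inter> Z2)) T ?f"
    proof (rule continuous_map_eq)
      have "continuous_map (subtopology (subtopology Z Z2) {z \<in> topspace (subtopology Z Z2). f z \<in> U}) T (\<lambda>z. inv (s2' z) \<otimes> t (f z))"
        using 2 x by (intro framing_continuous [OF s2']) simp
      moreover have "Z2 \<inter> {z \<in> topspace (subtopology Z Z2). f z \<in> U} = ?W \<inter> (?W \<inter> Z2)"
        using sub by auto
      ultimately show "continuous_map (subtopology (subtopology Z ?W) (?W \<inter> Z2)) T (\<lambda>z. inv (s2' z) \<otimes> t (f z))"
        by (simp only: subtopology_subtopology)
    qed (simp add: s22)
    show ?case
      unfolding x prod.case
    proof (rule pasting_lemma_closed [where I = "{Z1, Z2}" and T = "\<lambda>S. ?W \<inter> S" and f = "\<lambda>_. ?f"])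
      show "closedin (subtopology Z ?W) (?W \<inter> S)" if "S \<in> {Z1, Z2}" for S
        using that Z closedin_subtopology_Int_closed by blast
      show "continuous_map (subtopology (subtopology Z ?W) (?W \<inter> S)) T ?f" if "S \<in> {Z1, Z2}" for S
        using that 1 2 by blast
    qed (use Z(3) in auto)
  qed
  then show ?thesis by blast
qed

section \<open>Sections over squares and their retracts\<close>

lemma framing_top_of_set_subset:
  assumes "framing \<A> (top_of_set S) f s" "S' \<subseteq> S"
  shows "framing \<A> (top_of_set S') f s"
  using framing_subtopology [OF assms(1), of S'] assms(2)
  by (simp add: subtopology_subtopology Int_absorb1)

lemma framing_glue_euclidean:
  fixes S1 S2 :: "'z::topological_space set"
  assumes A: "atlas X \<A>" and f: "continuous_map (top_of_set (S1 \<union> S2)) X f"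
    and S: "closed S1" "closed S2"
    and fr: "framing \<A> (top_of_set S1) f s1" "framing \<A> (top_of_set S2) f s2"
    and r: "continuous_on S2 r" "r ` S2 \<subseteq> S1 \<inter> S2" "\<And>z. z \<in> S1 \<inter> S2 \<Longrightarrow> r z = z"
  shows "\<exists>s. framing \<A> (top_of_set (S1 \<union> S2)) f s"
proof (rule framing_glue [OF A f])
  show "closedin (top_of_set (S1 \<union> S2)) S1" "closedin (top_of_set (S1 \<union> S2)) S2"
    using S by (auto intro: closed_subset)
  have eq: "subtopology (top_of_set (S1 \<union> S2)) S = top_of_set S" if "S \<subseteq> S1 \<union> S2" for S
    using that by (simp add: subtopology_subtopology Int_absorb1)
  show "framing \<A> (subtopology (top_of_set (S1 \<union> S2)) S1) f s1"
      "framing \<A> (subtopology (top_of_set (S1 \<union> S2)) S2) f s2"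
    using fr by (simp_all add: eq)
  have "S1 \<inter> S2 \<subseteq> S1 \<union> S2" by blast
  then show "continuous_map (subtopology (top_of_set (S1 \<union> S2)) S2)
      (subtopology (top_of_set (S1 \<union> S2)) (S1 \<inter> S2)) r"
    using r by (auto simp: eq)
qed (use r in auto)

text \<open>Bisection in the second coordinate. The width \<open>d\<close> is quantified inside the
  property, so that gluing two rectangles may pass to the smaller of their widths.\<close>

lemma framing_strip:
  assumes A: "atlas X \<A>" and f: "continuous_map (top_of_set ({0..1} \<times> {0..1})) X f"
    and x: "x \<in> {0..1::real}"
  shows "\<exists>d>0. \<exists>s. framing \<A> (top_of_set (({x-d..x+d} \<inter> {0..1}) \<times> {0..1::real})) f s"
proof -
  let ?S = "\<lambda>d. {x-d..x+d} \<inter> {0..1}"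
  let ?Q = "\<lambda>c e::real. 0 \<le> c \<longrightarrow> e \<le> 1 \<longrightarrow> (\<exists>d>0. \<exists>s. framing \<A> (top_of_set (?S d \<times> {c..e})) f s)"
  have "(0::real) \<le> 1" by simp
  then have "?Q 0 1"
  proof (induction rule: Bolzano [where P = "?Q"])
    case (trans c e g)
    show ?case
    proof (intro impI)
      assume cg: "0 \<le> c" "g \<le> 1"
      obtain d1 s1 where 1: "d1 > 0" "framing \<A> (top_of_set (?S d1 \<times> {c..e})) f s1"
        using trans cg by auto
      obtain d2 s2 where 2: "d2 > 0" "framing \<A> (top_of_set (?S d2 \<times> {e..g})) f s2"
        using trans cg by auto
      define d where "d = min d1 d2"
      have eq: "?S d \<times> {c..g} = ?S d \<times> {c..e} \<union> ?S d \<times> {e..g}"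
        using trans by auto
      have "\<exists>s. framing \<A> (top_of_set (?S d \<times> {c..e} \<union> ?S d \<times> {e..g})) f s"
      \<comment> \<open>The retraction projects the upper rectangle to the common edge at height
        \<open>e\<close>.\<close>
      proof (rule framing_glue_euclidean [OF A, where r = "\<lambda>z. (fst z, e)"])
        show "continuous_map (top_of_set (?S d \<times> {c..e} \<union> ?S d \<times> {e..g})) X f"
          unfolding eq [symmetric] using cg
          by (intro continuous_map_from_subtopology_mono [OF f]) auto
        show "framing \<A> (top_of_set (?S d \<times> {c..e})) f s1"
          by (rule framing_top_of_set_subset [OF 1(2)]) (auto simp: d_def)
        show "framing \<A> (top_of_set (?S d \<times> {e..g})) f s2"
          by (rule framing_top_of_set_subset [OF 2(2)]) (auto simp: d_def)
      qed (use trans in \<open>auto intro!: closed_Times continuous_intros\<close>)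
      then show "\<exists>d>0. \<exists>s. framing \<A> (top_of_set (?S d \<times> {c..g})) f s"
        unfolding eq [symmetric] using 1(1) 2(1) by (intro exI [of _ d]) (simp add: d_def)
    qed
  next
    case (local y)
    have xy: "(x, y) \<in> {0..1} \<times> {0..1}" using x local by auto
    then have "f (x, y) \<in> topspace X"
      using continuous_map_image_subset_topspace [OF f] by auto
    then obtain U t where U: "(U, t) \<in> \<A>" "f (x, y) \<in> U"
      using atlas_chart [OF A] by metis
    have "openin (top_of_set ({0..1} \<times> {0..1})) {z \<in> {0..1} \<times> {0..1}. f z \<in> U}"
      using openin_continuous_map_preimage [OF f atlas_open [OF A U(1)]] by simp
    then obtain r where r: "r > 0" "ball (x, y) r \<inter> ({0..1} \<times> {0..1}) \<subseteq> {z \<in> {0..1} \<times> {0..1}. f z \<in> U}"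
      unfolding openin_contains_ball using xy U(2) by blast
    show ?case
    \<comment> \<open>Each coordinate deviates from the point by at most r/3, so the rectangle stays
      inside the ball of radius r.\<close>
    proof (rule exI [of _ "r/3"], intro conjI allI impI)
      show "r / 3 > 0" using r by simp
      fix a b assume ab: "a \<le> y \<and> y \<le> b \<and> b - a < r / 3" "0 \<le> a" "b \<le> 1"
      have sub: "?S (r/3) \<times> {a..b} \<subseteq> {0..1} \<times> {0..1}"
        using ab by auto
      have "?S (r/3) \<times> {a..b} \<subseteq> ball (x, y) r"
      proof (rule subsetI, elim SigmaE, hypsubst)
        fix u v assume uv: "u \<in> ?S (r/3)" "v \<in> {a..b}"
        have "dist (x, y) (u, v) \<le> dist x u + dist y v"
          by (simp add: dist_Pair_Pair sqrt_sum_squares_le_sum)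
        also have "\<dots> < r"
          using uv ab r(1) by (auto simp: dist_real_def abs_if)
        finally show "(u, v) \<in> ball (x, y) r" by simp
      qed
      then have "f ` (?S (r/3) \<times> {a..b}) \<subseteq> U"
        using sub r(2) by blast
      then have "framing \<A> (top_of_set (?S (r/3) \<times> {a..b})) f (\<lambda>z. t (f z))"
        by (intro framing_chart [OF A _ U(1)] continuous_map_from_subtopology_mono [OF f] sub) simp
      then show "\<exists>d>0. \<exists>s. framing \<A> (top_of_set (?S d \<times> {a..b})) f s"
        using r(1) by (intro exI [of _ "r/3"]) auto
    qed
  qed
  then show ?thesis by simp
qed

text \<open>Bisection in the first coordinate, started by the strips of \<open>framing_strip\<close>
  and glued along common edges. All later sections over paths and disks are drawn from this
  one.\<close>

lemma framing_square:
  assumes A: "atlas X \<A>" and f: "continuous_map (top_of_set ({0..1} \<times> {0..1})) X f"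
  shows "\<exists>s. framing \<A> (top_of_set ({0..1::real} \<times> {0..1::real})) f s"
proof -
  let ?Q = "\<lambda>a b::real. 0 \<le> a \<longrightarrow> b \<le> 1 \<longrightarrow> (\<exists>s. framing \<A> (top_of_set ({a..b} \<times> {0..1::real})) f s)"
  have "(0::real) \<le> 1" by simp
  then have "?Q 0 1"
  proof (induction rule: Bolzano [where P = "?Q"])
    case (trans a b c)
    show ?case
    proof (intro impI)
      assume ac: "0 \<le> a" "c \<le> 1"
      obtain s1 s2 where s: "framing \<A> (top_of_set ({a..b} \<times> {0..1})) f s1"
          "framing \<A> (top_of_set ({b..c} \<times> {0..1})) f s2"
        using trans ac by auto
      have eq: "{a..c} \<times> {0..1} = {a..b} \<times> {0..1::real} \<union> {b..c} \<times> {0..1}"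
        using trans by auto
      show "\<exists>s. framing \<A> (top_of_set ({a..c} \<times> {0..1})) f s"
        unfolding eq
      proof (rule framing_glue_euclidean [OF A _ _ _ s, where r = "\<lambda>z. (b, snd z)"])
        show "continuous_map (top_of_set ({a..b} \<times> {0..1} \<union> {b..c} \<times> {0..1})) X f"
          unfolding eq [symmetric] using ac
          by (intro continuous_map_from_subtopology_mono [OF f]) auto
      qed (use trans in \<open>auto intro!: closed_Times continuous_intros\<close>)
    qed
  next
    case (local x)
    then obtain d s where d: "d > 0" and s: "framing \<A> (top_of_set (({x-d..x+d} \<inter> {0..1}) \<times> {0..1})) f s"
      using framing_strip [OF A f, of x] by auto
    have "\<exists>s. framing \<A> (top_of_set ({a..b} \<times> {0..1})) f s"
      if "a \<le> x \<and> x \<le> b \<and> b - a < d" "0 \<le> a" "b \<le> 1" for a b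
      using framing_top_of_set_subset [OF s, of "{a..b} \<times> {0..1}"] that by fastforce
    then show ?case
      using d by blast
  qed
  then show ?thesis by simp
qed

text \<open>The bundle is pulled back to the square along \<rho>, where a section exists, and that
  section is restricted along \<iota>. The composite of \<open>f\<close>, \<rho> and \<iota> equals
  \<open>f\<close> on the topspace only, hence the comparison of preimages at the end.\<close>

lemma framing_retract_of_square:
  fixes \<iota> :: "'z \<Rightarrow> real \<times> real"
  assumes A: "atlas X \<A>" and f: "continuous_map Z X f"
    and \<rho>: "continuous_map (top_of_set ({0..1} \<times> {0..1})) Z \<rho>"
    and \<iota>: "continuous_map Z (top_of_set ({0..1} \<times> {0..1})) \<iota>" "\<And>z. z \<in> topspace Z \<Longrightarrow> \<rho> (\<iota> z) = z"
  shows "\<exists>s. framing \<A> Z f s"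
proof -
  have "continuous_map (top_of_set ({0..1} \<times> {0..1})) X (\<lambda>z. f (\<rho> z))"
    using continuous_map_compose [OF \<rho> f] by (simp add: o_def)
  then obtain s where "framing \<A> (top_of_set ({0..1} \<times> {0..1})) (\<lambda>z. f (\<rho> z)) s"
    using framing_square [OF A] by blast
  from framing_compose [OF this \<iota>(1)]
  have "framing \<A> Z (\<lambda>z. f (\<rho> (\<iota> z))) (\<lambda>z. s (\<iota> z))" .
  moreover have "{z \<in> topspace Z. f (\<rho> (\<iota> z)) \<in> U} = {z \<in> topspace Z. f z \<in> U}" for U
    using \<iota>(2) by auto
  ultimately have "framing \<A> Z f (\<lambda>z. s (\<iota> z))"
    using \<iota>(2) unfolding framing_def
    by (force intro: continuous_map_eq)
  then show ?thesis by blast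
qed

lemma framing_path:
  assumes A: "atlas X \<A>" and p: "pathin X p"
  shows "\<exists>s. framing \<A> (top_of_set {0..1::real}) p s"
  using p unfolding pathin_def
  by (intro framing_retract_of_square [OF A, where \<rho> = fst and \<iota> = "\<lambda>x. (x, 0)"])
    (auto intro!: continuous_intros)

end

text \<open>In the applications \<open>A\<close> is \<pi>0 of \<open>G\<close>, or \<open>G\<close>
  itself when \<open>G\<close> is discrete. The last three assumptions reflect that \<pi>0 is
  discrete, that the kernel of \<open>q\<close> is the unit path component, and that \<pi>1
  vanishes; the homotopy \<open>H\<close> keeps the ends fixed and has its time in the first
  coordinate.\<close>

locale group_quotient = top_group G T + A: comm_group A
  for G :: "'g monoid" (structure) and T :: "'g topology" and A :: "'a monoid" +
  fixes q :: "'g \<Rightarrow> 'a"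
  assumes q_hom: "q \<in> hom G A"
    and q_surj: "q ` carrier G = carrier A"
    and open_kernel: "openin T {g \<in> carrier G. q g = \<one>\<^bsub>A\<^esub>}"
    and kernel_path_connected:
      "\<And>g. g \<in> carrier G \<Longrightarrow> q g = \<one>\<^bsub>A\<^esub> \<Longrightarrow> \<exists>p. pathin T p \<and> p 0 = \<one> \<and> p 1 = g"
    and loops_contractible:
      "\<And>p. pathin T p \<Longrightarrow> p 0 = \<one> \<Longrightarrow> p 1 = \<one> \<Longrightarrow>
         \<exists>H. continuous_map (top_of_set ({0..1} \<times> {0..1})) T H \<and>
             (\<forall>x\<in>{0..1}. H (0, x) = p x \<and> H (1, x) = \<one> \<and> H (x, 0) = \<one> \<and> H (x, 1) = \<one>)"
begin

lemma q_in [simp]: "g \<in> carrier G \<Longrightarrow> q g \<in> carrier A"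
  using q_surj by blast

lemma q_mult: "g \<in> carrier G \<Longrightarrow> h \<in> carrier G \<Longrightarrow> q (g \<otimes> h) = q g \<otimes>\<^bsub>A\<^esub> q h"
  using q_hom by (rule hom_mult)

sublocale q: group_hom G A q
  using q_hom by unfold_locales

lemma q_inv: "g \<in> carrier G \<Longrightarrow> q (inv g) = inv\<^bsub>A\<^esub> (q g)"
  by (rule q.hom_inv)

lemma q_lift:
  assumes "a \<in> carrier A" obtains g where "g \<in> carrier G" "q g = a"
proof -
  have "a \<in> q ` carrier G" using assms(1) q_surj by simp
  then show ?thesis using that by blast
qed

text \<open>Left translation by \<open>inv h\<close> carries the coset of \<open>h\<close> to the
  open kernel, and \<open>q\<close> is constant on that coset.\<close>

lemma continuous_map_q: "continuous_map T (discrete_topology (carrier A)) q"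
proof (rule continuous_map_locally)
  fix h assume "h \<in> topspace T"
  then have h: "h \<in> carrier G" by (simp add: topspace_T)
  define W where "W = {g \<in> topspace T. inv h \<otimes> g \<in> {g \<in> carrier G. q g = \<one>\<^bsub>A\<^esub>}}"
  have "openin T W"
    unfolding W_def using h
    by (intro openin_continuous_map_preimage [OF _ open_kernel] continuous_map_mult) (auto simp: topspace_T)
  moreover have "h \<in> W"
    using h by (simp add: W_def topspace_T)
  moreover have "q g = q h" if "g \<in> W" for g
  proof -
    have g: "g \<in> carrier G" "q (inv h \<otimes> g) = \<one>\<^bsub>A\<^esub>"
      using that by (auto simp: W_def topspace_T)
    then have "inv\<^bsub>A\<^esub> (q h) \<otimes>\<^bsub>A\<^esub> q g = \<one>\<^bsub>A\<^esub>"
      using h by (simp add: q_mult q_inv)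
    then show ?thesis
      using g(1) h by (metis A.inv_equality A.inv_inv A.inv_closed q_in A.m_comm)
  qed
  then have "continuous_map (subtopology T W) (discrete_topology (carrier A)) q"
    using h by (intro continuous_map_eq [where f = "\<lambda>_. q h" and g = q]) simp_all
  ultimately show "\<exists>W. openin T W \<and> h \<in> W \<and> continuous_map (subtopology T W) (discrete_topology (carrier A)) q"
    by blast
qed

text \<open>A connected subset of a discrete space has at most one point. Applied to ratios of
  framings, this is the parallel transport on which \<kappa> rests.\<close>

lemma q_constant:
  assumes k: "continuous_map Z T k" and Z: "connected_space Z" and xy: "x \<in> topspace Z" "y \<in> topspace Z"
  shows "q (k x) = q (k y)"
proof -
  have "connectedin Z (topspace Z)"
    using Z by (simp add: connectedin_topspace)
  then have "connectedin (discrete_topology (carrier A)) ((q \<circ> k) ` topspace Z)"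
    by (rule connectedin_continuous_map_image [OF continuous_map_compose [OF k continuous_map_q]])
  then obtain a where "(q \<circ> k) ` topspace Z \<subseteq> {a}"
    unfolding connectedin_discrete_topology by blast
  then show ?thesis
    using xy by auto
qed

section \<open>Holonomy\<close>

text \<open>The last condition is the cocycle condition for a singular 2-simplex, represented by the triangle
  with vertices \<open>(0, 0)\<close>, \<open>(1, 0)\<close>, \<open>(1, 1)\<close> in the unit square.\<close>

definition path_cocycle :: "'m topology \<Rightarrow> ((real \<Rightarrow> 'm) \<Rightarrow> 'a) \<Rightarrow> bool" where
  "path_cocycle X \<kappa> \<longleftrightarrow>
     (\<forall>p. pathin X p \<longrightarrow> \<kappa> p \<in> carrier A) \<and>
     (\<forall>p p'. pathin X p \<longrightarrow> (\<forall>t\<in>{0..1}. p t = p' t) \<longrightarrow> \<kappa> p = \<kappa> p') \<and>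
     (\<forall>H. continuous_map (top_of_set ({0..1} \<times> {0..1})) X H \<longrightarrow>
        \<kappa> (\<lambda>s. H (s, 0)) \<otimes>\<^bsub>A\<^esub> \<kappa> (\<lambda>s. H (1, s)) = \<kappa> (\<lambda>s. H (s, s)))"

lemma path_cocycle_in: "path_cocycle X \<kappa> \<Longrightarrow> pathin X p \<Longrightarrow> \<kappa> p \<in> carrier A"
  unfolding path_cocycle_def by blast

lemma path_cocycle_cong:
  "path_cocycle X \<kappa> \<Longrightarrow> pathin X p \<Longrightarrow> (\<And>t. t \<in> {0..1} \<Longrightarrow> p t = p' t) \<Longrightarrow> \<kappa> p = \<kappa> p'"
  unfolding path_cocycle_def by blast

lemma path_cocycle_triangle:
  "path_cocycle X \<kappa> \<Longrightarrow> continuous_map (top_of_set ({0..1} \<times> {0..1})) X H \<Longrightarrow>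
    \<kappa> (\<lambda>s. H (s, 0)) \<otimes>\<^bsub>A\<^esub> \<kappa> (\<lambda>s. H (1, s)) = \<kappa> (\<lambda>s. H (s, s))"
  unfolding path_cocycle_def by blast

lemma path_cocycle_subtopology:
  assumes "path_cocycle X \<kappa>"
  shows "path_cocycle (subtopology X S) \<kappa>"
  using assms unfolding path_cocycle_def pathin_def by (simp add: continuous_map_in_subtopology)

lemma pathin_square:
  assumes "continuous_map (top_of_set ({0..1} \<times> {0..1})) X H" "continuous_on {0..1} g"
    "g ` {0..1} \<subseteq> {0..1::real} \<times> {0..1::real}"
  shows "pathin X (\<lambda>s. H (g s))"
proof -
  have "continuous_map (top_of_set {0..1}) (top_of_set ({0..1} \<times> {0..1})) g"
    using assms(2,3) by (simp add: image_subset_iff_funcset)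
  from continuous_map_compose [OF this assms(1)] show ?thesis
    by (simp add: pathin_def o_def)
qed

text \<open>The diagonal cuts the square into two triangles; the triangle relation sees the second
  one after the coordinates are swapped.\<close>

lemma path_cocycle_square:
  assumes \<kappa>: "path_cocycle X \<kappa>" and H: "continuous_map (top_of_set ({0..1} \<times> {0..1})) X H"
  shows "\<kappa> (\<lambda>s. H (s, 0)) \<otimes>\<^bsub>A\<^esub> \<kappa> (\<lambda>s. H (1, s)) = \<kappa> (\<lambda>s. H (0, s)) \<otimes>\<^bsub>A\<^esub> \<kappa> (\<lambda>s. H (s, 1))"
proof -
  have "continuous_map (top_of_set ({0..1} \<times> {0..1})) (top_of_set ({0..1::real} \<times> {0..1::real})) prod.swap"
    by (auto intro!: continuous_intros)
  from continuous_map_compose [OF this H]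
  have "continuous_map (top_of_set ({0..1} \<times> {0..1})) X (\<lambda>z. H (prod.swap z))"
    by (simp add: o_def)
  from path_cocycle_triangle [OF \<kappa> this] path_cocycle_triangle [OF \<kappa> H] show ?thesis
    by simp
qed

text \<open>A constant square exhibits the value as an idempotent of the group
  \<open>A\<close>.\<close>

lemma path_cocycle_const:
  assumes \<kappa>: "path_cocycle X \<kappa>" and x: "x \<in> topspace X"
  shows "\<kappa> (\<lambda>_. x) = \<one>\<^bsub>A\<^esub>"
proof -
  have "\<kappa> (\<lambda>_. x) \<otimes>\<^bsub>A\<^esub> \<kappa> (\<lambda>_. x) = \<kappa> (\<lambda>_. x)"
    using path_cocycle_triangle [OF \<kappa>, of "\<lambda>_. x"] x by simp
  moreover have "\<kappa> (\<lambda>_. x) \<in> carrier A"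
    using x by (intro path_cocycle_in [OF \<kappa>]) (simp add: pathin_def)
  ultimately show ?thesis
    by (simp add: A.l_cancel_one)
qed

text \<open>The edge at height 1 is collapsed to \<open>x\<close> and contributes the unit, which
  turns the square relation into one for a cone with apex \<open>x\<close>.\<close>

lemma path_cocycle_cone:
  assumes \<kappa>: "path_cocycle X \<kappa>" and H: "continuous_map (top_of_set ({0..1} \<times> {0..1})) X H"
    and x: "\<And>s. s \<in> {0..1} \<Longrightarrow> H (s, 1) = x"
  shows "\<kappa> (\<lambda>s. H (s, 0)) \<otimes>\<^bsub>A\<^esub> \<kappa> (\<lambda>s. H (1, s)) = \<kappa> (\<lambda>s. H (0, s))"
proof -
  have "pathin X (\<lambda>s. H (s, 1))"
    by (rule pathin_square [OF H]) (auto intro!: continuous_intros)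
  then have "\<kappa> (\<lambda>s. H (s, 1)) = \<kappa> (\<lambda>_. x)"
    using x by (intro path_cocycle_cong [OF \<kappa>]) auto
  moreover have "x \<in> topspace X"
    using x [of 1] continuous_map_image_subset_topspace [OF H] by auto
  moreover have "\<kappa> (\<lambda>s. H (0, s)) \<in> carrier A"
    by (intro path_cocycle_in [OF \<kappa>] pathin_square [OF H]) (auto intro!: continuous_intros)
  ultimately show ?thesis
    using path_cocycle_square [OF \<kappa> H] path_cocycle_const [OF \<kappa>] by simp
qed

text \<open>Under \<open>q\<close> the charts become parallel sections of the flat
  \<open>A\<close>-bundle with holonomy \<kappa>. The condition is imposed on single charts because
  that is what can be verified while an atlas is being built; \<open>parallel_framing\<close>
  transfers it to all framings along paths.\<close>

definition parallel_atlas ::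
    "'m topology \<Rightarrow> ((real \<Rightarrow> 'm) \<Rightarrow> 'a) \<Rightarrow> ('m set \<times> ('m \<Rightarrow> 'g)) set \<Rightarrow> bool" where
  "parallel_atlas X \<kappa> \<A> \<longleftrightarrow> atlas X \<A> \<and>
     (\<forall>(U, t)\<in>\<A>. \<forall>p. pathin X p \<longrightarrow> p ` {0..1} \<subseteq> U \<longrightarrow> q (t (p 0)) = \<kappa> p \<otimes>\<^bsub>A\<^esub> q (t (p 1)))"

text \<open>Bisection of the interval: a short piece of the path lies in one chart, where the ratio
  of \<open>s\<close> to the chart has constant image under \<open>q\<close>, and adjacent pieces
  are joined by the triangle relation.\<close>

lemma parallel_framing:
  assumes \<kappa>: "path_cocycle X \<kappa>" and par: "parallel_atlas X \<kappa> \<A>" and p: "pathin X p"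
    and s: "framing \<A> (top_of_set {0..1}) p s"
  shows "q (s 0) = \<kappa> p \<otimes>\<^bsub>A\<^esub> q (s 1)"
proof -
  have A: "atlas X \<A>"
    using par by (simp add: parallel_atlas_def)
  have cp: "continuous_map (top_of_set {0..1}) X p"
    using p by (simp add: pathin_def)
  have sin: "s x \<in> carrier G" if "x \<in> {0..1}" for x
    using framing_in [OF s] that by simp
  \<comment> \<open>Affine parametrization of [x, y], since \<kappa> only takes paths on the unit
    interval.\<close>
  let ?seg = "\<lambda>x y u. x + u * (y - x)"
  have seg: "?seg x y u \<in> {x..y}" if "u \<in> {0..1}" "x \<le> y" for x y u :: real
    using that mult_left_le_one_le [of "y-x" u] by auto
  have pseg: "pathin X (\<lambda>u. p (?seg x y u))" if "0 \<le> x" "x \<le> y" "y \<le> 1" for x y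
  proof -
    have "continuous_map (top_of_set {0..1}) (top_of_set {0..1}) (?seg x y)"
      using seg [OF _ that(2)] that by (force intro!: continuous_intros)
    from continuous_map_compose [OF this cp] show ?thesis
      by (simp add: pathin_def o_def)
  qed
  let ?P = "\<lambda>x y. 0 \<le> x \<longrightarrow> y \<le> 1 \<longrightarrow> q (s x) = \<kappa> (\<lambda>u. p (?seg x y u)) \<otimes>\<^bsub>A\<^esub> q (s y)"
  have "(0::real) \<le> 1" by simp
  then have "?P 0 1"
  proof (induction rule: Bolzano [where P = "?P"])
    case (trans x y z)
    show ?case
    proof (intro impI)
      assume xz: "0 \<le> x" "z \<le> 1"
      \<comment> \<open>A degenerate square inside the path: its bottom edge runs from x to y, its
        right edge from y to z, and its diagonal from x to z.\<close>
      define H where "H = (\<lambda>(u, v). p (x + u * (y - x) + v * (z - y)))"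
      have "x + u * (y - x) + v * (z - y) \<in> {0..1}" if "u \<in> {0..1}" "v \<in> {0..1}" for u v
        using seg [of u x y] seg [of v y z] that trans xz by auto
      then have "continuous_map (top_of_set ({0..1} \<times> {0..1})) (top_of_set {0..1})
          (\<lambda>(u, v). x + u * (y - x) + v * (z - y))"
        by (auto intro!: continuous_intros simp: case_prod_unfold)
      from continuous_map_compose [OF this cp]
      have "continuous_map (top_of_set ({0..1} \<times> {0..1})) X H"
        by (simp add: H_def o_def case_prod_unfold)
      from path_cocycle_triangle [OF \<kappa> this]
      have "\<kappa> (\<lambda>u. p (?seg x y u)) \<otimes>\<^bsub>A\<^esub> \<kappa> (\<lambda>u. p (?seg y z u)) = \<kappa> (\<lambda>u. p (?seg x z u))"
        by (simp add: H_def algebra_simps)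
      moreover have "q (s x) = \<kappa> (\<lambda>u. p (?seg x y u)) \<otimes>\<^bsub>A\<^esub> (\<kappa> (\<lambda>u. p (?seg y z u)) \<otimes>\<^bsub>A\<^esub> q (s z))"
        using trans xz by simp
      moreover have "\<kappa> (\<lambda>u. p (?seg x y u)) \<in> carrier A" "\<kappa> (\<lambda>u. p (?seg y z u)) \<in> carrier A" "q (s z) \<in> carrier A"
        using trans xz by (auto intro!: path_cocycle_in [OF \<kappa>] pseg sin q_in)
      ultimately show "q (s x) = \<kappa> (\<lambda>u. p (?seg x z u)) \<otimes>\<^bsub>A\<^esub> q (s z)"
        by (metis A.m_assoc)
    qed
  next
    case (local x)
    have x: "x \<in> {0..1}" using local by auto
    then have "p x \<in> topspace X"
      using continuous_map_image_subset_topspace [OF cp] by auto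
    then obtain U t where U: "(U, t) \<in> \<A>" "p x \<in> U"
      using atlas_chart [OF A] by metis
    have "openin (top_of_set {0..1}) {z \<in> {0..1}. p z \<in> U}"
      using openin_continuous_map_preimage [OF cp atlas_open [OF A U(1)]] by simp
    then obtain r where r: "r > 0" "ball x r \<inter> {0..1} \<subseteq> {z \<in> {0..1}. p z \<in> U}"
      unfolding openin_contains_ball using x U(2) by blast
    show ?case
    proof (intro exI [of _ r] conjI r(1) allI impI)
      fix a b assume ab: "a \<le> x \<and> x \<le> b \<and> b - a < r" "0 \<le> a" "b \<le> 1"
      have "{a..b} \<subseteq> ball x r \<inter> {0..1}"
        using ab by (auto simp: dist_real_def)
      then have sub: "{a..b} \<subseteq> {z \<in> {0..1}. p z \<in> U}"
        using r(2) by blast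
      have tin: "t (p y) \<in> carrier G" if "y \<in> {a..b}" for y
        using atlas_in [OF A U(1)] sub that by auto
      have "continuous_map (top_of_set {a..b}) T (\<lambda>z. inv (s z) \<otimes> t (p z))"
        using framing_continuous [OF framing_top_of_set_subset [OF s, of "{a..b}"] U(1)] sub
        by (simp add: subtopology_subtopology Int_absorb2 subset_eq Collect_conj_eq flip: atLeastAtMost_iff)
      then have 1: "q (inv (s a) \<otimes> t (p a)) = q (inv (s b) \<otimes> t (p b))"
        by (rule q_constant) (use ab connected_space_top_of_set [of "{a..b}"] in simp_all)
      have 2: "q (t (p a)) = \<kappa> (\<lambda>u. p (?seg a b u)) \<otimes>\<^bsub>A\<^esub> q (t (p b))"
      proof -
        have "(\<lambda>u. p (?seg a b u)) ` {0..1} \<subseteq> U"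
        proof clarify
          fix u :: real assume "u \<in> {0..1}"
          then have "?seg a b u \<in> {a..b}" using ab by (intro seg) auto
          then show "p (?seg a b u) \<in> U" using sub by blast
        qed
        then show ?thesis
          using par U(1) pseg [of a b] ab unfolding parallel_atlas_def by fastforce
      qed
      show "q (s a) = \<kappa> (\<lambda>u. p (?seg a b u)) \<otimes>\<^bsub>A\<^esub> q (s b)"
      proof -
        let ?k = "\<kappa> (\<lambda>u. p (?seg a b u))"
        have k: "?k \<in> carrier A"
          using ab by (intro path_cocycle_in [OF \<kappa>] pseg) auto
        have in': "s a \<in> carrier G" "s b \<in> carrier G" "t (p a) \<in> carrier G" "t (p b) \<in> carrier G"
          using ab sin tin by auto
        have "inv\<^bsub>A\<^esub> (q (s a)) \<otimes>\<^bsub>A\<^esub> ?k \<otimes>\<^bsub>A\<^esub> q (t (p b)) = inv\<^bsub>A\<^esub> (q (s b)) \<otimes>\<^bsub>A\<^esub> q (t (p b))"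
          using 1 2 in' k by (simp add: q_mult q_inv A.m_assoc)
        then have "inv\<^bsub>A\<^esub> (q (s a)) \<otimes>\<^bsub>A\<^esub> ?k = inv\<^bsub>A\<^esub> (q (s b))"
          using in' k by simp
        then have "q (s a) \<otimes>\<^bsub>A\<^esub> (inv\<^bsub>A\<^esub> (q (s a)) \<otimes>\<^bsub>A\<^esub> ?k) \<otimes>\<^bsub>A\<^esub> q (s b) = q (s a) \<otimes>\<^bsub>A\<^esub> inv\<^bsub>A\<^esub> (q (s b)) \<otimes>\<^bsub>A\<^esub> q (s b)"
          by simp
        then show ?thesis
          using in' k by (simp add: A.m_assoc flip: A.m_assoc [of "q (s a)" "inv\<^bsub>A\<^esub> (q (s a))"])
      qed
    qed
  qed
  then show ?thesis by simp
qed

end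

section \<open>Attaching cells\<close>

definition disk :: "nat \<Rightarrow> (nat \<Rightarrow> real) set" where
  "disk n = {x. (\<forall>i\<ge>n. x i = 0) \<and> (\<Sum>i<n. (x i)\<^sup>2) \<le> 1}"

text \<open>On the type \<open>nat \<Rightarrow> real\<close> the topology \<open>euclidean\<close>
  is the product topology. In this form the calculus of \<open>continuous_on\<close> applies to
  disks.\<close>

lemma unit_disk_eq: "unit_disk n = top_of_set (disk n)"
proof -
  have "{x::nat \<Rightarrow> real. \<forall>i\<ge>n. x i = 0} \<inter> {x. (\<Sum>i<n. (x i)\<^sup>2) \<le> 1} = disk n"
    by (auto simp: disk_def)
  then show ?thesis
    by (simp add: unit_disk_def Euclidean_space_def subtopology_subtopology euclidean_product_topology)
qed

lemma topspace_unit_disk [simp]: "topspace (unit_disk n) = disk n"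
  by (simp add: unit_disk_eq)

lemma open_disk_eq: "open_disk n = {x \<in> disk n. (\<Sum>i<n. (x i)\<^sup>2) < 1}"
  by (auto simp: open_disk_def disk_def topspace_Euclidean_space)

lemma boundary_sphere_eq: "boundary_sphere n = {x \<in> disk n. (\<Sum>i<n. (x i)\<^sup>2) = 1}"
  by (auto simp: boundary_sphere_def disk_def topspace_Euclidean_space)

lemma disk_split: "disk n = open_disk n \<union> boundary_sphere n"
  by (auto simp: open_disk_eq boundary_sphere_eq disk_def)

lemma open_disk_subset: "open_disk n \<subseteq> disk n" and boundary_sphere_subset: "boundary_sphere n \<subseteq> disk n"
  by (auto simp: disk_split)

lemma open_disk_in: "z \<in> open_disk n \<Longrightarrow> z \<in> disk n"
  by (simp add: open_disk_eq)

lemma continuous_on_coordinate: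
  fixes f :: "'a::topological_space \<Rightarrow> 'i \<Rightarrow> real"
  shows "continuous_on S f \<Longrightarrow> continuous_on S (\<lambda>x. f x i)"
  by (rule continuous_on_product_then_coordinatewise)

lemma openin_open_disk: "openin (unit_disk n) (open_disk n)"
proof -
  have "continuous_on (disk n) (\<lambda>x. \<Sum>i<n. (x i)\<^sup>2)"
    by (intro continuous_intros continuous_on_coordinate [OF continuous_on_id])
  then have "openin (top_of_set (disk n)) (disk n \<inter> (\<lambda>x. \<Sum>i<n. (x i)\<^sup>2) -` {..<1})"
    by (rule continuous_openin_preimage_gen) simp
  moreover have "disk n \<inter> (\<lambda>x. \<Sum>i<n. (x i)\<^sup>2) -` {..<1} = open_disk n"
    by (auto simp: open_disk_eq)
  ultimately show ?thesis
    by (simp add: unit_disk_eq)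
qed

lemma disk_coordinate_bound: "x \<in> disk n \<Longrightarrow> x i \<in> {-1..1}"
proof -
  assume x: "x \<in> disk n"
  show ?thesis
  proof (cases "i < n")
    case True
    then have "(x i)\<^sup>2 \<le> (\<Sum>i<n. (x i)\<^sup>2)"
      by (intro member_le_sum) auto
    then have "(x i)\<^sup>2 \<le> 1" using x by (simp add: disk_def)
    then show ?thesis by (simp add: abs_square_le_1 abs_le_iff)
  next
    case False
    then show ?thesis using x by (simp add: disk_def)
  qed
qed

text \<open>A closed subset of a product of intervals, compact by Tychonoff. The product is infinite
  because the coordinates from \<open>n\<close> on vanish but are still present.\<close>

lemma compact_disk: "compact (disk n)"
proof -
  have "compactin (powertop_real UNIV) (UNIV \<rightarrow>\<^sub>E {-1..1})"
    by (simp add: compactin_PiE)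
  then have "compact (UNIV \<rightarrow>\<^sub>E {-1..1} :: (nat \<Rightarrow> real) set)"
    by (simp add: euclidean_product_topology)
  moreover have "closed (disk n)"
  proof -
    have "closed {x::nat \<Rightarrow> real. x i = 0}" for i
      by (intro closed_Collect_eq continuous_on_const continuous_on_coordinate [OF continuous_on_id])
    moreover have "closed {x::nat \<Rightarrow> real. (\<Sum>i<n. (x i)\<^sup>2) \<le> 1}"
      by (intro closed_Collect_le continuous_intros continuous_on_coordinate [OF continuous_on_id])
    moreover have "disk n = (\<Inter>i\<in>{n..}. {x. x i = 0}) \<inter> {x. (\<Sum>i<n. (x i)\<^sup>2) \<le> 1}"
      by (auto simp: disk_def)
    ultimately show ?thesis by auto
  qed
  moreover have "disk n \<subseteq> UNIV \<rightarrow>\<^sub>E {-1..1}"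
    using disk_coordinate_bound by (auto simp: PiE_UNIV_domain)
  ultimately show ?thesis
    by (metis compact_Int_closed inf.absorb2)
qed

lemma compact_space_unit_disk: "compact_space (unit_disk n)"
  using compact_disk by (simp add: unit_disk_eq compact_space_subtopology)

section \<open>Radial coordinates in the disk\<close>

definition radius :: "nat \<Rightarrow> (nat \<Rightarrow> real) \<Rightarrow> real" where
  "radius n z = sqrt (\<Sum>i<n. (z i)\<^sup>2)"

text \<open>Linear motion along the ray of \<open>z\<close>, from \<open>z\<close> at time 0 to its
  projection on the sphere at time 1, written as one scalar factor. At the centre continuity fails,
  so the centre is removed wherever continuity matters.\<close>

definition radial :: "nat \<Rightarrow> real \<Rightarrow> (nat \<Rightarrow> real) \<Rightarrow> nat \<Rightarrow> real" where
  "radial n u z = (\<lambda>i. ((1 - u) + u / radius n z) * z i)"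

lemma radius_nonneg: "radius n z \<ge> 0"
  by (simp add: radius_def sum_nonneg)

lemma radius_pos: "z \<in> disk n \<Longrightarrow> z \<noteq> (\<lambda>_. 0) \<Longrightarrow> radius n z > 0"
proof -
  assume z: "z \<in> disk n" "z \<noteq> (\<lambda>_. 0)"
  then obtain i where i: "z i \<noteq> 0" by auto
  then have "i < n" using z by (auto simp: disk_def not_less[symmetric])
  then have "(\<Sum>i<n. (z i)\<^sup>2) > 0"
    using i by (intro sum_pos2[where i = i]) auto
  then show ?thesis by (simp add: radius_def)
qed

lemma openin_punctured_disk: "openin (top_of_set (disk n)) (disk n - {\<lambda>_. 0})"
proof -
  have "closed {\<lambda>_::nat. 0::real}" by simp
  then show ?thesis
    by (simp add: Diff_eq openin_open_Int open_Compl)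
qed

lemma radius_scale: "radius n (\<lambda>i. c * z i) = \<bar>c\<bar> * radius n z"
  by (simp add: radius_def power_mult_distrib real_sqrt_mult flip: sum_distrib_left)

lemma disk_iff_radius: "z \<in> disk n \<longleftrightarrow> (\<forall>i\<ge>n. z i = 0) \<and> radius n z \<le> 1"
  by (simp add: disk_def radius_def)

lemma open_disk_iff_radius: "z \<in> open_disk n \<longleftrightarrow> (\<forall>i\<ge>n. z i = 0) \<and> radius n z < 1"
  by (auto simp: open_disk_eq disk_def radius_def)

lemma boundary_sphere_iff_radius: "z \<in> boundary_sphere n \<longleftrightarrow> (\<forall>i\<ge>n. z i = 0) \<and> radius n z = 1"
  by (auto simp: boundary_sphere_eq disk_def radius_def)

lemma zero_in_open_disk: "(\<lambda>_. 0) \<in> open_disk n"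
  by (simp add: open_disk_iff_radius radius_def)

lemma radius_radial:
  assumes "z \<in> disk n" "z \<noteq> (\<lambda>_. 0)" "u \<in> {0..1}"
  shows "radius n (radial n u z) = (1 - u) * radius n z + u"
proof -
  have "(1 - u) + u / radius n z \<ge> 0"
    using assms radius_pos[of z n] by auto
  then show ?thesis
    using radius_pos[OF assms(1,2)] unfolding radial_def radius_scale by (simp add: distrib_right)
qed

lemma radial_in_disk:
  assumes "z \<in> disk n" "z \<noteq> (\<lambda>_. 0)" "u \<in> {0..1}"
  shows "radial n u z \<in> disk n"
proof -
  have "(1 - u) * radius n z + u \<le> 1"
    using assms convex_bound_le[of "radius n z" 1 1 "1-u" u] unfolding disk_iff_radius by simp
  then have "radius n (radial n u z) \<le> 1"
    by (simp only: radius_radial[OF assms])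
  then show ?thesis
    using assms(1) by (simp add: disk_iff_radius radial_def)
qed

lemma radial_1_in_sphere:
  assumes "z \<in> disk n" "z \<noteq> (\<lambda>_. 0)"
  shows "radial n 1 z \<in> boundary_sphere n"
proof -
  have "radius n (radial n 1 z) = 1"
    using radius_radial[OF assms, of 1] by simp
  then show ?thesis
    using assms(1) by (simp add: boundary_sphere_iff_radius disk_iff_radius radial_def)
qed

lemma radial_0 [simp]: "radial n 0 z = z"
  by (simp add: radial_def)

lemma radial_sphere: "z \<in> boundary_sphere n \<Longrightarrow> radial n u z = z"
  by (simp add: radial_def boundary_sphere_iff_radius)

lemma continuous_on_radius [continuous_intros]: "continuous_on S f \<Longrightarrow> continuous_on S (\<lambda>x. radius n (f x))"
  unfolding radius_def
  by (intro continuous_on_real_sqrt continuous_on_sum continuous_on_power continuous_on_coordinate)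

lemma continuous_on_radial:
  assumes "continuous_on S f" "continuous_on S g" "f ` S \<subseteq> disk n - {\<lambda>_. 0}"
  shows "continuous_on S (\<lambda>x. radial n (g x) (f x))"
proof (rule continuous_on_coordinatewise_then_product)
  fix i
  have "radius n (f x) \<noteq> 0" if "x \<in> S" for x
    using assms(3) that radius_pos[of "f x" n] by fastforce
  then show "continuous_on S (\<lambda>x. radial n (g x) (f x) i)"
    unfolding radial_def using assms(1,2) continuous_on_coordinate [OF assms(1)]
    by (intro continuous_on_mult continuous_on_add continuous_on_diff continuous_on_divide
        continuous_on_const continuous_on_radius) auto
qed

lemma scale_in_disk:
  assumes "z \<in> disk n" "c \<in> {0..1}"
  shows "(\<lambda>i. c * z i) \<in> disk n"
proof -
  have "c * radius n z \<le> 1"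
    using assms radius_nonneg[of n z] mult_le_one[of c "radius n z"] by (auto simp: disk_iff_radius)
  then show ?thesis
    using assms by (simp add: disk_iff_radius radius_scale)
qed

lemma continuous_on_scale:
  fixes f :: "'a::topological_space \<Rightarrow> nat \<Rightarrow> real"
  assumes "continuous_on S f" "continuous_on S g"
  shows "continuous_on S (\<lambda>x i. g x * f x i)"
  using continuous_on_mult [OF assms(2) continuous_on_coordinate [OF assms(1)]]
  by (rule continuous_on_coordinatewise_then_product)

text \<open>A pushout of \<open>Y\<close> and a family of \<open>n\<close>-disks along their
  boundary spheres, described by its properties: \<open>attach_openin\<close> says that openness may
  be tested on \<open>Y\<close> and on the disks, which is the final topology.\<close>

locale cell_attachment =
  fixes X :: "'m topology" and Y :: "'m set" and n :: nat and F :: "'i set"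
    and \<Phi> :: "'i \<Rightarrow> (nat \<Rightarrow> real) \<Rightarrow> 'm"
  assumes closed_base: "closedin X Y"
    and attach_continuous: "f \<in> F \<Longrightarrow> continuous_map (unit_disk n) X (\<Phi> f)"
    and attach_boundary: "f \<in> F \<Longrightarrow> z \<in> boundary_sphere n \<Longrightarrow> \<Phi> f z \<in> Y"
    and attach_inj: "f \<in> F \<Longrightarrow> g \<in> F \<Longrightarrow> z \<in> open_disk n \<Longrightarrow> w \<in> open_disk n \<Longrightarrow> \<Phi> f z = \<Phi> g w \<Longrightarrow> f = g \<and> z = w"
    and attach_disjoint: "f \<in> F \<Longrightarrow> z \<in> open_disk n \<Longrightarrow> \<Phi> f z \<notin> Y"
    and attach_cover: "x \<in> topspace X \<Longrightarrow> x \<notin> Y \<Longrightarrow> \<exists>f\<in>F. \<exists>z\<in>open_disk n. x = \<Phi> f z"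
    and attach_openin: "S \<subseteq> topspace X \<Longrightarrow> openin (subtopology X Y) (S \<inter> Y) \<Longrightarrow>
      (\<And>f. f \<in> F \<Longrightarrow> openin (unit_disk n) {z \<in> disk n. \<Phi> f z \<in> S}) \<Longrightarrow> openin X S"
begin

lemma base_subset: "Y \<subseteq> topspace X"
  using closed_base closedin_subset by blast

lemma attach_in: "f \<in> F \<Longrightarrow> z \<in> disk n \<Longrightarrow> \<Phi> f z \<in> topspace X"
  using continuous_map_image_subset_topspace [OF attach_continuous] by fastforce

text \<open>Boundary points go to \<open>Y\<close>, which the images of interior points avoid; so
  injectivity on the open disks still holds when one of the points is taken in the closed
  disk.\<close>

lemma attach_eq_cell:
  assumes "f \<in> F" "g \<in> F" "z \<in> disk n" "w \<in> open_disk n" "\<Phi> f z = \<Phi> g w"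
  shows "f = g \<and> z = w"
  using assms attach_inj attach_boundary attach_disjoint unfolding disk_split by (metis UnE)

text \<open>An open cell meets neither \<open>Y\<close> nor any other cell, so only its own disk has
  to be inspected.\<close>

lemma openin_cell_image:
  assumes f: "f \<in> F" and S: "openin (unit_disk n) S" "S \<subseteq> open_disk n"
  shows "openin X (\<Phi> f ` S)"
proof (rule attach_openin)
  show "\<Phi> f ` S \<subseteq> topspace X"
    using attach_in [OF f] S open_disk_subset by blast
  have "\<Phi> f ` S \<inter> Y = {}"
    using attach_disjoint [OF f] S by blast
  then show "openin (subtopology X Y) (\<Phi> f ` S \<inter> Y)"
    by simp
  fix g assume g: "g \<in> F"
  have "{z \<in> disk n. \<Phi> g z \<in> \<Phi> f ` S} = (if f = g then S else {})"
    using attach_eq_cell [OF g f] S by (auto intro: open_disk_in)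
  then show "openin (unit_disk n) {z \<in> disk n. \<Phi> g z \<in> \<Phi> f ` S}"
    using S by simp
qed

text \<open>The universal property of the pushout, localized at an open set \<open>W\<close>; the
  local form is required because charts are defined on open sets only.\<close>

lemma continuous_map_attach:
  assumes W: "openin X W"
    and gY: "continuous_map (subtopology X (W \<inter> Y)) Z g"
    and gF: "\<And>f. f \<in> F \<Longrightarrow> continuous_map (subtopology (unit_disk n) {z \<in> disk n. \<Phi> f z \<in> W}) Z (\<lambda>z. g (\<Phi> f z))"
  shows "continuous_map (subtopology X W) Z g"
  unfolding continuous_map_openin_preimage_eq
proof (intro conjI allI impI)
  have WX: "W \<subseteq> topspace X" using W openin_subset by blast
  have "g x \<in> topspace Z" if xW: "x \<in> W" for x
  proof (cases "x \<in> Y")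
    case True
    then show ?thesis
      using continuous_map_image_subset_topspace [OF gY] that WX by auto
  next
    case False
    then obtain f z where fz: "f \<in> F" "z \<in> open_disk n" "x = \<Phi> f z"
      using attach_cover [of x] WX xW by blast
    then have "z \<in> topspace (subtopology (unit_disk n) {z \<in> disk n. \<Phi> f z \<in> W})"
      using that open_disk_subset by auto
    then show ?thesis
      using continuous_map_image_subset_topspace [OF gF [OF fz(1)]] fz(3) by blast
  qed
  then show "g \<in> topspace (subtopology X W) \<rightarrow> topspace Z"
    by auto
  fix O' assume O: "openin Z O'"
  have "openin X (W \<inter> g -` O')"
  proof (rule attach_openin)
    show "W \<inter> g -` O' \<subseteq> topspace X" using WX by blast
    have "openin (subtopology X (W \<inter> Y)) {x \<in> topspace (subtopology X (W \<inter> Y)). g x \<in> O'}"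
      using gY O by (rule openin_continuous_map_preimage)
    moreover have "{x \<in> topspace (subtopology X (W \<inter> Y)). g x \<in> O'} = W \<inter> g -` O' \<inter> Y"
      using WX by auto
    ultimately have "openin (subtopology (subtopology X Y) (Y \<inter> W)) (W \<inter> g -` O' \<inter> Y)"
      by (simp add: subtopology_subtopology Int_commute Int_left_commute)
    moreover have "openin (subtopology X Y) (Y \<inter> W)"
      using W by (simp add: openin_subtopology_Int2)
    ultimately show "openin (subtopology X Y) (W \<inter> g -` O' \<inter> Y)"
      by (rule openin_trans_full)
    fix f assume f: "f \<in> F"
    let ?V = "{z \<in> disk n. \<Phi> f z \<in> W}"
    have "openin (subtopology (unit_disk n) ?V) {z \<in> topspace (subtopology (unit_disk n) ?V). g (\<Phi> f z) \<in> O'}"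
      using gF [OF f] O by (rule openin_continuous_map_preimage)
    moreover have "{z \<in> topspace (subtopology (unit_disk n) ?V). g (\<Phi> f z) \<in> O'} = {z \<in> disk n. \<Phi> f z \<in> W \<inter> g -` O'}"
      by auto
    moreover have "openin (unit_disk n) ?V"
      using openin_continuous_map_preimage [OF attach_continuous [OF f] W] by simp
    ultimately show "openin (unit_disk n) {z \<in> disk n. \<Phi> f z \<in> W \<inter> g -` O'}"
      by (simp only: openin_trans_full)
  qed
  moreover have "topspace (subtopology X W) \<inter> g -` O' = W \<inter> (W \<inter> g -` O')"
    using WX by auto
  ultimately show "openin (subtopology X W) (topspace (subtopology X W) \<inter> g -` O')"
    by (metis openin_subtopology_Int2)
qed

definition cell_of :: "'m \<Rightarrow> 'i" where
  "cell_of x = (SOME f. f \<in> F \<and> (\<exists>z\<in>open_disk n. x = \<Phi> f z))"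

definition coord :: "'m \<Rightarrow> nat \<Rightarrow> real" where
  "coord x = (SOME z. z \<in> open_disk n \<and> x = \<Phi> (cell_of x) z)"

lemma cell_of_attach:
  assumes "f \<in> F" "z \<in> open_disk n"
  shows "cell_of (\<Phi> f z) = f" "coord (\<Phi> f z) = z"
proof -
  show *: "cell_of (\<Phi> f z) = f"
    unfolding cell_of_def using assms attach_inj by (intro some_equality) auto
  show "coord (\<Phi> f z) = z"
    unfolding coord_def * using assms attach_inj by (intro some_equality) auto
qed

lemma continuous_map_coord:
  assumes f: "f \<in> F"
  shows "continuous_map (subtopology X (\<Phi> f ` open_disk n)) (unit_disk n) coord"
  unfolding continuous_map_def
proof (intro conjI allI impI)
  show "coord \<in> topspace (subtopology X (\<Phi> f ` open_disk n)) \<rightarrow> topspace (unit_disk n)"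
    using cell_of_attach [OF f] by (auto intro: open_disk_in)
  fix S assume S: "openin (unit_disk n) S"
  have "openin X (\<Phi> f ` (open_disk n \<inter> S))"
    using S openin_open_disk by (intro openin_cell_image [OF f] openin_Int) auto
  moreover have "{x \<in> topspace (subtopology X (\<Phi> f ` open_disk n)). coord x \<in> S} = \<Phi> f ` (open_disk n \<inter> S)"
    using cell_of_attach [OF f] attach_in [OF f] by (auto intro: open_disk_in)
  moreover have "\<Phi> f ` (open_disk n \<inter> S) \<subseteq> \<Phi> f ` open_disk n" by blast
  ultimately show "openin (subtopology X (\<Phi> f ` open_disk n)) {x \<in> topspace (subtopology X (\<Phi> f ` open_disk n)). coord x \<in> S}"
    by (metis openin_subset_topspace_eq openin_subtopology_Int2 inf.absorb2)
qed

section \<open>The radial retraction off the centres of the cells\<close>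

definition punctured :: "'m set" where
  "punctured = topspace X - (\<lambda>f. \<Phi> f (\<lambda>_. 0)) ` F"

text \<open>Time is the last argument, so that \<open>retraction x\<close> is the track of
  \<open>x\<close>, a path to which \<kappa> can be applied.\<close>

definition retraction :: "'m \<Rightarrow> real \<Rightarrow> 'm" where
  "retraction x u = (if x \<in> Y then x else \<Phi> (cell_of x) (radial n u (coord x)))"

lemma base_punctured: "Y \<subseteq> punctured"
  using base_subset attach_disjoint zero_in_open_disk by (auto simp: punctured_def)

lemma attach_punctured:
  assumes "f \<in> F" "z \<in> disk n"
  shows "\<Phi> f z \<in> punctured \<longleftrightarrow> z \<noteq> (\<lambda>_. 0)"
  using assms attach_in attach_eq_cell [OF assms(1) _ assms(2) zero_in_open_disk] by (auto simp: punctured_def)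

lemma punctured_cases:
  assumes "x \<in> punctured"
  obtains "x \<in> Y" | f z where "f \<in> F" "z \<in> open_disk n" "z \<noteq> (\<lambda>_. 0)" "x = \<Phi> f z" "x \<notin> Y"
proof (cases "x \<in> Y")
  case False
  have "x \<in> topspace X"
    using assms by (simp add: punctured_def)
  then obtain f z where fz: "f \<in> F" "z \<in> open_disk n" "x = \<Phi> f z"
    using attach_cover False by blast
  moreover have "z \<noteq> (\<lambda>_. 0)"
    using attach_punctured [of f z] fz assms open_disk_subset by blast
  ultimately show ?thesis
    using that(2) False by blast
qed (use that in blast)

lemma openin_punctured: "openin X punctured"
proof (rule attach_openin)
  show "punctured \<subseteq> topspace X"
    by (auto simp: punctured_def)
  have "punctured \<inter> Y = topspace (subtopology X Y)"
    using base_punctured base_subset by auto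
  then show "openin (subtopology X Y) (punctured \<inter> Y)"
    by (metis openin_topspace)
  fix f assume f: "f \<in> F"
  have "{z \<in> disk n. \<Phi> f z \<in> punctured} = disk n - {\<lambda>_. 0}"
    using attach_punctured [OF f] by blast
  then show "openin (unit_disk n) {z \<in> disk n. \<Phi> f z \<in> punctured}"
    by (simp add: unit_disk_eq openin_punctured_disk)
qed

lemma retraction_attach:
  assumes "f \<in> F" "z \<in> disk n" "z \<noteq> (\<lambda>_. 0)"
  shows "retraction (\<Phi> f z) u = \<Phi> f (radial n u z)"
proof (cases "z \<in> open_disk n")
  case True
  then show ?thesis
    using assms attach_disjoint by (simp add: retraction_def cell_of_attach)
next
  case False
  then have "z \<in> boundary_sphere n"
    using assms by (auto simp: disk_split)
  then show ?thesis
    using assms attach_boundary by (simp add: retraction_def radial_sphere)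
qed

lemma retraction_base: "x \<in> Y \<Longrightarrow> retraction x u = x"
  by (simp add: retraction_def)

lemma retraction_0: "x \<in> punctured \<Longrightarrow> retraction x 0 = x"
  by (elim punctured_cases) (auto simp: retraction_base retraction_attach open_disk_in)

lemma retraction_1: "x \<in> punctured \<Longrightarrow> retraction x 1 \<in> Y"
  by (elim punctured_cases)
    (auto simp: retraction_base retraction_attach open_disk_in radial_1_in_sphere attach_boundary)

lemma retraction_in: "x \<in> punctured \<Longrightarrow> u \<in> {0..1} \<Longrightarrow> retraction x u \<in> topspace X"
  using base_subset by (elim punctured_cases)
    (auto simp: retraction_base retraction_attach open_disk_in radial_in_disk attach_in)

lemma continuous_map_radial_attach:
  assumes f: "f \<in> F"
  shows "continuous_map (top_of_set ((disk n - {\<lambda>_. 0}) \<times> {0..1})) X (\<lambda>(z, u). \<Phi> f (radial n u z))"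
proof -
  have "continuous_on ((disk n - {\<lambda>_. 0}) \<times> {0..1}) (\<lambda>x. radial n (snd x) (fst x))"
    by (intro continuous_on_radial continuous_intros) auto
  then have "continuous_map (top_of_set ((disk n - {\<lambda>_. 0}) \<times> {0..1})) (unit_disk n) (\<lambda>(z, u). radial n u z)"
    by (auto simp: unit_disk_eq case_prod_unfold intro!: radial_in_disk)
  from continuous_map_compose [OF this attach_continuous [OF f]] show ?thesis
    by (simp add: o_def case_prod_unfold)
qed

text \<open>These sets are the neighbourhoods needed for continuity of the retraction at points of
  \<open>Y\<close>, where the track is constant. On a disk openness is an instance of the tube
  lemma.\<close>

lemma openin_retraction_interior:
  assumes S: "openin X S"
  shows "openin X {x \<in> punctured. \<forall>u\<in>{0..1}. retraction x u \<in> S}"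
proof (rule attach_openin)
  have SX: "S \<subseteq> topspace X" using S openin_subset by blast
  show "{x \<in> punctured. \<forall>u\<in>{0..1}. retraction x u \<in> S} \<subseteq> topspace X"
    by (auto simp: punctured_def)
  have "{x \<in> punctured. \<forall>u\<in>{0..1}. retraction x u \<in> S} \<inter> Y = Y \<inter> S"
    using base_punctured by (auto simp: retraction_base intro: exI [of _ 0] dest!: bspec [of _ _ 0])
  then show "openin (subtopology X Y) ({x \<in> punctured. \<forall>u\<in>{0..1}. retraction x u \<in> S} \<inter> Y)"
    using S by (metis openin_subtopology_Int2)
  fix f assume f: "f \<in> F"
  let ?D = "disk n - {\<lambda>_. 0}"
  let ?g = "\<lambda>(z, u). \<Phi> f (radial n u z)"
  let ?C = "{x \<in> ?D \<times> {0..1}. ?g x \<in> topspace X - S}"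
  have "closedin (top_of_set (?D \<times> {0..1})) {x \<in> topspace (top_of_set (?D \<times> {0..1})). ?g x \<in> topspace X - S}"
    using S by (intro closedin_continuous_map_preimage [OF continuous_map_radial_attach [OF f]]) auto
  then have C: "closedin (prod_topology (top_of_set ?D) (top_of_set {0..1::real})) ?C"
    by (simp add: prod_topology_subtopology_eu)
  \<comment> \<open>Projection along a compact factor is a closed map, so the points whose track
    leaves \<open>S\<close> at some time form a closed set.\<close>
  have "compact_space (top_of_set {0..1::real})"
    by (simp add: compact_space_subtopology)
  then have "closed_map (prod_topology (top_of_set ?D) (top_of_set {0..1::real})) (top_of_set ?D) fst"
    by (rule Abstract_Topological_Spaces.closed_map_fst)
  then have "closedin (top_of_set ?D) (fst ` ?C)"
    using C by (simp add: closed_map_def)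
  then have "openin (top_of_set ?D) (?D - fst ` ?C)"
    by (simp add: closedin_def)
  then have "openin (top_of_set (disk n)) (?D - fst ` ?C)"
    using openin_punctured_disk by (rule openin_trans)
  moreover have "?D - fst ` ?C = {z \<in> disk n. \<Phi> f z \<in> {x \<in> punctured. \<forall>u\<in>{0..1}. retraction x u \<in> S}}"
  proof -
    have "z \<in> fst ` ?C \<longleftrightarrow> (\<exists>u\<in>{0..1}. retraction (\<Phi> f z) u \<notin> S)" if "z \<in> ?D" for z
    proof -
      have "z \<in> fst ` ?C \<longleftrightarrow> (\<exists>u\<in>{0..1}. \<Phi> f (radial n u z) \<in> topspace X - S)"
        using that by (force simp: image_iff)
      then show ?thesis
        using that retraction_attach [OF f] attach_in [OF f] radial_in_disk by auto
    qed
    then show ?thesis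
      using attach_punctured [OF f] by blast
  qed
  ultimately show "openin (unit_disk n) {z \<in> disk n. \<Phi> f z \<in> {x \<in> punctured. \<forall>u\<in>{0..1}. retraction x u \<in> S}}"
    by (simp add: unit_disk_eq)
qed

text \<open>Instead of showing that the product with the interval is again an attachment, continuity
  is checked pointwise: at points of \<open>Y\<close> by the open set of tracks staying in
  \<open>S\<close>, and inside a cell by the coordinates of the cell.\<close>

lemma continuous_map_retraction:
  "continuous_map (prod_topology (subtopology X punctured) (top_of_set {0..1})) X (\<lambda>(x, u). retraction x u)"
proof -
  let ?P = "prod_topology (subtopology X punctured) (top_of_set {0..1::real})"
  let ?h = "\<lambda>(x, u). retraction x u"
  have top: "topspace ?P = punctured \<times> {0..1}"
    by (auto simp: punctured_def)
  show ?thesis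
    unfolding continuous_map_def
  proof (intro conjI allI impI)
    show "?h \<in> topspace ?P \<rightarrow> topspace X"
      unfolding top using retraction_in by auto
    fix S assume S: "openin X S"
    show "openin ?P {x \<in> topspace ?P. ?h x \<in> S}"
    proof (subst openin_subopen, clarify)
      fix x u assume xu: "(x, u) \<in> topspace ?P" "retraction x u \<in> S"
      then have x: "x \<in> punctured" and u: "u \<in> {0..1}"
        by (auto simp: top)
      from x show "\<exists>V. openin ?P V \<and> (x, u) \<in> V \<and> V \<subseteq> {x \<in> topspace ?P. ?h x \<in> S}"
      proof (cases rule: punctured_cases)
        case 1
        let ?V = "{x \<in> punctured. \<forall>u\<in>{0..1}. retraction x u \<in> S}"
        have "openin (subtopology X punctured) ?V"
          using openin_retraction_interior [OF S] by (auto intro: openin_subset_topspace_eq simp: openin_open_subtopology openin_punctured)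
        then have "openin ?P (?V \<times> {0..1})"
          by (simp add: openin_prod_Times_iff)
        moreover have "(x, u) \<in> ?V \<times> {0..1}"
          using 1 x u xu by (auto simp: retraction_base)
        ultimately show ?thesis
          unfolding top by (intro exI [of _ "?V \<times> {0..1}"]) auto
      next
        case (2 f z)
        let ?C = "\<Phi> f ` (open_disk n - {\<lambda>_. 0})"
        have "openin (unit_disk n) (open_disk n - {\<lambda>_. 0})"
        proof -
          have "openin (unit_disk n) (open_disk n \<inter> (disk n - {\<lambda>_. 0}))"
            by (intro openin_Int openin_open_disk) (simp add: unit_disk_eq openin_punctured_disk)
          moreover have "open_disk n \<inter> (disk n - {\<lambda>_. 0}) = open_disk n - {\<lambda>_. 0}"
            using open_disk_subset by blast
          ultimately show ?thesis by simp
        qed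
        then have C: "openin X ?C"
          by (rule openin_cell_image [OF 2(1)]) auto
        have Csub: "?C \<subseteq> punctured"
          using attach_punctured [OF 2(1)] open_disk_subset by blast
        have CP: "openin ?P (?C \<times> {0..1})"
          using C Csub by (simp add: openin_prod_Times_iff openin_open_subtopology openin_punctured)
        have sub: "subtopology ?P (?C \<times> {0..1}) = prod_topology (subtopology X ?C) (top_of_set {0..1})"
          using Csub by (simp add: subtopology_Times subtopology_subtopology Int_absorb1)
        have "continuous_map (subtopology X ?C) (top_of_set (disk n - {\<lambda>_. 0})) coord"
        proof -
          have "continuous_map (subtopology X ?C) (unit_disk n) coord"
            by (rule continuous_map_from_subtopology_mono [OF continuous_map_coord [OF 2(1)]]) auto
          moreover have "coord ` topspace (subtopology X ?C) \<subseteq> disk n - {\<lambda>_. 0}"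
            using cell_of_attach [OF 2(1)] by (auto intro: open_disk_in)
          ultimately show ?thesis
            by (auto simp: unit_disk_eq continuous_map_in_subtopology)
        qed
        from continuous_map_compose [OF continuous_map_fst this]
        have "continuous_map (prod_topology (subtopology X ?C) (top_of_set {0..1::real}))
            (prod_topology (top_of_set (disk n - {\<lambda>_. 0})) (top_of_set {0..1})) (\<lambda>x. (coord (fst x), snd x))"
          by (intro continuous_map_pairedI continuous_map_snd) (simp add: o_def)
        from continuous_map_compose [OF this, of X "\<lambda>(z, u). \<Phi> f (radial n u z)"] continuous_map_radial_attach [OF 2(1)]
        have "continuous_map (prod_topology (subtopology X ?C) (top_of_set {0..1})) X
            (\<lambda>x. \<Phi> f (radial n (snd x) (coord (fst x))))"
          by (simp add: o_def prod_topology_subtopology_eu case_prod_unfold)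
        moreover have "\<Phi> f (radial n (snd x) (coord (fst x))) = ?h x"
          if "x \<in> topspace (prod_topology (subtopology X ?C) (top_of_set {0..1::real}))" for x
        proof -
          have "fst x \<in> ?C" using that by auto
          then obtain w where w: "w \<in> open_disk n" "w \<noteq> (\<lambda>_. 0)" "fst x = \<Phi> f w" by blast
          then show ?thesis
            using retraction_attach [OF 2(1) open_disk_in [OF w(1)] w(2)] cell_of_attach [OF 2(1) w(1)]
            by (simp add: case_prod_unfold)
        qed
        ultimately have "continuous_map (subtopology ?P (?C \<times> {0..1})) X ?h"
          unfolding sub by (rule continuous_map_eq)
        then have "openin (subtopology ?P (?C \<times> {0..1})) {x \<in> topspace (subtopology ?P (?C \<times> {0..1})). ?h x \<in> S}"
          using S by (rule openin_continuous_map_preimage)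
        then have "openin ?P {x \<in> topspace (subtopology ?P (?C \<times> {0..1})). ?h x \<in> S}"
          using CP openin_trans_full by blast
        moreover have "(x, u) \<in> {x \<in> topspace (subtopology ?P (?C \<times> {0..1})). ?h x \<in> S}"
          using xu 2 by auto
        ultimately show ?thesis
          by (intro exI conjI) auto
      qed
    qed
  qed
qed

end

section \<open>CW complexes as successive attachments of cells\<close>

locale CW_cells =
  fixes M :: "'m topology" and E :: "nat \<Rightarrow> 'm set set" and \<Phi> :: "nat \<Rightarrow> 'm set \<Rightarrow> (nat \<Rightarrow> real) \<Rightarrow> 'm"
  assumes CW: "CW_structure M E"
    and characteristic: "e \<in> E n \<Longrightarrow> characteristic_map M E n e (\<Phi> n e)"
begin

text \<open>The bound is strict: \<open>skeleton (Suc n)\<close> is the usual n-skeleton and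
  \<open>skeleton 0\<close> is empty, which gives inductions over skeleta a trivial start.\<close>

definition skeleton :: "nat \<Rightarrow> 'm set" where
  "skeleton k = (\<Union>j<k. \<Union>(E j))"

lemma cell_continuous: "e \<in> E n \<Longrightarrow> continuous_map (unit_disk n) M (\<Phi> n e)"
  using characteristic by (simp add: characteristic_map_def)

lemma cells_Hausdorff: "Hausdorff_space M"
  and cells_cover: "(\<Union>n. \<Union>(E n)) = topspace M"
  and cells_weak_topology: "A \<subseteq> topspace M \<Longrightarrow> closedin M A \<longleftrightarrow> (\<forall>n. \<forall>e\<in>E n. closedin M (A \<inter> M closure_of e))"
proof -
  note * = CW [unfolded CW_structure_def]
  show "Hausdorff_space M"
    using * by (elim conjE)
  show "(\<Union>n. \<Union>(E n)) = topspace M"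
    using * by (elim conjE)
  have "\<forall>A\<subseteq>topspace M. closedin M A \<longleftrightarrow> (\<forall>n. \<forall>e\<in>E n. closedin M (A \<inter> M closure_of e))"
    using * by (elim conjE)
  then show "A \<subseteq> topspace M \<Longrightarrow> closedin M A \<longleftrightarrow> (\<forall>n. \<forall>e\<in>E n. closedin M (A \<inter> M closure_of e))"
    by (elim allE impE)
qed

lemma cell_subset: "e \<in> E n \<Longrightarrow> e \<subseteq> topspace M"
  unfolding cells_cover [symmetric] by blast

lemma cell_disjoint: "e \<in> E m \<Longrightarrow> f \<in> E n \<Longrightarrow> x \<in> e \<Longrightarrow> x \<in> f \<Longrightarrow> m = n \<and> e = f"
proof -
  have *: "\<forall>m n. \<forall>e\<in>E m. \<forall>f\<in>E n. (m, e) \<noteq> (n, f) \<longrightarrow> e \<inter> f = {}"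
    using CW [unfolded CW_structure_def] by (elim conjE)
  assume "e \<in> E m" "f \<in> E n" "x \<in> e" "x \<in> f"
  moreover from this have "e \<inter> f \<noteq> {}" by blast
  ultimately show "m = n \<and> e = f"
    using * by (metis prod.inject)
qed

lemma cell_image: 
  assumes "e \<in> E n"
  shows "\<Phi> n e ` open_disk n = e" "inj_on (\<Phi> n e) (open_disk n)"
proof -
  have "homeomorphic_map (subtopology (unit_disk n) (open_disk n)) (subtopology M e) (\<Phi> n e)"
    using characteristic [OF assms] by (simp add: characteristic_map_def)
  moreover have "topspace (subtopology (unit_disk n) (open_disk n)) = open_disk n"
    using open_disk_subset by auto
  moreover have "topspace (subtopology M e) = e"
    using cell_subset [OF assms] by auto
  ultimately show "\<Phi> n e ` open_disk n = e" "inj_on (\<Phi> n e) (open_disk n)"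
    using homeomorphic_imp_surjective_map homeomorphic_imp_injective_map by metis+
qed

lemma cell_boundary:
  assumes "e \<in> E n"
  obtains K where "finite K" "K \<subseteq> (\<Union>k<n. E k)" "\<Phi> n e ` boundary_sphere n \<subseteq> \<Union>K"
  using characteristic [OF assms] unfolding characteristic_map_def by blast

text \<open>The image of a compact set in a Hausdorff space.\<close>

lemma closed_cell:
  assumes e: "e \<in> E n" and S: "closedin (unit_disk n) S"
  shows "closedin M (\<Phi> n e ` S)"
proof -
  have "compactin (unit_disk n) S"
    using compact_space_unit_disk S by (rule closedin_compact_space)
  then have "compactin M (\<Phi> n e ` S)"
    using image_compactin cell_continuous [OF e] by blast
  then show ?thesis
    using compactin_imp_closedin [OF cells_Hausdorff] by blast
qed

lemma closure_of_cell:
  assumes e: "e \<in> E n"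
  shows "M closure_of e \<subseteq> \<Phi> n e ` disk n"
proof (rule closure_of_minimal)
  show "e \<subseteq> \<Phi> n e ` disk n"
    using cell_image(1) [OF e] open_disk_subset by blast
  show "closedin M (\<Phi> n e ` disk n)"
    using closed_cell [OF e] closedin_topspace [of "unit_disk n"] by simp
qed

lemma skeleton_subset: "skeleton k \<subseteq> topspace M"
  using cell_subset by (auto simp: skeleton_def)

lemma skeleton_mono: "j \<le> k \<Longrightarrow> skeleton j \<subseteq> skeleton k"
  unfolding skeleton_def by (rule UN_mono) auto

lemma cell_boundary_in_skeleton:
  assumes "e \<in> E n" "z \<in> boundary_sphere n"
  shows "\<Phi> n e z \<in> skeleton n"
proof -
  obtain K where K: "finite K" "K \<subseteq> (\<Union>k<n. E k)" "\<Phi> n e ` boundary_sphere n \<subseteq> \<Union>K"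
    by (rule cell_boundary [OF assms(1)])
  have "\<Phi> n e z \<in> \<Union>K"
    using imageI [OF assms(2)] K(3) by (rule subsetD [rotated])
  then obtain f where "f \<in> K" "\<Phi> n e z \<in> f"
    by (rule UnionE)
  moreover from this obtain k where "k < n" "f \<in> E k"
    using K(2) by auto
  ultimately show ?thesis
    unfolding skeleton_def by auto
qed

lemma cell_in_skeleton:
  assumes "e \<in> E n" "z \<in> disk n" "n < k"
  shows "\<Phi> n e z \<in> skeleton k"
proof (cases "z \<in> open_disk n")
  case True
  then have "\<Phi> n e z \<in> e"
    using cell_image(1) [OF assms(1)] by blast
  then show ?thesis
    using assms by (auto simp: skeleton_def)
next
  case False
  then show ?thesis
    using cell_boundary_in_skeleton [OF assms(1)] assms skeleton_mono [of n k] by (auto simp: disk_split)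
qed

text \<open>The weak topology tests all cells, including those of dimension \<open>k\<close> and
  more. Such a cell misses \<open>C\<close>, and by closure-finiteness its closure meets
  \<open>C\<close> only in finitely many cells of lower dimension, so induction on the dimension
  disposes of it.\<close>

lemma closedin_skeleton_subset:
  assumes C: "C \<subseteq> skeleton k"
    and cl: "\<And>j e. j < k \<Longrightarrow> e \<in> E j \<Longrightarrow> closedin M (C \<inter> \<Phi> j e ` disk j)"
  shows "closedin M C"
proof -
  have "closedin M (C \<inter> M closure_of e)" if "e \<in> E j" for j e
    using that
  proof (induction j arbitrary: e rule: less_induct)
    case (less j)
    show ?case
    proof (cases "j < k")
      case True
      have "C \<inter> M closure_of e = (C \<inter> \<Phi> j e ` disk j) \<inter> M closure_of e"
        using closure_of_cell [OF less.prems] by blast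
      then show ?thesis
        using cl [OF True less.prems] by (metis closedin_Int closedin_closure_of)
    next
      case False
      obtain K where K: "finite K" "K \<subseteq> (\<Union>k<j. E k)" "\<Phi> j e ` boundary_sphere j \<subseteq> \<Union>K"
        by (rule cell_boundary [OF less.prems])
      have "x \<notin> e" if "x \<in> C" for x
      proof -
        obtain i f where "i < k" "f \<in> E i" "x \<in> f"
          using C \<open>x \<in> C\<close> unfolding skeleton_def by blast
        then show ?thesis
          using False cell_disjoint [OF less.prems, of f i x] by auto
      qed
      then have "C \<inter> e = {}" by blast
      have sub: "M closure_of e \<subseteq> e \<union> \<Union>K"
        using closure_of_cell [OF less.prems] cell_image(1) [OF less.prems] K(3)
        unfolding disk_split image_Un by blast
      have cl': "f \<subseteq> M closure_of f" if "f \<in> K" for f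
        using that K(2) cell_subset by (intro closure_of_subset) blast
      have "C \<inter> M closure_of e = (\<Union>f\<in>K. C \<inter> M closure_of f) \<inter> M closure_of e"
      proof (intro equalityI subsetI)
        fix x assume x: "x \<in> C \<inter> M closure_of e"
        then have "x \<in> \<Union>K"
          using sub \<open>C \<inter> e = {}\<close> by blast
        then show "x \<in> (\<Union>f\<in>K. C \<inter> M closure_of f) \<inter> M closure_of e"
          using x cl' by (elim UnionE) blast
      qed auto
      moreover have "closedin M (C \<inter> M closure_of f)" if "f \<in> K" for f
        using that K(2) less.IH by blast
      then have "closedin M (\<Union>f\<in>K. C \<inter> M closure_of f)"
        using K(1) by (intro closedin_Union) auto
      ultimately show ?thesis
        by (metis closedin_Int closedin_closure_of)
    qed
  qed
  moreover have "C \<subseteq> topspace M"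
    using C skeleton_subset by blast
  ultimately show ?thesis
    using cells_weak_topology [of C] by simp
qed

lemma closedin_skeleton: "closedin M (skeleton k)"
proof (rule closedin_skeleton_subset [OF subset_refl])
  fix j e assume j: "j < k" "e \<in> E j"
  then have "skeleton k \<inter> \<Phi> j e ` disk j = \<Phi> j e ` disk j"
    using cell_in_skeleton by blast
  then show "closedin M (skeleton k \<inter> \<Phi> j e ` disk j)"
    using closed_cell [OF j(2)] closedin_topspace [of "unit_disk j"] by simp
qed

text \<open>The point is the final topology. The complement of \<open>S\<close> in the skeleton is
  tested on closed cells: those of dimension \<open>n\<close> are handled by compactness of the
  disk, and those below by the assumption on the lower skeleton, which is closed in
  \<open>M\<close>.\<close>

lemma skeleton_attachment:
  "cell_attachment (subtopology M (skeleton (Suc n))) (skeleton n) n (E n) (\<Phi> n)"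
proof
  let ?X = "subtopology M (skeleton (Suc n))"
  have sub: "skeleton n \<subseteq> skeleton (Suc n)"
    by (rule skeleton_mono) simp
  show "closedin ?X (skeleton n)"
    using closedin_skeleton sub by (auto intro: closedin_subset_topspace)
  fix f assume f: "f \<in> E n"
  show "continuous_map (unit_disk n) ?X (\<Phi> n f)"
    using cell_continuous [OF f] cell_in_skeleton [OF f] by (auto simp: continuous_map_in_subtopology)
  show "\<Phi> n f z \<in> skeleton n" if "z \<in> boundary_sphere n" for z
    using cell_boundary_in_skeleton [OF f that] .
  have op: "\<Phi> n f z \<in> f" if "z \<in> open_disk n" for z
    using cell_image(1) [OF f] that by blast
  show "\<Phi> n f z \<notin> skeleton n" if "z \<in> open_disk n" for z
  proof
    assume "\<Phi> n f z \<in> skeleton n"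
    then obtain i g where "i < n" "g \<in> E i" "\<Phi> n f z \<in> g"
      unfolding skeleton_def by blast
    then show False
      using op [OF that] cell_disjoint [OF f, of g i] by auto
  qed
  fix g z w assume g: "g \<in> E n" and zw: "z \<in> open_disk n" "w \<in> open_disk n" "\<Phi> n f z = \<Phi> n g w"
  have "\<Phi> n g w \<in> g"
    using cell_image(1) [OF g] zw by blast
  then have "f = g"
    using op [OF zw(1)] zw(3) cell_disjoint [OF f g] by simp
  then show "f = g \<and> z = w"
    using cell_image(2) [OF f] zw by (auto dest: inj_onD)
next
  fix x assume x: "x \<in> topspace (subtopology M (skeleton (Suc n)))" "x \<notin> skeleton n"
  then obtain e where e: "e \<in> E n" "x \<in> e"
    by (auto simp: skeleton_def less_Suc_eq)
  then show "\<exists>f\<in>E n. \<exists>z\<in>open_disk n. x = \<Phi> n f z"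
    using cell_image(1) [OF e(1)] by blast
next
  let ?X = "subtopology M (skeleton (Suc n))"
  have sub: "skeleton n \<subseteq> skeleton (Suc n)"
    by (rule skeleton_mono) simp
  fix S assume S: "S \<subseteq> topspace ?X" "openin (subtopology ?X (skeleton n)) (S \<inter> skeleton n)"
    "\<And>f. f \<in> E n \<Longrightarrow> openin (unit_disk n) {z \<in> disk n. \<Phi> n f z \<in> S}"
  define C where "C = skeleton (Suc n) - S"
  have "closedin M C"
  proof (rule closedin_skeleton_subset [where k = "Suc n"])
    fix j e assume j: "j < Suc n" and e: "e \<in> E j"
    show "closedin M (C \<inter> \<Phi> j e ` disk j)"
    proof (cases "j = n")
      case True
      have "disk n - {z \<in> disk n. \<Phi> n e z \<in> S} = {z \<in> disk n. \<Phi> n e z \<in> C}"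
        using cell_in_skeleton e True by (auto simp: C_def)
      then have "closedin (unit_disk n) {z \<in> disk n. \<Phi> n e z \<in> C}"
        using closedin_diff [OF closedin_topspace S(3) [of e]] e True by simp
      then have "closedin M (\<Phi> n e ` {z \<in> disk n. \<Phi> n e z \<in> C})"
        using closed_cell e True by blast
      moreover have "\<Phi> n e ` {z \<in> disk n. \<Phi> n e z \<in> C} = C \<inter> \<Phi> j e ` disk j"
        using True by auto
      ultimately show ?thesis by simp
    next
      case False
      have "closedin (subtopology M (skeleton n)) (skeleton n - S \<inter> skeleton n)"
        using S(2) sub skeleton_subset
        by (metis (no_types, lifting) closedin_diff closedin_topspace inf.absorb2 subtopology_subtopology topspace_subtopology)
      then have "closedin M (skeleton n - S \<inter> skeleton n)"
        using closedin_skeleton closedin_trans_full by blast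
      moreover have "closedin M (\<Phi> j e ` disk j)"
        using closed_cell [OF e] closedin_topspace [of "unit_disk j"] by simp
      moreover have "C \<inter> \<Phi> j e ` disk j = (skeleton n - S \<inter> skeleton n) \<inter> \<Phi> j e ` disk j"
        using cell_in_skeleton [OF e] j False sub by (auto simp: C_def)
      ultimately show ?thesis
        by (simp add: closedin_Int)
    qed
  qed (simp add: C_def)
  then have "openin M (topspace M - C)"
    by blast
  moreover have "S = skeleton (Suc n) \<inter> (topspace M - C)"
    using S(1) by (auto simp: C_def)
  ultimately show "openin ?X S"
    by (metis openin_subtopology_Int2)
qed

end

context group_quotient
begin

section \<open>Extending bundles over cells\<close>

lemma continuous_map_ratio_sym:
  assumes c: "continuous_map Z T (\<lambda>x. inv (a x) \<otimes> b x)"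
    and ab: "\<And>x. x \<in> topspace Z \<Longrightarrow> a x \<in> carrier G" "\<And>x. x \<in> topspace Z \<Longrightarrow> b x \<in> carrier G"
  shows "continuous_map Z T (\<lambda>x. inv (b x) \<otimes> a x)"
  by (rule continuous_map_eq [OF continuous_map_inverse [OF c]]) (simp add: ab inv_inv_mult)

text \<open>The path is coned off to the centre of the disk, so its holonomy is determined by the
  two rays from its ends to the centre.\<close>

lemma path_cocycle_disk_cone:
  assumes \<kappa>: "path_cocycle X \<kappa>" and \<phi>: "continuous_map (unit_disk n) X \<phi>"
    and \<tau>: "continuous_on {0..1} \<tau>" "\<tau> ` {0..1} \<subseteq> disk n"
  shows "\<kappa> (\<lambda>s. \<phi> (\<tau> s)) \<otimes>\<^bsub>A\<^esub> \<kappa> (\<lambda>u. \<phi> (\<lambda>i. (1 - u) * \<tau> 1 i)) = \<kappa> (\<lambda>u. \<phi> (\<lambda>i. (1 - u) * \<tau> 0 i))"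
proof -
  define H where "H = (\<lambda>(s, u). \<phi> (\<lambda>i. (1 - u) * \<tau> s i))"
  have "continuous_on ({0..1} \<times> {0..1}) (\<lambda>x. \<tau> (fst x))"
    by (rule continuous_on_compose2 [OF \<tau>(1)]) (auto intro!: continuous_intros)
  then have "continuous_on ({0..1} \<times> {0..1}) (\<lambda>x i. (1 - snd x) * \<tau> (fst x) i)"
    by (rule continuous_on_scale) (intro continuous_intros)
  moreover have "(\<lambda>i. (1 - u) * \<tau> s i) \<in> disk n" if "s \<in> {0..1}" "u \<in> {0..1}" for s u
    using \<tau>(2) that by (intro scale_in_disk) auto
  ultimately have "continuous_map (top_of_set ({0..1} \<times> {0..1})) (unit_disk n) (\<lambda>x i. (1 - snd x) * \<tau> (fst x) i)"
    by (auto simp: unit_disk_eq)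
  from continuous_map_compose [OF this \<phi>]
  have "continuous_map (top_of_set ({0..1} \<times> {0..1})) X H"
    by (simp add: H_def o_def case_prod_unfold)
  from path_cocycle_cone [OF \<kappa> this, of "\<phi> (\<lambda>_. 0)"] show ?thesis
    by (simp add: H_def)
qed

text \<open>On the complement of the centres of the cells the new bundle is the pullback of the old one
  under the radial retraction, twisted by \<open>\<epsilon>\<close> so that its holonomy is \<open>\<kappa>\<close>; on each cell it is trivial,
  and \<open>\<gamma>\<close> provides the transition functions.\<close>

lemma parallel_atlas_attach:
  fixes X :: "'m topology"
  assumes att: "cell_attachment X Y n F \<Phi>" and \<kappa>: "path_cocycle X \<kappa>"
    and par: "parallel_atlas (subtopology X Y) \<kappa> \<A>"
    and sphere: "\<And>f. f \<in> F \<Longrightarrow> \<exists>\<gamma>. framing \<A> (subtopology (unit_disk n) (boundary_sphere n)) (\<Phi> f) \<gamma> \<and>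
      (\<forall>w\<in>boundary_sphere n. q (\<gamma> w) = \<kappa> (\<lambda>u. \<Phi> f (\<lambda>i. (1 - u) * w i)))"
  shows "\<exists>\<B>. parallel_atlas X \<kappa> \<B>"
proof -
  interpret cell_attachment X Y n F \<Phi> by (rule att)
  let ?S = "subtopology (unit_disk n) (boundary_sphere n)"
  let ?a = "\<lambda>f w. \<kappa> (\<lambda>u. \<Phi> f (\<lambda>i. (1 - u) * w i))"
  let ?R = "\<lambda>x. retraction x 1"
  let ?\<rho> = "\<lambda>x. radial n 1 (coord x)"
  have A: "atlas (subtopology X Y) \<A>"
    using par by (simp add: parallel_atlas_def)
  have topS: "topspace ?S = boundary_sphere n"
    using boundary_sphere_subset by auto
  obtain \<gamma> where \<gamma>: "\<And>f. f \<in> F \<Longrightarrow> framing \<A> ?S (\<Phi> f) (\<gamma> f)"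
    and q\<gamma>: "\<And>f w. f \<in> F \<Longrightarrow> w \<in> boundary_sphere n \<Longrightarrow> q (\<gamma> f w) = ?a f w"
    using sphere by metis
  have \<gamma>in: "\<gamma> f w \<in> carrier G" if "f \<in> F" "w \<in> boundary_sphere n" for f w
    using framing_in [OF \<gamma> [OF that(1)], of w] that(2) by (simp only: topS)
  have ret_path: "pathin X (retraction x)" if "x \<in> punctured" for x
  proof -
    have "continuous_map (top_of_set {0..1}) (prod_topology (subtopology X punctured) (top_of_set {0..1})) (\<lambda>u. (x, u))"
      using that by (auto simp: continuous_map_pairwise o_def punctured_def)
    from continuous_map_compose [OF this continuous_map_retraction] show ?thesis
      by (simp add: pathin_def o_def)
  qed
  \<comment> \<open>The twist \<epsilon> lifts the holonomy of the track of \<open>x\<close>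
    pointwise; as a common left factor it disappears from all ratios, so its discontinuity is
    harmless.\<close>
  have "\<exists>g. g \<in> carrier G \<and> q g = \<kappa> (retraction x)" if "x \<in> punctured" for x
    using q_lift [OF path_cocycle_in [OF \<kappa> ret_path [OF that]]] by metis
  then obtain \<epsilon> where \<epsilon>: "\<And>x. x \<in> punctured \<Longrightarrow> \<epsilon> x \<in> carrier G"
    and q\<epsilon>: "\<And>x. x \<in> punctured \<Longrightarrow> q (\<epsilon> x) = \<kappa> (retraction x)"
    by metis
  have cR: "continuous_map (subtopology X punctured) (subtopology X Y) ?R"
  proof -
    have "continuous_map (subtopology X punctured) (prod_topology (subtopology X punctured) (top_of_set {0..1})) (\<lambda>x. (x, 1::real))"
      by (auto simp: continuous_map_pairwise o_def)
    from continuous_map_compose [OF this continuous_map_retraction] show ?thesis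
      using retraction_1 by (auto simp: o_def continuous_map_in_subtopology)
  qed
  have RY: "?R x \<in> Y" if "x \<in> punctured" for x
    using retraction_1 [OF that] .
  define NV where "NV V = {x \<in> punctured. ?R x \<in> V}" for V
  define tN where "tN t x = \<epsilon> x \<otimes> t (?R x)" for t x
  \<comment> \<open>At the centre the unit is admissible because no other chart contains this point
    and the holonomy of the constant ray is trivial.\<close>
  define tc where "tc f x = (if coord x = (\<lambda>_. 0) then \<one> else \<epsilon> x \<otimes> \<gamma> f (?\<rho> x))" for f x
  define \<B> where "\<B> = (\<lambda>(V, t). (NV V, tN t)) ` \<A> \<union> (\<lambda>f. (\<Phi> f ` open_disk n, tc f)) ` F"
  have Nsub: "punctured \<subseteq> topspace X"
    by (auto simp: punctured_def)
  have VY: "V \<subseteq> Y" if "(V, t) \<in> \<A>" for V t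
    using openin_subset [OF atlas_open [OF A that]] by auto
  have NV_open: "openin X (NV V)" if "(V, t) \<in> \<A>" for V t
  proof -
    have "openin (subtopology X punctured) {x \<in> topspace (subtopology X punctured). ?R x \<in> V}"
      using cR atlas_open [OF A that] by (rule openin_continuous_map_preimage)
    then have "openin X {x \<in> topspace (subtopology X punctured). ?R x \<in> V}"
      using openin_punctured openin_trans_full by blast
    moreover have "{x \<in> topspace (subtopology X punctured). ?R x \<in> V} = NV V"
      using Nsub by (auto simp: NV_def)
    ultimately show ?thesis by simp
  qed
  have tN_in: "tN t x \<in> carrier G" if "(V, t) \<in> \<A>" "x \<in> NV V" for V t x
    using that atlas_in [OF A] \<epsilon> by (auto simp: tN_def NV_def)
  have cell: "\<exists>z. z \<in> open_disk n \<and> x = \<Phi> f z \<and> coord x = z" if "f \<in> F" "x \<in> \<Phi> f ` open_disk n" for f x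
    using that cell_of_attach by auto
  have cell_nz: "coord x \<noteq> (\<lambda>_. 0) \<longleftrightarrow> x \<in> punctured" if fx: "f \<in> F" "x \<in> \<Phi> f ` open_disk n" for f x
  proof -
    obtain z where z: "z \<in> open_disk n" "x = \<Phi> f z" "coord x = z"
      using cell [OF fx] by blast
    then show ?thesis
      using attach_punctured [OF fx(1) open_disk_in [OF z(1)]] by simp
  qed
  have \<rho>S: "?\<rho> x \<in> boundary_sphere n" if fx: "f \<in> F" "x \<in> \<Phi> f ` open_disk n" "coord x \<noteq> (\<lambda>_. 0)" for f x
  proof -
    obtain z where z: "z \<in> open_disk n" "x = \<Phi> f z" "coord x = z"
      using cell [OF fx(1,2)] by blast
    then show ?thesis
      using radial_1_in_sphere [OF open_disk_in [OF z(1)]] fx(3) by simp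
  qed
  have tc_in: "tc f x \<in> carrier G" if "f \<in> F" "x \<in> \<Phi> f ` open_disk n" for f x
  proof (cases "coord x = (\<lambda>_. 0)")
    case False
    then show ?thesis
      using m_closed [OF \<epsilon> \<gamma>in [OF that(1) \<rho>S [OF that False]]] cell_nz [OF that] by (simp add: tc_def)
  qed (simp add: tc_def)
  have cell_open: "openin X (\<Phi> f ` open_disk n)" if "f \<in> F" for f
    using openin_cell_image [OF that openin_open_disk] by simp
  \<comment> \<open>With \<epsilon> cancelled, the transition function is the old one pulled back
    along the retraction.\<close>
  have NN: "continuous_map (subtopology X (NV V \<inter> NV V')) T (\<lambda>x. inv (tN t x) \<otimes> tN t' x)"
    if V: "(V, t) \<in> \<A>" and V': "(V', t') \<in> \<A>" for V t V' t'
  proof (rule continuous_map_eq)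
    have "continuous_map (subtopology X (NV V \<inter> NV V')) (subtopology X Y) ?R"
      by (rule continuous_map_from_subtopology_mono [OF cR]) (auto simp: NV_def)
    then have "continuous_map (subtopology X (NV V \<inter> NV V')) (subtopology (subtopology X Y) (V \<inter> V')) ?R"
      by (auto simp: continuous_map_in_subtopology NV_def)
    from continuous_map_compose [OF this atlas_compat [OF A V V']]
    show "continuous_map (subtopology X (NV V \<inter> NV V')) T (\<lambda>x. inv (t (?R x)) \<otimes> t' (?R x))"
      by (simp add: o_def)
    fix x assume "x \<in> topspace (subtopology X (NV V \<inter> NV V'))"
    then have "x \<in> punctured" "?R x \<in> V" "?R x \<in> V'"
      by (auto simp: NV_def)
    then show "inv (t (?R x)) \<otimes> t' (?R x) = inv (tN t x) \<otimes> tN t' x"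
      using \<epsilon> atlas_in [OF A V] atlas_in [OF A V']
      by (simp add: tN_def inv_mult_group m_assoc) (simp flip: m_assoc [of "inv (\<epsilon> x)"])
  qed
  have cN: "continuous_map (subtopology X (\<Phi> f ` open_disk n \<inter> NV V)) T (\<lambda>x. inv (tc f x) \<otimes> tN t x)"
    if f: "f \<in> F" and V: "(V, t) \<in> \<A>" for f V t
  proof (rule continuous_map_eq)
    let ?C = "\<Phi> f ` open_disk n \<inter> NV V"
    let ?W = "{w \<in> topspace ?S. \<Phi> f w \<in> V}"
    have C: "coord x \<in> disk n" "coord x \<noteq> (\<lambda>_. 0)" "?\<rho> x \<in> boundary_sphere n" "?R x = \<Phi> f (?\<rho> x)"
        "\<Phi> f (?\<rho> x) \<in> V" "x \<in> punctured" if x: "x \<in> ?C" for x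
    proof -
      have x': "x \<in> \<Phi> f ` open_disk n" "x \<in> punctured" "?R x \<in> V"
        using x by (auto simp: NV_def)
      show nz: "coord x \<noteq> (\<lambda>_. 0)"
        using cell_nz [OF f x'(1)] x'(2) by simp
      obtain z where z: "z \<in> open_disk n" "x = \<Phi> f z" "coord x = z"
        using cell [OF f x'(1)] by blast
      show "coord x \<in> disk n" using z open_disk_in by simp
      show "?\<rho> x \<in> boundary_sphere n" by (rule \<rho>S [OF f x'(1) nz])
      show R: "?R x = \<Phi> f (?\<rho> x)"
        using retraction_attach [OF f open_disk_in [OF z(1)]] nz z by simp
      show "\<Phi> f (?\<rho> x) \<in> V" "x \<in> punctured" using R x' by simp_all
    qed
    have "continuous_map (subtopology X ?C) (unit_disk n) coord"
      by (rule continuous_map_from_subtopology_mono [OF continuous_map_coord [OF f]]) auto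
    then have "continuous_map (subtopology X ?C) (top_of_set (disk n - {\<lambda>_. 0})) coord"
      using C(1,2) by (auto simp: unit_disk_eq continuous_map_in_subtopology)
    moreover have "continuous_on (disk n - {\<lambda>_. 0}) (\<lambda>z. radial n 1 z)"
      by (rule continuous_on_radial [OF continuous_on_id continuous_on_const]) auto
    then have "continuous_map (top_of_set (disk n - {\<lambda>_. 0})) euclidean (\<lambda>z. radial n 1 z)"
      by simp
    ultimately have "continuous_map (subtopology X ?C) euclidean ((\<lambda>z. radial n 1 z) \<circ> coord)"
      by (rule continuous_map_compose)
    then have "continuous_map (subtopology X ?C) (subtopology ?S ?W) ?\<rho>"
      using C(3,5) boundary_sphere_subset by (auto simp: o_def unit_disk_eq continuous_map_in_subtopology topS)
    from continuous_map_compose [OF this framing_continuous [OF \<gamma> [OF f] V]]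
    show "continuous_map (subtopology X ?C) T (\<lambda>x. inv (\<gamma> f (?\<rho> x)) \<otimes> t (\<Phi> f (?\<rho> x)))"
      by (simp add: o_def)
    fix x assume "x \<in> topspace (subtopology X ?C)"
    then have x: "x \<in> ?C" by auto
    then have "t (\<Phi> f (?\<rho> x)) \<in> carrier G" "\<gamma> f (?\<rho> x) \<in> carrier G" "\<epsilon> x \<in> carrier G"
      using C [OF x] atlas_in [OF A V] \<gamma>in [OF f] \<epsilon> by auto
    then show "inv (\<gamma> f (?\<rho> x)) \<otimes> t (\<Phi> f (?\<rho> x)) = inv (tc f x) \<otimes> tN t x"
      using C(2,4) [OF x]
      by (simp add: tc_def tN_def inv_mult_group m_assoc) (simp flip: m_assoc [of "inv (\<epsilon> x)"])
  qed
  have cc: "continuous_map (subtopology X (\<Phi> f ` open_disk n \<inter> \<Phi> g ` open_disk n)) T (\<lambda>x. inv (tc f x) \<otimes> tc g x)"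
    if f: "f \<in> F" and g: "g \<in> F" for f g
  proof (cases "f = g")
    case True
    show ?thesis
      by (rule continuous_map_eq [OF continuous_map_const_carrier [OF one_closed]]) (use tc_in f True in auto)
  next
    case False
    then have "\<Phi> f ` open_disk n \<inter> \<Phi> g ` open_disk n = {}"
      using attach_inj f g by blast
    then show ?thesis by simp
  qed
  have compat: "continuous_map (subtopology X (U1 \<inter> U2)) T (\<lambda>x. inv (t1 x) \<otimes> t2 x)"
    if b: "(U1, t1) \<in> \<B>" "(U2, t2) \<in> \<B>" for U1 t1 U2 t2
  proof -
    from b(1) consider (N) V t where "(V, t) \<in> \<A>" "U1 = NV V" "t1 = tN t"
      | (c) f where "f \<in> F" "U1 = \<Phi> f ` open_disk n" "t1 = tc f"
      unfolding \<B>_def by auto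
    note 1 = this
    from b(2) consider (N) V t where "(V, t) \<in> \<A>" "U2 = NV V" "t2 = tN t"
      | (c) f where "f \<in> F" "U2 = \<Phi> f ` open_disk n" "t2 = tc f"
      unfolding \<B>_def by auto
    note 2 = this
    show ?thesis
    proof (cases rule: 1)
      case (N V t)
      note N' = this
      show ?thesis
      proof (cases rule: 2)
        case (N V' t')
        then show ?thesis using N' NN by simp
      next
        case (c f)
        have "continuous_map (subtopology X (NV V \<inter> \<Phi> f ` open_disk n)) T (\<lambda>x. inv (tN t x) \<otimes> tc f x)"
          using continuous_map_ratio_sym [OF cN [OF c(1) N'(1)]] tc_in [OF c(1)] tN_in [OF N'(1)]
          by (simp add: Int_commute)
        then show ?thesis using N' c by simp
      qed
    next
      case (c f)
      note c' = this
      show ?thesis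
        by (cases rule: 2) (use c' cN cc in simp_all)
    qed
  qed
  have "atlas X \<B>"
    unfolding atlas_def
  proof (intro conjI ballI, goal_cases)
    case (1 b)
    then show ?case
      unfolding \<B>_def using NV_open tN_in cell_open tc_in by fastforce
  next
    case (2 x)
    show ?case
    proof (cases "x \<in> punctured")
      case True
      then have "?R x \<in> topspace (subtopology X Y)"
        using RY base_subset by auto
      then obtain V t where "(V, t) \<in> \<A>" "?R x \<in> V"
        using atlas_chart [OF A] by metis
      then show ?thesis
        using True unfolding \<B>_def by (intro bexI [of _ "(NV V, tN t)"]) (auto simp: NV_def)
    next
      case False
      then obtain f where "f \<in> F" "x = \<Phi> f (\<lambda>_. 0)"
        using 2 by (auto simp: punctured_def)
      then show ?thesis
        using zero_in_open_disk unfolding \<B>_def by (intro bexI [of _ "(\<Phi> f ` open_disk n, tc f)"]) auto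
    qed
  next
    case (3 b)
    then show ?case
      using compat by blast
  qed
  moreover have "q (tN t (p 0)) = \<kappa> p \<otimes>\<^bsub>A\<^esub> q (tN t (p 1))"
    if V: "(V, t) \<in> \<A>" and p: "pathin X p" and pV: "p ` {0..1} \<subseteq> NV V" for V t p
  proof -
    have pN: "p s \<in> punctured" "?R (p s) \<in> V" if "s \<in> {0..1}" for s
      using subsetD [OF pV imageI [OF that]] by (auto simp: NV_def)
    have cp: "continuous_map (top_of_set {0..1}) (subtopology X punctured) p"
      using p pN by (auto simp: pathin_def continuous_map_in_subtopology)
    have "continuous_map (prod_topology (top_of_set {0..1}) (top_of_set {0..1}))
        (prod_topology (subtopology X punctured) (top_of_set {0..1})) (\<lambda>(s, u). (p s, id u))"
      using cp by (intro continuous_map_prod_top [THEN iffD2] disjI2 conjI) auto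
    from continuous_map_compose [OF this continuous_map_retraction]
    have "continuous_map (top_of_set ({0..1} \<times> {0..1})) X (\<lambda>(s, u). retraction (p s) u)"
      by (simp add: o_def case_prod_unfold prod_topology_subtopology_eu)
    \<comment> \<open>The vertical sides of this square are the tracks of the end points of
      \<open>p\<close>, the top is the image of \<open>p\<close> in \<open>Y\<close>. The factors
      \<open>q (\<epsilon> (p 0))\<close> and \<open>q (\<epsilon> (p 1))\<close> thus convert the
      holonomy in \<open>Y\<close> into \<open>\<kappa> p\<close>.\<close>
    from path_cocycle_square [OF \<kappa> this]
    have sq: "\<kappa> (\<lambda>s. retraction (p s) 0) \<otimes>\<^bsub>A\<^esub> \<kappa> (retraction (p 1)) = \<kappa> (retraction (p 0)) \<otimes>\<^bsub>A\<^esub> \<kappa> (\<lambda>s. ?R (p s))"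
      by simp
    have "\<kappa> p = \<kappa> (\<lambda>s. retraction (p s) 0)"
      using p by (rule path_cocycle_cong [OF \<kappa>]) (simp add: retraction_0 pN)
    moreover have Rp: "pathin (subtopology X Y) (\<lambda>s. ?R (p s))"
      using continuous_map_compose [OF cp cR] by (simp add: pathin_def o_def)
    moreover have "q (t (?R (p 0))) = \<kappa> (\<lambda>s. ?R (p s)) \<otimes>\<^bsub>A\<^esub> q (t (?R (p 1)))"
      using par V Rp pN(2) unfolding parallel_atlas_def by fastforce
    moreover have "\<kappa> p \<in> carrier A" "\<kappa> (\<lambda>s. ?R (p s)) \<in> carrier A" "\<kappa> (retraction (p 0)) \<in> carrier A" "\<kappa> (retraction (p 1)) \<in> carrier A"
      using path_cocycle_in [OF \<kappa>] p ret_path pN(1) Rp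
      by (auto simp: pathin_def continuous_map_in_subtopology)
    moreover have "t (?R (p 0)) \<in> carrier G" "t (?R (p 1)) \<in> carrier G" "\<epsilon> (p 0) \<in> carrier G" "\<epsilon> (p 1) \<in> carrier G"
      using atlas_in [OF A V] pN \<epsilon> by auto
    ultimately show ?thesis
      using sq q\<epsilon> pN(1) by (simp add: tN_def q_mult flip: A.m_assoc)
  qed
  moreover have "q (tc f (p 0)) = \<kappa> p \<otimes>\<^bsub>A\<^esub> q (tc f (p 1))"
    if f: "f \<in> F" and p: "pathin X p" and pf: "p ` {0..1} \<subseteq> \<Phi> f ` open_disk n" for f p
  proof -
    \<comment> \<open>The track from \<open>z\<close> out to the sphere is accounted for by
      \<epsilon>, the ray from there back to the centre by \<gamma>; together they give the holonomy
      of the ray from \<open>z\<close> to the centre.\<close>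
    have qtc: "q (tc f (\<Phi> f z)) = ?a f z" if z: "z \<in> open_disk n" for z
    proof (cases "z = (\<lambda>_. 0)")
      case True
      then show ?thesis
        using path_cocycle_const [OF \<kappa> attach_in [OF f open_disk_in [OF z]]] cell_of_attach [OF f z]
        by (simp add: tc_def)
    next
      case False
      note zd = open_disk_in [OF z]
      have "continuous_on {0..1} (\<lambda>s. radial n s z)"
        using zd False by (intro continuous_on_radial continuous_on_id continuous_on_const) auto
      then have "\<kappa> (\<lambda>s. \<Phi> f (radial n s z)) \<otimes>\<^bsub>A\<^esub> ?a f (radial n 1 z) = ?a f (radial n 0 z)"
        using radial_in_disk [OF zd False] by (intro path_cocycle_disk_cone [OF \<kappa> attach_continuous [OF f]]) auto
      moreover have "retraction (\<Phi> f z) = (\<lambda>s. \<Phi> f (radial n s z))"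
        using retraction_attach [OF f zd False] by auto
      moreover have "\<Phi> f z \<in> punctured"
        using attach_punctured [OF f zd] False by simp
      ultimately show ?thesis
        using False cell_of_attach [OF f z] q\<epsilon> [of "\<Phi> f z"] q\<gamma> [OF f radial_1_in_sphere [OF zd False]]
          \<epsilon> [of "\<Phi> f z"] \<gamma>in [OF f radial_1_in_sphere [OF zd False]]
        by (simp add: tc_def q_mult)
    qed
    have "continuous_map (top_of_set {0..1}) (subtopology X (\<Phi> f ` open_disk n)) p"
      using p pf by (auto simp: pathin_def continuous_map_in_subtopology)
    from continuous_map_compose [OF this continuous_map_coord [OF f]]
    have c: "continuous_on {0..1} (\<lambda>s. coord (p s))" "(\<lambda>s. coord (p s)) ` {0..1} \<subseteq> disk n"
      by (auto simp: unit_disk_eq o_def)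
    have pc: "p s = \<Phi> f (coord (p s))" "coord (p s) \<in> open_disk n" if "s \<in> {0..1}" for s
      using cell [OF f subsetD [OF pf imageI [OF that]]] by auto
    have "\<kappa> p = \<kappa> (\<lambda>s. \<Phi> f (coord (p s)))"
      using p pc by (intro path_cocycle_cong [OF \<kappa>]) auto
    then have "\<kappa> p \<otimes>\<^bsub>A\<^esub> ?a f (coord (p 1)) = ?a f (coord (p 0))"
      using path_cocycle_disk_cone [OF \<kappa> attach_continuous [OF f] c] by simp
    then show ?thesis
      using qtc [OF pc(2), of 0] qtc [OF pc(2), of 1] pc(1) [of 0] pc(1) [of 1] by simp
  qed
  ultimately have "parallel_atlas X \<kappa> \<B>"
    unfolding parallel_atlas_def \<B>_def by auto
  then show ?thesis by blast
qed

end

section \<open>Disks and spheres of dimension at most two\<close>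

definition circle :: "real \<Rightarrow> nat \<Rightarrow> real" where
  "circle \<theta> = (\<lambda>i. if i = 0 then cos (2 * pi * \<theta>) else if i = 1 then sin (2 * pi * \<theta>) else 0)"

lemma radius_2: "radius 2 z = sqrt ((z 0)\<^sup>2 + (z 1)\<^sup>2)"
  by (simp add: radius_def numeral_2_eq_2)

lemma circle_in_sphere: "circle \<theta> \<in> boundary_sphere 2"
  by (auto simp: boundary_sphere_iff_radius radius_2 circle_def)

lemma circle_surj:
  assumes "w \<in> boundary_sphere 2"
  obtains \<theta> where "\<theta> \<in> {0..1}" "w = circle \<theta>"
proof -
  have w: "\<forall>i\<ge>2. w i = 0" "(w 0)\<^sup>2 + (w 1)\<^sup>2 = 1"
    using assms by (auto simp: boundary_sphere_iff_radius radius_2)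
  obtain t where t: "0 \<le> t" "t \<le> 2 * pi" "w 0 = cos t" "w 1 = sin t"
    using sincos_total_2pi_le [OF w(2)] by blast
  have "w = circle (t / (2 * pi))"
  proof
    fix i
    show "w i = circle (t / (2 * pi)) i"
      using t w(1) by (cases "i \<ge> 2") (auto simp: circle_def not_le less_2_cases_iff)
  qed
  moreover have "t / (2 * pi) \<in> {0..1}"
    using t by simp
  ultimately show ?thesis
    using that by blast
qed

lemma circle_eq:
  assumes "\<theta> \<in> {0..1}" "\<theta>' \<in> {0..1}" "circle \<theta> = circle \<theta>'"
  shows "\<theta> = \<theta>' \<or> \<theta> = 0 \<and> \<theta>' = 1 \<or> \<theta> = 1 \<and> \<theta>' = 0"
proof -
  have "cos (2 * pi * \<theta>) = cos (2 * pi * \<theta>')" "sin (2 * pi * \<theta>) = sin (2 * pi * \<theta>')"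
    using fun_cong [OF assms(3), of 0] fun_cong [OF assms(3), of 1] by (auto simp: circle_def)
  then obtain k :: int where "2 * pi * \<theta> = 2 * pi * \<theta>' + 2 * pi * k"
    using sin_cos_eq_iff by blast
  then have "2 * pi * (\<theta> - \<theta>' - k) = 0"
    by (simp add: algebra_simps)
  then have k: "\<theta> = \<theta>' + k" by simp
  then have "real_of_int k \<le> 1" "real_of_int k \<ge> -1"
    using assms(1,2) by auto
  then have "k = -1 \<or> k = 0 \<or> k = 1" by linarith
  then show ?thesis
    using k assms(1,2) by auto
qed

lemma circle_0_1: "circle 1 = circle 0"
  by (auto simp: circle_def)

lemma continuous_on_circle: "continuous_on S circle"
proof (rule continuous_on_coordinatewise_then_product)
  fix i
  show "continuous_on S (\<lambda>\<theta>. circle \<theta> i)"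
    unfolding circle_def by (cases "i = 0"; cases "i = 1") (auto intro!: continuous_intros)
qed

lemma Hausdorff_space_unit_disk: "Hausdorff_space (unit_disk n)"
  by (simp add: unit_disk_eq Hausdorff_space_subtopology)

lemma topspace_sphere: "topspace (subtopology (unit_disk n) (boundary_sphere n)) = boundary_sphere n"
  using boundary_sphere_subset by auto

text \<open>A continuous surjection from a compact space onto a Hausdorff space. Functions on the
  circle can therefore be defined on the interval with matching ends.\<close>

lemma quotient_map_circle:
  "quotient_map (top_of_set {0..1}) (subtopology (unit_disk 2) (boundary_sphere 2)) circle"
proof (rule T1_Spaces.continuous_imp_quotient_map)
  show "continuous_map (top_of_set {0..1}) (subtopology (unit_disk 2) (boundary_sphere 2)) circle"
    using circle_in_sphere boundary_sphere_subset [of 2] continuous_on_circle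
    by (auto simp: unit_disk_eq continuous_map_in_subtopology)
  show "compact_space (top_of_set {0..1::real})"
    by (simp add: compact_space_subtopology)
  show "Hausdorff_space (subtopology (unit_disk 2) (boundary_sphere 2))"
    by (simp add: Hausdorff_space_subtopology Hausdorff_space_unit_disk)
  show "circle ` topspace (top_of_set {0..1}) = topspace (subtopology (unit_disk 2) (boundary_sphere 2))"
    unfolding topspace_sphere topspace_euclidean_subtopology
  proof (intro equalityI subsetI)
    fix w assume "w \<in> boundary_sphere 2"
    then obtain \<theta> where "\<theta> \<in> {0..1}" "w = circle \<theta>" by (rule circle_surj)
    then show "w \<in> circle ` {0..1}" by (rule rev_image_eqI)
  qed (use circle_in_sphere in blast)
qed

lemma radius_circle: "radius 2 (\<lambda>i. r * circle \<theta> i) = \<bar>r\<bar>"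
  using circle_in_sphere [of \<theta>] by (simp add: radius_scale boundary_sphere_iff_radius)

text \<open>The same compactness argument; it reduces a function on the disk to one on the square
  that is constant on the side of radius 0 and agrees on the sides of angle 0 and 1.\<close>

lemma quotient_map_polar:
  "quotient_map (top_of_set ({0..1} \<times> {0..1})) (unit_disk 2) (\<lambda>(r, \<theta>) i. r * circle \<theta> i)"
proof (rule T1_Spaces.continuous_imp_quotient_map)
  have c: "circle \<theta> \<in> disk 2" for \<theta>
    using circle_in_sphere boundary_sphere_subset by blast
  have "continuous_on ({0..1} \<times> {0..1}) (\<lambda>x. circle (snd x))"
    by (rule continuous_on_compose2 [OF continuous_on_circle [of UNIV]]) (auto intro!: continuous_intros)
  then have "continuous_on ({0..1} \<times> {0..1}) (\<lambda>x i. fst x * circle (snd x) i)"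
    by (rule continuous_on_scale) (intro continuous_intros)
  then show "continuous_map (top_of_set ({0..1} \<times> {0..1})) (unit_disk 2) (\<lambda>(r, \<theta>) i. r * circle \<theta> i)"
    using scale_in_disk [OF c] by (auto simp: unit_disk_eq case_prod_unfold)
  show "compact_space (top_of_set ({0..1::real} \<times> {0..1::real}))"
    by (simp add: compact_space_subtopology compact_Times)
  show "Hausdorff_space (unit_disk 2)"
    by (rule Hausdorff_space_unit_disk)
  show "(\<lambda>(r, \<theta>) i. r * circle \<theta> i) ` topspace (top_of_set ({0..1} \<times> {0..1})) = topspace (unit_disk 2)"
  proof (intro equalityI subsetI)
    fix z assume "z \<in> topspace (unit_disk 2)"
    then have z: "z \<in> disk 2" by simp
    show "z \<in> (\<lambda>(r, \<theta>) i. r * circle \<theta> i) ` topspace (top_of_set ({0..1} \<times> {0..1}))"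
    proof (cases "z = (\<lambda>_. 0)")
      case True
      then show ?thesis by (intro image_eqI [of _ _ "(0, 0)"]) auto
    next
      case False
      obtain \<theta> where \<theta>: "\<theta> \<in> {0..1}" "radial 2 1 z = circle \<theta>"
        using circle_surj [OF radial_1_in_sphere [OF z False]] by metis
      have "z i = radius 2 z * circle \<theta> i" for i
        using radius_pos [OF z False] unfolding \<theta>(2) [symmetric] by (simp add: radial_def)
      moreover have "radius 2 z \<in> {0..1}"
        using z radius_nonneg by (auto simp: disk_iff_radius)
      ultimately show ?thesis
        using \<theta>(1) by (intro image_eqI [of _ _ "(radius 2 z, \<theta>)"]) auto
    qed
  qed (use scale_in_disk [OF c] in auto)
qed

context top_group
begin

text \<open>The disk is a retract of the square: \<iota> rescales the coordinates from [-1, 1] to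
  [0, 1], and \<rho> undoes this and then divides by the maximum of 1 and the radius, pushing the
  corners onto the sphere. At most two coordinates fit, hence \<open>n \<le> 2\<close>.\<close>

lemma framing_disk:
  assumes A: "atlas X \<A>" and \<phi>: "continuous_map (unit_disk n) X \<phi>" and n: "n \<le> 2"
  shows "\<exists>s. framing \<A> (unit_disk n) \<phi> s"
proof -
  define v where "v x = (\<lambda>i. if i < n then (if i = 0 then 2 * fst x - 1 else 2 * snd x - 1) else 0)" for x :: "real \<times> real"
  define \<rho> where "\<rho> x = (\<lambda>i. inverse (max 1 (radius n (v x))) * v x i)" for x
  define \<iota> where "\<iota> z = ((z 0 + 1) / 2, (z 1 + 1) / 2)" for z :: "nat \<Rightarrow> real"
  have "continuous_on S v" for S
  proof (rule continuous_on_coordinatewise_then_product)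
    fix i
    show "continuous_on S (\<lambda>x. v x i)"
      unfolding v_def by (cases "i < n"; cases "i = 0") (auto intro!: continuous_intros)
  qed
  then have c: "continuous_on S \<rho>" for S
    unfolding \<rho>_def
    by (intro continuous_on_scale continuous_on_inverse continuous_on_max continuous_on_const continuous_on_radius)
      auto
  have \<rho>_in: "\<rho> x \<in> disk n" for x
  proof -
    have "radius n (\<rho> x) = inverse (max 1 (radius n (v x))) * radius n (v x)"
      unfolding \<rho>_def radius_scale by simp
    also have "\<dots> \<le> 1"
      by (simp add: divide_simps max_def flip: divide_inverse_commute)
    finally show ?thesis
      by (simp add: disk_iff_radius) (simp add: \<rho>_def v_def)
  qed
  have "\<rho> (\<iota> z) = z" if "z \<in> disk n" for z
  proof -
    have "v (\<iota> z) = z"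
    proof
      fix i show "v (\<iota> z) i = z i"
        using that n by (cases "i < n"; cases "i = 0"; cases "i = 1") (auto simp: v_def \<iota>_def disk_def field_simps)
    qed
    moreover have "max 1 (radius n z) = 1"
      using that by (simp add: disk_iff_radius)
    ultimately show ?thesis
      by (simp add: \<rho>_def)
  qed
  moreover have "continuous_on (disk n) \<iota>"
    unfolding \<iota>_def by (intro continuous_intros continuous_on_coordinate [OF continuous_on_id]) auto
  moreover have "\<iota> z \<in> {0..1} \<times> {0..1}" if "z \<in> disk n" for z
    using disk_coordinate_bound [OF that, of 0] disk_coordinate_bound [OF that, of 1] by (auto simp: \<iota>_def)
  ultimately show ?thesis
    using \<rho>_in c by (intro framing_retract_of_square [OF A \<phi>, of \<rho> \<iota>]) (auto simp: unit_disk_eq)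
qed

end

section \<open>Holonomy of framings and isomorphisms over cells\<close>

context group_quotient
begin

text \<open>The requirement of \<open>parallel_atlas\<close>, tested on framings along paths instead
  of charts; in this form it passes between different atlases of one bundle.\<close>

definition holonomy ::
    "'m topology \<Rightarrow> ('m set \<times> ('m \<Rightarrow> 'g)) set \<Rightarrow> ((real \<Rightarrow> 'm) \<Rightarrow> 'a) \<Rightarrow> bool" where
  "holonomy X \<A> \<kappa> \<longleftrightarrow> atlas X \<A> \<and>
     (\<forall>p s. pathin X p \<longrightarrow> framing \<A> (top_of_set {0..1}) p s \<longrightarrow> q (s 0) = \<kappa> p \<otimes>\<^bsub>A\<^esub> q (s 1))"

lemma parallel_atlas_holonomy:
  "path_cocycle X \<kappa> \<Longrightarrow> parallel_atlas X \<kappa> \<A> \<Longrightarrow> holonomy X \<A> \<kappa>"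
proof -
  assume \<kappa>: "path_cocycle X \<kappa>" and par: "parallel_atlas X \<kappa> \<A>"
  have "atlas X \<A>"
    using par by (simp add: parallel_atlas_def)
  then show ?thesis
    unfolding holonomy_def using parallel_framing [OF \<kappa> par] by blast
qed

lemma holonomy_atlas: "holonomy X \<A> \<kappa> \<Longrightarrow> atlas X \<A>"
  by (simp add: holonomy_def)

lemma holonomy_framing:
  assumes "holonomy X \<A> \<kappa>" "continuous_map Z X \<phi>" "framing \<A> Z \<phi> s" "pathin Z g"
  shows "q (s (g 0)) = \<kappa> (\<lambda>u. \<phi> (g u)) \<otimes>\<^bsub>A\<^esub> q (s (g 1))"
proof -
  have g: "continuous_map (top_of_set {0..1}) Z g"
    using assms(4) by (simp add: pathin_def)
  have "pathin X (\<lambda>u. \<phi> (g u))"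
    using continuous_map_compose [OF g assms(2)] by (simp add: pathin_def o_def)
  moreover have "framing \<A> (top_of_set {0..1}) (\<lambda>u. \<phi> (g u)) (\<lambda>u. s (g u))"
    by (rule framing_compose [OF assms(3) g])
  ultimately show ?thesis
    using assms(1) unfolding holonomy_def by blast
qed

lemma pathin_disk_ray:
  assumes "z \<in> disk n"
  shows "pathin (unit_disk n) (\<lambda>u i. (1 - u) * z i)"
proof -
  have "continuous_on {0..1} (\<lambda>u i. (1 - u) * z i)"
    by (intro continuous_on_scale continuous_on_const continuous_intros)
  then show ?thesis
    using scale_in_disk [OF assms] by (auto simp: pathin_def unit_disk_eq)
qed

text \<open>A constant right factor makes the second framing agree with the first at the centre.
  Along each ray to the centre both have the same holonomy, so their images under \<open>q\<close>
  agree everywhere.\<close>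

lemma framings_disk_match:
  assumes A: "holonomy X \<A> \<kappa>" and B: "holonomy X \<B> \<kappa>" and \<phi>: "continuous_map (unit_disk n) X \<phi>" and n: "n \<le> 2"
    and \<kappa>: "\<And>p. pathin X p \<Longrightarrow> \<kappa> p \<in> carrier A"
  shows "\<exists>\<gamma> \<delta>. framing \<A> (unit_disk n) \<phi> \<gamma> \<and> framing \<B> (unit_disk n) \<phi> \<delta> \<and> (\<forall>z\<in>disk n. q (\<gamma> z) = q (\<delta> z))"
proof -
  note A' = holonomy_atlas [OF A] and B' = holonomy_atlas [OF B]
  obtain \<gamma> \<delta>0 where \<gamma>: "framing \<A> (unit_disk n) \<phi> \<gamma>" and \<delta>0: "framing \<B> (unit_disk n) \<phi> \<delta>0"
    using framing_disk [OF A' \<phi> n] framing_disk [OF B' \<phi> n] by blast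
  let ?o = "\<lambda>_::nat. 0::real"
  have o: "?o \<in> disk n"
    using zero_in_open_disk open_disk_in by blast
  have in0: "\<gamma> ?o \<in> carrier G" "\<delta>0 ?o \<in> carrier G"
    using framing_in [OF \<gamma>] framing_in [OF \<delta>0] o by auto
  define g where "g = inv (\<delta>0 ?o) \<otimes> \<gamma> ?o"
  have g: "g \<in> carrier G" "\<delta>0 ?o \<otimes> g = \<gamma> ?o"
    using in0 by (simp_all add: g_def flip: m_assoc)
  define \<delta> where "\<delta> z = \<delta>0 z \<otimes> g" for z
  have \<delta>: "framing \<B> (unit_disk n) \<phi> \<delta>"
    unfolding \<delta>_def by (intro framing_mult [OF B' \<phi> \<delta>0] continuous_map_const_carrier g)
  have "q (\<gamma> z) = q (\<delta> z)" if z: "z \<in> disk n" for z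
    using holonomy_framing [OF A \<phi> \<gamma> pathin_disk_ray [OF z]] holonomy_framing [OF B \<phi> \<delta> pathin_disk_ray [OF z]] g
    by (simp add: \<delta>_def)
  then show ?thesis
    using \<gamma> \<delta> by blast
qed

text \<open>An isomorphism of bundles acts on the identified fibres by left multiplication with
  \<open>h x\<close>, and \<open>inv t' \<otimes> h \<otimes> t\<close> is its matrix in a pair of
  charts. Values in the kernel of \<open>q\<close> mean that it respects the parallel structures
  exactly, not just up to a coboundary.\<close>

definition frame_iso ::
    "('m set \<times> ('m \<Rightarrow> 'g)) set \<Rightarrow> ('m set \<times> ('m \<Rightarrow> 'g)) set \<Rightarrow> 'm topology \<Rightarrow> ('m \<Rightarrow> 'g) \<Rightarrow> bool" where
  "frame_iso \<A> \<B> X h \<longleftrightarrow>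
     (\<forall>x\<in>topspace X. h x \<in> carrier G \<and> q (h x) = \<one>\<^bsub>A\<^esub>) \<and>
     (\<forall>(U, t)\<in>\<A>. \<forall>(V, t')\<in>\<B>. continuous_map (subtopology X (U \<inter> V)) T (\<lambda>x. inv (t' x) \<otimes> h x \<otimes> t x))"

text \<open>In frames over a cell the isomorphism on the boundary becomes a map from the sphere to
  the kernel of \<open>q\<close>, and extending this map over the disk extends the isomorphism. The
  homotopy of the kernel enters through \<open>ext\<close> alone.\<close>

lemma frame_iso_attach:
  fixes M :: "'m topology"
  assumes A: "atlas M \<A>" and B: "atlas M \<B>" and att: "cell_attachment (subtopology M S) Y n F \<Phi>"
    and ext: "\<And>k. continuous_map (subtopology (unit_disk n) (boundary_sphere n)) T k \<Longrightarrow>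
      (\<And>w. w \<in> boundary_sphere n \<Longrightarrow> q (k w) = \<one>\<^bsub>A\<^esub>) \<Longrightarrow>
      \<exists>K. continuous_map (unit_disk n) T K \<and> (\<forall>w\<in>boundary_sphere n. K w = k w) \<and> (\<forall>z\<in>disk n. q (K z) = \<one>\<^bsub>A\<^esub>)"
    and frames: "\<And>f. f \<in> F \<Longrightarrow> \<exists>\<gamma> \<delta>. framing \<A> (unit_disk n) (\<Phi> f) \<gamma> \<and> framing \<B> (unit_disk n) (\<Phi> f) \<delta> \<and>
      (\<forall>z\<in>disk n. q (\<gamma> z) = q (\<delta> z))"
    and h: "frame_iso \<A> \<B> (subtopology M Y) h"
  shows "\<exists>h'. frame_iso \<A> \<B> (subtopology M S) h'"
proof -
  interpret cell_attachment "subtopology M S" Y n F \<Phi> by (rule att)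
  let ?S = "subtopology (unit_disk n) (boundary_sphere n)"
  obtain \<gamma> \<delta> where \<gamma>: "\<And>f. f \<in> F \<Longrightarrow> framing \<A> (unit_disk n) (\<Phi> f) (\<gamma> f)"
    and \<delta>: "\<And>f. f \<in> F \<Longrightarrow> framing \<B> (unit_disk n) (\<Phi> f) (\<delta> f)"
    and q\<gamma>\<delta>: "\<And>f z. f \<in> F \<Longrightarrow> z \<in> disk n \<Longrightarrow> q (\<gamma> f z) = q (\<delta> f z)"
    using frames by metis
  have YS: "Y \<subseteq> topspace M" "Y \<subseteq> S" using base_subset by auto
  have c\<Phi>: "continuous_map (unit_disk n) M (\<Phi> f)" if "f \<in> F" for f
    using attach_continuous [OF that] by (simp add: continuous_map_in_subtopology)
  have \<gamma>in: "\<gamma> f z \<in> carrier G" and \<delta>in: "\<delta> f z \<in> carrier G" if "f \<in> F" "z \<in> disk n" for f z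
    using framing_in [OF \<gamma>] framing_in [OF \<delta>] that by auto
  have hin: "h x \<in> carrier G" "q (h x) = \<one>\<^bsub>A\<^esub>" if "x \<in> Y" for x
    using h that YS unfolding frame_iso_def by auto
  have hc: "continuous_map (subtopology (subtopology M Y) (U \<inter> V)) T (\<lambda>x. inv (t' x) \<otimes> h x \<otimes> t x)"
    if "(U, t) \<in> \<A>" "(V, t') \<in> \<B>" for U t V t'
    using h that unfolding frame_iso_def by blast
  \<comment> \<open>The given isomorphism read in the frames \<gamma> and \<delta>; it takes values
    in the kernel because the frames have equal images under \<open>q\<close>.\<close>
  define k where "k f w = inv (\<delta> f w) \<otimes> h (\<Phi> f w) \<otimes> \<gamma> f w" for f w
  have "\<exists>K. continuous_map (unit_disk n) T K \<and> (\<forall>w\<in>boundary_sphere n. K w = k f w) \<and> (\<forall>z\<in>disk n. q (K z) = \<one>\<^bsub>A\<^esub>)"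
    if f: "f \<in> F" for f
  proof (rule ext)
    have kin: "\<Phi> f w \<in> Y" "w \<in> disk n" "\<gamma> f w \<in> carrier G" "\<delta> f w \<in> carrier G" "h (\<Phi> f w) \<in> carrier G"
      if "w \<in> boundary_sphere n" for w
      using attach_boundary [OF f that] hin \<gamma>in [OF f, of w] \<delta>in [OF f, of w] that boundary_sphere_subset by auto
    show "q (k f w) = \<one>\<^bsub>A\<^esub>" if "w \<in> boundary_sphere n" for w
      using kin [OF that] hin q\<gamma>\<delta> [OF f, of w] by (simp add: k_def q_mult q_inv)
    show "continuous_map ?S T (k f)"
    proof (rule continuous_map_locally)
      fix w assume "w \<in> topspace ?S"
      then have w: "w \<in> boundary_sphere n" by simp
      have "\<Phi> f w \<in> topspace M"
        using kin [OF w] YS by blast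
      then obtain U t V t' where U: "(U, t) \<in> \<A>" "\<Phi> f w \<in> U" and V: "(V, t') \<in> \<B>" "\<Phi> f w \<in> V"
        using atlas_chart [OF A] atlas_chart [OF B] by metis
      define W where "W = {w \<in> topspace ?S. \<Phi> f w \<in> U \<inter> V}"
      have cS: "continuous_map ?S M (\<Phi> f)"
        by (rule continuous_map_from_subtopology [OF c\<Phi> [OF f]])
      have W: "openin ?S W" "w \<in> W"
        unfolding W_def using openin_continuous_map_preimage [OF cS openin_Int [OF atlas_open [OF A U(1)] atlas_open [OF B V(1)]]]
          U(2) V(2) w boundary_sphere_subset by auto
      have WS: "W \<subseteq> boundary_sphere n" by (auto simp: W_def)
      have c1: "continuous_map (subtopology ?S W) T (\<lambda>w. inv (\<delta> f w) \<otimes> t' (\<Phi> f w))"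
        using framing_continuous [OF \<delta> [OF f] V(1)] unfolding subtopology_subtopology
        by (rule continuous_map_from_subtopology_mono) (auto simp: W_def)
      have c2: "continuous_map (subtopology ?S W) T (\<lambda>w. inv (\<gamma> f w) \<otimes> t (\<Phi> f w))"
        using framing_continuous [OF \<gamma> [OF f] U(1)] unfolding subtopology_subtopology
        by (rule continuous_map_from_subtopology_mono) (auto simp: W_def)
      have "continuous_map (subtopology ?S W) (subtopology (subtopology M Y) (U \<inter> V)) (\<Phi> f)"
        using continuous_map_from_subtopology [OF cS] kin(1) WS by (auto simp: continuous_map_in_subtopology W_def)
      from continuous_map_compose [OF this hc [OF U(1) V(1)]]
      have c3: "continuous_map (subtopology ?S W) T (\<lambda>w. inv (t' (\<Phi> f w)) \<otimes> h (\<Phi> f w) \<otimes> t (\<Phi> f w))"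
        by (simp add: o_def)
      have "continuous_map (subtopology ?S W) T (\<lambda>w. (inv (\<delta> f w) \<otimes> t' (\<Phi> f w)) \<otimes>
          (inv (t' (\<Phi> f w)) \<otimes> h (\<Phi> f w) \<otimes> t (\<Phi> f w)) \<otimes> inv (inv (\<gamma> f w) \<otimes> t (\<Phi> f w)))"
        by (rule continuous_map_mult [OF continuous_map_mult [OF c1 c3] continuous_map_inverse [OF c2]])
      moreover have "(inv (\<delta> f w) \<otimes> t' (\<Phi> f w)) \<otimes>
          (inv (t' (\<Phi> f w)) \<otimes> h (\<Phi> f w) \<otimes> t (\<Phi> f w)) \<otimes> inv (inv (\<gamma> f w) \<otimes> t (\<Phi> f w)) = k f w"
        if "w \<in> topspace (subtopology ?S W)" for w
      proof -
        have "w \<in> W" using that by auto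
        then have "\<Phi> f w \<in> U" "\<Phi> f w \<in> V" "w \<in> boundary_sphere n" by (auto simp: W_def)
        then have i: "t (\<Phi> f w) \<in> carrier G" "t' (\<Phi> f w) \<in> carrier G" "h (\<Phi> f w) \<in> carrier G" "\<gamma> f w \<in> carrier G" "\<delta> f w \<in> carrier G"
          using atlas_in [OF A U(1)] atlas_in [OF B V(1)] kin by auto
        then show ?thesis
          by (simp add: k_def inv_inv_mult m_assoc inv_solve_left' r_cancel_one)
            (simp add: m_assoc [symmetric])
      qed
      ultimately have "continuous_map (subtopology ?S W) T (k f)"
        by (rule continuous_map_eq)
      then show "\<exists>W. openin ?S W \<and> w \<in> W \<and> continuous_map (subtopology ?S W) T (k f)"
        using W by blast
    qed
  qed
  then obtain K where cK: "\<And>f. f \<in> F \<Longrightarrow> continuous_map (unit_disk n) T (K f)"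
    and Kk: "\<And>f w. f \<in> F \<Longrightarrow> w \<in> boundary_sphere n \<Longrightarrow> K f w = k f w"
    and qK: "\<And>f z. f \<in> F \<Longrightarrow> z \<in> disk n \<Longrightarrow> q (K f z) = \<one>\<^bsub>A\<^esub>"
    by metis
  have Kin: "K f z \<in> carrier G" if "f \<in> F" "z \<in> disk n" for f z
    using continuous_map_in_carrier [OF cK [OF that(1)]] that by simp
  \<comment> \<open>On the open cells the extended map \<open>K\<close> is translated back from the
    frames; \<open>h'\<Phi>\<close> shows that the same formula is valid up to the boundary.\<close>
  define h' where "h' x = (if x \<in> Y then h x else
      \<delta> (cell_of x) (coord x) \<otimes> K (cell_of x) (coord x) \<otimes> inv (\<gamma> (cell_of x) (coord x)))" for x
  have h'\<Phi>: "h' (\<Phi> f z) = \<delta> f z \<otimes> K f z \<otimes> inv (\<gamma> f z)" if f: "f \<in> F" and z: "z \<in> disk n" for f z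
  proof (cases "z \<in> open_disk n")
    case True
    then show ?thesis
      using attach_disjoint [OF f True] cell_of_attach [OF f True] by (simp add: h'_def)
  next
    case False
    then have S: "z \<in> boundary_sphere n" using z by (auto simp: disk_split)
    then have i: "h (\<Phi> f z) \<in> carrier G" "\<gamma> f z \<in> carrier G" "\<delta> f z \<in> carrier G"
      using attach_boundary [OF f S] hin \<gamma>in [OF f z] \<delta>in [OF f z] by auto
    have "\<delta> f z \<otimes> K f z \<otimes> inv (\<gamma> f z) = \<delta> f z \<otimes> (inv (\<delta> f z) \<otimes> h (\<Phi> f z) \<otimes> \<gamma> f z) \<otimes> inv (\<gamma> f z)"
      using Kk [OF f S] by (simp add: k_def)
    also have "\<dots> = h (\<Phi> f z)"
      using i by (simp add: m_assoc) (simp add: m_assoc [symmetric])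
    finally show ?thesis
      using attach_boundary [OF f S] by (simp add: h'_def)
  qed
  have "h' x \<in> carrier G \<and> q (h' x) = \<one>\<^bsub>A\<^esub>" if x: "x \<in> topspace (subtopology M S)" for x
  proof (cases "x \<in> Y")
    case True
    then show ?thesis using hin by (simp add: h'_def)
  next
    case False
    then obtain f z where fz: "f \<in> F" "z \<in> open_disk n" "x = \<Phi> f z"
      using attach_cover [OF x] by blast
    note z = open_disk_in [OF fz(2)]
    show ?thesis
      using h'\<Phi> [OF fz(1) z] \<gamma>in [OF fz(1) z] \<delta>in [OF fz(1) z] Kin [OF fz(1) z] qK [OF fz(1) z] q\<gamma>\<delta> [OF fz(1) z] fz(3)
      by (simp add: q_mult q_inv)
  qed
  moreover have "continuous_map (subtopology (subtopology M S) (U \<inter> V)) T (\<lambda>x. inv (t' x) \<otimes> h' x \<otimes> t x)"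
    if U: "(U, t) \<in> \<A>" and V: "(V, t') \<in> \<B>" for U t V t'
  proof -
    let ?W = "S \<inter> (U \<inter> V)"
    have UV: "openin M (U \<inter> V)"
      using atlas_open [OF A U] atlas_open [OF B V] by blast
    have "continuous_map (subtopology (subtopology M S) ?W) T (\<lambda>x. inv (t' x) \<otimes> h' x \<otimes> t x)"
    \<comment> \<open>Continuity is tested on \<open>Y\<close> and on each closed disk, where the
      chart expression is a product of ratios of framings to charts with \<open>K\<close> in the
      middle.\<close>
    proof (rule continuous_map_attach)
      show "openin (subtopology M S) ?W"
        using UV by (rule openin_subtopology_Int2)
      have "continuous_map (subtopology (subtopology M S) (?W \<inter> Y)) T (\<lambda>x. inv (t' x) \<otimes> h x \<otimes> t x)"
      proof -
        have "S \<inter> (?W \<inter> Y) = Y \<inter> (U \<inter> V)" using YS by blast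
        then show ?thesis
          using hc [OF U V] by (simp add: subtopology_subtopology)
      qed
      then show "continuous_map (subtopology (subtopology M S) (?W \<inter> Y)) T (\<lambda>x. inv (t' x) \<otimes> h' x \<otimes> t x)"
        by (rule continuous_map_eq) (simp add: h'_def)
      fix f assume f: "f \<in> F"
      let ?D = "{z \<in> disk n. \<Phi> f z \<in> ?W}"
      have c1: "continuous_map (subtopology (unit_disk n) ?D) T (\<lambda>z. inv (\<delta> f z) \<otimes> t' (\<Phi> f z))"
        by (rule continuous_map_from_subtopology_mono [OF framing_continuous [OF \<delta> [OF f] V]]) auto
      have c2: "continuous_map (subtopology (unit_disk n) ?D) T (\<lambda>z. inv (\<gamma> f z) \<otimes> t (\<Phi> f z))"
        by (rule continuous_map_from_subtopology_mono [OF framing_continuous [OF \<gamma> [OF f] U]]) auto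
      have c3: "continuous_map (subtopology (unit_disk n) ?D) T (K f)"
        by (rule continuous_map_from_subtopology [OF cK [OF f]])
      have "continuous_map (subtopology (unit_disk n) ?D) T (\<lambda>z. inv (inv (\<delta> f z) \<otimes> t' (\<Phi> f z)) \<otimes> K f z \<otimes> (inv (\<gamma> f z) \<otimes> t (\<Phi> f z)))"
        by (rule continuous_map_mult [OF continuous_map_mult [OF continuous_map_inverse [OF c1] c3] c2])
      then show "continuous_map (subtopology (unit_disk n) ?D) T (\<lambda>z. inv (t' (\<Phi> f z)) \<otimes> h' (\<Phi> f z) \<otimes> t (\<Phi> f z))"
      proof (rule continuous_map_eq)
        fix z assume "z \<in> topspace (subtopology (unit_disk n) ?D)"
        then have z: "z \<in> disk n" "\<Phi> f z \<in> U" "\<Phi> f z \<in> V" by auto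
        then have i: "t (\<Phi> f z) \<in> carrier G" "t' (\<Phi> f z) \<in> carrier G" "K f z \<in> carrier G" "\<gamma> f z \<in> carrier G" "\<delta> f z \<in> carrier G"
          using atlas_in [OF A U] atlas_in [OF B V] Kin [OF f] \<gamma>in [OF f] \<delta>in [OF f] by auto
        then show "inv (inv (\<delta> f z) \<otimes> t' (\<Phi> f z)) \<otimes> K f z \<otimes> (inv (\<gamma> f z) \<otimes> t (\<Phi> f z)) =
            inv (t' (\<Phi> f z)) \<otimes> h' (\<Phi> f z) \<otimes> t (\<Phi> f z)"
          by (simp add: h'\<Phi> [OF f z(1)] inv_inv_mult m_assoc)
      qed
    qed
    moreover have "subtopology (subtopology M S) ?W = subtopology (subtopology M S) (U \<inter> V)"
      by (simp add: subtopology_subtopology Int_absorb)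
    ultimately show ?thesis by simp
  qed
  ultimately have "frame_iso \<A> \<B> (subtopology M S) h'"
    unfolding frame_iso_def by blast
  then show ?thesis by blast
qed

end

lemma boundary_sphere_0: "boundary_sphere 0 = {}"
  by (auto simp: boundary_sphere_iff_radius radius_def)

lemma boundary_sphere_1:
  "boundary_sphere 1 = {\<lambda>i. if i = 0 then -1 else 0, \<lambda>i. if i = 0 then 1 else 0}"
proof -
  have "w \<in> {\<lambda>i. if i = 0 then -1 else 0, \<lambda>i. if i = 0 then 1 else 0}" if w: "w \<in> boundary_sphere 1" for w
  proof -
    have w0: "w i = 0" if "i \<noteq> 0" for i
      using w that by (simp add: boundary_sphere_iff_radius)
    have "\<bar>w 0\<bar> = 1"
      using w by (simp add: boundary_sphere_iff_radius radius_def)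
    then have "w 0 = -1 \<or> w 0 = 1" by linarith
    then have "w = (\<lambda>i. if i = 0 then -1 else 0) \<or> w = (\<lambda>i. if i = 0 then 1 else 0)"
      using w0 by (auto simp: fun_eq_iff)
    then show ?thesis by blast
  qed
  moreover have "(\<lambda>i. if i = 0 then c else 0) \<in> boundary_sphere 1" if "\<bar>c\<bar> = 1" for c
    using that by (simp add: boundary_sphere_iff_radius radius_def)
  ultimately show ?thesis
    by (intro equalityI subsetI) auto
qed

section \<open>Extension problems over spheres and disks\<close>

context group_quotient
begin

text \<open>A path in the kernel is moved into the coset by left translation with \<open>g\<close>;
  by connectedness \<open>q\<close> remains constant along it.\<close>

lemma kernel_path:
  assumes "g \<in> carrier G" "h \<in> carrier G" "q g = q h"
  shows "\<exists>c::real \<Rightarrow> 'g. continuous_map (top_of_set {0..1}) T c \<and> c 0 = g \<and> c 1 = h \<and> (\<forall>t\<in>{0..1}. q (c t) = q g)"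
proof -
  have "q (inv g \<otimes> h) = \<one>\<^bsub>A\<^esub>"
    using assms by (simp add: q_mult q_inv)
  then obtain p where p: "pathin T p" "p 0 = \<one>" "p 1 = inv g \<otimes> h"
    using kernel_path_connected [of "inv g \<otimes> h"] assms by auto
  have cp: "continuous_map (top_of_set {0..1}) T p"
    using p(1) by (simp add: pathin_def)
  then have c: "continuous_map (top_of_set {0..1}) T (\<lambda>t. g \<otimes> p t)"
    using assms by (intro continuous_map_mult continuous_map_const_carrier) auto
  have "q (g \<otimes> p t) = q (g \<otimes> p 0)" if "t \<in> {0..1}" for t
    using q_constant [OF c connected_space_top_of_set [of "{0..1}"], of t 0] that by simp
  moreover have "g \<otimes> p 1 = h"
    using assms p by (simp flip: m_assoc)
  ultimately show ?thesis
    using c p(2) assms by (intro exI [of _ "\<lambda>t. g \<otimes> p t"]) simp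
qed

text \<open>The obstruction is the homotopy class of a map from the (n-1)-sphere to the kernel:
  nothing for n = 0, a pair of points to be joined for n = 1, and a loop to be contracted for n =
  2.\<close>

lemma extension_to_disk:
  assumes n: "n \<le> 2" and k: "continuous_map (subtopology (unit_disk n) (boundary_sphere n)) T k"
    and qk: "\<And>w. w \<in> boundary_sphere n \<Longrightarrow> q (k w) = \<one>\<^bsub>A\<^esub>"
  shows "\<exists>K. continuous_map (unit_disk n) T K \<and> (\<forall>w\<in>boundary_sphere n. K w = k w) \<and> (\<forall>z\<in>disk n. q (K z) = \<one>\<^bsub>A\<^esub>)"
proof -
  have kin: "k w \<in> carrier G" if "w \<in> boundary_sphere n" for w
    using continuous_map_in_carrier [OF k, of w] that by (simp only: topspace_sphere)
  consider "n = 0" | "n = 1" | "n = 2" using n by linarith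
  then show ?thesis
  proof cases
    case 1
    then show ?thesis
      using continuous_map_const_carrier [OF one_closed]
      by (intro exI [of _ "\<lambda>_. \<one>"]) (simp add: boundary_sphere_0)
  next
    case 2
    define a b :: "nat \<Rightarrow> real" where "a = (\<lambda>i. if i = 0 then -1 else 0)" and "b = (\<lambda>i. if i = 0 then 1 else 0)"
    have S: "boundary_sphere n = {a, b}"
      using boundary_sphere_1 2 by (simp add: a_def b_def)
    then have ab: "k a \<in> carrier G" "k b \<in> carrier G" "q (k a) = \<one>\<^bsub>A\<^esub>" "q (k b) = \<one>\<^bsub>A\<^esub>"
      using kin qk by auto
    obtain c :: "real \<Rightarrow> 'g" where c: "continuous_map (top_of_set {0..1}) T c" "c 0 = k a" "c 1 = k b"
      "\<And>t. t \<in> {0..1} \<Longrightarrow> q (c t) = q (k a)"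
      using kernel_path [of "k a" "k b"] ab by auto
    have "continuous_on (disk n) (\<lambda>z. (z 0 + 1) / 2)"
      by (intro continuous_intros continuous_on_coordinate [OF continuous_on_id]) auto
    moreover have d: "(z 0 + 1) / 2 \<in> {0..1}" if "z \<in> disk n" for z
      using disk_coordinate_bound [OF that, of 0] by auto
    ultimately have "continuous_map (unit_disk n) (top_of_set {0..1}) (\<lambda>z. (z 0 + 1) / 2)"
      by (auto simp: unit_disk_eq)
    from continuous_map_compose [OF this c(1)] show ?thesis
      using c d S ab by (intro exI [of _ "\<lambda>z. c ((z 0 + 1) / 2)"]) (auto simp: o_def a_def b_def)
  next
    case 3
    define g where "g = k (circle 0)"
    have g: "g \<in> carrier G" "q g = \<one>\<^bsub>A\<^esub>"
      using kin qk circle_in_sphere 3 by (auto simp: g_def)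
    \<comment> \<open>Translated to start at the unit, since contractions are available only for
      loops there.\<close>
    define p where "p \<theta> = inv g \<otimes> k (circle \<theta>)" for \<theta>
    have "continuous_map (top_of_set {0..1}) T (\<lambda>\<theta>. k (circle \<theta>))"
      using continuous_map_compose [OF quotient_imp_continuous_map [OF quotient_map_circle]] k 3 by (simp add: o_def)
    then have "pathin T p"
      unfolding pathin_def p_def using g by (intro continuous_map_mult continuous_map_const_carrier) auto
    moreover have "p 0 = \<one>" "p 1 = \<one>"
      using g by (simp_all add: p_def circle_0_1 flip: g_def)
    ultimately obtain H :: "real \<times> real \<Rightarrow> 'g" where H: "continuous_map (top_of_set ({0..1} \<times> {0..1})) T H"
      and Hp: "\<And>x. x \<in> {0..1} \<Longrightarrow> H (0, x) = p x" "\<And>x. x \<in> {0..1} \<Longrightarrow> H (1, x) = \<one>"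
        "\<And>x. x \<in> {0..1} \<Longrightarrow> H (x, 0) = \<one>" "\<And>x. x \<in> {0..1} \<Longrightarrow> H (x, 1) = \<one>"
      using loops_contractible [of p] by auto
    let ?polar = "\<lambda>(r, \<theta>) i. r * circle \<theta> i"
    \<comment> \<open>Time is reversed: the loop, at time 0 of the contraction, belongs at radius 1,
      and the constant end belongs at the centre.\<close>
    define H' where "H' = (\<lambda>(r, \<theta>). g \<otimes> H (1 - r, \<theta>))"
    have "continuous_map (top_of_set ({0..1} \<times> {0..1})) (top_of_set ({0..1::real} \<times> {0..1::real})) (\<lambda>(r, \<theta>). (1 - r, \<theta>))"
      by (auto intro!: continuous_intros simp: case_prod_unfold)
    from continuous_map_compose [OF this H]
    have "continuous_map (top_of_set ({0..1} \<times> {0..1})) T (\<lambda>x. H (1 - fst x, snd x))"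
      by (simp add: o_def case_prod_unfold)
    then have cH': "continuous_map (top_of_set ({0..1} \<times> {0..1})) T H'"
      unfolding H'_def case_prod_unfold using g by (intro continuous_map_mult continuous_map_const_carrier)
    \<comment> \<open>Polar coordinates are ambiguous only at radius 0 and between the angles 0 and
      1; the contraction is constant on these three sides.\<close>
    have well_defined: "H' x = H' y" if "x \<in> {0..1} \<times> {0..1}" "y \<in> {0..1} \<times> {0..1}" "?polar x = ?polar y" for x y
    proof -
      obtain r \<theta> r' \<theta>' where xy: "x = (r, \<theta>)" "y = (r', \<theta>')" by fastforce
      then have r: "r \<in> {0..1}" "r' \<in> {0..1}" "\<theta> \<in> {0..1}" "\<theta>' \<in> {0..1}" using that by auto
      have eq: "(\<lambda>i. r * circle \<theta> i) = (\<lambda>i. r' * circle \<theta>' i)" using that xy by simp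
      then have "radius 2 (\<lambda>i. r * circle \<theta> i) = radius 2 (\<lambda>i. r' * circle \<theta>' i)" by simp
      then have rr: "r = r'" using r by (simp add: radius_circle)
      show ?thesis
      proof (cases "r = 0")
        case True
        then show ?thesis using rr r Hp by (simp add: H'_def xy)
      next
        case False
        then have "circle \<theta> = circle \<theta>'"
          using eq rr by (auto simp: fun_eq_iff)
        then show ?thesis
          using circle_eq [OF r(3,4)] rr r Hp by (auto simp: H'_def xy)
      qed
    qed
    define K where "K z = H' (SOME x. x \<in> {0..1} \<times> {0..1} \<and> ?polar x = z)" for z
    have K: "K (?polar x) = H' x" if "x \<in> {0..1} \<times> {0..1}" for x
    proof -
      have "\<exists>y. y \<in> {0..1} \<times> {0..1} \<and> ?polar y = ?polar x" using that by blast
      note some = someI_ex [OF this]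
      show ?thesis
        unfolding K_def by (rule well_defined) (use some that in auto)
    qed
    have "continuous_map (top_of_set ({0..1} \<times> {0..1})) T (K \<circ> ?polar)"
      by (rule continuous_map_eq [OF cH']) (simp add: K del: split_paired_All)
    then have cK: "continuous_map (unit_disk n) T K"
      using continuous_compose_quotient_map [OF quotient_map_polar] 3 by blast
    have K1: "K w = k w" if w: "w \<in> boundary_sphere n" for w
    proof -
      obtain \<theta> where \<theta>: "\<theta> \<in> {0..1}" "w = circle \<theta>"
        using circle_surj w 3 by blast
      have "K w = H' (1, \<theta>)"
        using K [of "(1, \<theta>)"] \<theta> by simp
      also have "\<dots> = g \<otimes> (inv g \<otimes> k (circle \<theta>))"
        using Hp \<theta> by (simp add: H'_def p_def)
      also have "\<dots> = k w"
        using g \<theta> kin [OF w] by (simp flip: m_assoc)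
      finally show ?thesis .
    qed
    have "q (K z) = \<one>\<^bsub>A\<^esub>" if z: "z \<in> disk n" for z
    proof -
      have "disk 2 = ?polar ` ({0..1} \<times> {0..1})"
        using quotient_imp_surjective_map [OF quotient_map_polar] by simp
      then obtain x where x: "x \<in> {0..1} \<times> {0..1}" "z = ?polar x"
        using z 3 by blast
      \<comment> \<open>The square is connected, so one value decides: the starting point of the
        loop lies in the kernel.\<close>
      have "q (H' x) = q (H' (1, 0))"
        using q_constant [OF cH' connected_space_top_of_set, of x "(1, 0)"] x by (simp add: connected_Times)
      then show ?thesis
        using K [OF x(1)] x(2) g Hp by (simp add: H'_def p_def circle_0_1 flip: g_def)
    qed
    then show ?thesis
      using cK K1 by blast
  qed
qed

text \<open>The prescribed value at \<open>w\<close> is the holonomy of the ray from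
  \<open>w\<close> to the centre, as it would be for a frame over the whole disk with trivial image
  at the centre. On two points any lift is continuous. On the circle, a frame along the loop is
  normalized at its start and its seam is closed by a path in the kernel.\<close>

lemma sphere_framing:
  fixes X :: "'m topology"
  assumes n: "n \<le> 2" and \<kappa>: "path_cocycle X \<kappa>" and par: "parallel_atlas (subtopology X Y) \<kappa> \<A>"
    and \<phi>: "continuous_map (unit_disk n) X \<phi>" and bd: "\<phi> ` boundary_sphere n \<subseteq> Y"
  shows "\<exists>\<gamma>. framing \<A> (subtopology (unit_disk n) (boundary_sphere n)) \<phi> \<gamma> \<and>
      (\<forall>w\<in>boundary_sphere n. q (\<gamma> w) = \<kappa> (\<lambda>u. \<phi> (\<lambda>i. (1 - u) * w i)))"
proof -
  let ?S = "subtopology (unit_disk n) (boundary_sphere n)"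
  define a where "a w = \<kappa> (\<lambda>u. \<phi> (\<lambda>i. (1 - u) * w i))" for w
  have A: "atlas (subtopology X Y) \<A>"
    using par by (simp add: parallel_atlas_def)
  have ray: "pathin X (\<lambda>u. \<phi> (\<lambda>i. (1 - u) * w i))" if "w \<in> disk n" for w
    using pathin_disk_ray [OF that] continuous_map_compose [OF _ \<phi>] by (auto simp: pathin_def o_def)
  have ain: "a w \<in> carrier A" if "w \<in> boundary_sphere n" for w
    unfolding a_def using that boundary_sphere_subset by (intro path_cocycle_in [OF \<kappa>] ray) blast
  have \<phi>S: "continuous_map ?S (subtopology X Y) \<phi>"
    using bd by (auto simp: continuous_map_in_subtopology intro: continuous_map_from_subtopology [OF \<phi>])
  consider "n = 0" | "n = 1" | "n = 2" using n by linarith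
  then have "\<exists>\<gamma>. framing \<A> ?S \<phi> \<gamma> \<and> (\<forall>w\<in>boundary_sphere n. q (\<gamma> w) = a w)"
  proof cases
    case 1
    then show ?thesis
      by (intro exI) (auto simp: framing_def boundary_sphere_0)
  next
    case 2
    have "\<exists>g. g \<in> carrier G \<and> q g = a w" if "w \<in> boundary_sphere n" for w
      using q_lift [OF ain [OF that]] by metis
    then obtain \<gamma> where \<gamma>: "\<And>w. w \<in> boundary_sphere n \<Longrightarrow> \<gamma> w \<in> carrier G \<and> q (\<gamma> w) = a w"
      by metis
    have "framing \<A> ?S \<phi> \<gamma>"
    proof (rule framing_locally [OF A \<phi>S])
      show "\<gamma> ` topspace ?S \<subseteq> carrier G"
        unfolding topspace_sphere using \<gamma> by blast
      fix w assume "w \<in> topspace ?S"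
      then have w: "w \<in> boundary_sphere n" by simp
      have "\<phi> w \<in> topspace (subtopology X Y)"
        using continuous_map_image_subset_topspace [OF \<phi>S] w unfolding topspace_sphere by blast
      then obtain U t where U: "(U, t) \<in> \<A>" "\<phi> w \<in> U"
        using atlas_chart [OF A] by metis
      \<comment> \<open>The two points of the 0-sphere are separated by the sign of their first
        coordinate.\<close>
      have "openin ?S {w}"
      proof -
        have "continuous_on (disk n) (\<lambda>v. v 0 * w 0)"
          by (intro continuous_intros continuous_on_coordinate [OF continuous_on_id])
        then have "openin (unit_disk n) (disk n \<inter> (\<lambda>v. v 0 * w 0) -` {0<..})"
          unfolding unit_disk_eq by (rule continuous_openin_preimage_gen) simp
        then have "openin ?S (boundary_sphere n \<inter> (disk n \<inter> (\<lambda>v. v 0 * w 0) -` {0<..}))"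
          by (rule openin_subtopology_Int2)
        moreover have "boundary_sphere n \<inter> (disk n \<inter> (\<lambda>v. v 0 * w 0) -` {0<..}) = {w}"
        proof -
          have "v = w" if "v \<in> boundary_sphere 1" "v 0 * w 0 > 0" for v
            using that w unfolding 2 boundary_sphere_1 by auto
          moreover have "w 0 * w 0 > 0"
            using w unfolding 2 boundary_sphere_1 by auto
          ultimately show ?thesis
            using w boundary_sphere_subset 2 by auto
        qed
        ultimately show ?thesis by simp
      qed
      moreover have "continuous_map (subtopology ?S {w}) T (\<lambda>z. inv (\<gamma> z) \<otimes> t (\<phi> z))"
        using \<gamma> [OF w] atlas_in [OF A U]
        by (intro continuous_map_eq [OF continuous_map_const_carrier [of "inv (\<gamma> w) \<otimes> t (\<phi> w)"]]) auto
      ultimately show "\<exists>W U t. openin ?S W \<and> w \<in> W \<and> (U, t) \<in> \<A> \<and> \<phi> ` W \<subseteq> U \<and>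
          continuous_map (subtopology ?S W) T (\<lambda>z. inv (\<gamma> z) \<otimes> t (\<phi> z))"
        using U by (intro exI [of _ "{w}"] exI [of _ U] exI [of _ t]) auto
    qed
    then show ?thesis using \<gamma> by blast
  next
    case 3
    have circ: "continuous_map (top_of_set {0..1}) ?S circle"
      using quotient_imp_continuous_map [OF quotient_map_circle] 3 by simp
    have cS: "circle \<theta> \<in> boundary_sphere n" for \<theta>
      using circle_in_sphere 3 by simp
    let ?p = "\<lambda>\<theta>. \<phi> (circle \<theta>)"
    have p: "continuous_map (top_of_set {0..1}) (subtopology X Y) ?p"
      using continuous_map_compose [OF circ \<phi>S] by (simp add: o_def)
    then obtain s where s: "framing \<A> (top_of_set {0..1}) ?p s"
      using framing_path [OF A] by (auto simp: pathin_def)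
    have sin: "s \<theta> \<in> carrier G" if "\<theta> \<in> {0..1}" for \<theta>
      using framing_in [OF s] that by simp
    \<comment> \<open>The holonomy of the arc from angle 0 to \<theta> is computed twice, from the
      frame \<open>s\<close> and by coning the arc off in the disk.\<close>
    have rel: "q (s 0) \<otimes>\<^bsub>A\<^esub> a (circle \<theta>) = q (s \<theta>) \<otimes>\<^bsub>A\<^esub> a (circle 0)" if \<theta>: "\<theta> \<in> {0..1}" for \<theta>
    proof -
      have sub: "\<theta> * u \<in> {0..1}" if "u \<in> {0..1}" for u
        using \<theta> that by (auto intro: mult_le_one)
      then have path: "pathin (top_of_set {0..1}) (\<lambda>u. \<theta> * u)"
        by (auto simp: pathin_def intro!: continuous_intros)
      have Yp: "pathin (subtopology X Y) (\<lambda>u. ?p (\<theta> * u))"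
        using continuous_map_compose [OF path [unfolded pathin_def] p] by (simp add: pathin_def o_def)
      have 1: "q (s 0) = \<kappa> (\<lambda>u. ?p (\<theta> * u)) \<otimes>\<^bsub>A\<^esub> q (s \<theta>)"
        using holonomy_framing [OF parallel_atlas_holonomy [OF path_cocycle_subtopology [OF \<kappa>] par] p s path] by simp
      have "continuous_on {0..1} (\<lambda>u. circle (\<theta> * u))"
        by (rule continuous_on_compose2 [OF continuous_on_circle [of UNIV]]) (auto intro!: continuous_intros)
      then have 2: "\<kappa> (\<lambda>u. ?p (\<theta> * u)) \<otimes>\<^bsub>A\<^esub> a (circle \<theta>) = a (circle 0)"
        using path_cocycle_disk_cone [OF \<kappa> \<phi>, of "\<lambda>u. circle (\<theta> * u)"] cS boundary_sphere_subset [of n]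
        by (auto simp: a_def)
      have "\<kappa> (\<lambda>u. ?p (\<theta> * u)) \<in> carrier A"
        using Yp path_cocycle_in [OF path_cocycle_subtopology [OF \<kappa>]] by blast
      then show ?thesis
        using 1 2 ain [OF cS] sin [OF \<theta>] by (metis A.m_assoc A.m_comm q_in)
    qed
    \<comment> \<open>A constant correction that gives the required value at angle 0; by
      \<open>rel\<close> it then gives the required value at every angle.\<close>
    obtain g where g: "g \<in> carrier G" "q g = inv\<^bsub>A\<^esub> (q (s 0)) \<otimes>\<^bsub>A\<^esub> a (circle 0)"
      using q_lift [of "inv\<^bsub>A\<^esub> (q (s 0)) \<otimes>\<^bsub>A\<^esub> a (circle 0)"] ain [OF cS] sin [of 0] by auto
    have qsg: "q (s \<theta> \<otimes> g) = a (circle \<theta>)" if "\<theta> \<in> {0..1}" for \<theta>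
    proof -
      have "q (s \<theta> \<otimes> g) = inv\<^bsub>A\<^esub> (q (s 0)) \<otimes>\<^bsub>A\<^esub> (q (s \<theta>) \<otimes>\<^bsub>A\<^esub> a (circle 0))"
        using g sin [OF that] sin [of 0] ain [OF cS] by (simp add: q_mult A.m_ac)
      also have "\<dots> = a (circle \<theta>)"
        using rel [OF that] sin [of 0] ain [OF cS] by (simp flip: A.m_assoc) (simp flip: rel [OF that] A.m_assoc)
      finally show ?thesis .
    qed
    have "q (inv (s 1 \<otimes> g) \<otimes> (s 0 \<otimes> g)) = inv\<^bsub>A\<^esub> (q (s 1 \<otimes> g)) \<otimes>\<^bsub>A\<^esub> q (s 0 \<otimes> g)"
      using g(1) sin [of 0] sin [of 1] by (simp only: q_mult q_inv m_closed inv_closed atLeastAtMost_iff) simp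
    also have "\<dots> = \<one>\<^bsub>A\<^esub>"
      using qsg [of 0] qsg [of 1] ain [OF cS] by (simp add: circle_0_1)
    finally obtain c :: "real \<Rightarrow> 'g" where c: "continuous_map (top_of_set {0..1}) T c" "c 0 = \<one>" "c 1 = inv (s 1 \<otimes> g) \<otimes> (s 0 \<otimes> g)"
      and qc: "\<forall>\<theta>\<in>{0..1}. q (c \<theta>) = \<one>\<^bsub>A\<^esub>"
      using kernel_path [of \<one> "inv (s 1 \<otimes> g) \<otimes> (s 0 \<otimes> g)"] g(1) sin [of 0] sin [of 1] by auto
    \<comment> \<open>The path \<open>c\<close> runs in the kernel from the unit to the mismatch at
      the seam, so \<open>s'\<close> closes up and its image under \<open>q\<close> stays as it
      was.\<close>
    define s' where "s' \<theta> = s \<theta> \<otimes> g \<otimes> c \<theta>" for \<theta>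
    have s': "framing \<A> (top_of_set {0..1}) ?p s'"
      unfolding s'_def
      by (rule framing_mult [OF A p framing_mult [OF A p s continuous_map_const_carrier [OF g(1)]] c(1)])
    have cin: "c \<theta> \<in> carrier G" if "\<theta> \<in> {0..1}" for \<theta>
      using continuous_map_in_carrier [OF c(1)] that by simp
    have qs': "q (s' \<theta>) = a (circle \<theta>)" if "\<theta> \<in> {0..1}" for \<theta>
    proof -
      have "q (s' \<theta>) = q (s \<theta> \<otimes> g) \<otimes>\<^bsub>A\<^esub> q (c \<theta>)"
        unfolding s'_def using sin [OF that] g cin [OF that] by (intro q_mult) auto
      then show ?thesis
        using qsg [OF that] bspec [OF qc that] ain [OF cS] by simp
    qed
    have s'01: "s' 0 = s' 1"
      using c sin [of 0] sin [of 1] g by (simp add: s'_def) (simp flip: m_assoc)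
    define \<gamma> where "\<gamma> w = s' (SOME \<theta>. \<theta> \<in> {0..1} \<and> circle \<theta> = w)" for w
    have \<gamma>: "\<gamma> (circle \<theta>) = s' \<theta>" if "\<theta> \<in> {0..1}" for \<theta>
    proof -
      have "\<exists>\<theta>'. \<theta>' \<in> {0..1} \<and> circle \<theta>' = circle \<theta>" using that by blast
      from someI_ex [OF this] show ?thesis
        unfolding \<gamma>_def using circle_eq [OF _ that] s'01 by fastforce
    qed
    have circ_cover: "\<exists>\<theta>\<in>{0..1}. w = circle \<theta>" if "w \<in> boundary_sphere n" for w
      using circle_surj that 3 by metis
    have "framing \<A> ?S \<phi> \<gamma>"
      unfolding framing_def
    proof (intro conjI ballI, goal_cases)
      case 1
      then show ?case
        unfolding topspace_sphere using circ_cover \<gamma> framing_in [OF s'] by fastforce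
    next
      case (2 x)
      obtain U t where x: "x = (U, t)" by fastforce
      let ?W = "{w \<in> topspace ?S. \<phi> w \<in> U}"
      let ?V = "{\<theta> \<in> topspace (top_of_set {0..1}). ?p \<theta> \<in> U}"
      have U: "(U, t) \<in> \<A>" using 2 x by simp
      have "openin ?S ?W"
        using \<phi>S atlas_open [OF A U] by (rule openin_continuous_map_preimage)
      moreover have "{\<theta> \<in> topspace (top_of_set {0..1}). circle \<theta> \<in> ?W} = ?V"
        unfolding topspace_sphere using cS by auto
      \<comment> \<open>A quotient map restricts to a quotient map over an open set, so continuity
        over the circle can be tested on the interval.\<close>
      ultimately have qm: "quotient_map (subtopology (top_of_set {0..1}) ?V) (subtopology ?S ?W) circle"
        using quotient_map_restriction quotient_map_circle 3 by blast
      have "continuous_map (subtopology (top_of_set {0..1}) ?V) T ((\<lambda>w. inv (\<gamma> w) \<otimes> t (\<phi> w)) \<circ> circle)"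
        by (rule continuous_map_eq [OF framing_continuous [OF s' U]]) (simp add: \<gamma>)
      then have "continuous_map (subtopology ?S ?W) T (\<lambda>w. inv (\<gamma> w) \<otimes> t (\<phi> w))"
        by (rule continuous_compose_quotient_map [OF qm])
      then show ?case by (simp only: x prod.case)
    qed
    moreover have "q (\<gamma> w) = a w" if "w \<in> boundary_sphere n" for w
      using circ_cover [OF that] \<gamma> qs' by auto
    ultimately show ?thesis by blast
  qed
  then show ?thesis by (simp add: a_def)
qed

section \<open>Bundles over two-dimensional complexes\<close>

lemma CW_cells_obtain:
  assumes "CW_complex_of_dim M d"
  obtains E \<Phi> where "CW_cells M E \<Phi>" "CW_cells.skeleton E (Suc d) = topspace M"
proof -
  obtain E where E: "CW_structure M E" "\<And>n. n > d \<Longrightarrow> E n = {}"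
    using assms by (auto simp: CW_complex_of_dim_def)
  have "\<forall>n. \<forall>e\<in>E n. \<exists>\<phi>. characteristic_map M E n e \<phi>"
    using E(1) [unfolded CW_structure_def] by (elim conjE)
  then obtain \<Phi> where "\<And>n e. e \<in> E n \<Longrightarrow> characteristic_map M E n e (\<Phi> n e)"
    by metis
  with E(1) have C: "CW_cells M E \<Phi>"
    by unfold_locales
  interpret CW_cells M E \<Phi> by (rule C)
  have "skeleton (Suc d) = (\<Union>n. \<Union>(E n))"
  proof (intro equalityI subsetI)
    fix x assume "x \<in> (\<Union>n. \<Union>(E n))"
    then obtain n e where "e \<in> E n" "x \<in> e" by blast
    moreover from this have "n < Suc d" using E(2) [of n] by (cases "n > d") auto
    ultimately show "x \<in> skeleton (Suc d)" unfolding skeleton_def by blast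
  qed (auto simp: skeleton_def)
  then show ?thesis
    using that [OF C] cells_cover by simp
qed

text \<open>Induction over skeleta, from the empty atlas on the empty one. As
  \<open>skeleton 3\<close> contains all cells of dimension at most two, only spheres of dimension
  at most one have to be framed.\<close>

theorem exists_parallel_atlas:
  assumes M: "CW_complex_of_dim M 2" and \<kappa>: "path_cocycle M \<kappa>"
  shows "\<exists>\<A>. parallel_atlas M \<kappa> \<A>"
proof -
  obtain E \<Phi> where C: "CW_cells M E \<Phi>" "CW_cells.skeleton E (Suc 2) = topspace M"
    by (rule CW_cells_obtain [OF M])
  interpret CW_cells M E \<Phi> by (rule C)
  have "\<exists>\<A>. parallel_atlas (subtopology M (skeleton k)) \<kappa> \<A>" if "k \<le> 3" for k
    using that
  proof (induction k)
    case 0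
    have "parallel_atlas (subtopology M (skeleton 0)) \<kappa> {}"
      by (auto simp: parallel_atlas_def atlas_def skeleton_def)
    then show ?case by blast
  next
    case (Suc n)
    let ?X = "subtopology M (skeleton (Suc n))"
    interpret cell_attachment ?X "skeleton n" n "E n" "\<Phi> n"
      by (rule skeleton_attachment)
    obtain \<A> where "parallel_atlas (subtopology M (skeleton n)) \<kappa> \<A>"
      using Suc by auto
    then have par: "parallel_atlas (subtopology ?X (skeleton n)) \<kappa> \<A>"
      using skeleton_mono [of n "Suc n"] by (simp add: subtopology_subtopology Int_absorb1)
    show ?case
    proof (rule parallel_atlas_attach [OF skeleton_attachment path_cocycle_subtopology [OF \<kappa>] par])
      fix f assume f: "f \<in> E n"
      show "\<exists>\<gamma>. framing \<A> (subtopology (unit_disk n) (boundary_sphere n)) (\<Phi> n f) \<gamma> \<and>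
          (\<forall>w\<in>boundary_sphere n. q (\<gamma> w) = \<kappa> (\<lambda>u. \<Phi> n f (\<lambda>i. (1 - u) * w i)))"
        using Suc.prems attach_boundary [OF f]
        by (intro sphere_framing [OF _ path_cocycle_subtopology [OF \<kappa>] par attach_continuous [OF f]]) auto
    qed
  qed
  from this [of 3] show ?thesis
    using C(2) by (simp add: numeral_3_eq_3 numeral_2_eq_2 subtopology_topspace)
qed

text \<open>The induction over skeleta for isomorphisms: equal \<kappa> supplies matching frames
  over each cell, and \<open>extension_to_disk\<close> fills in.\<close>

theorem exists_frame_iso:
  assumes M: "CW_complex_of_dim M 2" and A: "holonomy M \<A> \<kappa>" and B: "holonomy M \<B> \<kappa>"
    and \<kappa>: "\<And>p. pathin M p \<Longrightarrow> \<kappa> p \<in> carrier A"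
  shows "\<exists>h. frame_iso \<A> \<B> M h"
proof -
  obtain E \<Phi> where C: "CW_cells M E \<Phi>" "CW_cells.skeleton E (Suc 2) = topspace M"
    by (rule CW_cells_obtain [OF M])
  interpret CW_cells M E \<Phi> by (rule C)
  have "\<exists>h. frame_iso \<A> \<B> (subtopology M (skeleton k)) h" if "k \<le> 3" for k
    using that
  proof (induction k)
    case 0
    have "frame_iso \<A> \<B> (subtopology M (skeleton 0)) (\<lambda>_. \<one>)"
      by (auto simp: frame_iso_def skeleton_def)
    then show ?case by blast
  next
    case (Suc n)
    then obtain h where h: "frame_iso \<A> \<B> (subtopology M (skeleton n)) h" by auto
    show ?case
      using Suc.prems
      by (intro frame_iso_attach [OF holonomy_atlas [OF A] holonomy_atlas [OF B] skeleton_attachment _ _ h]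
          extension_to_disk framings_disk_match [OF A B cell_continuous _ \<kappa>]) auto
  qed
  from this [of 3] show ?thesis
    using C(2) by (simp add: numeral_3_eq_3 numeral_2_eq_2 subtopology_topspace)
qed

end

section \<open>Atlases and principal bundles\<close>

context top_group
begin

lemma principal_act:
  assumes "principal_bundle G T M P" "y \<in> topspace (total_space P)" "g \<in> carrier G"
  shows "act P y g \<in> topspace (total_space P)" "act P y \<one> = y" "proj P (act P y g) = proj P y"
    "h \<in> carrier G \<Longrightarrow> act P (act P y g) h = act P y (g \<otimes> h)"
  using assms(2,3) principal_bundle_proj_act [OF TG assms]
    conjunct1 [OF assms(1) [unfolded principal_bundle_def]] by (auto simp: right_action_def)

text \<open>The trivialization is repackaged as the group coordinate \<open>c\<close> of its
  inverse, continuous, equivariant and injective on fibres, together with the section through the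
  unit.\<close>

lemma local_trivialization_coordinates:
  assumes P: "principal_bundle G T M P" and x: "x \<in> topspace M"
  obtains U c where "openin M U" "x \<in> U"
    "continuous_map (subtopology (total_space P) {y \<in> topspace (total_space P). proj P y \<in> U}) T c"
    "\<And>y g. y \<in> topspace (total_space P) \<Longrightarrow> proj P y \<in> U \<Longrightarrow> g \<in> carrier G \<Longrightarrow> c (act P y g) = c y \<otimes> g"
    "\<And>y y'. y \<in> topspace (total_space P) \<Longrightarrow> y' \<in> topspace (total_space P) \<Longrightarrow>
       proj P y = proj P y' \<Longrightarrow> proj P y \<in> U \<Longrightarrow> c y = c y' \<Longrightarrow> y = y'"
    "\<exists>s. continuous_map (subtopology M U) (total_space P) s \<and> (\<forall>b\<in>U. proj P (s b) = b)"
proof -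
  obtain U \<phi> where U: "openin M U" "x \<in> U" and lt: "local_trivialization G T M P U \<phi>"
    using principal_bundle_trivialization [OF P x] .
  note UM = openin_subset [OF U(1)]
  have ra: "right_action G (topspace (total_space P)) (act P)"
    using P by (simp add: principal_bundle_def)
  let ?E = "subtopology (total_space P) {y \<in> topspace (total_space P). proj P y \<in> U}"
  let ?B = "prod_topology (subtopology M U) T"
  have hm: "homeomorphic_map ?B ?E \<phi>"
    using lt unfolding local_trivialization_def by blast
  then obtain \<psi> where \<psi>: "homeomorphic_maps ?B ?E \<phi> \<psi>"
    by (auto simp: homeomorphic_map_maps)
  have c\<psi>: "continuous_map ?E ?B \<psi>" and c\<phi>: "continuous_map ?B ?E \<phi>"
    and \<psi>\<phi>: "\<And>b g. b \<in> U \<Longrightarrow> g \<in> carrier G \<Longrightarrow> \<psi> (\<phi> (b, g)) = (b, g)"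
    using \<psi> UM by (auto simp: homeomorphic_maps_def topspace_T)
  have repr: "\<exists>g\<in>carrier G. y = \<phi> (proj P y, g)" if "y \<in> topspace (total_space P)" "proj P y \<in> U" for y
    using local_trivialization_obtain [OF topspace_T UM lt that] by metis
  show ?thesis
  proof (rule that [OF U, of "snd \<circ> \<psi>"])
    show "continuous_map ?E T (snd \<circ> \<psi>)"
      using continuous_map_compose [OF c\<psi> continuous_map_snd] .
    show "(snd \<circ> \<psi>) (act P y g) = (snd \<circ> \<psi>) y \<otimes> g"
      if y: "y \<in> topspace (total_space P)" "proj P y \<in> U" and g: "g \<in> carrier G" for y g
    proof -
      obtain h where h: "h \<in> carrier G" "y = \<phi> (proj P y, h)" using repr [OF y] by blast
      have "act P (\<phi> (proj P y, h)) g = \<phi> (proj P y, h \<otimes> g)"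
        by (rule local_trivialization_act [OF is_group ra topspace_T UM lt y(2) h(1) g])
      then have "act P y g = \<phi> (proj P y, h \<otimes> g)"
        using h(2) by simp
      moreover have "\<psi> y = (proj P y, h)"
        using \<psi>\<phi> [OF y(2) h(1)] h(2) by simp
      ultimately show ?thesis
        using \<psi>\<phi> [OF y(2) m_closed [OF h(1) g]] by simp
    qed
    show "y = y'" if y: "y \<in> topspace (total_space P)" "y' \<in> topspace (total_space P)"
       "proj P y = proj P y'" "proj P y \<in> U" "(snd \<circ> \<psi>) y = (snd \<circ> \<psi>) y'" for y y'
    proof -
      obtain h where h: "h \<in> carrier G" "y = \<phi> (proj P y, h)" using repr y by metis
      obtain h' where h': "h' \<in> carrier G" "y' = \<phi> (proj P y, h')" using repr y by metis
      have "\<psi> y = (proj P y, h)" "\<psi> y' = (proj P y, h')"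
        using \<psi>\<phi> [OF y(4) h(1)] \<psi>\<phi> [OF y(4) h'(1)] h(2) h'(2) by simp_all
      then show ?thesis using y(5) h(2) h'(2) by simp
    qed
    show "\<exists>s. continuous_map (subtopology M U) (total_space P) s \<and> (\<forall>b\<in>U. proj P (s b) = b)"
    proof (intro exI conjI ballI)
      have "continuous_map (subtopology M U) ?B (\<lambda>b. (b, \<one>))"
        by (simp add: continuous_map_pairwise o_def topspace_T)
      from continuous_map_compose [OF this c\<phi>]
      show "continuous_map (subtopology M U) (total_space P) (\<lambda>b. \<phi> (b, \<one>))"
        by (simp add: o_def continuous_map_in_subtopology)
      show "proj P (\<phi> (b, \<one>)) = b" if "b \<in> U" for b
        using lt that unfolding local_trivialization_def by blast
    qed
  qed
qed

lemma local_coordinate_in: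
  "continuous_map (subtopology (total_space P) {y \<in> topspace (total_space P). proj P y \<in> U}) T c \<Longrightarrow>
    y \<in> topspace (total_space P) \<Longrightarrow> proj P y \<in> U \<Longrightarrow> c y \<in> carrier G"
  by (erule continuous_map_in_carrier) auto

lemma local_section_exists:
  assumes P: "principal_bundle G T M P" and x: "x \<in> topspace M"
  shows "\<exists>U s. openin M U \<and> x \<in> U \<and> continuous_map (subtopology M U) (total_space P) s \<and> (\<forall>b\<in>U. proj P (s b) = b)"
  by (rule local_trivialization_coordinates [OF P x]) blast

lemma fibre_transitive:
  assumes P: "principal_bundle G T M P"
    and y: "y \<in> topspace (total_space P)" "y' \<in> topspace (total_space P)" "proj P y = proj P y'"
  shows "\<exists>!g. g \<in> carrier G \<and> act P y g = y'"
proof -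
  obtain U c where U: "openin M U" "proj P y \<in> U"
    and cc: "continuous_map (subtopology (total_space P) {y \<in> topspace (total_space P). proj P y \<in> U}) T c"
    and ca: "\<And>y g. y \<in> topspace (total_space P) \<Longrightarrow> proj P y \<in> U \<Longrightarrow> g \<in> carrier G \<Longrightarrow> c (act P y g) = c y \<otimes> g"
    and ci: "\<And>y y'. y \<in> topspace (total_space P) \<Longrightarrow> y' \<in> topspace (total_space P) \<Longrightarrow>
       proj P y = proj P y' \<Longrightarrow> proj P y \<in> U \<Longrightarrow> c y = c y' \<Longrightarrow> y = y'"
    by (rule local_trivialization_coordinates [OF P principal_bundle_proj_in [OF P y(1)]], rule that; assumption)
  have cin: "c y \<in> carrier G" "c y' \<in> carrier G"
    using local_coordinate_in [OF cc] y U by simp_all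
  show ?thesis
  proof (rule ex1I [of _ "inv (c y) \<otimes> c y'"])
    have "c (act P y (inv (c y) \<otimes> c y')) = c y'"
      using ca [OF y(1) U(2), of "inv (c y) \<otimes> c y'"] cin by (simp flip: m_assoc)
    then show "inv (c y) \<otimes> c y' \<in> carrier G \<and> act P y (inv (c y) \<otimes> c y') = y'"
      using cin principal_act [OF P y(1)] y U by (auto intro!: ci)
    fix g assume g: "g \<in> carrier G \<and> act P y g = y'"
    then have "c y' = c y \<otimes> g"
      using ca [OF y(1) U(2), of g] by auto
    then show "g = inv (c y) \<otimes> c y'"
      using cin g by (simp flip: m_assoc)
  qed
qed

text \<open>The translation function of a principal bundle, with \<open>y' = act P y g\<close>; it
  is meaningful for two points of one fibre only.\<close>

definition translation :: "('e, 'g, 'm) gbundle \<Rightarrow> 'e \<Rightarrow> 'e \<Rightarrow> 'g" where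
  "translation P y y' = (THE g. g \<in> carrier G \<and> act P y g = y')"

lemma translation:
  assumes "principal_bundle G T M P" "y \<in> topspace (total_space P)" "y' \<in> topspace (total_space P)" "proj P y = proj P y'"
  shows "translation P y y' \<in> carrier G" "act P y (translation P y y') = y'"
  using theI' [OF fibre_transitive [OF assms]] by (simp_all add: translation_def)

lemma translation_act:
  assumes P: "principal_bundle G T M P" and y: "y \<in> topspace (total_space P)" and g: "g \<in> carrier G"
  shows "translation P y (act P y g) = g"
  unfolding translation_def
  using fibre_transitive [OF P y principal_act(1) [OF P y g]] principal_act(3) [OF P y g] g by (intro the1_equality) auto

text \<open>In a local coordinate \<open>c\<close> the translation from the section to
  \<open>y\<close> is \<open>inv (c (\<sigma> (proj P y))) \<otimes> c y\<close>.\<close>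

lemma continuous_map_translation:
  assumes P: "principal_bundle G T M P" and \<sigma>: "continuous_map (subtopology M S) (total_space P) \<sigma>"
    and S: "openin M S" and ps: "\<And>x. x \<in> S \<Longrightarrow> proj P (\<sigma> x) = x"
  shows "continuous_map (subtopology (total_space P) {y \<in> topspace (total_space P). proj P y \<in> S}) T
    (\<lambda>y. translation P (\<sigma> (proj P y)) y)"
proof -
  let ?E = "total_space P"
  let ?ES = "\<lambda>S. {y \<in> topspace ?E. proj P y \<in> S}"
  have cp: "continuous_map ?E M (proj P)"
    using P by (simp add: principal_bundle_def)
  have \<sigma>in: "\<sigma> x \<in> topspace ?E" if "x \<in> S" for x
    using continuous_map_image_subset_topspace [OF \<sigma>] that openin_subset [OF S] by auto
  show ?thesis
  proof (rule continuous_map_locally)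
    fix y assume "y \<in> topspace (subtopology ?E (?ES S))"
    then have y: "y \<in> topspace ?E" "proj P y \<in> S" by auto
    obtain U c where U: "openin M U" "proj P y \<in> U"
      and cc: "continuous_map (subtopology (total_space P) {y \<in> topspace (total_space P). proj P y \<in> U}) T c"
      and ca: "\<And>y g. y \<in> topspace (total_space P) \<Longrightarrow> proj P y \<in> U \<Longrightarrow> g \<in> carrier G \<Longrightarrow> c (act P y g) = c y \<otimes> g"
      by (rule local_trivialization_coordinates [OF P principal_bundle_proj_in [OF P y(1)]], rule that; assumption)
    let ?W = "?ES (S \<inter> U)"
    have W: "openin ?E ?W"
      using openin_continuous_map_preimage [OF cp openin_Int [OF S U(1)]] .
    have c1: "continuous_map (subtopology ?E ?W) T c"
      by (rule continuous_map_from_subtopology_mono [OF cc]) auto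
    have "continuous_map (subtopology ?E ?W) (subtopology M S) (proj P)"
      by (auto simp: continuous_map_in_subtopology intro: continuous_map_from_subtopology [OF cp])
    from continuous_map_compose [OF this \<sigma>]
    have "continuous_map (subtopology ?E ?W) (subtopology ?E (?ES U)) (\<lambda>y. \<sigma> (proj P y))"
      using ps \<sigma>in by (auto simp: continuous_map_in_subtopology o_def)
    from continuous_map_compose [OF this cc]
    have c2: "continuous_map (subtopology ?E ?W) T (\<lambda>y. c (\<sigma> (proj P y)))"
      by (simp add: o_def)
    have "continuous_map (subtopology ?E ?W) T (\<lambda>y. inv (c (\<sigma> (proj P y))) \<otimes> c y)"
      by (rule continuous_map_mult [OF continuous_map_inverse [OF c2] c1])
    moreover have "inv (c (\<sigma> (proj P y))) \<otimes> c y = translation P (\<sigma> (proj P y)) y"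
      if "y \<in> topspace (subtopology ?E ?W)" for y
    proof -
      have y: "y \<in> topspace ?E" "proj P y \<in> S" "proj P y \<in> U" using that by auto
      let ?s = "\<sigma> (proj P y)"
      have s: "?s \<in> topspace ?E" "proj P ?s = proj P y" using \<sigma>in y ps by auto
      note t = translation [OF P s(1) y(1) s(2)]
      have "c y = c ?s \<otimes> translation P ?s y"
        using ca [of ?s "translation P ?s y"] s y t by simp
      moreover have "c ?s \<in> carrier G"
        using local_coordinate_in [OF cc s(1)] s y by simp
      ultimately show ?thesis
        using t by (simp flip: m_assoc)
    qed
    ultimately have "continuous_map (subtopology ?E ?W) T (\<lambda>y. translation P (\<sigma> (proj P y)) y)"
      by (rule continuous_map_eq)
    moreover have "subtopology (subtopology ?E (?ES S)) ?W = subtopology ?E ?W"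
      by (simp add: subtopology_subtopology Collect_conj_eq Int_ac)
    moreover have "openin (subtopology ?E (?ES S)) ?W"
      using W by (auto intro: openin_subset_topspace_eq simp: openin_subtopology)
    ultimately show "\<exists>W. openin (subtopology ?E (?ES S)) W \<and> y \<in> W \<and>
        continuous_map (subtopology (subtopology ?E (?ES S)) W) T (\<lambda>y. translation P (\<sigma> (proj P y)) y)"
      using y U(2) by (intro exI [of _ ?W]) auto
  qed
qed

text \<open>A choice of points in the fibres, in general discontinuous, turns a bundle into an atlas.\<close>

definition fibre_points :: "'m topology \<Rightarrow> ('e, 'g, 'm) gbundle \<Rightarrow> ('m \<Rightarrow> 'e) \<Rightarrow> bool" where
  "fibre_points M P e \<longleftrightarrow> (\<forall>x\<in>topspace M. e x \<in> topspace (total_space P) \<and> proj P (e x) = x)"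

definition bundle_atlas ::
    "'m topology \<Rightarrow> ('e, 'g, 'm) gbundle \<Rightarrow> ('m \<Rightarrow> 'e) \<Rightarrow> ('m set \<times> ('m \<Rightarrow> 'g)) set" where
  "bundle_atlas M P e = {(U, t). openin M U \<and> t ` U \<subseteq> carrier G \<and>
     continuous_map (subtopology M U) (total_space P) (\<lambda>x. act P (e x) (t x))}"

lemma fibre_points_exist:
  assumes P: "principal_bundle G T M P"
  shows "\<exists>e. fibre_points M P e"
proof -
  have "\<exists>y. y \<in> topspace (total_space P) \<and> proj P y = x" if xM: "x \<in> topspace M" for x
  proof -
    obtain U s where U: "openin M U" "x \<in> U" "continuous_map (subtopology M U) (total_space P) s" "\<forall>b\<in>U. proj P (s b) = b"
      using local_section_exists [OF P xM] by blast
    then have "s x \<in> topspace (total_space P)"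
      using continuous_map_image_subset_topspace [OF U(3)] xM by auto
    then show ?thesis using U by blast
  qed
  then show ?thesis
    unfolding fibre_points_def by metis
qed

lemma bundle_section_subset:
  assumes "fibre_points M P e" "principal_bundle G T M P" "U \<subseteq> topspace M" "t ` U \<subseteq> carrier G" "x \<in> U"
  shows "act P (e x) (t x) \<in> topspace (total_space P)" "proj P (act P (e x) (t x)) = x"
  using assms principal_act [OF assms(2), of "e x" "t x"] by (auto simp: fibre_points_def subset_iff)

text \<open>The ratio of two sections is the translation from one to the other, hence continuous,
  although each factor depends on the arbitrary points \<open>e x\<close>.\<close>

lemma atlas_bundle_atlas:
  assumes P: "principal_bundle G T M P" and e: "fibre_points M P e"
  shows "atlas M (bundle_atlas M P e)"
  unfolding atlas_def
proof (intro conjI ballI, goal_cases)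
  case (1 x)
  then show ?case by (auto simp: bundle_atlas_def)
next
  case (2 x)
  obtain U s where U: "openin M U" "x \<in> U" and s: "continuous_map (subtopology M U) (total_space P) s" "\<forall>b\<in>U. proj P (s b) = b"
    using local_section_exists [OF P 2] by blast
  have sin: "s b \<in> topspace (total_space P)" if "b \<in> U" for b
    using continuous_map_image_subset_topspace [OF s(1)] that openin_subset [OF U(1)] by auto
  let ?t = "\<lambda>b. translation P (e b) (s b)"
  have t: "?t b \<in> carrier G" "act P (e b) (?t b) = s b" if "b \<in> U" for b
    using translation [OF P _ sin [OF that], of "e b"] e s(2) that openin_subset [OF U(1)] by (auto simp: fibre_points_def)
  have "continuous_map (subtopology M U) (total_space P) (\<lambda>b. act P (e b) (?t b))"
    by (rule continuous_map_eq [OF s(1)]) (simp add: t)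
  then have "(U, ?t) \<in> bundle_atlas M P e"
    using U t by (auto simp: bundle_atlas_def)
  then show ?case using U by blast
next
  case (3 z)
  show ?case
  proof (clarify)
    fix U t V t' assume z: "z = (U, t)" and V: "(V, t') \<in> bundle_atlas M P e"
    let ?W = "U \<inter> V"
    have U: "openin M U" "t ` U \<subseteq> carrier G" "continuous_map (subtopology M U) (total_space P) (\<lambda>x. act P (e x) (t x))"
      using 3 z by (auto simp: bundle_atlas_def)
    have V: "openin M V" "t' ` V \<subseteq> carrier G" "continuous_map (subtopology M V) (total_space P) (\<lambda>x. act P (e x) (t' x))"
      using V by (auto simp: bundle_atlas_def)
    note UM = openin_subset [OF U(1)] and VM = openin_subset [OF V(1)]
    have W: "openin M ?W" using U(1) V(1) by blast
    let ?\<sigma> = "\<lambda>x. act P (e x) (t x)" and ?\<sigma>' = "\<lambda>x. act P (e x) (t' x)"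
    have c: "continuous_map (subtopology M ?W) (total_space P) ?\<sigma>" "continuous_map (subtopology M ?W) (total_space P) ?\<sigma>'"
      by (rule continuous_map_from_subtopology_mono [OF U(3)], simp) (rule continuous_map_from_subtopology_mono [OF V(3)], simp)
    note s = bundle_section_subset [OF e P UM U(2)] and s' = bundle_section_subset [OF e P VM V(2)]
    have "continuous_map (subtopology M ?W) (subtopology (total_space P) {y \<in> topspace (total_space P). proj P y \<in> ?W}) ?\<sigma>'"
      using c(2) s' by (auto simp: continuous_map_in_subtopology)
    from continuous_map_compose [OF this continuous_map_translation [OF P c(1) W]]
    have "continuous_map (subtopology M ?W) T (\<lambda>x. translation P (?\<sigma> (proj P (?\<sigma>' x))) (?\<sigma>' x))"
      using s(2) by (simp add: o_def)
    then show "continuous_map (subtopology M ?W) T (\<lambda>x. inv (t x) \<otimes> t' x)"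
    proof (rule continuous_map_eq)
      fix x assume "x \<in> topspace (subtopology M ?W)"
      then have x: "x \<in> U" "x \<in> V" by auto
      then have tt: "t x \<in> carrier G" "t' x \<in> carrier G" using U V by auto
      have ex: "e x \<in> topspace (total_space P)" using e x UM by (auto simp: fibre_points_def)
      have "?\<sigma>' x = act P (?\<sigma> x) (inv (t x) \<otimes> t' x)"
        using principal_act(4) [OF P ex tt(1), of "inv (t x) \<otimes> t' x"] tt by (simp flip: m_assoc)
      then have "translation P (?\<sigma> x) (?\<sigma>' x) = inv (t x) \<otimes> t' x"
        using translation_act [OF P s(1) [OF x(1)], of "inv (t x) \<otimes> t' x"] tt by simp
      then show "translation P (?\<sigma> (proj P (?\<sigma>' x))) (?\<sigma>' x) = inv (t x) \<otimes> t' x"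
        using s'(2) [OF x(2)] by simp
    qed
  qed
qed

text \<open>With fibre points \<open>e\<close>, \<open>e'\<close> fixed, an equivariant map over the
  identity sends \<open>act P (e x) g\<close> to \<open>act Q (e' x) (h x \<otimes> g)\<close>. The
  function \<open>h\<close> itself may be discontinuous; carrying sections to sections is what
  expresses continuity of the map.\<close>

definition gauge_maps ::
    "('m set \<times> ('m \<Rightarrow> 'g)) set \<Rightarrow> ('m set \<times> ('m \<Rightarrow> 'g)) set \<Rightarrow> ('m \<Rightarrow> 'g) \<Rightarrow> bool" where
  "gauge_maps \<A> \<B> h \<longleftrightarrow> (\<forall>(U, t)\<in>\<A>. (U, \<lambda>x. h x \<otimes> t x) \<in> \<B>)"

text \<open>The factor \<open>h\<close> cancels from the ratio of the moved framing to the moved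
  chart.\<close>

lemma framing_gauge:
  assumes A: "atlas X \<A>" and B: "atlas X \<B>" and h: "gauge_maps \<A> \<B> h" "h ` topspace X \<subseteq> carrier G"
    and f: "continuous_map Z X f" and s: "framing \<A> Z f s"
  shows "framing \<B> Z f (\<lambda>z. h (f z) \<otimes> s z)"
proof (rule framing_locally [OF B f])
  have fin: "f z \<in> topspace X" if "z \<in> topspace Z" for z
    using continuous_map_image_subset_topspace [OF f] that by auto
  have hin: "h (f z) \<in> carrier G" if "z \<in> topspace Z" for z
    using h(2) fin [OF that] by blast
  show "(\<lambda>z. h (f z) \<otimes> s z) ` topspace Z \<subseteq> carrier G"
    using hin framing_in [OF s] by auto
  fix z assume z: "z \<in> topspace Z"
  obtain U t where U: "(U, t) \<in> \<A>" "f z \<in> U"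
    using atlas_chart [OF A fin [OF z]] by metis
  let ?W = "{z \<in> topspace Z. f z \<in> U}"
  have "openin Z ?W"
    using f atlas_open [OF A U(1)] by (rule openin_continuous_map_preimage)
  moreover have "(U, \<lambda>x. h x \<otimes> t x) \<in> \<B>"
    using h(1) U(1) by (auto simp: gauge_maps_def)
  moreover have "continuous_map (subtopology Z ?W) T (\<lambda>z. inv (h (f z) \<otimes> s z) \<otimes> (h (f z) \<otimes> t (f z)))"
  proof (rule continuous_map_eq [OF framing_continuous [OF s U(1)]])
    fix w assume "w \<in> topspace (subtopology Z ?W)"
    then have w: "w \<in> topspace Z" "f w \<in> U" by auto
    show "inv (s w) \<otimes> t (f w) = inv (h (f w) \<otimes> s w) \<otimes> (h (f w) \<otimes> t (f w))"
      using hin [OF w(1)] framing_in [OF s w(1)] atlas_in [OF A U(1) w(2)]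
      by (simp add: inv_mult_group m_assoc) (simp flip: m_assoc [of "inv (h (f w))"])
  qed
  ultimately show "\<exists>W U t. openin Z W \<and> z \<in> W \<and> (U, t) \<in> \<B> \<and> f ` W \<subseteq> U \<and>
      continuous_map (subtopology Z W) T (\<lambda>z. inv (h (f z) \<otimes> s z) \<otimes> t (f z))"
    using z U(2) by (intro exI [of _ ?W] exI [of _ U] exI [of _ "\<lambda>x. h x \<otimes> t x"]) auto
qed

text \<open>The function \<open>h\<close> records where the equivalence sends the chosen fibre
  points: it is the translation from \<open>e' x\<close> to \<open>k (e x)\<close>.\<close>

lemma equivalence_gauge_maps:
  assumes P: "principal_bundle G T M P" and Q: "principal_bundle G T M Q"
    and e: "fibre_points M P e" and e': "fibre_points M Q e'" and k: "bundle_equivalence G P Q k"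
  shows "\<exists>h. h ` topspace M \<subseteq> carrier G \<and> gauge_maps (bundle_atlas M P e) (bundle_atlas M Q e') h"
proof -
  define h where "h x = translation Q (e' x) (k (e x))" for x
  have kin: "k y \<in> topspace (total_space Q)" if "y \<in> topspace (total_space P)" for y
    using bundle_equivalence_image [OF k] that by blast
  have kp: "proj Q (k y) = proj P y" "\<And>g. g \<in> carrier G \<Longrightarrow> k (act P y g) = act Q (k y) g" if "y \<in> topspace (total_space P)" for y
    using k that by (auto simp: bundle_equivalence_def)
  have h: "h x \<in> carrier G" "act Q (e' x) (h x) = k (e x)" if "x \<in> topspace M" for x
    using e e' that kin kp translation [OF Q, of "e' x" "k (e x)"] by (auto simp: fibre_points_def h_def)
  have "(U, \<lambda>x. h x \<otimes> t x) \<in> bundle_atlas M Q e'" if "(U, t) \<in> bundle_atlas M P e" for U t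
  proof -
    have U: "openin M U" "t ` U \<subseteq> carrier G" "continuous_map (subtopology M U) (total_space P) (\<lambda>x. act P (e x) (t x))"
      using that by (auto simp: bundle_atlas_def)
    have UM: "x \<in> topspace M" if "x \<in> U" for x using openin_subset [OF U(1)] that by blast
    have "continuous_map (total_space P) (total_space Q) k"
      using k homeomorphic_imp_continuous_map by (auto simp: bundle_equivalence_def)
    from continuous_map_compose [OF U(3) this]
    have "continuous_map (subtopology M U) (total_space Q) (\<lambda>x. k (act P (e x) (t x)))"
      by (simp add: o_def)
    then have "continuous_map (subtopology M U) (total_space Q) (\<lambda>x. act Q (e' x) (h x \<otimes> t x))"
    proof (rule continuous_map_eq)
      fix x assume "x \<in> topspace (subtopology M U)"
      then have x: "x \<in> U" "x \<in> topspace M" by auto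
      then have tx: "t x \<in> carrier G" using U(2) by blast
      have "e x \<in> topspace (total_space P)" "e' x \<in> topspace (total_space Q)"
        using e e' x by (auto simp: fibre_points_def)
      then show "k (act P (e x) (t x)) = act Q (e' x) (h x \<otimes> t x)"
        using kp tx h [OF x(2)] principal_act(4) [OF Q, of "e' x" "h x" "t x"] by simp
    qed
    moreover have "(\<lambda>x. h x \<otimes> t x) ` U \<subseteq> carrier G"
      using U(2) h(1) UM by auto
    ultimately show ?thesis using U(1) by (auto simp: bundle_atlas_def)
  qed
  then show ?thesis
    using h(1) by (intro exI [of _ h]) (auto simp: gauge_maps_def)
qed

text \<open>Moving the points of the fibres by \<open>g\<close> changes the holonomy by the
  coboundary of the composite of \<open>q\<close> and \<open>g\<close>; this is the freedom
  exploited in \<open>cohomologous_equivalent_bundles\<close>.\<close>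

lemma gauge_maps_change_points:
  assumes P: "principal_bundle G T M P" and e: "fibre_points M P e" and g: "g ` topspace M \<subseteq> carrier G"
  shows "fibre_points M P (\<lambda>x. act P (e x) (g x))"
    "gauge_maps (bundle_atlas M P (\<lambda>x. act P (e x) (g x))) (bundle_atlas M P e) g"
proof -
  have ex: "e x \<in> topspace (total_space P)" "proj P (e x) = x" "g x \<in> carrier G" if "x \<in> topspace M" for x
    using e g that by (auto simp: fibre_points_def)
  show "fibre_points M P (\<lambda>x. act P (e x) (g x))"
    using ex principal_act [OF P] by (auto simp: fibre_points_def)
  have "(U, \<lambda>x. g x \<otimes> t x) \<in> bundle_atlas M P e"
    if "(U, t) \<in> bundle_atlas M P (\<lambda>x. act P (e x) (g x))" for U t
  proof -
    have U: "openin M U" "t ` U \<subseteq> carrier G" "continuous_map (subtopology M U) (total_space P) (\<lambda>x. act P (act P (e x) (g x)) (t x))"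
      using that by (auto simp: bundle_atlas_def)
    have UM: "x \<in> topspace M" "t x \<in> carrier G" if "x \<in> U" for x using openin_subset [OF U(1)] U(2) that by auto
    have "continuous_map (subtopology M U) (total_space P) (\<lambda>x. act P (e x) (g x \<otimes> t x))"
      by (rule continuous_map_eq [OF U(3)]) (use ex UM principal_act(4) [OF P] in auto)
    then show ?thesis
      using U(1) ex UM by (auto simp: bundle_atlas_def)
  qed
  then show "gauge_maps (bundle_atlas M P (\<lambda>x. act P (e x) (g x))) (bundle_atlas M P e) g"
    by (auto simp: gauge_maps_def)
qed

text \<open>The formula mixes the discontinuous choices \<open>e\<close>, \<open>e'\<close> and
  \<open>h\<close>. Over a chart \<open>t\<close> it is rewritten as the section with coordinate
  \<open>h \<otimes> t\<close> acted on by the translation from the section with coordinate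
  \<open>t\<close> to \<open>y\<close>, and these pieces are continuous.\<close>

lemma gauge_maps_continuous:
  assumes P: "principal_bundle G T M P" and Q: "principal_bundle G T M Q"
    and e: "fibre_points M P e" and e': "fibre_points M Q e'"
    and h: "gauge_maps (bundle_atlas M P e) (bundle_atlas M Q e') h" "h ` topspace M \<subseteq> carrier G"
  shows "continuous_map (total_space P) (total_space Q)
    (\<lambda>y. act Q (e' (proj P y)) (h (proj P y) \<otimes> translation P (e (proj P y)) y))"
proof (rule continuous_map_locally)
  let ?k = "\<lambda>y. act Q (e' (proj P y)) (h (proj P y) \<otimes> translation P (e (proj P y)) y)"
  fix y assume y: "y \<in> topspace (total_space P)"
  have cp: "continuous_map (total_space P) M (proj P)"
    using P by (simp add: principal_bundle_def)
  obtain U t where Ut: "(U, t) \<in> bundle_atlas M P e" "proj P y \<in> U"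
    using atlas_chart [OF atlas_bundle_atlas [OF P e] principal_bundle_proj_in [OF P y]] .
  have U: "openin M U" "t ` U \<subseteq> carrier G" "continuous_map (subtopology M U) (total_space P) (\<lambda>x. act P (e x) (t x))"
    using Ut by (auto simp: bundle_atlas_def)
  note UM = openin_subset [OF U(1)]
  note s = bundle_section_subset [OF e P UM U(2)]
  have c': "continuous_map (subtopology M U) (total_space Q) (\<lambda>x. act Q (e' x) (h x \<otimes> t x))"
    using h(1) Ut(1) by (auto simp: gauge_maps_def bundle_atlas_def)
  let ?W = "{y \<in> topspace (total_space P). proj P y \<in> U}"
  let ?E = "subtopology (total_space P) ?W"
  have W: "openin (total_space P) ?W"
    using cp U(1) by (rule openin_continuous_map_preimage)
  have "continuous_map ?E (subtopology M U) (proj P)"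
    by (auto simp: continuous_map_in_subtopology intro: continuous_map_from_subtopology [OF cp])
  from continuous_map_compose [OF this c']
  have "continuous_map ?E (prod_topology (total_space Q) T)
      (\<lambda>y. (act Q (e' (proj P y)) (h (proj P y) \<otimes> t (proj P y)), translation P (act P (e (proj P y)) (t (proj P y))) y))"
    using continuous_map_translation [OF P U(3) U(1) s(2)] by (simp add: continuous_map_paired o_def)
  from continuous_map_compose [OF this principal_bundle_continuous_action [OF TG Q]]
  have "continuous_map ?E (total_space Q)
      (\<lambda>y. act Q (act Q (e' (proj P y)) (h (proj P y) \<otimes> t (proj P y))) (translation P (act P (e (proj P y)) (t (proj P y))) y))"
    by (simp add: o_def)
  then have "continuous_map ?E (total_space Q) ?k"
  proof (rule continuous_map_eq)
    fix y assume "y \<in> topspace ?E"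
    then have y: "y \<in> topspace (total_space P)" "proj P y \<in> U" by auto
    let ?x = "proj P y"
    have x: "?x \<in> topspace M" "t ?x \<in> carrier G" "h ?x \<in> carrier G" "e ?x \<in> topspace (total_space P)" "proj P (e ?x) = ?x" "e' ?x \<in> topspace (total_space Q)"
      using y UM U(2) h(2) e e' by (auto simp: fibre_points_def)
    let ?s = "act P (e ?x) (t ?x)"
    have s': "?s \<in> topspace (total_space P)" "proj P ?s = ?x" using s [OF y(2)] .
    note tr = translation [OF P s'(1) y(1) s'(2)]
    have "act P (e ?x) (t ?x \<otimes> translation P ?s y) = y"
      using principal_act(4) [OF P x(4) x(2) tr(1)] tr(2) by simp
    then have "translation P (e ?x) y = t ?x \<otimes> translation P ?s y"
      using translation_act [OF P x(4), of "t ?x \<otimes> translation P ?s y"] x(2) tr(1) by simp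
    then show "act Q (act Q (e' ?x) (h ?x \<otimes> t ?x)) (translation P ?s y) = ?k y"
      using principal_act(4) [OF Q x(6), of "h ?x \<otimes> t ?x" "translation P ?s y"] x tr(1) by (simp add: m_assoc)
  qed
  then show "\<exists>W. openin (total_space P) W \<and> y \<in> W \<and> continuous_map (subtopology (total_space P) W) (total_space Q) ?k"
    using W y Ut(2) by blast
qed

text \<open>The functions \<open>h\<close> and \<open>inv h\<close> induce mutually inverse
  equivariant maps, and each is continuous by \<open>gauge_maps_continuous\<close>.\<close>

lemma gauge_maps_equivalent:
  assumes P: "principal_bundle G T M P" and Q: "principal_bundle G T M Q"
    and e: "fibre_points M P e" and e': "fibre_points M Q e'"
    and h: "gauge_maps (bundle_atlas M P e) (bundle_atlas M Q e') h" "h ` topspace M \<subseteq> carrier G"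
    and h': "gauge_maps (bundle_atlas M Q e') (bundle_atlas M P e) (\<lambda>x. inv (h x))"
  shows "equivalent_bundles G P Q"
proof -
  let ?k = "\<lambda>y. act Q (e' (proj P y)) (h (proj P y) \<otimes> translation P (e (proj P y)) y)"
  let ?l = "\<lambda>y. act P (e (proj Q y)) (inv (h (proj Q y)) \<otimes> translation Q (e' (proj Q y)) y)"
  have pt: "e x \<in> topspace (total_space P)" "proj P (e x) = x" "e' x \<in> topspace (total_space Q)" "proj Q (e' x) = x" "h x \<in> carrier G"
    if "x \<in> topspace M" for x
    using e e' h(2) that by (auto simp: fibre_points_def)
  have P': "proj P y \<in> topspace M" "translation P (e (proj P y)) y \<in> carrier G" "act P (e (proj P y)) (translation P (e (proj P y)) y) = y"
    if "y \<in> topspace (total_space P)" for y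
    using principal_bundle_proj_in [OF P that] translation [OF P _ that, of "e (proj P y)"] pt by auto
  have Q': "proj Q y \<in> topspace M" "translation Q (e' (proj Q y)) y \<in> carrier G" "act Q (e' (proj Q y)) (translation Q (e' (proj Q y)) y) = y"
    if "y \<in> topspace (total_space Q)" for y
    using principal_bundle_proj_in [OF Q that] translation [OF Q _ that, of "e' (proj Q y)"] pt by auto
  have kin: "?k y \<in> topspace (total_space Q)" "proj Q (?k y) = proj P y" if y: "y \<in> topspace (total_space P)" for y
    using principal_act [OF Q pt(3) [OF P'(1) [OF y]], of "h (proj P y) \<otimes> translation P (e (proj P y)) y"] P' [OF y] pt by auto
  have lin: "?l y \<in> topspace (total_space P)" "proj P (?l y) = proj Q y" if y: "y \<in> topspace (total_space Q)" for y
    using principal_act [OF P pt(1) [OF Q'(1) [OF y]], of "inv (h (proj Q y)) \<otimes> translation Q (e' (proj Q y)) y"] Q' [OF y] pt by auto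
  have lk: "?l (?k y) = y" if y: "y \<in> topspace (total_space P)" for y
    using P' [OF y] pt [OF P'(1) [OF y]] kin(2) [OF y] translation_act [OF Q, of "e' (proj P y)" "h (proj P y) \<otimes> translation P (e (proj P y)) y"]
    by (simp flip: m_assoc)
  have kl: "?k (?l y) = y" if y: "y \<in> topspace (total_space Q)" for y
    using Q' [OF y] pt [OF Q'(1) [OF y]] lin(2) [OF y] translation_act [OF P, of "e (proj Q y)" "inv (h (proj Q y)) \<otimes> translation Q (e' (proj Q y)) y"]
    by (simp flip: m_assoc)
  have ck: "continuous_map (total_space P) (total_space Q) ?k"
    by (rule gauge_maps_continuous [OF P Q e e' h])
  have cl: "continuous_map (total_space Q) (total_space P) ?l"
    by (rule gauge_maps_continuous [OF Q P e' e h']) (use h(2) in auto)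
  have "homeomorphic_maps (total_space P) (total_space Q) ?k ?l"
    unfolding homeomorphic_maps_def using ck cl lk kl by blast
  then have "homeomorphic_map (total_space P) (total_space Q) ?k"
    using homeomorphic_map_maps by blast
  moreover have "?k (act P y g) = act Q (?k y) g" if y: "y \<in> topspace (total_space P)" and g: "g \<in> carrier G" for y g
  proof -
    let ?x = "proj P y" let ?t = "translation P (e ?x) y"
    note p = P' [OF y] and x = pt [OF P'(1) [OF y]]
    have "act P y g = act P (e ?x) (?t \<otimes> g)"
      using principal_act(4) [OF P x(1) p(2) g] p(3) by simp
    then have "translation P (e ?x) (act P y g) = ?t \<otimes> g"
      using translation_act [OF P x(1) m_closed [OF p(2) g]] by simp
    then show ?thesis
      using principal_act(3) [OF P y g] principal_act(4) [OF Q x(3), of "h ?x \<otimes> ?t" g] p(2) x(5) g by (simp add: m_assoc)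
  qed
  ultimately have "bundle_equivalence G P Q ?k"
    unfolding bundle_equivalence_def using kin by blast
  then show ?thesis
    unfolding equivalent_bundles_def by blast
qed

text \<open>The bundle glued from transition functions. As the charts are already written in common
  fibre coordinates, no quotient has to be formed: the set is the plain product, and only its
  topology is coinduced by the charts.\<close>

definition atlas_bundle ::
    "'m topology \<Rightarrow> ('m set \<times> ('m \<Rightarrow> 'g)) set \<Rightarrow> ('m \<times> 'g, 'g, 'm) gbundle" where
  "atlas_bundle M \<A> =
     \<lparr>total_space = topology (\<lambda>W. W \<subseteq> topspace M \<times> carrier G \<and>
        (\<forall>(U, t)\<in>\<A>. openin (prod_topology (subtopology M U) T) {(x, g) \<in> U \<times> carrier G. (x, t x \<otimes> g) \<in> W})),
      act = (\<lambda>(b, g) h. (b, g \<otimes> h)), proj = fst\<rparr>"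

lemma openin_atlas_bundle:
  "openin (total_space (atlas_bundle M \<A>)) W \<longleftrightarrow> W \<subseteq> topspace M \<times> carrier G \<and>
     (\<forall>(U, t)\<in>\<A>. openin (prod_topology (subtopology M U) T) {(x, g) \<in> U \<times> carrier G. (x, t x \<otimes> g) \<in> W})"
proof -
  let ?L = "\<lambda>W. W \<subseteq> topspace M \<times> carrier G \<and>
     (\<forall>(U, t)\<in>\<A>. openin (prod_topology (subtopology M U) T) {(x, g) \<in> U \<times> carrier G. (x, t x \<otimes> g) \<in> W})"
  have "istopology ?L"
    unfolding istopology_def
  proof (intro conjI allI impI)
    fix W W' assume W: "?L W" and W': "?L W'"
    have eq: "{(x, g) \<in> U \<times> carrier G. (x, t x \<otimes> g) \<in> W \<inter> W'} =
        {(x, g) \<in> U \<times> carrier G. (x, t x \<otimes> g) \<in> W} \<inter> {(x, g) \<in> U \<times> carrier G. (x, t x \<otimes> g) \<in> W'}" for U t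
      by auto
    show "W \<inter> W' \<subseteq> topspace M \<times> carrier G" using W by blast
    show "\<forall>(U, t)\<in>\<A>. openin (prod_topology (subtopology M U) T) {(x, g) \<in> U \<times> carrier G. (x, t x \<otimes> g) \<in> W \<inter> W'}"
      unfolding eq using W W' by (auto intro!: openin_Int)
  next
    fix \<W> assume \<W>: "\<forall>W\<in>\<W>. ?L W"
    have eq: "{(x, g) \<in> U \<times> carrier G. (x, t x \<otimes> g) \<in> \<Union>\<W>} =
        (\<Union>W\<in>\<W>. {(x, g) \<in> U \<times> carrier G. (x, t x \<otimes> g) \<in> W})" for U t
      by auto
    show "\<Union>\<W> \<subseteq> topspace M \<times> carrier G" using \<W> by blast
    show "\<forall>(U, t)\<in>\<A>. openin (prod_topology (subtopology M U) T) {(x, g) \<in> U \<times> carrier G. (x, t x \<otimes> g) \<in> \<Union>\<W>}"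
      unfolding eq using \<W> by (auto intro!: openin_Union)
  qed
  then show ?thesis
    by (simp add: atlas_bundle_def topology_inverse')
qed

lemma topspace_atlas_bundle:
  assumes A: "atlas M \<A>"
  shows "topspace (total_space (atlas_bundle M \<A>)) = topspace M \<times> carrier G"
proof
  show "topspace (total_space (atlas_bundle M \<A>)) \<subseteq> topspace M \<times> carrier G"
    using openin_topspace [of "total_space (atlas_bundle M \<A>)"] unfolding openin_atlas_bundle by blast
  have "{(x, g) \<in> U \<times> carrier G. (x, t x \<otimes> g) \<in> topspace M \<times> carrier G} = topspace (prod_topology (subtopology M U) T)"
    if "(U, t) \<in> \<A>" for U t
    using atlas_in [OF A that] openin_subset [OF atlas_open [OF A that]] by (auto simp: topspace_T)
  then have "openin (total_space (atlas_bundle M \<A>)) (topspace M \<times> carrier G)"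
    unfolding openin_atlas_bundle by (auto simp del: topspace_prod_topology)
  then show "topspace M \<times> carrier G \<subseteq> topspace (total_space (atlas_bundle M \<A>))"
    by (rule openin_subset)
qed

lemma atlas_bundle_simps [simp]:
  "proj (atlas_bundle M \<A>) = fst" "act (atlas_bundle M \<A>) (b, g) h = (b, g \<otimes> h)"
  by (simp_all add: atlas_bundle_def)

text \<open>Continuity of the chart is built into the topology. For its inverse, openness is tested
  in every other chart, where left multiplication by the continuous transition function
  appears.\<close>

lemma atlas_bundle_chart:
  assumes A: "atlas M \<A>" and U: "(U, t) \<in> \<A>"
  shows "local_trivialization G T M (atlas_bundle M \<A>) U (\<lambda>(x, g). (x, t x \<otimes> g))"
  unfolding local_trivialization_def
proof (intro conjI ballI)
  let ?E = "total_space (atlas_bundle M \<A>)"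
  let ?EU = "subtopology ?E {e \<in> topspace ?E. proj (atlas_bundle M \<A>) e \<in> U}"
  let ?\<phi> = "\<lambda>(x, g). (x, t x \<otimes> g)" and ?\<psi> = "\<lambda>(x, g). (x, inv (t x) \<otimes> g)"
  let ?B = "prod_topology (subtopology M U) T"
  note UM = openin_subset [OF atlas_open [OF A U]]
  have topB: "topspace ?B = U \<times> carrier G" using UM by (auto simp: topspace_T)
  have E: "topspace ?E = topspace M \<times> carrier G" by (rule topspace_atlas_bundle [OF A])
  have EU: "{e \<in> topspace ?E. proj (atlas_bundle M \<A>) e \<in> U} = U \<times> carrier G"
    using UM by (auto simp: E)
  have topEU: "topspace (subtopology ?E (U \<times> carrier G)) = U \<times> carrier G"
    using UM by (auto simp: E)
  have "continuous_map ?B ?E ?\<phi>"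
    unfolding continuous_map_def topB
  proof (intro conjI allI impI)
    show "?\<phi> \<in> U \<times> carrier G \<rightarrow> topspace ?E"
      using atlas_in [OF A U] UM by (auto simp: E)
    fix W assume "openin ?E W"
    then have "openin ?B {(x, g) \<in> U \<times> carrier G. (x, t x \<otimes> g) \<in> W}"
      using U unfolding openin_atlas_bundle by blast
    moreover have "{(x, g) \<in> U \<times> carrier G. (x, t x \<otimes> g) \<in> W} = {z \<in> U \<times> carrier G. ?\<phi> z \<in> W}"
      by auto
    ultimately show "openin ?B {z \<in> U \<times> carrier G. ?\<phi> z \<in> W}" by simp
  qed
  then have c\<phi>: "continuous_map ?B (subtopology ?E (U \<times> carrier G)) ?\<phi>"
    using atlas_in [OF A U] topB by (auto simp: continuous_map_in_subtopology simp del: topspace_prod_topology)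
  have c\<psi>: "continuous_map (subtopology ?E (U \<times> carrier G)) ?B ?\<psi>"
    unfolding continuous_map_def topB topEU
  proof (intro conjI allI impI)
    show "?\<psi> \<in> U \<times> carrier G \<rightarrow> U \<times> carrier G"
      using atlas_in [OF A U] by auto
    fix S assume S: "openin ?B S"
    let ?W = "{z \<in> U \<times> carrier G. ?\<psi> z \<in> S}"
    have "openin ?E ?W"
      unfolding openin_atlas_bundle
    proof (intro conjI ballI, goal_cases)
      case 1
      then show ?case using UM by auto
    next
      case (2 z)
      obtain V t' where z: "z = (V, t')" by fastforce
      have V: "(V, t') \<in> \<A>" using 2 z by simp
      note VM = openin_subset [OF atlas_open [OF A V]]
      let ?B' = "prod_topology (subtopology M (U \<inter> V)) T"
      let ?f = "\<lambda>z. (fst z, (inv (t (fst z)) \<otimes> t' (fst z)) \<otimes> snd z)"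
      have "continuous_map ?B' T (\<lambda>z. inv (t (fst z)) \<otimes> t' (fst z))"
        using continuous_map_compose [OF continuous_map_fst atlas_compat [OF A U V]] by (simp add: o_def)
      then have "continuous_map ?B' T (\<lambda>z. (inv (t (fst z)) \<otimes> t' (fst z)) \<otimes> snd z)"
        by (rule continuous_map_mult [OF _ continuous_map_snd])
      moreover have "continuous_map ?B' (subtopology M U) fst"
        using continuous_map_fst [of "subtopology M (U \<inter> V)" T] by (auto simp: continuous_map_in_subtopology)
      ultimately have "continuous_map ?B' ?B ?f"
        by (rule continuous_map_pairedI [rotated])
      then have o1: "openin ?B' {z \<in> topspace ?B'. ?f z \<in> S}"
        using S by (rule openin_continuous_map_preimage)
      have eq: "?B' = subtopology (prod_topology (subtopology M V) T) ((U \<inter> V) \<times> topspace T)"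
        by (simp add: subtopology_Times subtopology_subtopology subtopology_topspace Int_ac)
      have o2: "openin (prod_topology (subtopology M V) T) ((U \<inter> V) \<times> topspace T)"
        using atlas_open [OF A U] by (simp add: openin_prod_Times_iff openin_subtopology_Int)
      have "openin (subtopology (prod_topology (subtopology M V) T) ((U \<inter> V) \<times> topspace T)) {z \<in> topspace ?B'. ?f z \<in> S}"
        by (subst eq [symmetric]) (rule o1)
      then have "openin (prod_topology (subtopology M V) T) {z \<in> topspace ?B'. ?f z \<in> S}"
        using o2 by (rule openin_trans_full)
      moreover have "{z \<in> topspace ?B'. ?f z \<in> S} = {(x, g) \<in> V \<times> carrier G. (x, t' x \<otimes> g) \<in> ?W}"
      proof -
        have eq: "?f (x, g) \<in> S \<longleftrightarrow> ?\<psi> (x, t' x \<otimes> g) \<in> S" "t' x \<otimes> g \<in> carrier G" if "x \<in> U" "x \<in> V" "g \<in> carrier G" for x g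
          using that atlas_in [OF A U that(1)] atlas_in [OF A V that(2)] by (simp_all add: m_assoc)
        have S_sub: "x \<in> U" if "(x, g) \<in> S" for x g
          using openin_subset [OF S] that topB by blast
        have "topspace ?B' = (U \<inter> V) \<times> carrier G"
          using UM by (auto simp: topspace_T)
        then show ?thesis
          using eq S_sub by (auto simp del: topspace_prod_topology)
      qed
      ultimately show ?case by (simp only: z prod.case)
    qed
    then show "openin (subtopology ?E (U \<times> carrier G)) ?W"
      by (auto intro: openin_subset_topspace_eq simp: openin_subtopology)
  qed
  have "homeomorphic_maps ?B (subtopology ?E (U \<times> carrier G)) ?\<phi> ?\<psi>"
    unfolding homeomorphic_maps_def topB topEU using c\<phi> c\<psi> atlas_in [OF A U] by (auto simp flip: m_assoc)
  then show "homeomorphic_map ?B ?EU ?\<phi>"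
    unfolding EU using homeomorphic_map_maps by blast
  fix b g assume b: "b \<in> U" and g: "g \<in> carrier G"
  then show "proj (atlas_bundle M \<A>) (?\<phi> (b, g)) = b"
    "?\<phi> (b, g) = act (atlas_bundle M \<A>) (?\<phi> (b, \<one>)) g"
    using atlas_in [OF A U b] by simp_all
qed

lemma principal_atlas_bundle:
  assumes A: "atlas M \<A>"
  shows "principal_bundle G T M (atlas_bundle M \<A>)"
  unfolding principal_bundle_def
proof (intro conjI exI [of _ "fst ` \<A>"])
  let ?E = "total_space (atlas_bundle M \<A>)"
  show "right_action G (topspace ?E) (act (atlas_bundle M \<A>))"
    unfolding topspace_atlas_bundle [OF A] right_action_def by (auto simp: m_assoc)
  show "\<forall>U\<in>fst ` \<A>. openin M U"
    using atlas_open [OF A] by auto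
  show "\<Union>(fst ` \<A>) = topspace M"
  proof (intro equalityI subsetI)
    fix x assume "x \<in> topspace M"
    then obtain U t where "(U, t) \<in> \<A>" "x \<in> U" by (rule atlas_chart [OF A])
    then show "x \<in> \<Union>(fst ` \<A>)" by force
  next
    fix x assume "x \<in> \<Union>(fst ` \<A>)"
    then obtain U t where "(U, t) \<in> \<A>" "x \<in> U" by auto
    then show "x \<in> topspace M"
      using openin_subset [OF atlas_open [OF A]] by blast
  qed
  show "\<forall>U\<in>fst ` \<A>. \<exists>\<phi>. local_trivialization G T M (atlas_bundle M \<A>) U \<phi>"
    using atlas_bundle_chart [OF A] by fastforce
  show "continuous_map ?E M (proj (atlas_bundle M \<A>))"
    unfolding continuous_map_def topspace_atlas_bundle [OF A]
  proof (intro conjI allI impI)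
    fix S assume S: "openin M S"
    note SM = openin_subset [OF S]
    have "openin ?E (S \<times> carrier G)"
      unfolding openin_atlas_bundle
    proof (intro conjI ballI, goal_cases)
      case (2 z)
      obtain U t where z: "z = (U, t)" by fastforce
      have U: "(U, t) \<in> \<A>" using 2 z by simp
      have "openin (prod_topology (subtopology M U) T) ((U \<inter> S) \<times> topspace T)"
        using S by (simp add: openin_prod_Times_iff openin_subtopology_Int2)
      moreover have "(U \<inter> S) \<times> topspace T = {(x, g) \<in> U \<times> carrier G. (x, t x \<otimes> g) \<in> S \<times> carrier G}"
        using atlas_in [OF A U] by (auto simp: topspace_T)
      ultimately show ?case by (simp only: z prod.case)
    qed (use SM in auto)
    moreover have "S \<times> carrier G = {x \<in> topspace M \<times> carrier G. proj (atlas_bundle M \<A>) x \<in> S}"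
      using SM by auto
    ultimately show "openin ?E {x \<in> topspace M \<times> carrier G. proj (atlas_bundle M \<A>) x \<in> S}" by simp
  qed auto
qed

lemma fibre_points_atlas_bundle:
  assumes A: "atlas M \<A>"
  shows "fibre_points M (atlas_bundle M \<A>) (\<lambda>x. (x, \<one>))"
  by (simp add: fibre_points_def topspace_atlas_bundle [OF A])

text \<open>Relative to the points \<open>(x, \<one>)\<close> a chart \<open>t\<close> is the
  section x \<mapsto> \<open>(x, t x)\<close>. An inclusion is enough later on, because a framing
  for a larger atlas is one for a smaller.\<close>

lemma atlas_subset_bundle_atlas:
  assumes A: "atlas M \<A>"
  shows "\<A> \<subseteq> bundle_atlas M (atlas_bundle M \<A>) (\<lambda>x. (x, \<one>))"
proof clarify
  fix U t assume U: "(U, t) \<in> \<A>"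
  let ?E = "total_space (atlas_bundle M \<A>)"
  have "continuous_map (prod_topology (subtopology M U) T)
      (subtopology ?E {e \<in> topspace ?E. proj (atlas_bundle M \<A>) e \<in> U}) (\<lambda>(x, g). (x, t x \<otimes> g))"
    using atlas_bundle_chart [OF A U] homeomorphic_imp_continuous_map unfolding local_trivialization_def by blast
  then have "continuous_map (prod_topology (subtopology M U) T) ?E (\<lambda>(x, g). (x, t x \<otimes> g))"
    by (rule continuous_map_into_fulltopology)
  moreover have "continuous_map (subtopology M U) (prod_topology (subtopology M U) T) (\<lambda>b. (b, \<one>))"
    by (simp add: continuous_map_pairwise o_def topspace_T)
  ultimately have "continuous_map (subtopology M U) ?E ((\<lambda>(x, g). (x, t x \<otimes> g)) \<circ> (\<lambda>b. (b, \<one>)))"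
    by (rule continuous_map_compose [rotated])
  then have "continuous_map (subtopology M U) ?E (\<lambda>x. act (atlas_bundle M \<A>) (x, \<one>) (t x))"
    by (rule continuous_map_eq) (use atlas_in [OF A U] in auto)
  then show "(U, t) \<in> bundle_atlas M (atlas_bundle M \<A>) (\<lambda>x. (x, \<one>))"
    using atlas_open [OF A U] atlas_in [OF A U] by (auto simp: bundle_atlas_def)
qed

lemma framing_cong:
  assumes "\<And>z. z \<in> topspace Z \<Longrightarrow> f z = f' z" "framing \<A> Z f s"
  shows "framing \<A> Z f' s"
  unfolding framing_def
proof (intro conjI ballI, goal_cases)
  case 1
  then show ?case using assms(2) by (simp add: framing_def)
next
  case (2 x)
  obtain U t where x: "x = (U, t)" by fastforce
  have "{z \<in> topspace Z. f' z \<in> U} = {z \<in> topspace Z. f z \<in> U}" using assms(1) by auto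
  moreover have "continuous_map (subtopology Z {z \<in> topspace Z. f z \<in> U}) T (\<lambda>z. inv (s z) \<otimes> t (f' z))"
    by (rule continuous_map_eq [OF framing_continuous [OF assms(2)]]) (use 2 x assms(1) in auto)
  ultimately show ?case by (simp add: x)
qed

end

section \<open>The cocycle of a bundle\<close>

context group_quotient
begin

lemma holonomy_path:
  "holonomy X \<A> \<kappa> \<Longrightarrow> pathin X p \<Longrightarrow> framing \<A> (top_of_set {0..1}) p s \<Longrightarrow> q (s 0) = \<kappa> p \<otimes>\<^bsub>A\<^esub> q (s 1)"
  unfolding holonomy_def by blast

lemma holonomy_exists:
  fixes X :: "'b topology"
  assumes A: "atlas X \<A>"
  shows "\<exists>\<kappa>. path_cocycle X \<kappa> \<and> holonomy X \<A> \<kappa>"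
proof -
  let ?I = "top_of_set {0..1::real}"
  define \<kappa> where "\<kappa> p = (let s = SOME s. framing \<A> ?I p s in q (s 0) \<otimes>\<^bsub>A\<^esub> inv\<^bsub>A\<^esub> q (s 1))" for p
  have conn: "connected_space ?I"
    by (rule connected_space_top_of_set) simp
  have \<kappa>: "\<kappa> p = q (s 0) \<otimes>\<^bsub>A\<^esub> inv\<^bsub>A\<^esub> q (s 1)" if p: "pathin X p" and s: "framing \<A> ?I p s" for p s
  proof -
    define s' where "s' = (SOME s. framing \<A> ?I p s)"
    have s': "framing \<A> ?I p s'"
      unfolding s'_def by (rule someI [where P = "framing \<A> ?I p", OF s])
    have i: "s x \<in> carrier G" "s' x \<in> carrier G" if "x \<in> {0..1}" for x
      using framing_in [OF s] framing_in [OF s'] that by auto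
    have "q (inv (s 0) \<otimes> s' 0) = q (inv (s 1) \<otimes> s' 1)"
      using q_constant [OF framing_ratio [OF A p [unfolded pathin_def] s s'] conn] by simp
    then have eq: "inv\<^bsub>A\<^esub> (q (s 0)) \<otimes>\<^bsub>A\<^esub> q (s' 0) = inv\<^bsub>A\<^esub> (q (s 1)) \<otimes>\<^bsub>A\<^esub> q (s' 1)"
      using i [of 0] i [of 1] by (simp add: q_mult q_inv)
    have "q (s' 0) = q (s 0) \<otimes>\<^bsub>A\<^esub> (inv\<^bsub>A\<^esub> (q (s 0)) \<otimes>\<^bsub>A\<^esub> q (s' 0))"
      using i [of 0] by (simp flip: A.m_assoc)
    also have "\<dots> = q (s 0) \<otimes>\<^bsub>A\<^esub> inv\<^bsub>A\<^esub> (q (s 1)) \<otimes>\<^bsub>A\<^esub> q (s' 1)"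
      unfolding eq using i [of 0] i [of 1] by (simp add: A.m_assoc)
    finally have "q (s' 0) \<otimes>\<^bsub>A\<^esub> inv\<^bsub>A\<^esub> q (s' 1) = q (s 0) \<otimes>\<^bsub>A\<^esub> inv\<^bsub>A\<^esub> q (s 1)"
      using i [of 0] i [of 1] by (simp add: A.m_assoc)
    then show ?thesis
      by (simp add: \<kappa>_def Let_def s'_def)
  qed
  have \<kappa>': "\<exists>s. framing \<A> ?I p s \<and> s 0 \<in> carrier G \<and> s 1 \<in> carrier G \<and> \<kappa> p = q (s 0) \<otimes>\<^bsub>A\<^esub> inv\<^bsub>A\<^esub> q (s 1)"
    if p: "pathin X p" for p
  proof -
    obtain s where s: "framing \<A> ?I p s" using framing_path [OF A p] by blast
    then show ?thesis
      using \<kappa> [OF p s] framing_in [OF s, of 0] framing_in [OF s, of 1] by auto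
  qed
  have "path_cocycle X \<kappa>"
    unfolding path_cocycle_def
  proof (intro conjI allI impI)
    show "\<kappa> p \<in> carrier A" if "pathin X p" for p
      using \<kappa>' [OF that] by auto
    show "\<kappa> p = \<kappa> p'" if pp: "pathin X p" "\<forall>t\<in>{0..1}. p t = p' t" for p p'
    proof -
      have "pathin X p'"
        using pp continuous_map_eq [of ?I X p p'] by (simp add: pathin_def)
      moreover obtain s where "framing \<A> ?I p s" "\<kappa> p = q (s 0) \<otimes>\<^bsub>A\<^esub> inv\<^bsub>A\<^esub> q (s 1)" using \<kappa>' [OF pp(1)] by blast
      moreover from this have "framing \<A> ?I p' s"
        using pp(2) by (intro framing_cong [of ?I p p']) auto
      ultimately show ?thesis using \<kappa> by simp
    qed
    fix H :: "real \<times> real \<Rightarrow> 'b"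
    assume H: "continuous_map (top_of_set ({0..1} \<times> {0..1})) X H"
    obtain s where s: "framing \<A> (top_of_set ({0..1} \<times> {0..1})) H s"
      using framing_square [OF A H] by blast
    have edge: "\<kappa> (\<lambda>u. H (g u)) = q (s (g 0)) \<otimes>\<^bsub>A\<^esub> inv\<^bsub>A\<^esub> q (s (g 1))"
      if g: "continuous_on {0..1} g" "g ` {0..1} \<subseteq> {0..1} \<times> {0..1}" for g
    proof (rule \<kappa>)
      show "pathin X (\<lambda>u. H (g u))" by (rule pathin_square [OF H g])
      have "continuous_map ?I (top_of_set ({0..1} \<times> {0..1})) g"
        using g by (simp add: image_subset_iff_funcset)
      then show "framing \<A> ?I (\<lambda>u. H (g u)) (\<lambda>u. s (g u))"
        by (rule framing_compose [OF s])
    qed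
    have "\<kappa> (\<lambda>s. H (s, 0)) = q (s (0, 0)) \<otimes>\<^bsub>A\<^esub> inv\<^bsub>A\<^esub> q (s (1, 0))"
      "\<kappa> (\<lambda>s. H (1, s)) = q (s (1, 0)) \<otimes>\<^bsub>A\<^esub> inv\<^bsub>A\<^esub> q (s (1, 1))"
      "\<kappa> (\<lambda>s. H (s, s)) = q (s (0, 0)) \<otimes>\<^bsub>A\<^esub> inv\<^bsub>A\<^esub> q (s (1, 1))"
      by (rule edge; auto intro!: continuous_intros)+
    moreover have "s (0, 0) \<in> carrier G" "s (1, 0) \<in> carrier G" "s (1, 1) \<in> carrier G"
      using framing_in [OF s] by auto
    ultimately show "\<kappa> (\<lambda>s. H (s, 0)) \<otimes>\<^bsub>A\<^esub> \<kappa> (\<lambda>s. H (1, s)) = \<kappa> (\<lambda>s. H (s, s))"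
      by (simp add: A.m_assoc) (simp flip: A.m_assoc)
  qed
  moreover have "holonomy X \<A> \<kappa>"
    unfolding holonomy_def
  proof (intro conjI A allI impI)
    fix p s assume p: "pathin X p" and s: "framing \<A> ?I p s"
    then show "q (s 0) = \<kappa> p \<otimes>\<^bsub>A\<^esub> q (s 1)"
      using \<kappa> [OF p s] framing_in [OF s, of 0] framing_in [OF s, of 1] by (simp add: A.m_assoc)
  qed
  ultimately show ?thesis by blast
qed

text \<open>A relation and not a function, because \<kappa> depends on the chosen points of the
  fibres.\<close>

definition bundle_cocycle :: "'m topology \<Rightarrow> ('e, 'g, 'm) gbundle \<Rightarrow> ((real \<Rightarrow> 'm) \<Rightarrow> 'a) \<Rightarrow> bool" where
  "bundle_cocycle M P \<kappa> \<longleftrightarrow> path_cocycle M \<kappa> \<and> (\<exists>e. fibre_points M P e \<and> holonomy M (bundle_atlas M P e) \<kappa>)"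

text \<open>The 0-cochain \<open>b\<close> is a bare function on points; the relation is written
  without inverses.\<close>

definition cohomologous :: "'m topology \<Rightarrow> ((real \<Rightarrow> 'm) \<Rightarrow> 'a) \<Rightarrow> ((real \<Rightarrow> 'm) \<Rightarrow> 'a) \<Rightarrow> bool" where
  "cohomologous M \<kappa> \<kappa>' \<longleftrightarrow>
     (\<exists>b. b ` topspace M \<subseteq> carrier A \<and> (\<forall>p. pathin M p \<longrightarrow> \<kappa>' p \<otimes>\<^bsub>A\<^esub> b (p 1) = b (p 0) \<otimes>\<^bsub>A\<^esub> \<kappa> p))"

lemma pathin_ends: "pathin M p \<Longrightarrow> p 0 \<in> topspace M" "pathin M p \<Longrightarrow> p 1 \<in> topspace M"
  unfolding pathin_def by (auto dest!: continuous_map_image_subset_topspace)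

lemma bundle_cocycle_exists:
  assumes P: "principal_bundle G T M P"
  shows "\<exists>\<kappa>. bundle_cocycle M P \<kappa>"
proof -
  obtain e where e: "fibre_points M P e" using fibre_points_exist [OF P] by blast
  then show ?thesis
    using holonomy_exists [OF atlas_bundle_atlas [OF P e]] unfolding bundle_cocycle_def by blast
qed

text \<open>The 0-cochain is the composite of \<open>q\<close> with the gauge function
  \<open>h\<close> of the equivalence: a framing \<open>s\<close> of the first bundle becomes the
  framing \<open>h \<otimes> s\<close> of the second, and the two holonomy relations are
  compared.\<close>

lemma equivalent_bundles_cohomologous:
  assumes P: "principal_bundle G T M P" and Q: "principal_bundle G T M Q" and eq: "equivalent_bundles G P Q"
    and \<kappa>: "bundle_cocycle M P \<kappa>" and \<kappa>': "bundle_cocycle M Q \<kappa>'"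
  shows "cohomologous M \<kappa> \<kappa>'"
proof -
  obtain e e' where e: "fibre_points M P e" "holonomy M (bundle_atlas M P e) \<kappa>"
    and e': "fibre_points M Q e'" "holonomy M (bundle_atlas M Q e') \<kappa>'"
    using \<kappa> \<kappa>' by (auto simp: bundle_cocycle_def)
  obtain h where h: "h ` topspace M \<subseteq> carrier G" "gauge_maps (bundle_atlas M P e) (bundle_atlas M Q e') h"
    using eq equivalence_gauge_maps [OF P Q e(1) e'(1)] unfolding equivalent_bundles_def by blast
  have "\<kappa>' p \<otimes>\<^bsub>A\<^esub> q (h (p 1)) = q (h (p 0)) \<otimes>\<^bsub>A\<^esub> \<kappa> p" if p: "pathin M p" for p
  proof -
    obtain s where s: "framing (bundle_atlas M P e) (top_of_set {0..1}) p s"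
      using framing_path [OF atlas_bundle_atlas [OF P e(1)] p] by blast
    have s': "framing (bundle_atlas M Q e') (top_of_set {0..1}) p (\<lambda>u. h (p u) \<otimes> s u)"
      using framing_gauge [OF atlas_bundle_atlas [OF P e(1)] atlas_bundle_atlas [OF Q e'(1)] h(2,1) _ s] p
      by (simp add: pathin_def)
    have i: "s 0 \<in> carrier G" "s 1 \<in> carrier G" "h (p 0) \<in> carrier G" "h (p 1) \<in> carrier G"
      using framing_in [OF s] h(1) pathin_ends [OF p] by auto
    have k: "\<kappa> p \<in> carrier A" "\<kappa>' p \<in> carrier A"
      using \<kappa> \<kappa>' p path_cocycle_in by (auto simp: bundle_cocycle_def)
    have "q (s 0) = \<kappa> p \<otimes>\<^bsub>A\<^esub> q (s 1)"
      using holonomy_path [OF e(2) p s] .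
    moreover have "q (h (p 0)) \<otimes>\<^bsub>A\<^esub> q (s 0) = \<kappa>' p \<otimes>\<^bsub>A\<^esub> (q (h (p 1)) \<otimes>\<^bsub>A\<^esub> q (s 1))"
      using holonomy_path [OF e'(2) p s'] i by (simp add: q_mult)
    ultimately have "(q (h (p 0)) \<otimes>\<^bsub>A\<^esub> \<kappa> p) \<otimes>\<^bsub>A\<^esub> q (s 1) = (\<kappa>' p \<otimes>\<^bsub>A\<^esub> q (h (p 1))) \<otimes>\<^bsub>A\<^esub> q (s 1)"
      using i k by (simp add: A.m_assoc)
    then show ?thesis
      using i k by simp
  qed
  then show ?thesis
    unfolding cohomologous_def using h(1) by (intro exI [of _ "\<lambda>x. q (h x)"]) auto
qed

text \<open>Near a point, \<open>h \<otimes> t\<close> is a chart \<open>t'\<close> of the second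
  bundle times the continuous function \<open>inv t' \<otimes> h \<otimes> t\<close>, and the action
  is continuous.\<close>

lemma frame_iso_gauge_maps:
  assumes A: "atlas M \<A>" and Q: "principal_bundle G T M Q" and e': "fibre_points M Q e'"
    and h: "frame_iso \<A> (bundle_atlas M Q e') M h"
  shows "gauge_maps \<A> (bundle_atlas M Q e') h"
proof -
  note B = atlas_bundle_atlas [OF Q e']
  have hin: "h x \<in> carrier G" if "x \<in> topspace M" for x
    using h that by (simp add: frame_iso_def)
  have "(U, \<lambda>x. h x \<otimes> t x) \<in> bundle_atlas M Q e'" if U: "(U, t) \<in> \<A>" for U t
  proof -
    note UM = openin_subset [OF atlas_open [OF A U]]
    have hc: "continuous_map (subtopology M (U \<inter> V)) T (\<lambda>x. inv (t' x) \<otimes> h x \<otimes> t x)"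
      if "(V, t') \<in> bundle_atlas M Q e'" for V t'
      using h U that unfolding frame_iso_def by blast
    have "continuous_map (subtopology M U) (total_space Q) (\<lambda>x. act Q (e' x) (h x \<otimes> t x))"
    proof (rule continuous_map_locally)
      fix x assume "x \<in> topspace (subtopology M U)"
      then have x: "x \<in> U" "x \<in> topspace M" by auto
      obtain V t' where V: "(V, t') \<in> bundle_atlas M Q e'" "x \<in> V"
        using atlas_chart [OF B x(2)] .
      have "continuous_map (subtopology M V) (total_space Q) (\<lambda>x. act Q (e' x) (t' x))"
        using V(1) by (simp add: bundle_atlas_def)
      then have "continuous_map (subtopology M (U \<inter> V)) (total_space Q) (\<lambda>x. act Q (e' x) (t' x))"
        by (rule continuous_map_from_subtopology_mono) auto
      then have "continuous_map (subtopology M (U \<inter> V)) (prod_topology (total_space Q) T) (\<lambda>x. (act Q (e' x) (t' x), inv (t' x) \<otimes> h x \<otimes> t x))"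
        using hc [OF V(1)] by (simp add: continuous_map_paired)
      from continuous_map_compose [OF this principal_bundle_continuous_action [OF TG Q]]
      have "continuous_map (subtopology M (U \<inter> V)) (total_space Q) (\<lambda>x. act Q (act Q (e' x) (t' x)) (inv (t' x) \<otimes> h x \<otimes> t x))"
        by (simp add: o_def)
      then have "continuous_map (subtopology M (U \<inter> V)) (total_space Q) (\<lambda>x. act Q (e' x) (h x \<otimes> t x))"
      proof (rule continuous_map_eq)
        fix y assume "y \<in> topspace (subtopology M (U \<inter> V))"
        then have y: "y \<in> U" "y \<in> V" "y \<in> topspace M" by auto
        have i: "t y \<in> carrier G" "t' y \<in> carrier G" "h y \<in> carrier G" "e' y \<in> topspace (total_space Q)"
          using atlas_in [OF A U y(1)] atlas_in [OF B V(1) y(2)] hin [OF y(3)] e' y(3) by (auto simp: fibre_points_def)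
        have "t' y \<otimes> (inv (t' y) \<otimes> h y \<otimes> t y) = h y \<otimes> t y"
          using i by (simp add: m_assoc) (simp flip: m_assoc)
        then show "act Q (act Q (e' y) (t' y)) (inv (t' y) \<otimes> h y \<otimes> t y) = act Q (e' y) (h y \<otimes> t y)"
          using principal_act(4) [OF Q i(4,2), of "inv (t' y) \<otimes> h y \<otimes> t y"] i by simp
      qed
      moreover have "openin (subtopology M U) (U \<inter> V)"
        using atlas_open [OF B V(1)] by (rule openin_subtopology_Int2)
      moreover have "subtopology (subtopology M U) (U \<inter> V) = subtopology M (U \<inter> V)"
        by (simp add: subtopology_subtopology)
      ultimately show "\<exists>W. openin (subtopology M U) W \<and> x \<in> W \<and>
          continuous_map (subtopology (subtopology M U) W) (total_space Q) (\<lambda>x. act Q (e' x) (h x \<otimes> t x))"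
        using x V(2) by (intro exI [of _ "U \<inter> V"]) auto
    qed
    then show ?thesis
      using atlas_open [OF A U] atlas_in [OF A U] hin UM by (auto simp: bundle_atlas_def)
  qed
  then show ?thesis by (auto simp: gauge_maps_def)
qed

lemma frame_iso_inverse:
  assumes A: "atlas M \<A>" and B: "atlas M \<B>" and h: "frame_iso \<A> \<B> M h"
  shows "frame_iso \<B> \<A> M (\<lambda>x. inv (h x))"
  unfolding frame_iso_def
proof (intro conjI ballI, goal_cases)
  case (1 x)
  then show ?case using h by (simp add: frame_iso_def)
next
  case (2 x)
  then show ?case using h by (simp add: frame_iso_def q_inv)
next
  case (3 z)
  show ?case
  proof clarify
    fix V t' U t assume z: "z = (V, t')" and U: "(U, t) \<in> \<A>"
    have V: "(V, t') \<in> \<B>" using 3 z by simp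
    have "continuous_map (subtopology M (U \<inter> V)) T (\<lambda>x. inv (t' x) \<otimes> h x \<otimes> t x)"
      using h U V unfolding frame_iso_def by blast
    from continuous_map_inverse [OF this]
    have "continuous_map (subtopology M (V \<inter> U)) T (\<lambda>x. inv (inv (t' x) \<otimes> h x \<otimes> t x))"
      by (simp add: Int_commute)
    then show "continuous_map (subtopology M (V \<inter> U)) T (\<lambda>x. inv (t x) \<otimes> inv (h x) \<otimes> t' x)"
    proof (rule continuous_map_eq)
      fix x assume "x \<in> topspace (subtopology M (V \<inter> U))"
      then have x: "x \<in> U" "x \<in> V" "x \<in> topspace M" by auto
      then have "h x \<in> carrier G" using h by (simp add: frame_iso_def)
      then show "inv (inv (t' x) \<otimes> h x \<otimes> t x) = inv (t x) \<otimes> inv (h x) \<otimes> t' x"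
        using atlas_in [OF A U x(1)] atlas_in [OF B V x(2)] by (simp add: inv_mult_group m_assoc)
    qed
  qed
qed

text \<open>A pointwise lift of the 0-cochain along \<open>q\<close> moves the fibre points of the
  second bundle. Afterwards both bundles have literally the same \<kappa>, and
  \<open>exists_frame_iso\<close> applies.\<close>

lemma cohomologous_equivalent_bundles:
  assumes M: "CW_complex_of_dim M 2" and P: "principal_bundle G T M P" and Q: "principal_bundle G T M Q"
    and \<kappa>: "bundle_cocycle M P \<kappa>" and \<kappa>': "bundle_cocycle M Q \<kappa>'" and co: "cohomologous M \<kappa> \<kappa>'"
  shows "equivalent_bundles G P Q"
proof -
  obtain e e' where e: "fibre_points M P e" "holonomy M (bundle_atlas M P e) \<kappa>"
    and e': "fibre_points M Q e'" "holonomy M (bundle_atlas M Q e') \<kappa>'"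
    using \<kappa> \<kappa>' by (auto simp: bundle_cocycle_def)
  obtain b where b: "b ` topspace M \<subseteq> carrier A" "\<And>p. pathin M p \<Longrightarrow> \<kappa>' p \<otimes>\<^bsub>A\<^esub> b (p 1) = b (p 0) \<otimes>\<^bsub>A\<^esub> \<kappa> p"
    using co by (auto simp: cohomologous_def)
  have "\<exists>g. g \<in> carrier G \<and> q g = b x" if "x \<in> topspace M" for x
    using q_lift [of "b x"] b(1) that by auto
  then obtain g where g: "\<And>x. x \<in> topspace M \<Longrightarrow> g x \<in> carrier G" "\<And>x. x \<in> topspace M \<Longrightarrow> q (g x) = b x"
    by metis
  have gM: "g ` topspace M \<subseteq> carrier G" using g by blast
  define e'' where "e'' x = act Q (e' x) (g x)" for x
  have e'': "fibre_points M Q e''" and gauge: "gauge_maps (bundle_atlas M Q e'') (bundle_atlas M Q e') g"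
    using gauge_maps_change_points [OF Q e'(1) gM] by (simp_all add: e''_def [abs_def])
  note A = atlas_bundle_atlas [OF P e(1)] and B = atlas_bundle_atlas [OF Q e'(1)] and C = atlas_bundle_atlas [OF Q e'']
  have k: "\<kappa> p \<in> carrier A" "\<kappa>' p \<in> carrier A" if "pathin M p" for p
    using \<kappa> \<kappa>' that path_cocycle_in by (auto simp: bundle_cocycle_def)
  have "holonomy M (bundle_atlas M Q e'') \<kappa>"
    unfolding holonomy_def
  proof (intro conjI C allI impI)
    fix p s assume p: "pathin M p" and s: "framing (bundle_atlas M Q e'') (top_of_set {0..1}) p s"
    have s': "framing (bundle_atlas M Q e') (top_of_set {0..1}) p (\<lambda>u. g (p u) \<otimes> s u)"
      using framing_gauge [OF C B gauge gM _ s] p by (simp add: pathin_def)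
    have i: "s 0 \<in> carrier G" "s 1 \<in> carrier G" "g (p 0) \<in> carrier G" "g (p 1) \<in> carrier G"
      "q (g (p 0)) = b (p 0)" "q (g (p 1)) = b (p 1)"
      using framing_in [OF s] g pathin_ends [OF p] by auto
    then have bi: "b (p 0) \<in> carrier A" "b (p 1) \<in> carrier A" by (metis q_in)+
    have "q (g (p 0) \<otimes> s 0) = \<kappa>' p \<otimes>\<^bsub>A\<^esub> q (g (p 1) \<otimes> s 1)"
      using holonomy_path [OF e'(2) p s'] .
    then have "b (p 0) \<otimes>\<^bsub>A\<^esub> q (s 0) = (\<kappa>' p \<otimes>\<^bsub>A\<^esub> b (p 1)) \<otimes>\<^bsub>A\<^esub> q (s 1)"
      using i k [OF p] bi by (simp add: q_mult A.m_assoc)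
    also have "\<dots> = b (p 0) \<otimes>\<^bsub>A\<^esub> (\<kappa> p \<otimes>\<^bsub>A\<^esub> q (s 1))"
      using b(2) [OF p] i k [OF p] bi by (simp add: A.m_assoc)
    finally show "q (s 0) = \<kappa> p \<otimes>\<^bsub>A\<^esub> q (s 1)"
      using i k [OF p] bi by simp
  qed
  then obtain h where h: "frame_iso (bundle_atlas M P e) (bundle_atlas M Q e'') M h"
    using exists_frame_iso [OF M e(2)] k(1) by blast
  show ?thesis
  proof (rule gauge_maps_equivalent [OF P Q e(1) e''])
    show "gauge_maps (bundle_atlas M P e) (bundle_atlas M Q e'') h"
      by (rule frame_iso_gauge_maps [OF A Q e'' h])
    show "gauge_maps (bundle_atlas M Q e'') (bundle_atlas M P e) (\<lambda>x. inv (h x))"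
      by (rule frame_iso_gauge_maps [OF C P e(1) frame_iso_inverse [OF A C h]])
    show "h ` topspace M \<subseteq> carrier G"
      using h by (auto simp: frame_iso_def)
  qed
qed

text \<open>The constructed atlas is parallel chart by chart. A framing for the full atlas of the
  resulting bundle is one for the constructed atlas, so its holonomy is \<kappa> by
  \<open>parallel_framing\<close>.\<close>

lemma bundle_with_cocycle_exists:
  fixes M :: "'m topology"
  assumes M: "CW_complex_of_dim M 2" and \<kappa>: "path_cocycle M \<kappa>"
  shows "\<exists>P :: ('m \<times> 'g, 'g, 'm) gbundle. principal_bundle G T M P \<and> bundle_cocycle M P \<kappa>"
proof -
  obtain \<A> where par: "parallel_atlas M \<kappa> \<A>"
    using exists_parallel_atlas [OF M \<kappa>] by blast
  then have A: "atlas M \<A>" by (simp add: parallel_atlas_def)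
  let ?P = "atlas_bundle M \<A>"
  let ?B = "bundle_atlas M ?P (\<lambda>x. (x, \<one>))"
  note P = principal_atlas_bundle [OF A]
  have "holonomy M ?B \<kappa>"
    unfolding holonomy_def
  proof (intro conjI allI impI atlas_bundle_atlas [OF P fibre_points_atlas_bundle [OF A]])
    fix p s assume p: "pathin M p" and "framing ?B (top_of_set {0..1}) p s"
    then have "framing \<A> (top_of_set {0..1}) p s"
      using atlas_subset_bundle_atlas [OF A] unfolding framing_def by blast
    then show "q (s 0) = \<kappa> p \<otimes>\<^bsub>A\<^esub> q (s 1)"
      by (rule parallel_framing [OF \<kappa> par p])
  qed
  then show ?thesis
    using P \<kappa> fibre_points_atlas_bundle [OF A] unfolding bundle_cocycle_def by blast
qed

text \<open>The constant section at the unit is a global chart, so a framing along a path is itself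
  continuous up to inversion and its image under \<open>q\<close> is constant.\<close>

lemma trivial_bundle_cocycle:
  "bundle_cocycle M (trivial_bundle G T M) (\<lambda>_. \<one>\<^bsub>A\<^esub>)"
proof -
  let ?P = "trivial_bundle G T M"
  let ?B = "bundle_atlas M ?P (\<lambda>x. (x, \<one>))"
  have pts: "fibre_points M ?P (\<lambda>x. (x, \<one>))"
    by (simp add: fibre_points_def trivial_bundle_def topspace_T)
  have P: "principal_bundle G T M ?P"
    by (rule principal_bundle_trivial [OF TG])
  note B = atlas_bundle_atlas [OF P pts]
  have U: "(topspace M, \<lambda>_. \<one>) \<in> ?B"
    by (auto simp: bundle_atlas_def trivial_bundle_def subtopology_topspace continuous_map_pairwise o_def topspace_T)
  have "path_cocycle M (\<lambda>_. \<one>\<^bsub>A\<^esub>)"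
    by (simp add: path_cocycle_def)
  moreover have "holonomy M ?B (\<lambda>_. \<one>\<^bsub>A\<^esub>)"
    unfolding holonomy_def
  proof (intro conjI allI impI B)
    fix p s assume p: "pathin M p" and s: "framing ?B (top_of_set {0..1}) p s"
    have pM: "p u \<in> topspace M" if "u \<in> {0..1}" for u
      using p that continuous_map_image_subset_topspace by (fastforce simp: pathin_def)
    then have "continuous_map (top_of_set {0..1}) T (\<lambda>u. inv (s u) \<otimes> \<one>)"
      using framing_continuous [OF s U] by (simp add: subtopology_subtopology Int_absorb2 subset_eq flip: atLeastAtMost_iff)
    moreover have "connected_space (top_of_set {0..1::real})"
      by (rule connected_space_top_of_set) simp
    ultimately have "q (inv (s 0) \<otimes> \<one>) = q (inv (s 1) \<otimes> \<one>)"
      by (rule q_constant) auto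
    then show "q (s 0) = \<one>\<^bsub>A\<^esub> \<otimes>\<^bsub>A\<^esub> q (s 1)"
      using framing_in [OF s, of 0] framing_in [OF s, of 1] by (simp add: q_inv A.inv_eq_1_iff) (metis A.inv_inv q_in)
  qed
  ultimately show ?thesis
    using pts unfolding bundle_cocycle_def by blast
qed

end

section \<open>Path cocycles and singular cohomology\<close>

text \<open>Barycentric coordinates on the 1-simplex, running from vertex 0 to vertex 1; hence face
  1 is the start of a path and face 0 its end.\<close>

definition edge_point :: "real \<Rightarrow> nat \<Rightarrow> real" where
  "edge_point t = (\<lambda>i. if i = 0 then 1 - t else if i = 1 then t else 0)"

definition path_of_simplex :: "((nat \<Rightarrow> real) \<Rightarrow> 'm) \<Rightarrow> real \<Rightarrow> 'm" where
  "path_of_simplex \<sigma> t = \<sigma> (edge_point t)"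

text \<open>Singular simplices are extensional functions, hence the restriction. It also makes the
  simplex depend on the path over [0, 1] only.\<close>

definition simplex_of_path :: "(real \<Rightarrow> 'm) \<Rightarrow> (nat \<Rightarrow> real) \<Rightarrow> 'm" where
  "simplex_of_path p = restrict (\<lambda>x. p (x 1)) (standard_simplex 1)"

lemma standard_simplex_eq: "subtopology (powertop_real UNIV) (standard_simplex n) = top_of_set (standard_simplex n)"
  by (simp add: euclidean_product_topology)

lemma standard_simplex_1:
  "x \<in> standard_simplex 1 \<longleftrightarrow> (\<exists>t\<in>{0..1}. x = edge_point t)"
proof
  assume x: "x \<in> standard_simplex 1"
  then have "x 0 + x 1 = 1" "\<forall>i>1. x i = 0" "x 1 \<in> {0..1}"
    by (auto simp: standard_simplex_def)
  moreover from this have "x = edge_point (x 1)"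
    by (auto simp: edge_point_def fun_eq_iff not_less)
  ultimately show "\<exists>t\<in>{0..1}. x = edge_point t" by blast
qed (auto simp: standard_simplex_def edge_point_def)

lemma edge_point_1 [simp]: "edge_point t 1 = t" "edge_point t (Suc 0) = t"
  by (simp_all add: edge_point_def)

lemma pathin_path_of_simplex:
  assumes "singular_simplex 1 M \<sigma>"
  shows "pathin M (path_of_simplex \<sigma>)"
proof -
  have "continuous_on {0..1} edge_point"
  proof (rule continuous_on_coordinatewise_then_product)
    fix i
    show "continuous_on {0..1} (\<lambda>t. edge_point t i)"
      unfolding edge_point_def by (cases "i = 0"; cases "i = 1") (auto intro!: continuous_intros)
  qed
  then have "continuous_map (top_of_set {0..1}) (top_of_set (standard_simplex 1)) edge_point"
    using standard_simplex_1 by auto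
  moreover have "continuous_map (top_of_set (standard_simplex 1)) M \<sigma>"
    using assms unfolding singular_simplex_def standard_simplex_eq by blast
  ultimately have "continuous_map (top_of_set {0..1}) M (\<sigma> \<circ> edge_point)"
    by (rule continuous_map_compose)
  then show ?thesis
    by (simp add: pathin_def path_of_simplex_def[abs_def] o_def)
qed

lemma singular_simplex_of_path:
  assumes "pathin M p"
  shows "singular_simplex 1 M (simplex_of_path p)"
proof -
  have "continuous_map (top_of_set (standard_simplex 1)) (top_of_set {0..1}) (\<lambda>x. x 1)"
    by (auto simp: standard_simplex_def intro!: continuous_on_coordinate [OF continuous_on_id])
  then have "continuous_map (top_of_set (standard_simplex 1)) M (p \<circ> (\<lambda>x. x 1))"
    using assms unfolding pathin_def by (rule continuous_map_compose)
  then have "continuous_map (top_of_set (standard_simplex 1)) M (simplex_of_path p)"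
    by (rule continuous_map_eq) (simp add: simplex_of_path_def)
  then show ?thesis
    by (simp add: singular_simplex_def standard_simplex_eq simplex_of_path_def)
qed

lemma path_of_simplex_of_path: "t \<in> {0..1} \<Longrightarrow> path_of_simplex (simplex_of_path p) t = p t"
  using standard_simplex_1 [of "edge_point t"] by (auto simp: path_of_simplex_def simplex_of_path_def)

lemma simplex_of_path_of_simplex:
  assumes "singular_simplex 1 M \<sigma>"
  shows "simplex_of_path (path_of_simplex \<sigma>) = \<sigma>"
proof
  fix x
  have "\<sigma> \<in> extensional (standard_simplex 1)"
    using assms by (simp add: singular_simplex_def)
  then show "simplex_of_path (path_of_simplex \<sigma>) x = \<sigma> x"
    using standard_simplex_1 [of x]
    by (cases "x \<in> standard_simplex 1") (auto simp: simplex_of_path_def path_of_simplex_def extensional_def)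
qed

lemma simplex_of_path_cong:
  "(\<And>t. t \<in> {0..1} \<Longrightarrow> p t = p' t) \<Longrightarrow> simplex_of_path p = simplex_of_path p'"
  unfolding simplex_of_path_def by (rule restrict_ext) (auto simp: standard_simplex_def)

lemma simplical_face_edge_point:
  "simplical_face 0 (edge_point t) = (\<lambda>i. if i = 1 then 1 - t else if i = 2 then t else 0)"
  "simplical_face 1 (edge_point t) = (\<lambda>i. if i = 0 then 1 - t else if i = 2 then t else 0)"
  "simplical_face 2 (edge_point t) = (\<lambda>i. if i = 0 then 1 - t else if i = 1 then t else 0)"
  by (auto simp: simplical_face_def edge_point_def fun_eq_iff)

lemma path_of_face:
  assumes "t \<in> {0..1}"
  shows "path_of_simplex (singular_face 2 k \<tau>) t = \<tau> (simplical_face k (edge_point t))"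
  using assms standard_simplex_1 [of "edge_point t"] by (auto simp: path_of_simplex_def singular_face_def)

lemma singular_simplex_of_face:
  assumes "singular_simplex 2 M \<tau>" "k \<le> 2"
  shows "singular_simplex 1 M (singular_face 2 k \<tau>)"
  using singular_simplex_singular_face [OF assms(1) _ assms(2)] by simp

definition point_simplex :: "'m \<Rightarrow> (nat \<Rightarrow> real) \<Rightarrow> 'm" where
  "point_simplex x = restrict (\<lambda>_. x) (standard_simplex 0)"

lemma singular_point_simplex: "x \<in> topspace M \<Longrightarrow> singular_simplex 0 M (point_simplex x)"
  by (auto simp: singular_simplex_def point_simplex_def intro: continuous_map_eq [of _ _ "\<lambda>_. x"])

lemma singular_simplex_0:
  assumes "singular_simplex 0 M \<sigma>"
  shows "\<exists>x\<in>topspace M. \<sigma> = point_simplex x"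
proof -
  let ?b = "\<lambda>j. if j = 0 then 1 else (0::real)"
  have "\<sigma> ?b \<in> topspace M"
    using assms unfolding singular_simplex_def
    by (elim conjE, drule_tac continuous_map_image_subset_topspace) (auto simp: standard_simplex_0)
  moreover have "\<sigma> = point_simplex (\<sigma> ?b)"
  proof
    fix x
    show "\<sigma> x = point_simplex (\<sigma> ?b) x"
      using assms by (cases "x = ?b") (auto simp: singular_simplex_def point_simplex_def standard_simplex_0 extensional_def)
  qed
  ultimately show ?thesis by blast
qed

lemma singular_face_1:
  "singular_face 1 0 \<sigma> = point_simplex (path_of_simplex \<sigma> 1)"
  "singular_face 1 1 \<sigma> = point_simplex (path_of_simplex \<sigma> 0)"
proof -
  have "simplical_face 0 (\<lambda>j. if j = 0 then 1 else (0::real)) = edge_point 1"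
    "simplical_face 1 (\<lambda>j. if j = 0 then 1 else (0::real)) = edge_point 0"
    by (auto simp: simplical_face_def edge_point_def fun_eq_iff)
  then show "singular_face 1 0 \<sigma> = point_simplex (path_of_simplex \<sigma> 1)"
    "singular_face 1 1 \<sigma> = point_simplex (path_of_simplex \<sigma> 0)"
    unfolding singular_face_def point_simplex_def path_of_simplex_def
    by (auto simp: standard_simplex_0 intro!: restrict_ext)
qed

lemma chain_boundary_1:
  "chain_boundary 1 (frag_of \<sigma>) = frag_of (point_simplex (path_of_simplex \<sigma> 1)) - frag_of (point_simplex (path_of_simplex \<sigma> 0))"
  using singular_face_1 [of \<sigma>] by (simp add: chain_boundary_of frag_cmul_minus_one)

lemma chain_boundary_2:
  "chain_boundary 2 (frag_of \<tau>) = frag_of (singular_face 2 0 \<tau>) - frag_of (singular_face 2 1 \<tau>) + frag_of (singular_face 2 2 \<tau>)"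
  by (simp add: chain_boundary_of numeral_2_eq_2 frag_cmul_minus_one)

section \<open>Singular cochains, cocycles and coboundaries in low degree\<close>

locale cochains = comm_group A for A :: "'a monoid" (structure)
begin

lemma cochain_add:
  assumes "\<phi> \<in> carrier (cochain_group n X A)" "singular_chain n X c" "singular_chain n X d"
  shows "\<phi> (c + d) = \<phi> c \<otimes> \<phi> d"
  using assms hom_mult [of \<phi> "chain_group n X" A c d] by (simp add: cochain_group_def)

lemma cochain_in:
  assumes "\<phi> \<in> carrier (cochain_group n X A)" "singular_chain n X c"
  shows "\<phi> c \<in> carrier A"
  using assms hom_in_carrier [of \<phi> "chain_group n X" A c] by (simp add: cochain_group_def)

lemma cochain_0:
  assumes "\<phi> \<in> carrier (cochain_group n X A)"
  shows "\<phi> 0 = \<one>"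
  using assms hom_one [of \<phi> "chain_group n X" A] is_group by (simp add: cochain_group_def)

lemma cochain_diff:
  assumes "\<phi> \<in> carrier (cochain_group n X A)" "singular_chain n X c" "singular_chain n X d"
  shows "\<phi> (c - d) = \<phi> c \<otimes> inv (\<phi> d)"
proof -
  have "\<phi> (c - d) \<otimes> \<phi> d = \<phi> c"
    using cochain_add [OF assms(1) singular_chain_diff [OF assms(2,3)] assms(3)] by simp
  then show ?thesis
    using cochain_in [OF assms(1)] assms(2,3) singular_chain_diff [OF assms(2,3)] by (metis inv_solve_right)
qed

text \<open>Chains are generated by simplices, and off the chains both functions are undefined by
  extensionality.\<close>

lemma cochain_ext:
  assumes "\<phi> \<in> carrier (cochain_group n X A)" "\<psi> \<in> carrier (cochain_group n X A)"
    and eq: "\<And>\<sigma>. singular_simplex n X \<sigma> \<Longrightarrow> \<phi> (frag_of \<sigma>) = \<psi> (frag_of \<sigma>)"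
  shows "\<phi> = \<psi>"
proof
  fix c
  show "\<phi> c = \<psi> c"
  proof (cases "singular_chain n X c")
    case True
    then have "Poly_Mapping.keys c \<subseteq> singular_simplex_set n X"
      by (simp add: singular_chain_def)
    then show ?thesis
    proof (induction c rule: free_Abelian_group_induct [consumes 1])
      case 1
      show ?case using cochain_0 [OF assms(1)] cochain_0 [OF assms(2)] by simp
    next
      case (2 x y)
      then show ?case
        using cochain_diff [OF assms(1), of x y] cochain_diff [OF assms(2), of x y] by (simp add: singular_chain_def)
    qed (use eq in auto)
  next
    case False
    then show ?thesis
      using assms(1,2) by (auto simp: cochain_group_def extensional_def)
  qed
qed

lemma cochain_exists:
  assumes "\<And>\<sigma>. singular_simplex n X \<sigma> \<Longrightarrow> f \<sigma> \<in> carrier A"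
  shows "\<exists>\<phi>\<in>carrier (cochain_group n X A). \<forall>\<sigma>. singular_simplex n X \<sigma> \<longrightarrow> \<phi> (frag_of \<sigma>) = f \<sigma>"
proof -
  obtain h where h: "h \<in> hom (chain_group n X) A" "\<And>\<sigma>. singular_simplex n X \<sigma> \<Longrightarrow> h (frag_of \<sigma>) = f \<sigma>"
    using free_Abelian_group_universal [of f "singular_simplex_set n X"] assms
    unfolding chain_group_def by (metis image_subsetI mem_Collect_eq)
  have "restrict h (singular_chain_set n X) \<in> hom (chain_group n X) A"
    using h(1) by (auto simp: hom_def singular_chain_add)
  then show ?thesis
    using h(2) by (intro bexI [of _ "restrict h (singular_chain_set n X)"])
      (auto simp: cochain_group_def singular_chain_of)
qed

lemma cochain_group_group: "group (cochain_group n X A)"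
  using comm_group_cochain_group [OF comm_group_axioms, of n X] by (simp add: comm_group_def)

lemma coboundary_group_hom: "group_hom (cochain_group n X A) (cochain_group (Suc n) X A) (coboundary n X)"
  by (simp add: group_hom_def group_hom_axioms_def cochain_group_group coboundary_hom)

lemma subgroup_cocycles: "subgroup (cocycles n X A) (cochain_group n X A)"
  using group_hom.subgroup_kernel [OF coboundary_group_hom [of n]] by (simp add: kernel_def cocycles_def)

lemma mult_cochain_group:
  "singular_chain n X c \<Longrightarrow> (\<phi> \<otimes>\<^bsub>cochain_group n X A\<^esub> \<psi>) c = \<phi> c \<otimes> \<psi> c"
  by (simp add: cochain_group_def)

text \<open>The faces 2, 0 and 1 of a 2-simplex are its edges 01, 12 and 02; solved for the edge 02,
  the cocycle condition takes the shape of the triangle relation in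
  \<open>path_cocycle\<close>.\<close>

lemma cocycles_1_iff:
  "\<phi> \<in> cocycles 1 X A \<longleftrightarrow> \<phi> \<in> carrier (cochain_group 1 X A) \<and>
    (\<forall>\<tau>. singular_simplex 2 X \<tau> \<longrightarrow>
      \<phi> (frag_of (singular_face 2 2 \<tau>)) \<otimes> \<phi> (frag_of (singular_face 2 0 \<tau>)) = \<phi> (frag_of (singular_face 2 1 \<tau>)))"
proof (cases "\<phi> \<in> carrier (cochain_group 1 X A)")
  case True
  have ch: "singular_chain 1 X (frag_of (singular_face 2 k \<tau>))" if "singular_simplex 2 X \<tau>" "k \<le> 2" for k \<tau>
    using singular_simplex_of_face [OF that] by (simp add: singular_chain_of)
  have "coboundary 1 X \<phi> (frag_of \<tau>) = \<one> \<longleftrightarrow>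
      \<phi> (frag_of (singular_face 2 2 \<tau>)) \<otimes> \<phi> (frag_of (singular_face 2 0 \<tau>)) = \<phi> (frag_of (singular_face 2 1 \<tau>))"
    if \<tau>: "singular_simplex 2 X \<tau>" for \<tau>
  proof -
    let ?f = "\<lambda>k. \<phi> (frag_of (singular_face 2 k \<tau>))"
    have f: "?f k \<in> carrier A" if "k \<le> 2" for k
      using cochain_in [OF True ch [OF \<tau> that]] .
    have "coboundary 1 X \<phi> (frag_of \<tau>) = \<phi> (chain_boundary 2 (frag_of \<tau>))"
      using \<tau> by (simp add: coboundary_def singular_chain_of numeral_2_eq_2)
    also have "\<dots> = ?f 0 \<otimes> inv (?f 1) \<otimes> ?f 2"
      unfolding chain_boundary_2
      using ch [OF \<tau>] by (simp only: cochain_add [OF True] cochain_diff [OF True] singular_chain_diff le_numeral_simps zero_le one_le_numeral order_refl)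
    also have "\<dots> = (?f 2 \<otimes> ?f 0) \<otimes> inv (?f 1)"
      using f [of 0] f [of 1] f [of 2] by (simp add: m_ac)
    finally show ?thesis
      using f [of 0] f [of 1] f [of 2] by (metis inv_solve_right' l_one m_closed one_closed one_le_numeral order_refl zero_le)
  qed
  moreover have "coboundary 1 X \<phi> = \<one>\<^bsub>cochain_group (Suc 1) X A\<^esub> \<longleftrightarrow>
      (\<forall>\<tau>. singular_simplex 2 X \<tau> \<longrightarrow> coboundary 1 X \<phi> (frag_of \<tau>) = \<one>)"
  proof
    assume eq: "coboundary 1 X \<phi> = \<one>\<^bsub>cochain_group (Suc 1) X A\<^esub>"
    show "\<forall>\<tau>. singular_simplex 2 X \<tau> \<longrightarrow> coboundary 1 X \<phi> (frag_of \<tau>) = \<one>"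
      unfolding eq by (simp add: cochain_group_def singular_chain_of numeral_2_eq_2)
  next
    assume all: "\<forall>\<tau>. singular_simplex 2 X \<tau> \<longrightarrow> coboundary 1 X \<phi> (frag_of \<tau>) = \<one>"
    show "coboundary 1 X \<phi> = \<one>\<^bsub>cochain_group (Suc 1) X A\<^esub>"
    proof (rule cochain_ext)
      show "coboundary 1 X \<phi> \<in> carrier (cochain_group (Suc 1) X A)"
        using group_hom.hom_closed [OF coboundary_group_hom True] .
      show "\<one>\<^bsub>cochain_group (Suc 1) X A\<^esub> \<in> carrier (cochain_group (Suc 1) X A)"
        using monoid.one_closed [OF group.is_monoid [OF cochain_group_group]] .
      fix \<sigma> assume "singular_simplex (Suc 1) X \<sigma>"
      then show "coboundary 1 X \<phi> (frag_of \<sigma>) = \<one>\<^bsub>cochain_group (Suc 1) X A\<^esub> (frag_of \<sigma>)"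
        using all by (simp add: cochain_group_def singular_chain_of numeral_2_eq_2)
    qed
  qed
  ultimately show ?thesis
    using True by (auto simp: cocycles_def)
qed (simp add: cocycles_def)

text \<open>A singular 0-simplex is a point, so a 0-cochain amounts to a function \<open>b\<close>
  on the points of the space.\<close>

lemma coboundaries_1_iff:
  "\<psi> \<in> coboundaries 1 X A \<longleftrightarrow> \<psi> \<in> carrier (cochain_group 1 X A) \<and>
    (\<exists>b. b ` topspace X \<subseteq> carrier A \<and> (\<forall>\<sigma>. singular_simplex 1 X \<sigma> \<longrightarrow>
      \<psi> (frag_of \<sigma>) = b (path_of_simplex \<sigma> 1) \<otimes> inv (b (path_of_simplex \<sigma> 0))))"
proof -
  have eq: "coboundaries 1 X A = coboundary 0 X ` carrier (cochain_group 0 X A)"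
    by (simp add: coboundaries_def)
  have ends: "path_of_simplex \<sigma> 0 \<in> topspace X" "path_of_simplex \<sigma> 1 \<in> topspace X" if "singular_simplex 1 X \<sigma>" for \<sigma>
    using pathin_path_of_simplex [OF that] continuous_map_image_subset_topspace by (fastforce simp: pathin_def)+
  have pt: "singular_chain 0 X (frag_of (point_simplex x))" if "x \<in> topspace X" for x
    using singular_point_simplex [OF that] by (simp add: singular_chain_of)
  have val: "coboundary 0 X \<beta> (frag_of \<sigma>) = \<beta> (frag_of (point_simplex (path_of_simplex \<sigma> 1))) \<otimes> inv (\<beta> (frag_of (point_simplex (path_of_simplex \<sigma> 0))))"
    if \<beta>: "\<beta> \<in> carrier (cochain_group 0 X A)" and \<sigma>: "singular_simplex 1 X \<sigma>" for \<beta> \<sigma>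
  proof -
    have "coboundary 0 X \<beta> (frag_of \<sigma>) = \<beta> (chain_boundary 1 (frag_of \<sigma>))"
      using \<sigma> by (simp add: coboundary_def singular_chain_of)
    then show ?thesis
      unfolding chain_boundary_1 using cochain_diff [OF \<beta> pt [OF ends(2) [OF \<sigma>]] pt [OF ends(1) [OF \<sigma>]]] by simp
  qed
  show ?thesis
  proof (intro iffI conjI)
    assume "\<psi> \<in> coboundaries 1 X A"
    then obtain \<beta> where \<beta>: "\<beta> \<in> carrier (cochain_group 0 X A)" "\<psi> = coboundary 0 X \<beta>"
      unfolding eq by blast
    show "\<psi> \<in> carrier (cochain_group 1 X A)"
      using group_hom.hom_closed [OF coboundary_group_hom \<beta>(1)] \<beta>(2) by simp
    show "\<exists>b. b ` topspace X \<subseteq> carrier A \<and> (\<forall>\<sigma>. singular_simplex 1 X \<sigma> \<longrightarrow>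
      \<psi> (frag_of \<sigma>) = b (path_of_simplex \<sigma> 1) \<otimes> inv (b (path_of_simplex \<sigma> 0)))"
      using val [OF \<beta>(1)] cochain_in [OF \<beta>(1) pt] \<beta>(2)
      by (intro exI [of _ "\<lambda>x. \<beta> (frag_of (point_simplex x))"]) auto
  next
    assume "\<psi> \<in> carrier (cochain_group 1 X A) \<and>
    (\<exists>b. b ` topspace X \<subseteq> carrier A \<and> (\<forall>\<sigma>. singular_simplex 1 X \<sigma> \<longrightarrow>
      \<psi> (frag_of \<sigma>) = b (path_of_simplex \<sigma> 1) \<otimes> inv (b (path_of_simplex \<sigma> 0))))"
    then obtain b where \<psi>: "\<psi> \<in> carrier (cochain_group 1 X A)" and b: "b ` topspace X \<subseteq> carrier A"
      and \<psi>b: "\<And>\<sigma>. singular_simplex 1 X \<sigma> \<Longrightarrow> \<psi> (frag_of \<sigma>) = b (path_of_simplex \<sigma> 1) \<otimes> inv (b (path_of_simplex \<sigma> 0))"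
      by blast
    \<comment> \<open>Transports \<open>b\<close> from points to 0-simplices; the choice is
      determined because distinct points give distinct simplices.\<close>
    define b' where "b' \<sigma> = b (SOME x. \<sigma> = point_simplex x)" for \<sigma>
    have inj: "x = y" if "point_simplex x = point_simplex y" for x y :: 'c
      using fun_cong [OF that, of "\<lambda>j. if j = 0 then 1 else 0"] by (simp add: point_simplex_def)
    have b': "b' (point_simplex x) = b x" for x
      unfolding b'_def using inj by (metis (mono_tags, lifting) someI_ex)
    have "b' \<sigma> \<in> carrier A" if "singular_simplex 0 X \<sigma>" for \<sigma>
      using singular_simplex_0 [OF that] b b' by auto
    then obtain \<beta> where \<beta>: "\<beta> \<in> carrier (cochain_group 0 X A)" "\<And>\<sigma>. singular_simplex 0 X \<sigma> \<Longrightarrow> \<beta> (frag_of \<sigma>) = b' \<sigma>"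
      using cochain_exists [of 0 X b'] by blast
    have "\<psi> = coboundary 0 X \<beta>"
    proof (rule cochain_ext [OF \<psi>])
      show "coboundary 0 X \<beta> \<in> carrier (cochain_group 1 X A)"
        using group_hom.hom_closed [OF coboundary_group_hom \<beta>(1)] by simp
      fix \<sigma> assume \<sigma>: "singular_simplex 1 X \<sigma>"
      show "\<psi> (frag_of \<sigma>) = coboundary 0 X \<beta> (frag_of \<sigma>)"
        using val [OF \<beta>(1) \<sigma>] \<psi>b [OF \<sigma>] \<beta>(2) [OF singular_point_simplex] ends [OF \<sigma>] b' by simp
    qed
    then show "\<psi> \<in> coboundaries 1 X A"
      unfolding eq using \<beta>(1) by blast
  qed
qed

lemma coboundaries_1_subgroup:
  "subgroup (coboundaries 1 X A) ((cochain_group 1 X A)\<lparr>carrier := cocycles 1 X A\<rparr>)"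
proof (rule group.subgroup_incl [OF cochain_group_group _ subgroup_cocycles])
  show "subgroup (coboundaries 1 X A) (cochain_group 1 X A)"
    using group_hom.img_is_subgroup [OF coboundary_group_hom [of 0]] by (simp add: coboundaries_def)
  show "coboundaries 1 X A \<subseteq> cocycles 1 X A"
  proof
    fix \<psi> assume "\<psi> \<in> coboundaries 1 X A"
    then obtain b where \<psi>: "\<psi> \<in> carrier (cochain_group 1 X A)" and b: "b ` topspace X \<subseteq> carrier A"
      and \<psi>b: "\<And>\<sigma>. singular_simplex 1 X \<sigma> \<Longrightarrow> \<psi> (frag_of \<sigma>) = b (path_of_simplex \<sigma> 1) \<otimes> inv (b (path_of_simplex \<sigma> 0))"
      unfolding coboundaries_1_iff by blast
    have "\<psi> (frag_of (singular_face 2 2 \<tau>)) \<otimes> \<psi> (frag_of (singular_face 2 0 \<tau>)) = \<psi> (frag_of (singular_face 2 1 \<tau>))"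
      if \<tau>: "singular_simplex 2 X \<tau>" for \<tau>
    proof -
      \<comment> \<open>The images of the three vertices; every edge value is a quotient of values
        of \<open>b\<close> at two of them.\<close>
      let ?v = "\<lambda>k. \<tau> (\<lambda>i. if i = k then 1 else 0)"
      have f: "path_of_simplex (singular_face 2 0 \<tau>) 0 = ?v 1" "path_of_simplex (singular_face 2 0 \<tau>) 1 = ?v 2"
        "path_of_simplex (singular_face 2 1 \<tau>) 0 = ?v 0" "path_of_simplex (singular_face 2 1 \<tau>) 1 = ?v 2"
        "path_of_simplex (singular_face 2 2 \<tau>) 0 = ?v 0" "path_of_simplex (singular_face 2 2 \<tau>) 1 = ?v 1"
        by (simp_all add: path_of_face simplical_face_edge_point simplical_face_edge_point [unfolded One_nat_def]) (auto intro!: arg_cong [of _ _ \<tau>] simp: fun_eq_iff)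
      have "?v k \<in> topspace X" if "k \<le> 2" for k
        using \<tau> that unfolding singular_simplex_def
        by (elim conjE, drule_tac continuous_map_image_subset_topspace) auto
      then have v: "b (?v k) \<in> carrier A" if "k \<le> 2" for k
        using b that by blast
      have "\<psi> (frag_of (singular_face 2 k \<tau>)) = b (path_of_simplex (singular_face 2 k \<tau>) 1) \<otimes> inv (b (path_of_simplex (singular_face 2 k \<tau>) 0))"
        if "k \<le> 2" for k
        using \<psi>b [OF singular_simplex_of_face [OF \<tau> that]] .
      then have "\<psi> (frag_of (singular_face 2 0 \<tau>)) = b (?v 2) \<otimes> inv (b (?v 1))"
        "\<psi> (frag_of (singular_face 2 1 \<tau>)) = b (?v 2) \<otimes> inv (b (?v 0))"
        "\<psi> (frag_of (singular_face 2 2 \<tau>)) = b (?v 1) \<otimes> inv (b (?v 0))"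
        by (simp_all add: f del: One_nat_def)
      moreover have "b (?v 1) \<otimes> inv (b (?v 0)) \<otimes> (b (?v 2) \<otimes> inv (b (?v 1))) = b (?v 2) \<otimes> inv (b (?v 0))"
      proof -
        have "b (?v 1) \<otimes> inv (b (?v 0)) \<otimes> (b (?v 2) \<otimes> inv (b (?v 1))) = (b (?v 1) \<otimes> inv (b (?v 1))) \<otimes> (b (?v 2) \<otimes> inv (b (?v 0)))"
          using v [of 0] v [of 1] v [of 2] by (simp only: m_ac m_closed inv_closed zero_le one_le_numeral order_refl)
        then show ?thesis using v [of 0] v [of 1] v [of 2] by simp
      qed
      ultimately show ?thesis by simp
    qed
    then show "\<psi> \<in> cocycles 1 X A"
      using \<psi> unfolding cocycles_1_iff by blast
  qed
qed

end

section \<open>Comparison of path cocycles with singular 1-cocycles\<close>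

context group_quotient
begin

sublocale A: cochains A
  by unfold_locales

definition path_cochain :: "'m topology \<Rightarrow> ((real \<Rightarrow> 'm) \<Rightarrow> 'a) \<Rightarrow> 'm chain \<Rightarrow> 'a" where
  "path_cochain M \<kappa> = (SOME \<phi>. \<phi> \<in> carrier (cochain_group 1 M A) \<and>
     (\<forall>\<sigma>. singular_simplex 1 M \<sigma> \<longrightarrow> \<phi> (frag_of \<sigma>) = \<kappa> (path_of_simplex \<sigma>)))"

lemma path_cochain:
  assumes "path_cocycle M \<kappa>"
  shows "path_cochain M \<kappa> \<in> carrier (cochain_group 1 M A)"
    "singular_simplex 1 M \<sigma> \<Longrightarrow> path_cochain M \<kappa> (frag_of \<sigma>) = \<kappa> (path_of_simplex \<sigma>)"
proof -
  have "\<exists>\<phi>\<in>carrier (cochain_group 1 M A). \<forall>\<sigma>. singular_simplex 1 M \<sigma> \<longrightarrow> \<phi> (frag_of \<sigma>) = \<kappa> (path_of_simplex \<sigma>)"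
    by (intro A.cochain_exists path_cocycle_in [OF assms] pathin_path_of_simplex)
  then have "\<exists>\<phi>. \<phi> \<in> carrier (cochain_group 1 M A) \<and> (\<forall>\<sigma>. singular_simplex 1 M \<sigma> \<longrightarrow> \<phi> (frag_of \<sigma>) = \<kappa> (path_of_simplex \<sigma>))"
    by blast
  note * = someI_ex [OF this, folded path_cochain_def]
  show "path_cochain M \<kappa> \<in> carrier (cochain_group 1 M A)"
    "singular_simplex 1 M \<sigma> \<Longrightarrow> path_cochain M \<kappa> (frag_of \<sigma>) = \<kappa> (path_of_simplex \<sigma>)"
    using * by blast+
qed

lemma path_cochain_cocycle:
  assumes \<kappa>: "path_cocycle M \<kappa>"
  shows "path_cochain M \<kappa> \<in> cocycles 1 M A"
  unfolding A.cocycles_1_iff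
proof (intro conjI allI impI path_cochain [OF \<kappa>])
  fix \<tau> assume \<tau>: "singular_simplex 2 M \<tau>"
  \<comment> \<open>The square is folded onto the 2-simplex: the bottom, the right side and the
    diagonal go to the edges 01, 12 and 02, and the minimum collapses the upper triangle onto the
    edge 02.\<close>
  define \<rho> :: "real \<times> real \<Rightarrow> nat \<Rightarrow> real" where
    "\<rho> = (\<lambda>(s, u) i. if i = 0 then 1 - s else if i = 1 then s - min s u else if i = 2 then min s u else 0)"
  have "continuous_on ({0..1} \<times> {0..1}) \<rho>"
  proof (rule continuous_on_coordinatewise_then_product)
    fix i
    show "continuous_on ({0..1} \<times> {0..1}) (\<lambda>x. \<rho> x i)"
      unfolding \<rho>_def case_prod_unfold
      by (cases "i = 0"; cases "i = 1"; cases "i = 2") (auto intro!: continuous_intros)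
  qed
  moreover have "\<rho> x \<in> standard_simplex 2" if "x \<in> {0..1} \<times> {0..1}" for x
    using that by (auto simp: \<rho>_def standard_simplex_def numeral_2_eq_2 min_def)
  ultimately have "continuous_map (top_of_set ({0..1} \<times> {0..1})) (top_of_set (standard_simplex 2)) \<rho>"
    by auto
  moreover have "continuous_map (top_of_set (standard_simplex 2)) M \<tau>"
    using \<tau> unfolding singular_simplex_def standard_simplex_eq by blast
  ultimately have "continuous_map (top_of_set ({0..1} \<times> {0..1})) M (\<tau> \<circ> \<rho>)"
    by (rule continuous_map_compose)
  from path_cocycle_triangle [OF \<kappa> this]
  have tri: "\<kappa> (\<lambda>s. \<tau> (\<rho> (s, 0))) \<otimes>\<^bsub>A\<^esub> \<kappa> (\<lambda>s. \<tau> (\<rho> (1, s))) = \<kappa> (\<lambda>s. \<tau> (\<rho> (s, s)))"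
    by (simp add: o_def)
  have path: "pathin M (path_of_simplex (singular_face 2 k \<tau>))" if "k \<le> 2" for k
    using pathin_path_of_simplex [OF singular_simplex_of_face [OF \<tau> that]] .
  have "\<kappa> (path_of_simplex (singular_face 2 2 \<tau>)) = \<kappa> (\<lambda>s. \<tau> (\<rho> (s, 0)))"
    by (rule path_cocycle_cong [OF \<kappa> path])
      (auto simp: path_of_face simplical_face_edge_point \<rho>_def min_def intro!: arg_cong [of _ _ \<tau>])
  moreover have "\<kappa> (path_of_simplex (singular_face 2 0 \<tau>)) = \<kappa> (\<lambda>s. \<tau> (\<rho> (1, s)))"
    by (rule path_cocycle_cong [OF \<kappa> path])
      (auto simp: path_of_face simplical_face_edge_point \<rho>_def min_def intro!: arg_cong [of _ _ \<tau>])
  moreover have "\<kappa> (path_of_simplex (singular_face 2 1 \<tau>)) = \<kappa> (\<lambda>s. \<tau> (\<rho> (s, s)))"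
    by (rule path_cocycle_cong [OF \<kappa> path])
      (auto simp: path_of_face simplical_face_edge_point [unfolded One_nat_def] \<rho>_def min_def intro!: arg_cong [of _ _ \<tau>])
  ultimately show "path_cochain M \<kappa> (frag_of (singular_face 2 2 \<tau>)) \<otimes>\<^bsub>A\<^esub> path_cochain M \<kappa> (frag_of (singular_face 2 0 \<tau>)) =
      path_cochain M \<kappa> (frag_of (singular_face 2 1 \<tau>))"
    using tri path_cochain(2) [OF \<kappa> singular_simplex_of_face [OF \<tau>]] by simp
qed

lemma cocycle_path_cocycle:
  assumes \<phi>: "\<phi> \<in> cocycles 1 M A"
  shows "\<exists>\<kappa>. path_cocycle M \<kappa> \<and> path_cochain M \<kappa> = \<phi>"
proof -
  define \<kappa> where "\<kappa> p = \<phi> (frag_of (simplex_of_path p))" for p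
  have \<phi>c: "\<phi> \<in> carrier (cochain_group 1 M A)"
    and \<phi>2: "\<And>\<tau>. singular_simplex 2 M \<tau> \<Longrightarrow>
      \<phi> (frag_of (singular_face 2 2 \<tau>)) \<otimes>\<^bsub>A\<^esub> \<phi> (frag_of (singular_face 2 0 \<tau>)) = \<phi> (frag_of (singular_face 2 1 \<tau>))"
    using \<phi> unfolding A.cocycles_1_iff by blast+
  have "path_cocycle M \<kappa>"
    unfolding path_cocycle_def
  proof (intro conjI allI impI)
    show "\<kappa> p \<in> carrier A" if "pathin M p" for p
      unfolding \<kappa>_def using singular_simplex_of_path [OF that]
      by (intro A.cochain_in [OF \<phi>c]) (simp add: singular_chain_of)
    show "\<kappa> p = \<kappa> p'" if "pathin M p" "\<forall>t\<in>{0..1}. p t = p' t" for p p'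
      unfolding \<kappa>_def using simplex_of_path_cong [of p p'] that(2) by simp
    fix H :: "real \<times> real \<Rightarrow> 'b"
    assume H: "continuous_map (top_of_set ({0..1} \<times> {0..1})) M H"
    \<comment> \<open>The affine map taking the vertices 0, 1 and 2 to (0, 0), (1, 0) and (1, 1), so
      that the edges 01, 12 and 02 are the paths of the triangle relation.\<close>
    define \<tau> where "\<tau> = restrict (\<lambda>x. H (x 1 + x 2, x 2)) (standard_simplex 2)"
    have sum: "x 0 + x 1 + x 2 = 1" "0 \<le> x i" if "x \<in> standard_simplex 2" for x :: "nat \<Rightarrow> real" and i
      using that by (auto simp: standard_simplex_def numeral_2_eq_2)
    have "continuous_on (standard_simplex 2) (\<lambda>x. (x 1 + x 2, x 2))"
      by (intro continuous_intros continuous_on_coordinate [OF continuous_on_id])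
    moreover have "(x 1 + x 2, x 2) \<in> {0..1} \<times> {0..1}" if "x \<in> standard_simplex 2" for x :: "nat \<Rightarrow> real"
      using sum(1) [OF that] sum(2) [OF that, of 0] sum(2) [OF that, of 1] sum(2) [OF that, of 2] by auto
    ultimately have "continuous_map (top_of_set (standard_simplex 2)) (top_of_set ({0..1} \<times> {0..1})) (\<lambda>x. (x 1 + x 2, x 2))"
      by auto
    from continuous_map_compose [OF this H]
    have "continuous_map (top_of_set (standard_simplex 2)) M \<tau>"
      by (rule continuous_map_eq) (simp add: \<tau>_def)
    then have \<tau>: "singular_simplex 2 M \<tau>"
      by (simp add: singular_simplex_def standard_simplex_eq \<tau>_def)
    have face: "singular_face 2 k \<tau> = simplex_of_path (\<lambda>t. H (g t))"
      if k: "k \<le> 2" and g: "\<And>t. t \<in> {0..1} \<Longrightarrow>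
        (simplical_face k (edge_point t) 1 + simplical_face k (edge_point t) 2, simplical_face k (edge_point t) 2) = g t" for k g
    proof -
      have in2: "simplical_face k x \<in> standard_simplex 2" if "x \<in> standard_simplex 1" for x :: "nat \<Rightarrow> real"
        using simplical_face_in_standard_simplex [of 2 k x] that k by simp
      have "simplex_of_path (path_of_simplex (singular_face 2 k \<tau>)) = simplex_of_path (\<lambda>t. H (g t))"
      proof (rule simplex_of_path_cong)
        fix t :: real assume t: "t \<in> {0..1}"
        then have "edge_point t \<in> standard_simplex 1"
          using standard_simplex_1 by blast
        then show "path_of_simplex (singular_face 2 k \<tau>) t = H (g t)"
          using path_of_face [OF t, of k \<tau>] in2 g [OF t] by (simp add: \<tau>_def)
      qed
      then show ?thesis
        using simplex_of_path_of_simplex [OF singular_simplex_of_face [OF \<tau> k]] by simp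
    qed
    have "singular_face 2 2 \<tau> = simplex_of_path (\<lambda>t. H (t, 0))"
      "singular_face 2 0 \<tau> = simplex_of_path (\<lambda>t. H (1, t))"
      "singular_face 2 1 \<tau> = simplex_of_path (\<lambda>t. H (t, t))"
      by (rule face; simp add: simplical_face_edge_point simplical_face_edge_point [unfolded One_nat_def])+
    then show "\<kappa> (\<lambda>s. H (s, 0)) \<otimes>\<^bsub>A\<^esub> \<kappa> (\<lambda>s. H (1, s)) = \<kappa> (\<lambda>s. H (s, s))"
      using \<phi>2 [OF \<tau>] by (simp add: \<kappa>_def)
  qed
  moreover from this have "path_cochain M \<kappa> = \<phi>"
    by (intro A.cochain_ext [OF path_cochain(1) \<phi>c])
      (auto simp del: One_nat_def simp: path_cochain(2) \<kappa>_def simplex_of_path_of_simplex)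
  ultimately show ?thesis by blast
qed

lemma cohomologous_iff:
  assumes \<kappa>: "path_cocycle M \<kappa>" and \<kappa>': "path_cocycle M \<kappa>'"
  shows "cohomologous M \<kappa> \<kappa>' \<longleftrightarrow>
    (\<exists>\<psi>\<in>coboundaries 1 M A. path_cochain M \<kappa>' = \<psi> \<otimes>\<^bsub>cochain_group 1 M A\<^esub> path_cochain M \<kappa>)"
proof
  assume "cohomologous M \<kappa> \<kappa>'"
  then obtain b where b: "b ` topspace M \<subseteq> carrier A" "\<And>p. pathin M p \<Longrightarrow> \<kappa>' p \<otimes>\<^bsub>A\<^esub> b (p 1) = b (p 0) \<otimes>\<^bsub>A\<^esub> \<kappa> p"
    by (auto simp: cohomologous_def)
  \<comment> \<open>The inverse matches conventions: a singular coboundary is end over start,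
    whereas \<open>cohomologous\<close> has \<open>b\<close> at the start over \<open>b\<close> at
    the end.\<close>
  let ?c = "\<lambda>x. inv\<^bsub>A\<^esub> (b x)"
  have pin: "\<kappa> p \<in> carrier A" "\<kappa>' p \<in> carrier A" "b (p 0) \<in> carrier A" "b (p 1) \<in> carrier A" if "pathin M p" for p
    using path_cocycle_in [OF \<kappa> that] path_cocycle_in [OF \<kappa>' that] pathin_ends [OF that] b(1) by auto
  obtain \<psi> where \<psi>: "\<psi> \<in> carrier (cochain_group 1 M A)"
    "\<And>\<sigma>. singular_simplex 1 M \<sigma> \<Longrightarrow> \<psi> (frag_of \<sigma>) = ?c (path_of_simplex \<sigma> 1) \<otimes>\<^bsub>A\<^esub> inv\<^bsub>A\<^esub> ?c (path_of_simplex \<sigma> 0)"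
    using A.cochain_exists [of 1 M "\<lambda>\<sigma>. ?c (path_of_simplex \<sigma> 1) \<otimes>\<^bsub>A\<^esub> inv\<^bsub>A\<^esub> ?c (path_of_simplex \<sigma> 0)"]
      pin(3,4) pathin_path_of_simplex by (metis (no_types, lifting) A.inv_closed A.m_closed)
  have "?c ` topspace M \<subseteq> carrier A" using b(1) by auto
  then have \<psi>B: "\<psi> \<in> coboundaries 1 M A"
    unfolding A.coboundaries_1_iff using \<psi> by (intro conjI exI [of _ ?c]) auto
  have "path_cochain M \<kappa>' = \<psi> \<otimes>\<^bsub>cochain_group 1 M A\<^esub> path_cochain M \<kappa>"
  proof (rule A.cochain_ext [OF path_cochain(1) [OF \<kappa>']])
    show "\<psi> \<otimes>\<^bsub>cochain_group 1 M A\<^esub> path_cochain M \<kappa> \<in> carrier (cochain_group 1 M A)"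
      using monoid.m_closed [OF group.is_monoid [OF A.cochain_group_group] \<psi>(1) path_cochain(1) [OF \<kappa>]] .
    fix \<sigma> assume \<sigma>: "singular_simplex 1 M \<sigma>"
    let ?p = "path_of_simplex \<sigma>"
    note p = pathin_path_of_simplex [OF \<sigma>]
    have "\<kappa>' ?p = inv\<^bsub>A\<^esub> (b (?p 1)) \<otimes>\<^bsub>A\<^esub> b (?p 0) \<otimes>\<^bsub>A\<^esub> \<kappa> ?p"
    proof -
      have "inv\<^bsub>A\<^esub> (b (?p 1)) \<otimes>\<^bsub>A\<^esub> b (?p 0) \<otimes>\<^bsub>A\<^esub> \<kappa> ?p = inv\<^bsub>A\<^esub> (b (?p 1)) \<otimes>\<^bsub>A\<^esub> (\<kappa>' ?p \<otimes>\<^bsub>A\<^esub> b (?p 1))"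
        using b(2) [OF p] pin [OF p] by (simp add: A.m_assoc)
      also have "\<dots> = \<kappa>' ?p \<otimes>\<^bsub>A\<^esub> (b (?p 1) \<otimes>\<^bsub>A\<^esub> inv\<^bsub>A\<^esub> (b (?p 1)))"
        using pin [OF p] by (simp only: A.m_ac A.m_closed A.inv_closed)
      finally show ?thesis
        using pin [OF p] by simp
    qed
    then show "path_cochain M \<kappa>' (frag_of \<sigma>) = (\<psi> \<otimes>\<^bsub>cochain_group 1 M A\<^esub> path_cochain M \<kappa>) (frag_of \<sigma>)"
      using path_cochain(2) [OF \<kappa>' \<sigma>] path_cochain(2) [OF \<kappa> \<sigma>] \<psi>(2) [OF \<sigma>] pin [OF p] \<sigma>
      by (simp add: A.mult_cochain_group singular_chain_of)
  qed
  then show "\<exists>\<psi>\<in>coboundaries 1 M A. path_cochain M \<kappa>' = \<psi> \<otimes>\<^bsub>cochain_group 1 M A\<^esub> path_cochain M \<kappa>"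
    using \<psi>B by blast
next
  assume "\<exists>\<psi>\<in>coboundaries 1 M A. path_cochain M \<kappa>' = \<psi> \<otimes>\<^bsub>cochain_group 1 M A\<^esub> path_cochain M \<kappa>"
  then obtain \<psi> where \<psi>: "\<psi> \<in> coboundaries 1 M A"
    and eq: "path_cochain M \<kappa>' = \<psi> \<otimes>\<^bsub>cochain_group 1 M A\<^esub> path_cochain M \<kappa>"
    by blast
  from \<psi> obtain b where b: "b ` topspace M \<subseteq> carrier A"
    and \<psi>b: "\<And>\<sigma>. singular_simplex 1 M \<sigma> \<Longrightarrow> \<psi> (frag_of \<sigma>) = b (path_of_simplex \<sigma> 1) \<otimes>\<^bsub>A\<^esub> inv\<^bsub>A\<^esub> (b (path_of_simplex \<sigma> 0))"
    unfolding A.coboundaries_1_iff by blast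
  let ?c = "\<lambda>x. inv\<^bsub>A\<^esub> (b x)"
  have "\<kappa>' p \<otimes>\<^bsub>A\<^esub> ?c (p 1) = ?c (p 0) \<otimes>\<^bsub>A\<^esub> \<kappa> p" if p: "pathin M p" for p
  proof -
    let ?\<sigma> = "simplex_of_path p"
    note \<sigma> = singular_simplex_of_path [OF p]
    have ps: "path_of_simplex ?\<sigma> 0 = p 0" "path_of_simplex ?\<sigma> 1 = p 1"
      by (simp_all add: path_of_simplex_of_path)
    have k: "\<kappa> (path_of_simplex ?\<sigma>) = \<kappa> p" "\<kappa>' (path_of_simplex ?\<sigma>) = \<kappa>' p"
      using path_cocycle_cong [OF \<kappa> p, of "path_of_simplex ?\<sigma>"] path_cocycle_cong [OF \<kappa>' p, of "path_of_simplex ?\<sigma>"]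
      by (simp_all add: path_of_simplex_of_path)
    have i: "\<kappa> p \<in> carrier A" "b (p 0) \<in> carrier A" "b (p 1) \<in> carrier A"
      using path_cocycle_in [OF \<kappa> p] pathin_ends [OF p] b by auto
    have "\<kappa>' p = b (p 1) \<otimes>\<^bsub>A\<^esub> inv\<^bsub>A\<^esub> (b (p 0)) \<otimes>\<^bsub>A\<^esub> \<kappa> p"
      using fun_cong [OF eq, of "frag_of ?\<sigma>"] path_cochain(2) [OF \<kappa>' \<sigma>] path_cochain(2) [OF \<kappa> \<sigma>] \<psi>b [OF \<sigma>] \<sigma>
      by (simp add: A.mult_cochain_group singular_chain_of k ps del: One_nat_def)
    then have "\<kappa>' p \<otimes>\<^bsub>A\<^esub> ?c (p 1) = (b (p 1) \<otimes>\<^bsub>A\<^esub> ?c (p 1)) \<otimes>\<^bsub>A\<^esub> (?c (p 0) \<otimes>\<^bsub>A\<^esub> \<kappa> p)"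
      using i by (simp only: A.m_ac A.m_closed A.inv_closed)
    then show ?thesis using i by simp
  qed
  moreover have "?c ` topspace M \<subseteq> carrier A" using b by auto
  ultimately show "cohomologous M \<kappa> \<kappa>'"
    unfolding cohomologous_def by (intro exI [of _ ?c]) blast
qed

end

section \<open>The classification\<close>

text \<open>The map induced by an invariant that is complete and surjective; since it is constant on
  classes, its image of a class is a singleton. The second conclusion serves to evaluate it at the
  base point.\<close>

lemma bij_betw_quotient_map:
  assumes r: "equiv S r" and F: "\<And>x y. x \<in> S \<Longrightarrow> y \<in> S \<Longrightarrow> F x = F y \<longleftrightarrow> (x, y) \<in> r" and T: "F ` S = T"
  shows "bij_betw (\<lambda>C. the_elem (F ` C)) (S // r) T" "x \<in> S \<Longrightarrow> the_elem (F ` (r `` {x})) = F x"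
proof -
  have *: "the_elem (F ` (r `` {x})) = F x" if x: "x \<in> S" for x
  proof -
    have "F y = F x" if "y \<in> r `` {x}" for y
    proof -
      have xy: "(x, y) \<in> r" using that by simp
      then have y: "y \<in> S" using equiv_type [OF r] by auto
      show ?thesis by (rule sym [OF iffD2 [OF F [OF x y] xy]])
    qed
    then have "F ` (r `` {x}) \<subseteq> {F x}" by blast
    moreover have "F x \<in> F ` (r `` {x})" using equiv_class_self [OF r x] by (rule imageI)
    ultimately have "F ` (r `` {x}) = {F x}" by blast
    then show ?thesis by simp
  qed
  show "x \<in> S \<Longrightarrow> the_elem (F ` (r `` {x})) = F x" by (rule *)
  show "bij_betw (\<lambda>C. the_elem (F ` C)) (S // r) T"
    unfolding bij_betw_def
  proof (intro conjI inj_onI)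
    fix C D assume "C \<in> S // r" "D \<in> S // r" and eq: "the_elem (F ` C) = the_elem (F ` D)"
    then obtain x y where xy: "x \<in> S" "y \<in> S" "C = r `` {x}" "D = r `` {y}" by (auto elim!: quotientE)
    then have "F x = F y" using eq * by simp
    then show "C = D" using F xy equiv_class_eq [OF r] by simp
  next
    have "(\<lambda>C. the_elem (F ` C)) ` (S // r) = (\<lambda>x. the_elem (F ` (r `` {x}))) ` S"
      by (auto simp: quotient_def)
    also have "\<dots> = T" using * T by auto
    finally show "(\<lambda>C. the_elem (F ` C)) ` (S // r) = T" .
  qed
qed

text \<open>Equality with the zero class is unfolded to a homotopy relative to the boundary of
  \<open>cube 1\<close>, which is then carried over from functions on a one-element index set to the
  interval.\<close>

lemma loop_null_homotopy:
  assumes "homotopy_classes 1 T a = {homotopy_zero 1 T a}" and p: "pathin T p" "p 0 = a" "p 1 = a"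
  shows "\<exists>H. continuous_map (top_of_set ({0..1} \<times> {0..1})) T H \<and>
    (\<forall>x\<in>{0..1}. H (0, x) = p x \<and> H (1, x) = a \<and> H (x, 0) = a \<and> H (x, 1) = a)"
proof -
  let ?\<gamma> = "\<lambda>t::nat \<Rightarrow> real. p (t 0)"
  let ?\<beta> = "\<lambda>h. \<forall>t\<in>cube_boundary 1. h t = a"
  have a: "a \<in> topspace T"
    using p continuous_map_image_subset_topspace by (fastforce simp: pathin_def)
  have "continuous_map (cube 1) (top_of_set {0..1}) (\<lambda>t. t 0)"
    unfolding cube_def by (rule continuous_map_product_projection) simp
  from continuous_map_compose [OF this p(1) [unfolded pathin_def]]
  have "spheroid 1 T a ?\<gamma>"
    using p by (auto simp: spheroid_def cube_boundary_def o_def)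
  then have "spheroid_class 1 T a ?\<gamma> = spheroid_class 1 T a (\<lambda>_. a)"
    using assms(1) by (auto simp: homotopy_classes_def homotopy_zero_def)
  moreover have "(\<lambda>_. a) \<in> spheroid_class 1 T a (\<lambda>_. a)"
    using a by (simp add: spheroid_class_def)
  ultimately have "homotopic_with ?\<beta> (cube 1) T ?\<gamma> (\<lambda>_. a)"
    unfolding spheroid_class_def by blast
  then obtain h where h: "continuous_map (prod_topology (top_of_set {0..1::real}) (cube 1)) T h"
    "\<And>t. h (0, t) = ?\<gamma> t" "\<And>t. h (1, t) = a" "\<And>s. s \<in> {0..1} \<Longrightarrow> ?\<beta> (\<lambda>t. h (s, t))"
    unfolding homotopic_with_def by blast
  \<comment> \<open>The point of \<open>cube 1\<close> with coordinate \<open>x\<close>; product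
    spaces consist of extensional functions, hence the restriction.\<close>
  define c :: "real \<Rightarrow> nat \<Rightarrow> real" where "c x = restrict (\<lambda>_. x) {..<1}" for x
  have cc: "continuous_map (top_of_set {0..1}) (cube 1) c"
    unfolding cube_def continuous_map_componentwise c_def by auto
  have "continuous_map (prod_topology (top_of_set {0..1::real}) (top_of_set {0..1})) (prod_topology (top_of_set {0..1::real}) (cube 1))
      (\<lambda>(s, x). (id s, c x))"
    using cc by (intro continuous_map_prod_top [THEN iffD2] disjI2 conjI) auto
  from continuous_map_compose [OF this h(1)]
  have "continuous_map (top_of_set ({0..1} \<times> {0..1})) T (\<lambda>(s, x). h (s, c x))"
    by (simp add: o_def case_prod_unfold prod_topology_subtopology_eu)
  moreover have "c x \<in> cube_boundary 1" if "x = 0 \<or> x = 1" for x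
    using that by (auto simp: cube_boundary_def cube_def c_def)
  then have "h (x, c 0) = a" "h (x, c 1) = a" if "x \<in> {0..1}" for x
    using h(4) [OF that] by auto
  moreover have "h (0, c x) = p x" for x
    using h(2) by (simp add: c_def)
  ultimately show ?thesis
    using h(3) by (intro exI [of _ "\<lambda>(s, x). h (s, c x)"]) simp
qed

context group_quotient
begin

definition cohomology_class :: "'m topology \<Rightarrow> ((real \<Rightarrow> 'm) \<Rightarrow> 'a) \<Rightarrow> ('m chain \<Rightarrow> 'a) set" where
  "cohomology_class M \<kappa> = coboundaries 1 M A #>\<^bsub>(cochain_group 1 M A)\<lparr>carrier := cocycles 1 M A\<rparr>\<^esub> path_cochain M \<kappa>"

text \<open>Two cosets of the coboundaries agree when the second representative lies in the first
  coset, which is the multiplicative relation of \<open>cohomologous_iff\<close>.\<close>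

lemma cohomology_class_eq:
  assumes \<kappa>: "path_cocycle M \<kappa>" and \<kappa>': "path_cocycle M \<kappa>'"
  shows "cohomology_class M \<kappa> = cohomology_class M \<kappa>' \<longleftrightarrow> cohomologous M \<kappa> \<kappa>'"
proof -
  let ?Z = "(cochain_group 1 M A)\<lparr>carrier := cocycles 1 M A\<rparr>"
  have Z: "group ?Z"
    by (rule subgroup.subgroup_is_group [OF A.subgroup_cocycles A.cochain_group_group])
  note B = A.coboundaries_1_subgroup [of M]
  have in_Z: "path_cochain M \<kappa> \<in> carrier ?Z" "path_cochain M \<kappa>' \<in> carrier ?Z"
    using path_cochain_cocycle [OF \<kappa>] path_cochain_cocycle [OF \<kappa>'] by simp_all
  have "cohomology_class M \<kappa> = cohomology_class M \<kappa>' \<longleftrightarrow> path_cochain M \<kappa>' \<in> cohomology_class M \<kappa>"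
    unfolding cohomology_class_def
  proof
    assume "coboundaries 1 M A #>\<^bsub>?Z\<^esub> path_cochain M \<kappa> = coboundaries 1 M A #>\<^bsub>?Z\<^esub> path_cochain M \<kappa>'"
    then show "path_cochain M \<kappa>' \<in> coboundaries 1 M A #>\<^bsub>?Z\<^esub> path_cochain M \<kappa>"
      by (rule group.repr_independenceD [OF Z B in_Z(2)])
  next
    assume "path_cochain M \<kappa>' \<in> coboundaries 1 M A #>\<^bsub>?Z\<^esub> path_cochain M \<kappa>"
    then show "coboundaries 1 M A #>\<^bsub>?Z\<^esub> path_cochain M \<kappa> = coboundaries 1 M A #>\<^bsub>?Z\<^esub> path_cochain M \<kappa>'"
      by (rule group.repr_independence [OF Z _ in_Z(1) B])
  qed
  also have "\<dots> \<longleftrightarrow> cohomologous M \<kappa> \<kappa>'"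
    unfolding cohomologous_iff [OF \<kappa> \<kappa>'] cohomology_class_def by (auto simp: r_coset_def)
  finally show ?thesis .
qed

text \<open>The class of a cocycle of the bundle is the complete invariant. Injectivity rests on
  extending isomorphisms over cells, surjectivity on constructing a bundle for each path
  cocycle.\<close>

theorem bundle_classification:
  fixes M :: "'m topology"
  assumes M: "CW_complex_of_dim M 2"
  shows "\<exists>f. bij_betw f (bundle_classes G T M) (carrier (cohomology_group 1 M A)) \<and>
    f (trivial_class G T M) = \<one>\<^bsub>cohomology_group 1 M A\<^esub>"
proof -
  let ?S = "Collect (principal_bundle G T M) :: ('m \<times> 'g, 'g, 'm) gbundle set"
  let ?r = "bundle_equiv_rel G T M"
  let ?Z = "(cochain_group 1 M A)\<lparr>carrier := cocycles 1 M A\<rparr>"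
  define \<kappa> where "\<kappa> P = (SOME \<kappa>. bundle_cocycle M P \<kappa>)" for P :: "('m \<times> 'g, 'g, 'm) gbundle"
  have \<kappa>: "bundle_cocycle M P (\<kappa> P)" if "P \<in> ?S" for P
  proof -
    have "\<exists>\<kappa>. bundle_cocycle M P \<kappa>"
      using that by (intro bundle_cocycle_exists) simp
    then show ?thesis unfolding \<kappa>_def by (rule someI_ex)
  qed
  have pc: "path_cocycle M (\<kappa> P)" if "P \<in> ?S" for P
    using \<kappa> [OF that] unfolding bundle_cocycle_def by blast
  define F where "F P = cohomology_class M (\<kappa> P)" for P
  have refl: "equivalent_bundles G P P" if "P \<in> ?S" for P
    using equiv_class_self [OF equiv_bundle_equiv_rel that] by (simp add: bundle_equiv_rel_def)
  \<comment> \<open>A bundle has many cocycles, and \<kappa> picks one. Equivalence of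
    \<open>P\<close> with itself shows that all of them are cohomologous, so any convenient cocycle
    computes \<open>F P\<close>.\<close>
  have F_unique: "F P = cohomology_class M \<kappa>'" if P: "P \<in> ?S" and \<kappa>': "bundle_cocycle M P \<kappa>'" for P \<kappa>'
  proof -
    have "cohomologous M (\<kappa> P) \<kappa>'"
      using equivalent_bundles_cohomologous [OF _ _ refl [OF P] \<kappa> [OF P] \<kappa>'] P by simp
    then show ?thesis
      unfolding F_def using cohomology_class_eq [OF pc [OF P]] \<kappa>' by (simp add: bundle_cocycle_def)
  qed
  have F_eq: "F P = F Q \<longleftrightarrow> (P, Q) \<in> ?r" if P: "P \<in> ?S" and Q: "Q \<in> ?S" for P Q
  proof -
    have "F P = F Q \<longleftrightarrow> cohomologous M (\<kappa> P) (\<kappa> Q)"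
      unfolding F_def by (rule cohomology_class_eq [OF pc [OF P] pc [OF Q]])
    also have "\<dots> \<longleftrightarrow> equivalent_bundles G P Q"
      using cohomologous_equivalent_bundles [OF M, of P Q] equivalent_bundles_cohomologous [of M P Q] P Q \<kappa> [OF P] \<kappa> [OF Q]
      by auto
    finally show ?thesis
      using P Q by (simp add: bundle_equiv_rel_def)
  qed
  have carrier: "carrier (cohomology_group 1 M A) = (\<lambda>\<phi>. coboundaries 1 M A #>\<^bsub>?Z\<^esub> \<phi>) ` cocycles 1 M A"
    by (auto simp: cohomology_group_def FactGroup_def RCOSETS_def)
  have surj: "F ` ?S = carrier (cohomology_group 1 M A)"
  proof (intro equalityI subsetI)
    fix c assume "c \<in> F ` ?S"
    then show "c \<in> carrier (cohomology_group 1 M A)"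
      unfolding carrier F_def cohomology_class_def using path_cochain_cocycle [OF pc] by blast
  next
    fix c assume "c \<in> carrier (cohomology_group 1 M A)"
    then obtain \<phi> where \<phi>: "\<phi> \<in> cocycles 1 M A" "c = coboundaries 1 M A #>\<^bsub>?Z\<^esub> \<phi>"
      unfolding carrier by blast
    obtain \<kappa>' where \<kappa>': "path_cocycle M \<kappa>'" "path_cochain M \<kappa>' = \<phi>"
      using cocycle_path_cocycle [OF \<phi>(1)] by blast
    obtain P :: "('m \<times> 'g, 'g, 'm) gbundle" where P: "principal_bundle G T M P" "bundle_cocycle M P \<kappa>'"
      using bundle_with_cocycle_exists [OF M \<kappa>'(1)] by blast
    have "F P = c"
      using F_unique [of P \<kappa>'] P \<kappa>'(2) \<phi>(2) by (simp add: cohomology_class_def)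
    then show "c \<in> F ` ?S"
      using P(1) by blast
  qed
  let ?f = "\<lambda>C. the_elem (F ` C)"
  have "bij_betw ?f (bundle_classes G T M) (carrier (cohomology_group 1 M A))"
    unfolding bundle_classes_def by (rule bij_betw_quotient_map [OF equiv_bundle_equiv_rel F_eq surj])
  moreover have "?f (trivial_class G T M) = \<one>\<^bsub>cohomology_group 1 M A\<^esub>"
  proof -
    have triv: "trivial_bundle G T M \<in> ?S"
      using principal_bundle_trivial [OF TG] by simp
    have one: "path_cocycle M (\<lambda>_. \<one>\<^bsub>A\<^esub>)"
      using trivial_bundle_cocycle [of M] by (simp add: bundle_cocycle_def)
    have "?f (trivial_class G T M) = F (trivial_bundle G T M)"
      unfolding trivial_class_def by (rule bij_betw_quotient_map(2) [OF equiv_bundle_equiv_rel F_eq surj triv])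
    also have "\<dots> = cohomology_class M (\<lambda>_. \<one>\<^bsub>A\<^esub>)"
      by (rule F_unique [OF triv trivial_bundle_cocycle])
    also have "\<dots> = coboundaries 1 M A"
      unfolding cohomology_class_def
    proof (rule subgroup.rcos_const [OF A.coboundaries_1_subgroup])
      show "group ?Z"
        by (rule subgroup.subgroup_is_group [OF A.subgroup_cocycles A.cochain_group_group])
      show "path_cochain M (\<lambda>_. \<one>\<^bsub>A\<^esub>) \<in> coboundaries 1 M A"
        unfolding A.coboundaries_1_iff using path_cochain [OF one]
        by (intro conjI exI [of _ "\<lambda>_. \<one>\<^bsub>A\<^esub>"]) auto
    qed
    finally show ?thesis
      by (simp add: cohomology_group_def FactGroup_def)
  qed
  ultimately show ?thesis by blast
qed

end

text \<open>The kernel of the projection is the unit path component; it is open because it is the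
  preimage of a point of a discrete quotient.\<close>

lemma pi0_group_quotient:
  assumes TG: "topological_group G T" and comm: "comm_group (pi0 G T)"
    and discrete: "pi0_topology G T = discrete_topology (carrier (pi0 G T))"
    and loops: "homotopy_classes 1 T \<one>\<^bsub>G\<^esub> = {homotopy_zero 1 T \<one>\<^bsub>G\<^esub>}"
  shows "group_quotient G T (pi0 G T) (pi0_proj G T)"
proof -
  interpret top_group G T by unfold_locales (rule TG)
  interpret P: comm_group "pi0 G T" by (rule comm)
  interpret N: normal "unit_path_component G T" G
    by (rule normal_unit_path_component [OF TG])
  have proj: "pi0_proj G T = (\<lambda>g. unit_path_component G T #>\<^bsub>G\<^esub> g)"
    by (simp add: fun_eq_iff pi0_proj_def)
  have one: "\<one>\<^bsub>pi0 G T\<^esub> = unit_path_component G T"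
    by (simp add: pi0_def FactGroup_def)
  show ?thesis
  proof unfold_locales
    show "pi0_proj G T \<in> hom G (pi0 G T)"
      unfolding proj pi0_def by (rule N.r_coset_hom_Mod)
    show "pi0_proj G T ` carrier G = carrier (pi0 G T)"
      by (auto simp: proj pi0_def FactGroup_def RCOSETS_def)
    have "openin (pi0_topology G T) {\<one>\<^bsub>pi0 G T\<^esub>}"
      by (simp add: discrete)
    then show "openin T {g \<in> carrier G. pi0_proj G T g = \<one>\<^bsub>pi0 G T\<^esub>}"
      by (simp add: openin_pi0_topology topspace_T)
    fix g assume g: "g \<in> carrier G" "pi0_proj G T g = \<one>\<^bsub>pi0 G T\<^esub>"
    then have "g \<in> unit_path_component G T"
      using rcos_self [OF g(1) N.subgroup_axioms] by (simp add: proj one)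
    then show "\<exists>p. pathin T p \<and> p 0 = \<one>\<^bsub>G\<^esub> \<and> p 1 = g"
      by (simp add: unit_path_component_def path_component_of_def)
  next
    fix p assume "pathin T p" "p 0 = \<one>\<^bsub>G\<^esub>" "p 1 = \<one>\<^bsub>G\<^esub>"
    then show "\<exists>H. continuous_map (top_of_set ({0..1} \<times> {0..1})) T H \<and>
             (\<forall>x\<in>{0..1}. H (0, x) = p x \<and> H (1, x) = \<one>\<^bsub>G\<^esub> \<and> H (x, 0) = \<one>\<^bsub>G\<^esub> \<and> H (x, 1) = \<one>\<^bsub>G\<^esub>)"
      by (rule loop_null_homotopy [OF loops])
  qed
qed

text \<open>In a discrete space the unit path component, being connected, is a point; so the
  projection to \<pi>0 is injective and \<open>G\<close> inherits commutativity. With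
  \<open>A = G\<close> and \<open>q = id\<close> the classification applies directly, and no
  isomorphism has to be carried through cohomology.\<close>

lemma discrete_group_quotient:
  assumes TG: "topological_group G T" and comm: "comm_group (pi0 G T)"
    and discrete: "T = discrete_topology (carrier G)"
    and loops: "homotopy_classes 1 T \<one>\<^bsub>G\<^esub> = {homotopy_zero 1 T \<one>\<^bsub>G\<^esub>}"
  shows "group_quotient G T G id"
proof -
  interpret top_group G T by unfold_locales (rule TG)
  interpret P: comm_group "pi0 G T" by (rule comm)
  have "unit_path_component G T = {\<one>\<^bsub>G\<^esub>}"
  proof -
    have "connectedin T (unit_path_component G T)"
      unfolding unit_path_component_def
      by (intro path_connectedin_imp_connectedin path_connectedin_path_component_of)
    then obtain a where "unit_path_component G T \<subseteq> {a}"
      unfolding discrete connectedin_discrete_topology by blast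
    moreover have "\<one>\<^bsub>G\<^esub> \<in> unit_path_component G T"
      by (simp add: unit_path_component_def path_component_of_refl topspace_T)
    ultimately show ?thesis by blast
  qed
  then have proj: "pi0_proj G T g = {g}" if "g \<in> carrier G" for g
    using that by (simp add: pi0_proj_def r_coset_def)
  have hom: "pi0_proj G T \<in> hom G (pi0 G T)"
  proof -
    interpret N: normal "unit_path_component G T" G
      by (rule normal_unit_path_component [OF TG])
    show ?thesis
      using N.r_coset_hom_Mod by (simp add: pi0_proj_def [abs_def] pi0_def)
  qed
  have "x \<otimes>\<^bsub>G\<^esub> y = y \<otimes>\<^bsub>G\<^esub> x" if "x \<in> carrier G" "y \<in> carrier G" for x y
  proof -
    have "pi0_proj G T (x \<otimes>\<^bsub>G\<^esub> y) = pi0_proj G T (y \<otimes>\<^bsub>G\<^esub> x)"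
      using that hom_mult [OF hom] hom_in_carrier [OF hom] P.m_comm by metis
    then show ?thesis using that proj by simp
  qed
  then interpret G: comm_group G
    by (intro group_comm_groupI)
  show ?thesis
  proof unfold_locales
    show "id \<in> hom G G" by (simp add: hom_def)
    show "openin T {g \<in> carrier G. id g = \<one>\<^bsub>G\<^esub>}"
      by (simp add: discrete) auto
    show "\<exists>p. pathin T p \<and> p 0 = \<one>\<^bsub>G\<^esub> \<and> p 1 = g" if "g \<in> carrier G" "id g = \<one>\<^bsub>G\<^esub>" for g
      using that by (intro exI [of _ "\<lambda>_. \<one>\<^bsub>G\<^esub>"]) (simp add: pathin_def topspace_T)
    fix p assume "pathin T p" "p 0 = \<one>\<^bsub>G\<^esub>" "p 1 = \<one>\<^bsub>G\<^esub>"
    then show "\<exists>H. continuous_map (top_of_set ({0..1} \<times> {0..1})) T H \<and>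
             (\<forall>x\<in>{0..1}. H (0, x) = p x \<and> H (1, x) = \<one>\<^bsub>G\<^esub> \<and> H (x, 0) = \<one>\<^bsub>G\<^esub> \<and> H (x, 1) = \<one>\<^bsub>G\<^esub>)"
      by (rule loop_null_homotopy [OF loops])
  qed simp
qed

text \<open>Two instances of one classification, with \<open>pi0_proj\<close> and with
  \<open>id\<close> in the role of \<open>q\<close>; in both the class of the trivial bundle goes to
  the neutral element.\<close>

theorem mainTheorem2:
  fixes M :: "'m topology" and x0 :: 'm
    and G :: "'g monoid" and T :: "'g topology"
  assumes "CW_complex_of_dim M 2" and "path_connected_space M" and "x0 \<in> topspace M"
    and "topological_group G T"
    and "comm_group (pi0 G T)"
    and "pi0_topology G T = discrete_topology (carrier (pi0 G T))"
    and "\<And>n. n \<ge> 1 \<Longrightarrow> pi0_acts_trivially n G T"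
    and "homotopy_classes 1 T \<one>\<^bsub>G\<^esub> = {homotopy_zero 1 T \<one>\<^bsub>G\<^esub>}"
  shows "(\<exists>f. bij_betw f (bundle_classes G T M) (carrier (cohomology_group 1 M (pi0 G T))) \<and>
              f (trivial_class G T M) = \<one>\<^bsub>cohomology_group 1 M (pi0 G T)\<^esub>) \<and>
         (T = discrete_topology (carrier G) \<longrightarrow>
            (\<exists>f. bij_betw f (bundle_classes G T M) (carrier (cohomology_group 1 M G)) \<and>
                 f (trivial_class G T M) = \<one>\<^bsub>cohomology_group 1 M G\<^esub>))"
  using group_quotient.bundle_classification [OF pi0_group_quotient [OF assms(4-6,8)] assms(1)]
    group_quotient.bundle_classification [OF discrete_group_quotient [OF assms(4,5) _ assms(8)] assms(1)]
  by blast

end
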